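(* Let $\sigma>0$, $\theta\in(1/2,1)$ and let the data $\ell^c,f^c,g^c,m_0^c$ satisfy assumptions (A), (B), (C), (D) of the context, with $r\in(0,1)$ the exponent in (B). There exist three constants $c_\theta\in(0,1)$, $C_\theta>0$ and $\bar C_\theta$, independent of $\Delta t$ and $h$, such that the following holds for all discretization parameters $\Delta t=1/T$, $h=1/N$ ($T,N\in\mathbb{N}_+$) satisfying $$\Delta t\le \frac{h^2}{2d(1-\theta)\sigma},\qquad h\le\frac{2(1-\theta)\sigma}{M}.$$ Let $(m_h^k,w_h^k)_{k\ge1}$ be generated by the generalized Frank-Wolfe algorithm described in the context, from an initialization $m_h^0\in\mathcal{P}(\tilde{\mathcal T},S)$, with, for all $k\ge1$, $$\lambda_k=\min\left\{\frac{\tilde J_{m_h^k}(m_h^k,w_h^k)-\tilde J_{m_h^k}(\bar m_h^k,\bar w_h^k)}{L_f|S|^{1/2}\|m_h^k-\bar m_h^k\|_{\infty,2}^2},\,1\right\},\qquad L_f=L_f^ch^{-d/2},$$ where $\lambda_k=1$ if $m_h^k=\bar m_h^k$. Let $u_h^k=\mathbf{HJB}_\theta(m_h^k)$ and $\gamma_k=\tilde J(m_h^k,w_h^k)-\tilde J(m_h,m_hv_h)$. Then $$\gamma_k\le C_\theta c_\theta^k,\qquad\forall k\ge1,$$ and, for all $k\ge1$, $$\|u_h^k-u_h\|_{\infty,\infty}+\|m_h^k-m_h\|_{\infty,1}\le\bar C_\theta c_\theta^{k/2},$$ $$\|u_h^k-u_h^*\|_{\infty,\infty}+\|m_h^k-m_h^*\|_{\infty,1}\le\bar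 C_\theta\big(h^r+c_\theta^{k/2}\big).$$ In particular, for $k\ge2r\log(h)/\log(c_\theta)$, $$\|u_h^k-u_h^*\|_{\infty,\infty}+\|m_h^k-m_h^*\|_{\infty,1}\le2\bar C_\theta h^r.$$
   Context: **Continuous problem.** $\mathbb{T}^d=\mathbb{R}^d/\mathbb{Z}^d$, $Q=[0,1]\times\mathbb{T}^d$, $\mathcal D=\{\mu\in L^2(\mathbb{T}^d):\mu\ge0,\int_{\mathbb{T}^d}\mu=1\}$. For $y\in\mathbb{T}^d$, $\|y\|$ is the distance from $y$ to $0$ in $\mathbb{T}^d$. Data: $\ell^c:Q\times\mathbb{R}^d\to\mathbb{R}$, $f^c:Q\times\mathcal D\to\mathbb{R}$, $g^c:\mathbb{T}^d\to\mathbb{R}$, $m_0^c\in\mathcal D$. $H^c(t,x,p)=\sup_{v\in\mathbb{R}^d}\langle -p,v\rangle-\ell^c(t,x,v)$. The mean field game is $$-\partial_tu-\sigma\Delta u+H^c(t,x,\nabla u)=f^c(t,x,m(t)),\quad v=-H^c_p(t,x,\nabla u),\quad \partial_tm-\sigma\Delta m+\mathrm{div}(vm)=0\ \text{ on }Q,$$ $$m(0,x)=m_0^c(x),\quad u(1,x)=g^c(x)\ \text{ on }\mathbb{T}^d.$$ **Assumption (A).** $\ell^c$ is continuously differentiable in $v$. There are constants $L_\ell^c,L_g^c,L_f^c>0$ such that, for all $(t,x)\in Q$, $v\in\mathbb{R}^d$, $m\in\mathcal D$: $\ell^c(\cdot,x,v)$, $\ell^c(t,\cdot,v)$ and $\ell^c_v(\cdot,x,v)$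 are $L_\ell^c$-Lipschitz (here $\ell_v^c$ is the gradient of $\ell^c$ in $v$); $g^c$ is $L_g^c$-Lipschitz; $f^c(\cdot,x,m)$, $f^c(t,\cdot,m)$, $f^c(t,x,\cdot)$ are $L_f^c$-Lipschitz (for the $L^2$-norm in the third variable). There is $\alpha^c>0$ with $\ell^c(t,x,v_2)\ge\ell^c(t,x,v_1)+\langle\ell^c_v(t,x,v_1),v_2-v_1\rangle+\frac{\alpha^c}{2}\|v_2-v_1\|^2$ for all $(t,x)\in Q$, $v_1,v_2\in\mathbb{R}^d$. Monotonicity: $\int_{\mathbb{T}^d}(f^c(t,x,m_1)-f^c(t,x,m_2))(m_1(x)-m_2(x))dx\ge0$ for all $t\in[0,1]$, $m_1,m_2\in\mathcal D$. **Assumption (B).** The mean field game admits a unique solution $(u^*,v^*,m^* )$, with $u^*,m^*\in\mathcal C^{1+r/2,2+r}(Q)$ and $v^*\in\mathcal C^r(Q)\cap L^\infty([0,1];\mathcal C^{1+r}(\mathbb{T}^d))$, where $r\in(0,1)$. **Assumption (C).** There is $F^c:[0,1]\times\mathcal D\to\mathbb{R}$ with $F^c(t,m_2)-F^c(t,m_1)=\int_0^1\int_{\mathbb{T}^d}f^c(t,x,m_1+s(m_2-m_1))(m_2(x)-m_1(x))\,dx\,ds$ for all $t\in[0,1]$, $m_1,m_2\in\mathcal D$. **Constant.** $M=\frac1{\alpha^c}\big(2\max_{(t,x)\in Q}\|\ell_v^c(t,x,0)\|+\sqrt d(L_\ell^c+L_f^c+L_g^c)\big)$. **Assumption (D).**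 A function $l:\mathbb{T}^d\to\mathbb{R}$ is $L$-semi-concave if $l(x)\ge\frac{l(x+y)+l(x-y)}2-L\|y\|^2$ for all $x,y\in\mathbb{T}^d$. (1) There is $L^c>0$ such that for all $(t,v,m)\in[0,1]\times\mathbb{R}^d\times\mathcal D$ with $\|v\|\le M$, the functions $\ell^c(t,\cdot,v)$, $f^c(t,\cdot,m)$, $g^c$ are $L^c$-semi-concave. (2) There are functions $\ell_i^c:Q\times\mathbb{R}\to\mathbb{R}$, $i=1,\dots,d$, with $\ell^c(t,x,v)=\sum_{i=1}^d\ell_i^c(t,x,v_i)$ for all $(t,x,v)\in Q\times\mathbb{R}^d$. **Discretization.** $\mathcal T=\{0,\dots,T-1\}$, $\tilde{\mathcal T}=\{0,\dots,T\}$, $S=\{(i_1,\dots,i_d)h: i_j\in\mathbb{Z}/N\mathbb{Z}\}\subset\mathbb{T}^d$, so $|S|=h^{-d}$. $\mathbb{R}(X)$, $\mathbb{R}^d(X)$ are the sets of functions from $X$ to $\mathbb{R}$, $\mathbb{R}^d$. $\mathcal P(S)$ is the set of $m:S\to[0,\infty)$ with $\sum_Sm=1$, and $\mathcal P(\tilde{\mathcal T},S)$ is the set of $m:\tilde{\mathcal T}\times S\to\mathbb{R}$ with $m(t,\cdot)\in\mathcal P(S)$ for all $t$. $\|\mu\|_{\infty,p}=\max_t\|\mu(t,\cdot)\|_p$, where $\|\nu\|_p=(\sum_{x\in S}\|\nu(x)\|^p)^{1/p}$ for $p<\infty$ and $\|\nu\|_\infty=\max_S\|\nu\|$. $B_h(x)=\prod_{i=1}^d[x_i-h/2,x_i+h/2)$.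 $\mathcal R_h(m)(y)=m(x)/h^d$ for $y\in B_h(x)$, $x\in S$; $\mathcal I_h(\mu)(x)=\int_{B_h(x)}\mu$. Discrete data: $\ell(t,x,v)=\ell^c(t\Delta t,x,v)$ if $\|v\|\le M$ and $+\infty$ otherwise; $g(x)=g^c(x)$; $f(t,x,m)=h^{-d}\int_{B_h(x)}f^c(t\Delta t,y,\mathcal R_h(m))dy$; $m_0=\mathcal I_h(m_0^c)$; $F(t,m)=F^c(t\Delta t,\mathcal R_h(m))$; $H(t,x,p)=\sup_v-\langle p,v\rangle-\ell(t,x,v)$. With $(e_i)$ the canonical basis: $\Delta_h\mu(x)=\sum_i\frac{\mu(x+he_i)+\mu(x-he_i)-2\mu(x)}{h^2}$, $\nabla_h\mu(x)=\big(\frac{\mu(x+he_i)-\mu(x-he_i)}{2h}\big)_i$, $\mathrm{div}_h\mu(x)=\sum_i\frac{\mu_i(x+he_i)-\mu_i(x-he_i)}{2h}$. **Theta-scheme.** $u=\mathbf{HJB}_\theta(m)\in\mathbb{R}(\tilde{\mathcal T}\times S)$ is defined by $u(T,\cdot)=g$ and, for $t\in\mathcal T$: $(Id-\theta\sigma\Delta t\Delta_h)u(t+1/2)=u(t+1)$ and $-\frac{u(t+1/2,x)-u(t,x)}{\Delta t}-(1-\theta)\sigma\Delta_hu(t+1/2,x)+H(t,x,\nabla_hu(t+1/2,x))=f(t,x,m(t))$. $v=\mathbf V_\theta(u)\in\mathbb{R}^d(\mathcal T\times S)$ is $v(t,x)=-H_p(t,x,\nabla_hu(t+1/2,x))$ with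 $u(t+1/2)$ obtained from $u(t+1)$ by solving $(Id-\theta\sigma\Delta t\Delta_h)u(t+1/2)=u(t+1)$. $m=\mathbf{FP}_\theta(v)$ is defined by $m(0)=m_0$ and $\frac{m(t+1)-m(t)}{\Delta t}-\theta\sigma\Delta_hm(t+1)-(1-\theta)\sigma\Delta_hm(t)+\mathrm{div}_h(v(t)m(t))=0$, $t\in\mathcal T$. Under (A), (B) and the bounds $\Delta t\le \frac{h^2}{2d(1-\theta)\sigma}$, $h\le\frac{2(1-\theta)\sigma}{M}$, the system $u=\mathbf{HJB}_\theta(m)$, $v=\mathbf V_\theta(u)$, $m=\mathbf{FP}_\theta(v)$ has a unique solution, denoted $(u_h,v_h,m_h)$. Traces of the continuous solution: $u_h^*(t,x)=u^*(t\Delta t,x)$, $m_h^*(t,\cdot)=\mathcal I_h(m^*(t\Delta t,\cdot))$. **Costs.** For $m,m'\in\mathcal P(\tilde{\mathcal T},S)$, $w\in\mathbb{R}^d(\mathcal T\times S)$: $\tilde J(m,w)=\Delta t\sum_{t\in\mathcal T}\sum_{x\in S}\tilde\ell[m,w](t,x)+\Delta t\sum_{t\in\mathcal T}F(t,m(t))+\sum_{x\in S}g(x)m(T,x)$ and $\tilde J_{m'}(m,w)=\Delta t\sum_{t\in\mathcal T}\sum_{x\in S}\big(\tilde\ell[m,w](t,x)+f(t,x,m'(t))m(t,x)\big)+\sum_{x\in S}g(x)m(T,x)$, where $\tilde\ell[m,w](t,x)=\ell(t,x,w(t,x)/m(t,x))m(t,x)$ if $m(t,x)\ne0$, $0$ if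 $m(t,x)=w(t,x)=0$, $+\infty$ otherwise. **Algorithm.** $\mathbf{BR}_\theta(m')=(\tilde m,\tilde m\tilde v)$ (pointwise product) with $\tilde v=\mathbf V_\theta(\mathbf{HJB}_\theta(m'))$ and $\tilde m=\mathbf{FP}_\theta(\tilde v)$. Given $m_h^0\in\mathcal P(\tilde{\mathcal T},S)$, set $(m_h^1,w_h^1)=\mathbf{BR}_\theta(m_h^0)$; for $k\ge1$ set $(\bar m_h^k,\bar w_h^k)=\mathbf{BR}_\theta(m_h^k)$ and $(m_h^{k+1},w_h^{k+1})=(1-\lambda_k)(m_h^k,w_h^k)+\lambda_k(\bar m_h^k,\bar w_h^k)$. *)

theory Defs
  imports "HOL-Analysis.Analysis"
begin

text \<open>
  A function on the torus is represented by a function on \<^typ>\<open>real ^ 'd\<close> that is periodic with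
  respect to the integer lattice, and its integral over the torus by the integral over the unit
  cube. The dimension is \<^term>\<open>CARD('d)\<close>.
\<close>

definition lattice_Z :: "(real ^ 'd::finite) set" where
  "lattice_Z = {k. \<forall>i. k $ i \<in> \<int>}"

definition periodic :: "(real ^ 'd::finite \<Rightarrow> 'b) \<Rightarrow> bool" where
  "periodic f \<longleftrightarrow> (\<forall>x. \<forall>k\<in>lattice_Z. f (x + k) = f x)"

definition tnorm :: "real ^ 'd::finite \<Rightarrow> real" where
  "tnorm y = infdist y lattice_Z"

definition torus_lipschitz :: "real \<Rightarrow> (real ^ 'd::finite \<Rightarrow> real) \<Rightarrow> bool" where
  "torus_lipschitz L f \<longleftrightarrow> (\<forall>x y. \<bar>f x - f y\<bar> \<le> L * tnorm (x - y))"

definition semi_concave :: "real \<Rightarrow> (real ^ 'd::finite \<Rightarrow> real) \<Rightarrow> bool" where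
  "semi_concave L l \<longleftrightarrow> (\<forall>x y. l x \<ge> (l (x + y) + l (x - y)) / 2 - L * (tnorm y)\<^sup>2)"

definition cube :: "(real ^ 'd::finite) set" where
  "cube = cbox 0 1"

definition L2_dist :: "(real ^ 'd::finite \<Rightarrow> real) \<Rightarrow> (real ^ 'd \<Rightarrow> real) \<Rightarrow> real" where
  "L2_dist m1 m2 = sqrt (LINT x:cube|lborel. (m1 x - m2 x)\<^sup>2)"

text \<open>
  Elements of the space \<open>L\<^sup>2\<close> are represented by Borel functions instead of classes. Functionals
  on \<open>densities\<close> that are Lipschitz for \<^const>\<open>L2_dist\<close> take equal values on functions that agree
  almost everywhere.
\<close>

definition densities :: "(real ^ 'd::finite \<Rightarrow> real) set" where
  "densities = {\<mu>. periodic \<mu> \<and> \<mu> \<in> borel_measurable borel \<and>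
     set_integrable lborel cube (\<lambda>x. (\<mu> x)\<^sup>2) \<and>
     (AE x in lborel. \<mu> x \<ge> 0) \<and> (LINT x:cube|lborel. \<mu> x) = 1}"

definition gradient :: "('a::real_inner \<Rightarrow> real) \<Rightarrow> 'a \<Rightarrow> 'a" where
  "gradient f x = (THE D. GDERIV f x :> D)"

definition has_gradient :: "('a::real_inner \<Rightarrow> real) \<Rightarrow> 'a \<Rightarrow> bool" where
  "has_gradient f x \<longleftrightarrow> (\<exists>D. GDERIV f x :> D)"

definition divergence :: "(real ^ 'd::finite \<Rightarrow> real ^ 'd) \<Rightarrow> real ^ 'd \<Rightarrow> real" where
  "divergence w x = (\<Sum>i\<in>UNIV. gradient (\<lambda>y. w y $ i) x $ i)"

definition hessian :: "'d \<Rightarrow> 'd \<Rightarrow> (real ^ 'd::finite \<Rightarrow> real) \<Rightarrow> real ^ 'd \<Rightarrow> real" where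
  "hessian i j f x = gradient (\<lambda>y. gradient f y $ i) x $ j"

definition laplacian :: "(real ^ 'd::finite \<Rightarrow> real) \<Rightarrow> real ^ 'd \<Rightarrow> real" where
  "laplacian f x = (\<Sum>i\<in>UNIV. hessian i i f x)"

text \<open>One-sided at the two ends of the time interval.\<close>

definition time_deriv :: "(real \<Rightarrow> real ^ 'd::finite \<Rightarrow> real) \<Rightarrow> real \<Rightarrow> real ^ 'd \<Rightarrow> real" where
  "time_deriv u t x = vector_derivative (\<lambda>s. u s x) (at t within {0..1})"

definition C_1_2 :: "(real \<Rightarrow> real ^ 'd::finite \<Rightarrow> real) \<Rightarrow> bool" where
  "C_1_2 u \<longleftrightarrow>
     (\<forall>t\<in>{0..1}. periodic (u t)) \<and>
     (\<forall>t\<in>{0..1}. \<forall>x. (\<lambda>s. u s x) differentiable (at t within {0..1})) \<and>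
     (\<forall>t\<in>{0..1}. \<forall>x. has_gradient (u t) x) \<and>
     (\<forall>t\<in>{0..1}. \<forall>x i. has_gradient (\<lambda>y. gradient (u t) y $ i) x) \<and>
     continuous_on ({0..1} \<times> UNIV) (\<lambda>(t, x). u t x) \<and>
     continuous_on ({0..1} \<times> UNIV) (\<lambda>(t, x). time_deriv u t x) \<and>
     continuous_on ({0..1} \<times> UNIV) (\<lambda>(t, x). gradient (u t) x) \<and>
     (\<forall>i j. continuous_on ({0..1} \<times> UNIV) (\<lambda>(t, x). hessian i j (u t) x))"

definition time_holder :: "real \<Rightarrow> (real \<Rightarrow> real ^ 'd::finite \<Rightarrow> real) \<Rightarrow> bool" where
  "time_holder a w \<longleftrightarrow>
     (\<exists>K. \<forall>t\<in>{0..1}. \<forall>s\<in>{0..1}. \<forall>x. \<bar>w t x - w s x\<bar> \<le> K * \<bar>t - s\<bar> powr a)"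

definition space_holder :: "real \<Rightarrow> (real \<Rightarrow> real ^ 'd::finite \<Rightarrow> real) \<Rightarrow> bool" where
  "space_holder a w \<longleftrightarrow>
     (\<exists>K. \<forall>t\<in>{0..1}. \<forall>x y. \<bar>w t x - w t y\<bar> \<le> K * tnorm (x - y) powr a)"

text \<open>
  The parabolic Hoelder space \<open>C\<^bsup>1+r/2,2+r\<^esup>(Q)\<close> in the sense of Ladyzhenskaya, Solonnikov and
  Uraltseva; suprema of the derivatives are finite because these are continuous and periodic.
\<close>

definition parabolic_holder :: "real \<Rightarrow> (real \<Rightarrow> real ^ 'd::finite \<Rightarrow> real) \<Rightarrow> bool" where
  "parabolic_holder r u \<longleftrightarrow> C_1_2 u \<and>
     time_holder (r / 2) (time_deriv u) \<and> space_holder r (time_deriv u) \<and>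
     (\<forall>i. time_holder ((1 + r) / 2) (\<lambda>t x. gradient (u t) x $ i)) \<and>
     (\<forall>i j. time_holder (r / 2) (\<lambda>t. hessian i j (u t)) \<and>
            space_holder r (\<lambda>t. hessian i j (u t)))"

definition holder_Q :: "real \<Rightarrow> (real \<Rightarrow> real ^ 'd::finite \<Rightarrow> real) \<Rightarrow> bool" where
  "holder_Q r w \<longleftrightarrow> (\<forall>t\<in>{0..1}. periodic (w t)) \<and>
     (\<exists>K. \<forall>t\<in>{0..1}. \<forall>s\<in>{0..1}. \<forall>x y.
        \<bar>w t x - w s y\<bar> \<le> K * norm (t - s, tnorm (x - y)) powr r)"

definition C_1_holder_bound :: "real \<Rightarrow> real \<Rightarrow> (real ^ 'd::finite \<Rightarrow> real) \<Rightarrow> bool" where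
  "C_1_holder_bound r K w \<longleftrightarrow> periodic w \<and>
     (\<forall>x. has_gradient w x \<and> \<bar>w x\<bar> \<le> K \<and> norm (gradient w x) \<le> K) \<and>
     (\<forall>x y. norm (gradient w x - gradient w y) \<le> K * tnorm (x - y) powr r)"

definition Linf_C_1_holder :: "real \<Rightarrow> (real \<Rightarrow> real ^ 'd::finite \<Rightarrow> real) \<Rightarrow> bool" where
  "Linf_C_1_holder r w \<longleftrightarrow>
     (\<exists>K. AE t in lborel. t \<in> {0..1} \<longrightarrow> C_1_holder_bound r K (w t))"

text \<open>
  Time arguments range over \<open>{0..1}\<close>, and the last arguments of \<open>fc\<close> and \<open>Fc\<close> over
  \<^const>\<open>densities\<close>; values elsewhere are irrelevant. \<open>Fc\<close> is the potential of \<open>fc\<close>.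
\<close>

record ('d::finite) mfg_data =
  sigma :: real
  ellc :: "real \<Rightarrow> real ^ 'd \<Rightarrow> real ^ 'd \<Rightarrow> real"
  fc :: "real \<Rightarrow> real ^ 'd \<Rightarrow> (real ^ 'd \<Rightarrow> real) \<Rightarrow> real"
  gc :: "real ^ 'd \<Rightarrow> real"
  m0c :: "real ^ 'd \<Rightarrow> real"
  Fc :: "real \<Rightarrow> (real ^ 'd \<Rightarrow> real) \<Rightarrow> real"
  Lell :: real
  Lf :: real
  Lg :: real
  alpha :: real

definition data_on_torus :: "'d::finite mfg_data \<Rightarrow> bool" where
  "data_on_torus D \<longleftrightarrow>
     (\<forall>t\<in>{0..1}. \<forall>v. periodic (\<lambda>x. ellc D t x v)) \<and>
     (\<forall>t\<in>{0..1}. \<forall>m\<in>densities. periodic (\<lambda>x. fc D t x m)) \<and>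
     periodic (gc D) \<and> m0c D \<in> densities"

definition assumption_A :: "'d::finite mfg_data \<Rightarrow> bool" where
  "assumption_A D \<longleftrightarrow>
     (\<forall>t\<in>{0..1}. \<forall>x. (\<forall>v. has_gradient (ellc D t x) v) \<and>
        continuous_on UNIV (gradient (ellc D t x))) \<and>
     Lell D > 0 \<and> Lg D > 0 \<and> Lf D > 0 \<and> alpha D > 0 \<and>
     (\<forall>x v. (Lell D)-lipschitz_on {0..1} (\<lambda>t. ellc D t x v)) \<and>
     (\<forall>t\<in>{0..1}. \<forall>v. torus_lipschitz (Lell D) (\<lambda>x. ellc D t x v)) \<and>
     (\<forall>x v. (Lell D)-lipschitz_on {0..1} (\<lambda>t. gradient (ellc D t x) v)) \<and>
     torus_lipschitz (Lg D) (gc D) \<and>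
     (\<forall>x. \<forall>m\<in>densities. (Lf D)-lipschitz_on {0..1} (\<lambda>t. fc D t x m)) \<and>
     (\<forall>t\<in>{0..1}. \<forall>m\<in>densities. torus_lipschitz (Lf D) (\<lambda>x. fc D t x m)) \<and>
     (\<forall>t\<in>{0..1}. \<forall>x. \<forall>m1\<in>densities. \<forall>m2\<in>densities.
        \<bar>fc D t x m1 - fc D t x m2\<bar> \<le> Lf D * L2_dist m1 m2) \<and>
     (\<forall>t\<in>{0..1}. \<forall>x v1 v2. ellc D t x v2 \<ge> ellc D t x v1
        + gradient (ellc D t x) v1 \<bullet> (v2 - v1) + alpha D / 2 * (norm (v2 - v1))\<^sup>2) \<and>
     (\<forall>t\<in>{0..1}. \<forall>m1\<in>densities. \<forall>m2\<in>densities.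
        (LINT x:cube|lborel. (fc D t x m1 - fc D t x m2) * (m1 x - m2 x)) \<ge> 0)"

definition Hc :: "'d::finite mfg_data \<Rightarrow> real \<Rightarrow> real ^ 'd \<Rightarrow> real ^ 'd \<Rightarrow> real" where
  "Hc D t x p = (SUP v. (- p) \<bullet> v - ellc D t x v)"

text \<open>
  Classical solutions. The initial condition holds almost everywhere since \<open>m0c\<close> represents an
  element of \<open>L\<^sup>2\<close>.
\<close>

definition mfg_solution :: "'d::finite mfg_data \<Rightarrow> (real \<Rightarrow> real ^ 'd \<Rightarrow> real) \<Rightarrow>
    (real \<Rightarrow> real ^ 'd \<Rightarrow> real ^ 'd) \<Rightarrow> (real \<Rightarrow> real ^ 'd \<Rightarrow> real) \<Rightarrow> bool" where
  "mfg_solution D u v m \<longleftrightarrow>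
     C_1_2 u \<and> C_1_2 m \<and>
     (\<forall>t\<in>{0..1}. periodic (v t) \<and> m t \<in> densities \<and>
        (\<forall>x i. has_gradient (\<lambda>y. (m t y *\<^sub>R v t y) $ i) x)) \<and>
     (\<forall>t\<in>{0..1}. \<forall>x.
        - time_deriv u t x - sigma D * laplacian (u t) x + Hc D t x (gradient (u t) x)
          = fc D t x (m t) \<and>
        v t x = - gradient (Hc D t x) (gradient (u t) x) \<and>
        time_deriv m t x - sigma D * laplacian (m t) x + divergence (\<lambda>y. m t y *\<^sub>R v t y) x
          = 0) \<and>
     (AE x in lborel. m 0 x = m0c D x) \<and> (\<forall>x. u 1 x = gc D x)"

definition assumption_B :: "'d::finite mfg_data \<Rightarrow> real \<Rightarrow> (real \<Rightarrow> real ^ 'd \<Rightarrow> real) \<Rightarrow>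
    (real \<Rightarrow> real ^ 'd \<Rightarrow> real ^ 'd) \<Rightarrow> (real \<Rightarrow> real ^ 'd \<Rightarrow> real) \<Rightarrow> bool" where
  "assumption_B D r u v m \<longleftrightarrow>
     mfg_solution D u v m \<and>
     (\<forall>u' v' m'. mfg_solution D u' v' m' \<longrightarrow>
        (\<forall>t\<in>{0..1}. \<forall>x. u' t x = u t x \<and> v' t x = v t x \<and> m' t x = m t x)) \<and>
     parabolic_holder r u \<and> parabolic_holder r m \<and>
     (\<forall>i. holder_Q r (\<lambda>t x. v t x $ i) \<and> Linf_C_1_holder r (\<lambda>t x. v t x $ i))"

definition assumption_C :: "'d::finite mfg_data \<Rightarrow> bool" where
  "assumption_C D \<longleftrightarrow> (\<forall>t\<in>{0..1}. \<forall>m1\<in>densities. \<forall>m2\<in>densities.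
     Fc D t m2 - Fc D t m1 =
       (LINT s:{0..1}|lborel. LINT x:cube|lborel.
          fc D t x (\<lambda>y. m1 y + s * (m2 y - m1 y)) * (m2 x - m1 x)))"

definition Mbound :: "'d::finite mfg_data \<Rightarrow> real" where
  "Mbound D = 1 / alpha D *
     (2 * (SUP (t, x)\<in>{0..1} \<times> UNIV. norm (gradient (ellc D t x) 0))
      + sqrt (real CARD('d)) * (Lell D + Lf D + Lg D))"

definition assumption_D :: "'d::finite mfg_data \<Rightarrow> bool" where
  "assumption_D D \<longleftrightarrow>
     (\<exists>Lc>0. \<forall>t\<in>{0..1}. \<forall>v. \<forall>m\<in>densities. norm v \<le> Mbound D \<longrightarrow>
        semi_concave Lc (\<lambda>x. ellc D t x v) \<and> semi_concave Lc (\<lambda>x. fc D t x m) \<and>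
        semi_concave Lc (gc D)) \<and>
     (\<exists>elli :: 'd \<Rightarrow> real \<Rightarrow> real ^ 'd \<Rightarrow> real \<Rightarrow> real.
        (\<forall>i. \<forall>t\<in>{0..1}. \<forall>a. periodic (\<lambda>x. elli i t x a)) \<and>
        (\<forall>t\<in>{0..1}. \<forall>x v. ellc D t x v = (\<Sum>i\<in>UNIV. elli i t x (v $ i))))"

text \<open>
  Below, the steps are \<open>h = 1 / N\<close> and \<open>1 / T\<close>. The grid consists of representatives in
  \<open>[0,1)\<^sup>d\<close>; \<open>wrap\<close> brings a point back to this set, so that shifts act modulo the lattice.
  Functions on the grid are extended by 0 to \<^typ>\<open>real ^ 'd\<close>.
\<close>

definition grid :: "nat \<Rightarrow> (real ^ 'd::finite) set" where
  "grid N = {x. \<forall>j. \<exists>i<N. x $ j = real i / real N}"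

definition wrap :: "real ^ 'd::finite \<Rightarrow> real ^ 'd" where
  "wrap x = (\<chi> j. frac (x $ j))"

definition grid_funs :: "nat \<Rightarrow> (real ^ 'd::finite \<Rightarrow> 'b::zero) set" where
  "grid_funs N = {f. \<forall>x. x \<notin> grid N \<longrightarrow> f x = 0}"

definition time_grid_funs :: "nat set \<Rightarrow> nat \<Rightarrow> (nat \<Rightarrow> real ^ 'd::finite \<Rightarrow> 'b::zero) set" where
  "time_grid_funs I N = {f. \<forall>t x. t \<notin> I \<or> x \<notin> grid N \<longrightarrow> f t x = 0}"

definition prob_flows :: "nat \<Rightarrow> nat \<Rightarrow> (nat \<Rightarrow> real ^ 'd::finite \<Rightarrow> real) set" where
  "prob_flows T N = {m \<in> time_grid_funs {..T} N.
     \<forall>t\<le>T. (\<forall>x\<in>grid N. m t x \<ge> 0) \<and> (\<Sum>x\<in>grid N. m t x) = 1}"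

definition shift :: "nat \<Rightarrow> 'd \<Rightarrow> real \<Rightarrow> real ^ 'd::finite \<Rightarrow> real ^ 'd" where
  "shift N i s x = wrap (x + (s / real N) *\<^sub>R axis i 1)"

definition lap_h :: "nat \<Rightarrow> (real ^ 'd::finite \<Rightarrow> real) \<Rightarrow> real ^ 'd \<Rightarrow> real" where
  "lap_h N \<mu> x = (\<Sum>i\<in>UNIV.
     (\<mu> (shift N i 1 x) + \<mu> (shift N i (-1) x) - 2 * \<mu> x) / (1 / real N)\<^sup>2)"

definition grad_h :: "nat \<Rightarrow> (real ^ 'd::finite \<Rightarrow> real) \<Rightarrow> real ^ 'd \<Rightarrow> real ^ 'd" where
  "grad_h N \<mu> x = (\<chi> i. (\<mu> (shift N i 1 x) - \<mu> (shift N i (-1) x)) / (2 * (1 / real N)))"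

definition div_h :: "nat \<Rightarrow> (real ^ 'd::finite \<Rightarrow> real ^ 'd) \<Rightarrow> real ^ 'd \<Rightarrow> real" where
  "div_h N \<mu> x =
     (\<Sum>i\<in>UNIV. (\<mu> (shift N i 1 x) $ i - \<mu> (shift N i (-1) x) $ i) / (2 * (1 / real N)))"

definition norm_p :: "nat \<Rightarrow> ereal \<Rightarrow> (real ^ 'd::finite \<Rightarrow> 'b::real_normed_vector) \<Rightarrow> real" where
  "norm_p N p \<nu> = (if p = \<infinity> then (MAX x\<in>grid N. norm (\<nu> x))
     else (\<Sum>x\<in>grid N. norm (\<nu> x) powr real_of_ereal p) powr (1 / real_of_ereal p))"

definition norm_inf_p ::
    "nat \<Rightarrow> nat \<Rightarrow> ereal \<Rightarrow> (nat \<Rightarrow> real ^ 'd::finite \<Rightarrow> 'b::real_normed_vector) \<Rightarrow> real" where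
  "norm_inf_p T N p \<mu> = (MAX t\<in>{..T}. norm_p N p (\<mu> t))"

definition box_h :: "nat \<Rightarrow> real ^ 'd::finite \<Rightarrow> (real ^ 'd) set" where
  "box_h N x =
     {y. \<forall>i. x $ i - (1 / real N) / 2 \<le> y $ i \<and> y $ i < x $ i + (1 / real N) / 2}"

text \<open>
  For fixed \<open>y\<close> exactly one grid point \<open>x\<close> contributes to the sum: the one whose box contains
  \<open>y\<close> modulo the lattice.
\<close>

definition R_h :: "nat \<Rightarrow> (real ^ 'd::finite \<Rightarrow> real) \<Rightarrow> real ^ 'd \<Rightarrow> real" where
  "R_h N m y = (\<Sum>x\<in>grid N.
     if \<exists>k\<in>lattice_Z. y + k \<in> box_h N x then m x / (1 / real N) ^ CARD('d) else 0)"

definition I_h :: "nat \<Rightarrow> (real ^ 'd::finite \<Rightarrow> real) \<Rightarrow> real ^ 'd \<Rightarrow> real" where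
  "I_h N \<mu> x = (LINT y:box_h N x|lborel. \<mu> y)"

definition ell :: "'d::finite mfg_data \<Rightarrow> nat \<Rightarrow> nat \<Rightarrow> real ^ 'd \<Rightarrow> real ^ 'd \<Rightarrow> ereal" where
  "ell D T t x v =
     (if norm v \<le> Mbound D then ereal (ellc D (real t * (1 / real T)) x v) else \<infinity>)"

definition f_disc ::
    "'d::finite mfg_data \<Rightarrow> nat \<Rightarrow> nat \<Rightarrow> nat \<Rightarrow> real ^ 'd \<Rightarrow> (real ^ 'd \<Rightarrow> real) \<Rightarrow> real" where
  "f_disc D T N t x m = 1 / (1 / real N) ^ CARD('d) *
     (LINT y:box_h N x|lborel. fc D (real t * (1 / real T)) y (R_h N m))"

definition F_disc ::
    "'d::finite mfg_data \<Rightarrow> nat \<Rightarrow> nat \<Rightarrow> nat \<Rightarrow> (real ^ 'd \<Rightarrow> real) \<Rightarrow> real" where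
  "F_disc D T N t m = Fc D (real t * (1 / real T)) (R_h N m)"

definition Ham :: "'d::finite mfg_data \<Rightarrow> nat \<Rightarrow> nat \<Rightarrow> real ^ 'd \<Rightarrow> real ^ 'd \<Rightarrow> real" where
  "Ham D T t x p = real_of_ereal (SUP v. ereal (- (p \<bullet> v)) - ell D T t x v)"

text \<open>Recovers \<open>u(t+1/2)\<close> from \<open>u(t+1)\<close>.\<close>

definition half_step :: "'d::finite mfg_data \<Rightarrow> real \<Rightarrow> nat \<Rightarrow> nat \<Rightarrow>
    (real ^ 'd \<Rightarrow> real) \<Rightarrow> (real ^ 'd \<Rightarrow> real)" where
  "half_step D \<theta> T N \<nu> = (THE w. w \<in> grid_funs N \<and>
     (\<forall>x\<in>grid N. w x - \<theta> * sigma D * (1 / real T) * lap_h N w x = \<nu> x))"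

definition HJB :: "'d::finite mfg_data \<Rightarrow> real \<Rightarrow> nat \<Rightarrow> nat \<Rightarrow>
    (nat \<Rightarrow> real ^ 'd \<Rightarrow> real) \<Rightarrow> (nat \<Rightarrow> real ^ 'd \<Rightarrow> real)" where
  "HJB D \<theta> T N m = (THE u. u \<in> time_grid_funs {..T} N \<and>
     (\<forall>x\<in>grid N. u T x = gc D x) \<and>
     (\<forall>t<T. \<forall>x\<in>grid N. let w = half_step D \<theta> T N (u (t + 1)) in
        - (w x - u t x) / (1 / real T) - (1 - \<theta>) * sigma D * lap_h N w x
          + Ham D T t x (grad_h N w x) = f_disc D T N t x (m t)))"

definition V_op :: "'d::finite mfg_data \<Rightarrow> real \<Rightarrow> nat \<Rightarrow> nat \<Rightarrow>
    (nat \<Rightarrow> real ^ 'd \<Rightarrow> real) \<Rightarrow> (nat \<Rightarrow> real ^ 'd \<Rightarrow> real ^ 'd)" where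
  "V_op D \<theta> T N u = (\<lambda>t x. if t < T \<and> x \<in> grid N
     then - gradient (Ham D T t x) (grad_h N (half_step D \<theta> T N (u (t + 1))) x) else 0)"

definition FP :: "'d::finite mfg_data \<Rightarrow> real \<Rightarrow> nat \<Rightarrow> nat \<Rightarrow>
    (nat \<Rightarrow> real ^ 'd \<Rightarrow> real ^ 'd) \<Rightarrow> (nat \<Rightarrow> real ^ 'd \<Rightarrow> real)" where
  "FP D \<theta> T N v = (THE m. m \<in> time_grid_funs {..T} N \<and>
     (\<forall>x\<in>grid N. m 0 x = I_h N (m0c D) x) \<and>
     (\<forall>t<T. \<forall>x\<in>grid N.
        (m (t + 1) x - m t x) / (1 / real T) - \<theta> * sigma D * lap_h N (m (t + 1)) x
          - (1 - \<theta>) * sigma D * lap_h N (m t) x + div_h N (\<lambda>y. m t y *\<^sub>R v t y) x = 0))"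

definition theta_mfg_solution :: "'d::finite mfg_data \<Rightarrow> real \<Rightarrow> nat \<Rightarrow> nat \<Rightarrow>
    (nat \<Rightarrow> real ^ 'd \<Rightarrow> real) \<Rightarrow> (nat \<Rightarrow> real ^ 'd \<Rightarrow> real ^ 'd) \<Rightarrow>
    (nat \<Rightarrow> real ^ 'd \<Rightarrow> real) \<Rightarrow> bool" where
  "theta_mfg_solution D \<theta> T N u v m \<longleftrightarrow>
     u = HJB D \<theta> T N m \<and> v = V_op D \<theta> T N u \<and> m = FP D \<theta> T N v"

definition ell_tilde :: "'d::finite mfg_data \<Rightarrow> nat \<Rightarrow> (nat \<Rightarrow> real ^ 'd \<Rightarrow> real) \<Rightarrow>
    (nat \<Rightarrow> real ^ 'd \<Rightarrow> real ^ 'd) \<Rightarrow> nat \<Rightarrow> real ^ 'd \<Rightarrow> ereal" where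
  "ell_tilde D T m w t x =
     (if m t x \<noteq> 0 then ell D T t x (w t x /\<^sub>R m t x) * ereal (m t x)
      else if w t x = 0 then 0 else \<infinity>)"

definition J_tilde :: "'d::finite mfg_data \<Rightarrow> nat \<Rightarrow> nat \<Rightarrow> (nat \<Rightarrow> real ^ 'd \<Rightarrow> real) \<Rightarrow>
    (nat \<Rightarrow> real ^ 'd \<Rightarrow> real ^ 'd) \<Rightarrow> ereal" where
  "J_tilde D T N m w =
     ereal (1 / real T) * (\<Sum>t<T. \<Sum>x\<in>grid N. ell_tilde D T m w t x)
     + ereal (1 / real T * (\<Sum>t<T. F_disc D T N t (m t)))
     + ereal (\<Sum>x\<in>grid N. gc D x * m T x)"

definition J_lin :: "'d::finite mfg_data \<Rightarrow> nat \<Rightarrow> nat \<Rightarrow> (nat \<Rightarrow> real ^ 'd \<Rightarrow> real) \<Rightarrow>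
    (nat \<Rightarrow> real ^ 'd \<Rightarrow> real) \<Rightarrow> (nat \<Rightarrow> real ^ 'd \<Rightarrow> real ^ 'd) \<Rightarrow> ereal" where
  "J_lin D T N m' m w =
     ereal (1 / real T) * (\<Sum>t<T. \<Sum>x\<in>grid N.
        ell_tilde D T m w t x + ereal (f_disc D T N t x (m' t) * m t x))
     + ereal (\<Sum>x\<in>grid N. gc D x * m T x)"

definition BR :: "'d::finite mfg_data \<Rightarrow> real \<Rightarrow> nat \<Rightarrow> nat \<Rightarrow> (nat \<Rightarrow> real ^ 'd \<Rightarrow> real) \<Rightarrow>
    (nat \<Rightarrow> real ^ 'd \<Rightarrow> real) \<times> (nat \<Rightarrow> real ^ 'd \<Rightarrow> real ^ 'd)" where
  "BR D \<theta> T N m' =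
     (let v = V_op D \<theta> T N (HJB D \<theta> T N m'); m = FP D \<theta> T N v
      in (m, \<lambda>t x. m t x *\<^sub>R v t x))"

text \<open>
  The values of \<^const>\<open>J_lin\<close> are extended reals; the step size is a real number.
\<close>

definition step_size :: "'d::finite mfg_data \<Rightarrow> nat \<Rightarrow> nat \<Rightarrow>
    (nat \<Rightarrow> real ^ 'd \<Rightarrow> real) \<Rightarrow> (nat \<Rightarrow> real ^ 'd \<Rightarrow> real ^ 'd) \<Rightarrow>
    (nat \<Rightarrow> real ^ 'd \<Rightarrow> real) \<Rightarrow> (nat \<Rightarrow> real ^ 'd \<Rightarrow> real ^ 'd) \<Rightarrow> real" where
  "step_size D T N m w mb wb =
     (if m = mb then 1
      else real_of_ereal (min
        ((J_lin D T N m m w - J_lin D T N m mb wb) /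
         ereal (Lf D * (1 / real N) powr (- (real CARD('d) / 2))
                * real (card (grid N :: (real ^ 'd) set)) powr (1 / 2)
                * (norm_inf_p T N 2 (\<lambda>t x. m t x - mb t x))\<^sup>2))
        1))"

definition frank_wolfe :: "'d::finite mfg_data \<Rightarrow> real \<Rightarrow> nat \<Rightarrow> nat \<Rightarrow>
    (nat \<Rightarrow> nat \<Rightarrow> real ^ 'd \<Rightarrow> real) \<Rightarrow> (nat \<Rightarrow> nat \<Rightarrow> real ^ 'd \<Rightarrow> real ^ 'd) \<Rightarrow> bool" where
  "frank_wolfe D \<theta> T N m w \<longleftrightarrow>
     m 0 \<in> prob_flows T N \<and>
     (m 1, w 1) = BR D \<theta> T N (m 0) \<and>
     (\<forall>k\<ge>1. let (mb, wb) = BR D \<theta> T N (m k);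
                lam = step_size D T N (m k) (w k) mb wb
            in m (k + 1) = (\<lambda>t x. (1 - lam) * m k t x + lam * mb t x) \<and>
               w (k + 1) = (\<lambda>t x. (1 - lam) *\<^sub>R w k t x + lam *\<^sub>R wb t x))"

end

theory Submission
  imports Defs
begin

text \<open>
  The scheme is stable uniformly in the mesh, and both parts of the theorem follow from this.

  \<^bold>\<open>Stability.\<close> The implicit and the explicit half of a step of the theta-scheme are Markov
  operators that commute with the shifts of the grid. An argument of Bakry and Emery turns the
  dissipation of the implicit half into the gradient estimate \<open>|\<nabla>\<^sub>h S\<^sub>t f| \<le> C |f| / sqrt t\<close> for the
  discrete heat semigroup (\<open>smoothing\<close>, \<open>grad_smoothing\<close>). With Duhamel's formula and a Gronwall
  inequality for the kernel \<open>t\<^bsup>-1/2\<^esup>\<close> one obtains two facts whose constants do not depend on the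
  mesh: a density that is transported by any velocity of norm at most \<open>M\<close> stays bounded by a multiple of
  \<open>h\<^sup>d\<close> (\<open>flow_bound\<close>), and the solution of the discrete Hamilton-Jacobi-Bellman (HJB) equation and its discrete
  gradient depend in a Lipschitz way on the right-hand side (\<open>hjb_stability\<close>). An energy estimate
  in \<open>L\<^sup>2\<close> controls densities by the velocities that transport them (\<open>energy_estimate\<close>).

  \<^bold>\<open>Linear convergence.\<close> The best response minimizes a linearized cost. By duality between the two
  discrete equations and strong convexity of the running cost, the gap between the linearized costs
  of an iterate and of its best response bounds the weighted squared distance of their velocities
  (\<open>lincost_gap\<close>); by the energy estimate and the bound on the densities, it bounds the squared
  distance of the densities (\<open>gap_controls_distance\<close>). So the step sizes are bounded from below.
  The potential is convex with a Lipschitz gradient; convexity makes the gap at least \<open>\<gamma>\<^sub>k\<close>, and every step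
  decreases the cost by a fixed fraction of the gap (\<open>frank_wolfe_rate\<close>). The same bound at the
  solution controls the distance of the densities by the square root of \<open>\<gamma>\<^sub>k\<close>, and \<open>hjb_stability\<close> transfers
  this to the value functions.

  \<^bold>\<open>Error of the scheme.\<close> The trace of \<open>u\<^sup>*\<close> on the grid solves the discrete HJB equation up to an
  error of order \<open>h\<^sup>r\<close> in the right-hand side, and the averages of \<open>m\<^sup>*\<close> over the boxes solve the discrete
  Fokker-Planck equation up to errors of order \<open>h\<^sup>r\<close> in the flux and in the right-hand side. Two points need
  care: the constraint \<open>|v| \<le> M\<close> of the discrete Hamiltonian is inactive along \<open>u\<^sup>*\<close>, which follows from
  a gradient bound obtained by the maximum principle (\<open>us_gradient_bound\<close>); and the bounds on the
  derivative of \<open>v\<^sup>*\<close> in space hold only for almost every time (\<open>divc_consistent\<close>). The uniqueness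
  argument of Lasry and Lions, applied to the discrete solution and to the traces, bounds the
  weighted squared distance of the velocities by a multiple of \<open>\<Delta> h\<^sup>r + h\<^bsup>2r\<^esup>\<close>, where \<open>\<Delta>\<close> is the
  distance of the densities (\<open>lasry_lions\<close>); the energy estimate bounds \<open>\<Delta>\<^sup>2\<close> by this, so that \<open>\<Delta>\<close> is
  of order \<open>h\<^sup>r\<close> (\<open>scheme_error\<close>).
\<close>

section \<open>Difference calculus on the periodic grid\<close>

abbreviation up :: "nat \<Rightarrow> 'd \<Rightarrow> real ^ 'd::finite \<Rightarrow> real ^ 'd" where
  "up N i \<equiv> shift N i 1"

abbreviation down :: "nat \<Rightarrow> 'd \<Rightarrow> real ^ 'd::finite \<Rightarrow> real ^ 'd" where
  "down N i \<equiv> shift N i (-1)"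

lemma wrap_cong: "x - y \<in> lattice_Z \<Longrightarrow> wrap x = wrap y"
proof -
  assume a: "x - y \<in> lattice_Z"
  have "frac (x $ j) = frac (y $ j)" for j
  proof -
    have "x $ j - y $ j \<in> \<int>" using a by (simp add: lattice_Z_def)
    then obtain k where "x $ j = y $ j + of_int k" by (metis Ints_cases diff_add_cancel add.commute)
    then show ?thesis by (simp add: frac_def)
  qed
  then show ?thesis by (simp add: wrap_def)
qed

lemma wrap_diff: "wrap x - x \<in> lattice_Z"
  by (simp add: lattice_Z_def wrap_def frac_def)

lemma lattice_uminus: "x \<in> lattice_Z \<Longrightarrow> - x \<in> lattice_Z"
  by (simp add: lattice_Z_def)

lemma wrap_add: "wrap (wrap x + a) = wrap (x + a)"
  by (rule wrap_cong) (use wrap_diff[of x] in simp)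

lemma periodic_wrap: "periodic f \<Longrightarrow> f (wrap x) = f x"
  using wrap_diff[of x] by (metis add.commute diff_add_cancel periodic_def)

lemma grid_bounds:
  assumes "x \<in> grid N" shows "0 \<le> x $ j" "x $ j < 1"
proof -
  from assms obtain i where i: "i < N" "x $ j = real i / real N" by (auto simp: grid_def)
  show "0 \<le> x $ j" "x $ j < 1" unfolding i(2) using i(1) by auto
qed

lemma wrap_grid: "x \<in> grid N \<Longrightarrow> wrap x = x"
  using grid_bounds by (auto simp: wrap_def vec_eq_iff frac_eq)

lemma frac_of_int_div:
  assumes "N > 0" shows "frac (of_int c / real N) = of_int (c mod int N) / real N"
proof -
  have "of_int c / real N - of_int (c mod int N) / real N = of_int (c div int N)"
  proof -
    have "real_of_int c = of_int (c div int N * int N + c mod int N)" by simp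
    also have "\<dots> = of_int (c div int N) * real N + of_int (c mod int N)"
      by (simp only: of_int_add of_int_mult of_int_of_nat_eq)
    finally show ?thesis using assms by (simp add: field_simps)
  qed
  moreover have "0 \<le> c mod int N" "c mod int N < int N" using assms by auto
  then have "0 \<le> real_of_int (c mod int N)" "real_of_int (c mod int N) < real N"
    by (linarith, metis of_int_less_iff of_int_of_nat_eq)
  ultimately show ?thesis using assms
    by (subst frac_unique_iff) auto
qed

lemma shift_grid:
  assumes "x \<in> grid N" "s \<in> \<int>" shows "shift N i s x \<in> grid N"
proof -
  have N: "N > 0" using assms(1) by (auto simp: grid_def)
  obtain k where k: "s = of_int k" using assms(2) by (auto elim: Ints_cases)
  have "\<exists>l<N. shift N i s x $ j = real l / real N" for j
  proof -
    obtain a where a: "a < N" "x $ j = real a / real N" using assms(1) by (auto simp: grid_def)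
    define c where "c = int a + (if j = i then k else 0)"
    have "shift N i s x $ j = frac (of_int c / real N)"
      by (auto simp: shift_def wrap_def c_def k a axis_def add_divide_distrib)
    also have "\<dots> = of_int (c mod int N) / real N" by (rule frac_of_int_div[OF N])
    also have "\<dots> = real (nat (c mod int N)) / real N" using N by simp
    finally show ?thesis using N by (intro exI[of _ "nat (c mod int N)"]) (simp add: nat_less_iff)
  qed
  then show ?thesis by (simp add: grid_def)
qed

lemma up_grid [simp]: "x \<in> grid N \<Longrightarrow> up N i x \<in> grid N"
  and down_grid [simp]: "x \<in> grid N \<Longrightarrow> down N i x \<in> grid N"
  by (simp_all add: shift_grid)

lemma shift_shift: "shift N i s (shift N j t x) = wrap (x + (t / real N) *\<^sub>R axis j 1 + (s / real N) *\<^sub>R axis i 1)"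
  unfolding shift_def by (rule wrap_add)

lemma shift_commute: "shift N i s (shift N j t x) = shift N j t (shift N i s x)"
  by (simp add: shift_shift add_ac)

lemma shift_inverse: "x \<in> grid N \<Longrightarrow> shift N i s (shift N i (- s) x) = x"
  using wrap_grid[of x N] by (simp add: shift_shift)

lemma up_down [simp]: "x \<in> grid N \<Longrightarrow> up N i (down N i x) = x"
  and down_up [simp]: "x \<in> grid N \<Longrightarrow> down N i (up N i x) = x"
  using shift_inverse[of x N i 1] shift_inverse[of x N i "-1"] by simp_all

lemma grid_eq_image:
  "(grid N :: (real ^ 'd::finite) set) = (\<lambda>f. (\<chi> j. real (f j) / real N)) ` (PiE UNIV (\<lambda>_. {..<N}))"
  (is "_ = ?F ` _")
proof
  show "grid N \<subseteq> ?F ` (PiE UNIV (\<lambda>_. {..<N}))"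
  proof
    fix x :: "real ^ 'd" assume "x \<in> grid N"
    then have "\<forall>j. \<exists>i<N. x $ j = real i / real N" by (simp add: grid_def)
    then obtain f where f: "\<forall>j. f j < N \<and> x $ j = real (f j) / real N" by metis
    then have "x = ?F f" by (simp add: vec_eq_iff)
    with f show "x \<in> ?F ` (PiE UNIV (\<lambda>_. {..<N}))" by (intro image_eqI[of _ _ f]) auto
  qed
qed (force simp: grid_def)

lemma finite_grid [simp]: "finite (grid N)"
  unfolding grid_eq_image by (intro finite_imageI finite_PiE) auto

lemma card_grid: "card (grid N :: (real ^ 'd::finite) set) = N ^ CARD('d)"
proof (cases "N = 0")
  case False
  have "inj_on (\<lambda>f. (\<chi> j. real (f j) / real N) :: real ^ 'd) (PiE UNIV (\<lambda>_. {..<N}))"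
    using False by (auto simp: inj_on_def vec_eq_iff)
  then show ?thesis unfolding grid_eq_image
    by (simp add: card_image card_PiE)
qed (simp add: grid_def)

lemma grid_nonempty: "N > 0 \<Longrightarrow> grid N \<noteq> {}"
  by (auto simp: grid_def intro!: exI[of _ "0::real^'d"])

lemma sum_shift:
  assumes "s \<in> \<int>"
  shows "(\<Sum>x\<in>grid N. f (shift N i s x)) = (\<Sum>x\<in>grid N. f x)"
proof (rule sum.reindex_bij_betw)
  show "bij_betw (shift N i s) (grid N) (grid N)"
    using assms shift_inverse[of _ N i s] shift_inverse[of _ N i "- s"]
    by (intro bij_betw_byWitness[of _ "shift N i (- s)"]) (auto simp: shift_grid Ints_minus)
qed

lemma sum_up: "(\<Sum>x\<in>grid N. f (up N i x)) = (\<Sum>x\<in>grid N. f x)"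
  and sum_down: "(\<Sum>x\<in>grid N. f (down N i x)) = (\<Sum>x\<in>grid N. f x)"
  by (rule sum_shift, simp)+

lemma sum_up_mult:
  "(\<Sum>x\<in>grid N. (f x :: 'a::comm_semiring_0) * g (up N i x)) = (\<Sum>x\<in>grid N. f (down N i x) * g x)"
  by (subst sum_up[symmetric, where i = i and f = "\<lambda>x. f (down N i x) * g x"])
    (auto intro: sum.cong)

lemma sum_down_mult:
  "(\<Sum>x\<in>grid N. (f x :: 'a::comm_semiring_0) * g (down N i x)) = (\<Sum>x\<in>grid N. f (up N i x) * g x)"
  by (subst sum_down[symmetric, where i = i and f = "\<lambda>x. f (up N i x) * g x"])
    (auto intro: sum.cong)

definition dplus :: "nat \<Rightarrow> 'd \<Rightarrow> (real ^ 'd::finite \<Rightarrow> real) \<Rightarrow> real ^ 'd \<Rightarrow> real" where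
  "dplus N i f x = (f (up N i x) - f x) * real N"

lemma lap_h_alt:
  "lap_h N f x = (real N)\<^sup>2 * (\<Sum>i\<in>UNIV. f (up N i x) + f (down N i x) - 2 * f x)"
  by (simp add: lap_h_def sum_distrib_left power_divide divide_simps mult_ac)

lemma grad_h_nth: "grad_h N f x $ i = (f (up N i x) - f (down N i x)) * real N / 2"
  by (simp add: grad_h_def)

lemma div_h_alt:
  "div_h N w x = real N / 2 * (\<Sum>i\<in>UNIV. w (up N i x) $ i - w (down N i x) $ i)"
  by (simp add: div_h_def sum_distrib_left mult_ac)

lemma div_h_grad: "div_h N w x = (\<Sum>i\<in>UNIV. grad_h N (\<lambda>y. w y $ i) x $ i)"
  by (simp add: div_h_alt grad_h_nth sum_distrib_left mult_ac)

lemma lap_h_cong: "x \<in> grid N \<Longrightarrow> (\<And>y. y \<in> grid N \<Longrightarrow> f y = g y) \<Longrightarrow> lap_h N f x = lap_h N g x"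
  by (simp add: lap_h_alt)

lemma grad_h_cong: "x \<in> grid N \<Longrightarrow> (\<And>y. y \<in> grid N \<Longrightarrow> f y = g y) \<Longrightarrow> grad_h N f x = grad_h N g x"
  by (simp add: grad_h_def)

lemma lap_h_lin: "lap_h N (\<lambda>y. a * f y + b * g y) x = a * lap_h N f x + b * lap_h N g x"
  by (simp add: lap_h_alt sum_distrib_left sum.distrib [symmetric] algebra_simps)

lemma lap_h_diff: "lap_h N (\<lambda>y. f y - g y) x = lap_h N f x - lap_h N g x"
  using lap_h_lin[of N 1 f "-1" g x] by simp

lemma lap_h_cmult: "lap_h N (\<lambda>y. a * f y) x = a * lap_h N f x"
  using lap_h_lin[of N a f 0 f x] by simp

lemma grad_h_diff: "grad_h N (\<lambda>y. f y - g y) x = grad_h N f x - grad_h N g x"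
  by (simp add: vec_eq_iff grad_h_nth field_simps)

lemma div_h_add: "div_h N (\<lambda>y. f y + g y) x = div_h N f x + div_h N g x"
  by (simp add: div_h_alt sum_distrib_left sum.distrib [symmetric] algebra_simps)

lemma div_h_diff: "div_h N (\<lambda>y. f y - g y) x = div_h N f x - div_h N g x"
  by (simp add: div_h_alt sum_distrib_left sum_subtractf [symmetric] algebra_simps)

lemma div_h_scaleR: "div_h N (\<lambda>y. a *\<^sub>R f y) x = a * div_h N f x"
  by (simp add: div_h_alt sum_distrib_left algebra_simps)

lemma sum_mult_lap:
  "(\<Sum>x\<in>grid N. f x * lap_h N g x) = - (\<Sum>i\<in>UNIV. \<Sum>x\<in>grid N. dplus N i f x * dplus N i g x)"
proof -
  have "(\<Sum>x\<in>grid N. f x * (g (up N i x) + g (down N i x) - 2 * g x)) =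
     - (\<Sum>x\<in>grid N. (f (up N i x) - f x) * (g (up N i x) - g x))" (is "?l = - ?r") for i
  proof -
    have "?l = (\<Sum>x\<in>grid N. f x * g (up N i x)) + (\<Sum>x\<in>grid N. f x * g (down N i x))
        - 2 * (\<Sum>x\<in>grid N. f x * g x)"
      by (simp add: algebra_simps sum.distrib sum_subtractf sum_distrib_left)
    moreover have "?r = (\<Sum>x\<in>grid N. f (up N i x) * g (up N i x)) - (\<Sum>x\<in>grid N. f (up N i x) * g x)
        - (\<Sum>x\<in>grid N. f x * g (up N i x)) + (\<Sum>x\<in>grid N. f x * g x)"
      by (simp add: algebra_simps sum.distrib sum_subtractf)
    moreover have "(\<Sum>x\<in>grid N. f (up N i x) * g (up N i x)) = (\<Sum>x\<in>grid N. f x * g x)"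
      by (rule sum_up)
    ultimately show ?thesis by (simp add: sum_down_mult)
  qed
  then have "(\<Sum>i\<in>UNIV. \<Sum>x\<in>grid N. (real N)\<^sup>2 * (f x * (g (up N i x) + g (down N i x) - 2 * g x)))
     = - (\<Sum>i\<in>UNIV. \<Sum>x\<in>grid N. dplus N i f x * dplus N i g x)"
    by (simp add: sum_distrib_left[symmetric] sum_negf dplus_def power2_eq_square mult_ac)
  moreover have "(\<Sum>x\<in>grid N. f x * lap_h N g x) =
      (\<Sum>i\<in>UNIV. \<Sum>x\<in>grid N. (real N)\<^sup>2 * (f x * (g (up N i x) + g (down N i x) - 2 * g x)))"
    by (subst sum.swap) (simp add: lap_h_alt sum_distrib_left mult_ac)
  ultimately show ?thesis by simp
qed

lemma sum_lap_symmetric: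
  "(\<Sum>x\<in>grid N. f x * lap_h N g x) = (\<Sum>x\<in>grid N. lap_h N f x * g x)"
  using sum_mult_lap[of f N g] sum_mult_lap[of g N f] by (simp add: mult.commute)

lemma sum_lap: "(\<Sum>x\<in>grid N. lap_h N g x) = 0"
  using sum_mult_lap[where f="\<lambda>_. 1" and N=N and g=g] by (simp add: dplus_def)

lemma sum_mult_div:
  "(\<Sum>x\<in>grid N. f x * div_h N w x) = - (\<Sum>x\<in>grid N. grad_h N f x \<bullet> w x)"
proof -
  have "(\<Sum>x\<in>grid N. f x * (w (up N i x) $ i - w (down N i x) $ i)) =
     - (\<Sum>x\<in>grid N. (f (up N i x) - f (down N i x)) * w x $ i)" for i
    using sum_up_mult[where f=f and g="\<lambda>x. w x $ i" and i=i and N=N] sum_down_mult[where f=f and g="\<lambda>x. w x $ i" and i=i and N=N]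
    by (simp add: algebra_simps sum.distrib sum_subtractf)
  then have e: "(\<Sum>x\<in>grid N. real N / 2 * (f x * (w (up N i x) $ i - w (down N i x) $ i)))
     = - (\<Sum>x\<in>grid N. grad_h N f x $ i * w x $ i)" for i
    by (simp only: sum_distrib_left[symmetric]) (simp add: sum_distrib_left grad_h_nth mult_ac)
  have "(\<Sum>i\<in>UNIV. \<Sum>x\<in>grid N. real N / 2 * (f x * (w (up N i x) $ i - w (down N i x) $ i)))
     = - (\<Sum>i\<in>UNIV. \<Sum>x\<in>grid N. grad_h N f x $ i * w x $ i)"
    by (simp only: e sum_negf)
  moreover have "(\<Sum>x\<in>grid N. f x * div_h N w x) =
      (\<Sum>i\<in>UNIV. \<Sum>x\<in>grid N. real N / 2 * (f x * (w (up N i x) $ i - w (down N i x) $ i)))"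
    by (subst sum.swap) (simp add: div_h_alt sum_distrib_left mult_ac)
  moreover have "(\<Sum>i\<in>UNIV. \<Sum>x\<in>grid N. grad_h N f x $ i * w x $ i) = (\<Sum>x\<in>grid N. grad_h N f x \<bullet> w x)"
    by (subst sum.swap) (simp add: inner_vec_def)
  ultimately show ?thesis by simp
qed

lemma sum_div: "(\<Sum>x\<in>grid N. div_h N w x) = 0"
  using sum_mult_div[where f="\<lambda>_. 1" and N=N and w=w] by (simp add: grad_h_def inner_vec_def)

lemma sum_grad_sq_le:
  "(\<Sum>x\<in>grid N. (norm (grad_h N f x))\<^sup>2) \<le> (\<Sum>i\<in>UNIV. \<Sum>x\<in>grid N. (dplus N i f x)\<^sup>2)"
proof -
  have "(\<Sum>x\<in>grid N. (grad_h N f x $ i)\<^sup>2) \<le> (\<Sum>x\<in>grid N. (dplus N i f x)\<^sup>2)" for i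
  proof -
    have "(grad_h N f x $ i)\<^sup>2 \<le> (dplus N i f x)\<^sup>2 / 2 + (dplus N i f (down N i x))\<^sup>2 / 2"
      if "x \<in> grid N" for x
    proof -
      have "grad_h N f x $ i = (dplus N i f x + dplus N i f (down N i x)) / 2"
        using that by (simp add: grad_h_nth dplus_def algebra_simps)
      moreover have "((a + b) / 2)\<^sup>2 \<le> a\<^sup>2 / 2 + b\<^sup>2 / 2" for a b :: real
        using sum_squares_bound[of a b] by (simp add: power2_eq_square field_simps)
      ultimately show ?thesis by metis
    qed
    then have "(\<Sum>x\<in>grid N. (grad_h N f x $ i)\<^sup>2) \<le>
        (\<Sum>x\<in>grid N. (dplus N i f x)\<^sup>2 / 2 + (dplus N i f (down N i x))\<^sup>2 / 2)"
      by (intro sum_mono)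
    also have "\<dots> = (\<Sum>x\<in>grid N. (dplus N i f x)\<^sup>2)"
      using sum_down[where f="\<lambda>x. (dplus N i f x)\<^sup>2" and i=i and N=N]
      by (simp add: sum.distrib sum_divide_distrib[symmetric])
    finally show ?thesis .
  qed
  then have "(\<Sum>i\<in>UNIV. \<Sum>x\<in>grid N. (grad_h N f x $ i)\<^sup>2) \<le> (\<Sum>i\<in>UNIV. \<Sum>x\<in>grid N. (dplus N i f x)\<^sup>2)"
    by (rule sum_mono)
  then show ?thesis
    by (subst (asm) sum.swap)
      (simp add: power2_norm_eq_inner inner_vec_def power2_eq_square[symmetric])
qed

section \<open>Translation invariant Markov operators\<close>

text \<open>
  The conditions are imposed at grid points only: grid functions are functions on the whole space
  whose values elsewhere carry no information.
\<close>

definition markov :: "nat \<Rightarrow> ((real ^ 'd::finite \<Rightarrow> real) \<Rightarrow> (real ^ 'd \<Rightarrow> real)) \<Rightarrow> bool" where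
  "markov N P \<longleftrightarrow>
     (\<forall>f g a b. \<forall>x\<in>grid N. P (\<lambda>y. a * f y + b * g y) x = a * P f x + b * P g x) \<and>
     (\<forall>f. (\<forall>x\<in>grid N. 0 \<le> f x) \<longrightarrow> (\<forall>x\<in>grid N. 0 \<le> P f x)) \<and>
     (\<forall>x\<in>grid N. P (\<lambda>_. 1) x = 1) \<and>
     (\<forall>f i s. s \<in> \<int> \<longrightarrow> (\<forall>x\<in>grid N. P (\<lambda>y. f (shift N i s y)) x = P f (shift N i s x)))"

lemma markov_lin:
  "markov N P \<Longrightarrow> x \<in> grid N \<Longrightarrow> P (\<lambda>y. a * f y + b * g y) x = a * P f x + b * P g x"
  unfolding markov_def by blast

lemma markov_nonneg: "markov N P \<Longrightarrow> x \<in> grid N \<Longrightarrow> (\<And>y. y \<in> grid N \<Longrightarrow> 0 \<le> f y) \<Longrightarrow> 0 \<le> P f x"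
  unfolding markov_def by blast

lemma markov_one: "markov N P \<Longrightarrow> x \<in> grid N \<Longrightarrow> P (\<lambda>_. 1) x = 1"
  unfolding markov_def by blast

lemma markov_shift:
  "markov N P \<Longrightarrow> s \<in> \<int> \<Longrightarrow> x \<in> grid N \<Longrightarrow> P (\<lambda>y. f (shift N i s y)) x = P f (shift N i s x)"
  unfolding markov_def by blast

lemma markov_cmult: "markov N P \<Longrightarrow> x \<in> grid N \<Longrightarrow> P (\<lambda>y. a * f y) x = a * P f x"
  using markov_lin[of N P x a f 0 f] by simp

lemma markov_add: "markov N P \<Longrightarrow> x \<in> grid N \<Longrightarrow> P (\<lambda>y. f y + g y) x = P f x + P g x"
  using markov_lin[of N P x 1 f 1 g] by simp

lemma markov_diff: "markov N P \<Longrightarrow> x \<in> grid N \<Longrightarrow> P (\<lambda>y. f y - g y) x = P f x - P g x"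
  using markov_lin[of N P x 1 f "-1" g] by simp

lemma markov_const: "markov N P \<Longrightarrow> x \<in> grid N \<Longrightarrow> P (\<lambda>_. c) x = c"
  using markov_cmult[of N P x c "\<lambda>_. 1"] markov_one[of N P x] by simp

lemma markov_sum:
  assumes "markov N P" "x \<in> grid N" "finite A"
  shows "P (\<lambda>y. \<Sum>i\<in>A. f i y) x = (\<Sum>i\<in>A. P (f i) x)"
  using assms(3)
proof (induction A rule: finite_induct)
  case empty
  show ?case using markov_const[OF assms(1,2), of 0] by simp
next
  case (insert j A)
  have "P (\<lambda>y. \<Sum>i\<in>insert j A. f i y) x = P (\<lambda>y. f j y + (\<Sum>i\<in>A. f i y)) x" using insert by simp
  also have "\<dots> = P (f j) x + P (\<lambda>y. \<Sum>i\<in>A. f i y) x" by (rule markov_add[OF assms(1,2)])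
  finally show ?case using insert by simp
qed

lemma markov_mono:
  assumes "markov N P" "x \<in> grid N" "\<And>y. y \<in> grid N \<Longrightarrow> f y \<le> g y"
  shows "P f x \<le> P g x"
  using markov_nonneg[OF assms(1,2), of "\<lambda>y. g y - f y"] assms(3) markov_diff[OF assms(1,2), of g f]
  by simp

lemma markov_cong:
  assumes "markov N P" "x \<in> grid N" "\<And>y. y \<in> grid N \<Longrightarrow> f y = g y"
  shows "P f x = P g x"
  using markov_mono[OF assms(1,2), of f g] markov_mono[OF assms(1,2), of g f] assms(3) by simp

lemma markov_bound:
  assumes "markov N P" "x \<in> grid N" "\<And>y. y \<in> grid N \<Longrightarrow> \<bar>f y\<bar> \<le> K"
  shows "\<bar>P f x\<bar> \<le> K"
proof -
  have "P f x \<le> P (\<lambda>_. K) x" using assms(3) by (intro markov_mono[OF assms(1,2)]) (auto simp: abs_le_iff)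
  moreover have "P (\<lambda>_. - K) x \<le> P f x" using assms(3)
    by (intro markov_mono[OF assms(1,2)]) (auto simp: abs_le_iff minus_le_iff)
  ultimately show ?thesis by (simp add: markov_const[OF assms(1,2)])
qed

text \<open>Jensen's inequality for the square, from the positivity of \<open>P ((f - P f x)\<^sup>2) x\<close>.\<close>

lemma markov_jensen:
  assumes "markov N P" "x \<in> grid N"
  shows "(P f x)\<^sup>2 \<le> P (\<lambda>y. (f y)\<^sup>2) x"
proof -
  define c where "c = P f x"
  have n: "0 \<le> P (\<lambda>y. (f y - c)\<^sup>2) x" by (rule markov_nonneg[OF assms]) simp
  have e: "(\<lambda>y. (f y - c)\<^sup>2) = (\<lambda>y. (1 * (f y)\<^sup>2 + (- 2 * c) * f y) + c\<^sup>2)"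
    by (auto simp: power2_eq_square algebra_simps)
  have "P (\<lambda>y. (f y - c)\<^sup>2) x = P (\<lambda>y. 1 * (f y)\<^sup>2 + (- 2 * c) * f y) x + P (\<lambda>_. c\<^sup>2) x"
    unfolding e by (rule markov_add[OF assms])
  also have "P (\<lambda>y. 1 * (f y)\<^sup>2 + (- 2 * c) * f y) x = 1 * P (\<lambda>y. (f y)\<^sup>2) x + (- 2 * c) * P f x"
    by (rule markov_lin[OF assms])
  also have "P (\<lambda>_. c\<^sup>2) x = c\<^sup>2" by (rule markov_const[OF assms])
  finally have "P (\<lambda>y. (f y - c)\<^sup>2) x = P (\<lambda>y. (f y)\<^sup>2) x - c\<^sup>2"
    by (simp add: c_def[symmetric] power2_eq_square)
  then show ?thesis using n by (simp add: c_def)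
qed

lemma markov_id: "markov N (\<lambda>f. f)"
  by (simp add: markov_def)

lemma markov_comp:
  assumes "markov N P" "markov N Q" shows "markov N (\<lambda>f. P (Q f))"
  unfolding markov_def
proof (intro conjI allI ballI impI)
  fix f g :: "real ^ 'a \<Rightarrow> real" and a b and x :: "real ^ 'a" assume x: "x \<in> grid N"
  have "P (Q (\<lambda>y. a * f y + b * g y)) x = P (\<lambda>y. a * Q f y + b * Q g y) x"
    by (rule markov_cong[OF assms(1) x]) (rule markov_lin[OF assms(2)])
  also have "\<dots> = a * P (Q f) x + b * P (Q g) x" by (rule markov_lin[OF assms(1) x])
  finally show "P (Q (\<lambda>y. a * f y + b * g y)) x = a * P (Q f) x + b * P (Q g) x" .
next
  fix f :: "real ^ 'a \<Rightarrow> real" and x :: "real ^ 'a"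
  assume "\<forall>x\<in>grid N. 0 \<le> f x" "x \<in> grid N"
  then show "0 \<le> P (Q f) x"
    by (intro markov_nonneg[OF assms(1), of x "Q f"] markov_nonneg[OF assms(2)]) auto
next
  fix x :: "real ^ 'a" assume x: "x \<in> grid N"
  have "P (Q (\<lambda>_. 1)) x = P (\<lambda>_. 1) x"
    by (rule markov_cong[OF assms(1) x]) (rule markov_one[OF assms(2)])
  also have "\<dots> = 1" by (rule markov_one[OF assms(1) x])
  finally show "P (Q (\<lambda>_. 1)) x = 1" .
next
  fix f :: "real ^ 'a \<Rightarrow> real" and i and s :: real and x :: "real ^ 'a" assume s: "s \<in> \<int>" and x: "x \<in> grid N"
  have "P (Q (\<lambda>y. f (shift N i s y))) x = P (\<lambda>y. Q f (shift N i s y)) x"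
    by (rule markov_cong[OF assms(1) x]) (rule markov_shift[OF assms(2) s])
  also have "\<dots> = P (Q f) (shift N i s x)" by (rule markov_shift[OF assms(1) s x])
  finally show "P (Q (\<lambda>y. f (shift N i s y))) x = P (Q f) (shift N i s x)" .
qed

lemma markov_funpow: "markov N P \<Longrightarrow> markov N (P ^^ n)"
proof (induction n)
  case 0 show ?case using markov_id[of N] by (simp add: id_def)
next
  case (Suc n)
  then show ?case using markov_comp[of N P "P ^^ n"] by (simp add: comp_def)
qed

lemma markov_lap:
  assumes "markov N P" "x \<in> grid N" shows "P (lap_h N f) x = lap_h N (P f) x"
proof -
  have "P (lap_h N f) x = P (\<lambda>x. (real N)\<^sup>2 * (\<Sum>i\<in>UNIV. f (up N i x) + f (down N i x) - 2 * f x)) x"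
    by (rule markov_cong[OF assms]) (rule lap_h_alt)
  also have "\<dots> = (real N)\<^sup>2 * (\<Sum>i\<in>UNIV. P (\<lambda>x. f (up N i x) + f (down N i x) - 2 * f x) x)"
    unfolding markov_cmult[OF assms] by (subst markov_sum[OF assms finite]) (rule refl)
  also have "(\<Sum>i\<in>UNIV. P (\<lambda>x. f (up N i x) + f (down N i x) - 2 * f x) x)
     = (\<Sum>i\<in>UNIV. P f (up N i x) + P f (down N i x) - 2 * P f x)"
  proof (rule sum.cong[OF refl])
    fix i
    have "P (\<lambda>x. f (up N i x) + f (down N i x) - 2 * f x) x = P (\<lambda>x. f (up N i x) + f (down N i x)) x - P (\<lambda>x. 2 * f x) x"
      by (rule markov_diff[OF assms])
    also have "P (\<lambda>x. f (up N i x) + f (down N i x)) x = P (\<lambda>x. f (up N i x)) x + P (\<lambda>x. f (down N i x)) x"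
      by (rule markov_add[OF assms])
    also have "P (\<lambda>x. 2 * f x) x = 2 * P f x" by (rule markov_cmult[OF assms])
    also have "P (\<lambda>x. f (up N i x)) x = P f (up N i x)" by (rule markov_shift[OF assms(1) _ assms(2)]) simp
    also have "P (\<lambda>x. f (down N i x)) x = P f (down N i x)" by (rule markov_shift[OF assms(1) _ assms(2)]) simp
    finally show "P (\<lambda>x. f (up N i x) + f (down N i x) - 2 * f x) x = P f (up N i x) + P f (down N i x) - 2 * P f x" .
  qed
  finally show ?thesis unfolding lap_h_alt[of N "P f"] .
qed

lemma markov_grad:
  assumes "markov N P" "x \<in> grid N" shows "P (\<lambda>y. grad_h N f y $ i) x = grad_h N (P f) x $ i"
proof -
  have "P (\<lambda>y. grad_h N f y $ i) x = P (\<lambda>y. (real N / 2) * (f (up N i y) - f (down N i y))) x"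
    by (rule markov_cong[OF assms]) (simp add: grad_h_nth)
  also have "\<dots> = (real N / 2) * P (\<lambda>y. f (up N i y) - f (down N i y)) x" by (rule markov_cmult[OF assms])
  also have "P (\<lambda>y. f (up N i y) - f (down N i y)) x = P (\<lambda>y. f (up N i y)) x - P (\<lambda>y. f (down N i y)) x"
    by (rule markov_diff[OF assms])
  also have "P (\<lambda>x. f (up N i x)) x = P f (up N i x)" by (rule markov_shift[OF assms(1) _ assms(2)]) simp
  also have "P (\<lambda>x. f (down N i x)) x = P f (down N i x)" by (rule markov_shift[OF assms(1) _ assms(2)]) simp
  finally show ?thesis by (simp add: grad_h_nth)
qed

lemma markov_div:
  assumes "markov N P" "x \<in> grid N"
  shows "P (div_h N w) x = (\<Sum>i\<in>UNIV. grad_h N (P (\<lambda>y. w y $ i)) x $ i)"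
proof -
  have "P (div_h N w) x = P (\<lambda>x. \<Sum>i\<in>UNIV. grad_h N (\<lambda>y. w y $ i) x $ i) x"
    by (rule markov_cong[OF assms]) (rule div_h_grad)
  also have "\<dots> = (\<Sum>i\<in>UNIV. P (\<lambda>x. grad_h N (\<lambda>y. w y $ i) x $ i) x)" by (rule markov_sum[OF assms finite])
  finally show ?thesis unfolding markov_grad[OF assms] .
qed

text \<open>
  The \<open>carre du champ\<close> of the discrete Laplacian, up to a factor 2. A Markov operator that
  commutes with translations commutes with the difference quotients, so that Jensen's inequality
  gives \<open>Gam (P f) \<le> P (Gam f)\<close>: the curvature condition of Bakry and Emery with constant 0.
\<close>

definition Gam :: "nat \<Rightarrow> (real ^ 'd::finite \<Rightarrow> real) \<Rightarrow> real ^ 'd \<Rightarrow> real" where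
  "Gam N f x = (real N)\<^sup>2 * (\<Sum>i\<in>UNIV. (f (up N i x) - f x)\<^sup>2 + (f (down N i x) - f x)\<^sup>2)"

lemma Gam_cong: "x \<in> grid N \<Longrightarrow> (\<And>y. y \<in> grid N \<Longrightarrow> f y = g y) \<Longrightarrow> Gam N f x = Gam N g x"
  by (simp add: Gam_def)

lemma markov_Gam:
  assumes P: "markov N P" and x: "x \<in> grid N" shows "Gam N (P f) x \<le> P (Gam N f) x"
proof -
  have 1: "(P f (shift N i s x) - P f x)\<^sup>2 \<le> P (\<lambda>y. (f (shift N i s y) - f y)\<^sup>2) x" if "s \<in> \<int>" for i s
  proof -
    have "P (\<lambda>y. f (shift N i s y) - f y) x = P (\<lambda>y. f (shift N i s y)) x - P f x" by (rule markov_diff[OF P x])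
    also have "P (\<lambda>y. f (shift N i s y)) x = P f (shift N i s x)" by (rule markov_shift[OF P that x])
    finally show ?thesis using markov_jensen[OF P x, of "\<lambda>y. f (shift N i s y) - f y"] by metis
  qed
  let ?q = "\<lambda>i x. (f (up N i x) - f x)\<^sup>2 + (f (down N i x) - f x)\<^sup>2"
  have "Gam N (P f) x \<le> (real N)\<^sup>2 * (\<Sum>i\<in>UNIV. P (?q i) x)"
    unfolding Gam_def
  proof (intro mult_left_mono sum_mono)
    fix i
    have "P (?q i) x = P (\<lambda>x. (f (up N i x) - f x)\<^sup>2) x + P (\<lambda>x. (f (down N i x) - f x)\<^sup>2) x"
      by (rule markov_add[OF P x])
    then show "(P f (up N i x) - P f x)\<^sup>2 + (P f (down N i x) - P f x)\<^sup>2 \<le> P (?q i) x"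
      using 1[of 1 i] 1[of "-1" i] by simp
  qed simp
  also have "(\<Sum>i\<in>UNIV. P (?q i) x) = P (\<lambda>x. \<Sum>i\<in>UNIV. ?q i x) x" by (rule markov_sum[OF P x finite, symmetric])
  also have "(real N)\<^sup>2 * \<dots> = P (\<lambda>x. (real N)\<^sup>2 * (\<Sum>i\<in>UNIV. ?q i x)) x" by (rule markov_cmult[OF P x, symmetric])
  also have "\<dots> = P (Gam N f) x" by (rule markov_cong[OF P x]) (simp add: Gam_def)
  finally show ?thesis .
qed

lemma lap_square: "lap_h N (\<lambda>y. (w y)\<^sup>2) x = 2 * w x * lap_h N w x + Gam N w x"
proof -
  have "(\<Sum>i\<in>UNIV. (w (up N i x))\<^sup>2 + (w (down N i x))\<^sup>2 - 2 * (w x)\<^sup>2) =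
    2 * w x * (\<Sum>i\<in>UNIV. w (up N i x) + w (down N i x) - 2 * w x) +
    (\<Sum>i\<in>UNIV. (w (up N i x) - w x)\<^sup>2 + (w (down N i x) - w x)\<^sup>2)"
    unfolding sum_distrib_left sum.distrib[symmetric]
    by (rule sum.cong) (auto simp: power2_eq_square algebra_simps)
  then show ?thesis by (simp add: lap_h_alt Gam_def algebra_simps)
qed

lemma grad_le_Gam: assumes "x \<in> grid N" shows "(grad_h N f x $ i)\<^sup>2 \<le> Gam N f x"
proof -
  have 1: "((a - b) / 2)\<^sup>2 \<le> (a - c)\<^sup>2 + (b - c)\<^sup>2" for a b c :: real
  proof -
    have "(a - c)\<^sup>2 + (b - c)\<^sup>2 - ((a - b) / 2)\<^sup>2 = ((a - c) + (b - c))\<^sup>2 / 4 + ((a - c)\<^sup>2 + (b - c)\<^sup>2) / 2"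
      by (simp add: power2_eq_square field_simps)
    moreover have "\<dots> \<ge> 0" by simp
    ultimately show ?thesis by linarith
  qed
  have "(grad_h N f x $ i)\<^sup>2 = (real N)\<^sup>2 * ((f (up N i x) - f (down N i x)) / 2)\<^sup>2"
    by (simp add: grad_h_nth power_mult_distrib power_divide)
  also have "\<dots> \<le> (real N)\<^sup>2 * ((f (up N i x) - f x)\<^sup>2 + (f (down N i x) - f x)\<^sup>2)"
    by (intro mult_left_mono 1) simp
  also have "\<dots> \<le> Gam N f x" unfolding Gam_def
    by (intro mult_left_mono member_le_sum[where f="\<lambda>i. (f (up N i x) - f x)\<^sup>2 + (f (down N i x) - f x)\<^sup>2"]) auto
  finally show ?thesis .
qed

subsection \<open>Explicit and implicit diffusion steps\<close>

definition expl :: "nat \<Rightarrow> real \<Rightarrow> (real ^ 'd::finite \<Rightarrow> real) \<Rightarrow> real ^ 'd \<Rightarrow> real" where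
  "expl N \<kappa> f x = f x + \<kappa> * lap_h N f x"

lemma lap_shift: "lap_h N (\<lambda>y. f (shift N i s y)) x = lap_h N f (shift N i s x)"
  unfolding lap_h_alt by (simp only: shift_commute[of N i s])

lemma markov_expl:
  assumes "\<kappa> \<ge> 0" "2 * real CARD('d) * \<kappa> * (real N)\<^sup>2 \<le> 1"
  shows "markov N (expl N \<kappa> :: (real ^ 'd::finite \<Rightarrow> real) \<Rightarrow> _)"
  unfolding markov_def
proof (intro conjI allI ballI impI)
  fix f :: "real ^ 'd \<Rightarrow> real" and x :: "real ^ 'd"
  assume f: "\<forall>x\<in>grid N. 0 \<le> f x" and x: "x \<in> grid N"
  have "expl N \<kappa> f x = (1 - 2 * real CARD('d) * \<kappa> * (real N)\<^sup>2) * f x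
     + \<kappa> * (real N)\<^sup>2 * (\<Sum>i\<in>UNIV. f (up N i x) + f (down N i x))"
    by (simp add: expl_def lap_h_alt sum_subtractf sum.distrib algebra_simps)
  also have "\<dots> \<ge> 0" using assms f x
    by (intro add_nonneg_nonneg mult_nonneg_nonneg sum_nonneg) auto
  finally show "0 \<le> expl N \<kappa> f x" .
qed (auto simp: expl_def lap_h_lin lap_shift algebra_simps, simp add: lap_h_def)

text \<open>
  Minimum principle: where \<open>w\<close> is minimal on the grid, its discrete Laplacian is nonnegative.
\<close>

lemma comparison:
  assumes "\<tau> \<ge> 0" "\<And>x. x \<in> grid N \<Longrightarrow> 0 \<le> w x - \<tau> * lap_h N w x" "x \<in> grid N"
  shows "0 \<le> w x"
proof -
  obtain z where z: "z \<in> grid N" "\<And>y. y \<in> grid N \<Longrightarrow> w z \<le> w y"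
    using arg_min_if_finite(1)[of "grid N" w] arg_min_least[of "grid N" _ w] assms(3) by fastforce
  have "0 \<le> lap_h N w z" unfolding lap_h_alt using z
  proof (intro mult_nonneg_nonneg sum_nonneg)
    fix i show "0 \<le> w (up N i z) + w (down N i z) - 2 * w z"
      using z(2)[of "up N i z"] z(2)[of "down N i z"] z(1) by simp
  qed simp
  then have "0 \<le> w z" using assms(1) assms(2)[OF z(1)] by (smt (verit) mult_nonneg_nonneg)
  then show ?thesis using z(2)[OF assms(3)] by linarith
qed

text \<open>
  The implicit step is a geometric mixture of powers of the average over the neighbours.
\<close>

lemma implicit_solvable:
  fixes f :: "real ^ 'd::finite \<Rightarrow> real"
  assumes "\<tau> \<ge> 0"
  shows "\<exists>w. \<forall>x\<in>grid N. w x - \<tau> * lap_h N w x = f x"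
proof -
  define nb :: "(real ^ 'd \<Rightarrow> real) \<Rightarrow> real ^ 'd \<Rightarrow> real" where
    "nb g x = (\<Sum>i\<in>UNIV. g (up N i x) + g (down N i x)) / (2 * real CARD('d))" for g x
  \<comment> \<open>With \<open>nb\<close> the mean over the neighbours, the equation reads \<open>(1 + c) w = f + c nb w\<close>.\<close>
  define c where "c = 2 * real CARD('d) * \<tau> * (real N)\<^sup>2"
  have c0: "c \<ge> 0" using assms by (simp add: c_def)
  define q where "q = c / (1 + c)"
  have q: "0 \<le> q" "q < 1" using c0 by (auto simp: q_def)
  have mnb: "markov N nb"
    unfolding markov_def
  proof (intro conjI allI ballI impI)
    fix f g :: "real ^ 'd \<Rightarrow> real" and a b and x :: "real ^ 'd"
    show "nb (\<lambda>y. a * f y + b * g y) x = a * nb f x + b * nb g x"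
      by (simp add: nb_def sum_distrib_left sum.distrib algebra_simps add_divide_distrib)
  next
    fix f :: "real ^ 'd \<Rightarrow> real" and i and s :: real and x :: "real ^ 'd"
    show "nb (\<lambda>y. f (shift N i s y)) x = nb f (shift N i s x)"
      unfolding nb_def by (simp only: shift_commute[of N i s])
  qed (auto simp: nb_def intro!: sum_nonneg divide_nonneg_nonneg add_nonneg_nonneg)
  define a where "a n x = q ^ n / (1 + c) * (nb ^^ n) f x" for n x
  define w where "w x = (\<Sum>n. a n x)" for x
  define K where "K = (\<Sum>x\<in>grid N. \<bar>f x\<bar>)"
  have fK: "\<bar>f x\<bar> \<le> K" if "x \<in> grid N" for x
    unfolding K_def using that by (intro member_le_sum[where f="\<lambda>x. \<bar>f x\<bar>"]) auto
  have sums: "(\<lambda>n. a n x) sums w x" if x: "x \<in> grid N" for x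
    unfolding w_def
  proof (rule summable_sums, rule summable_comparison_test)
    have "\<bar>a n x\<bar> \<le> q ^ n * (K / (1 + c))" for n
    proof -
      have "\<bar>(nb ^^ n) f x\<bar> \<le> K" by (rule markov_bound[OF markov_funpow[OF mnb] x fK])
      then have "\<bar>q ^ n / (1 + c)\<bar> * \<bar>(nb ^^ n) f x\<bar> \<le> \<bar>q ^ n / (1 + c)\<bar> * K"
        by (intro mult_left_mono) auto
      then show ?thesis using q c0 by (simp add: a_def abs_mult)
    qed
    then show "\<exists>M. \<forall>n\<ge>M. norm (a n x) \<le> q ^ n * (K / (1 + c))" by auto
    show "summable (\<lambda>n. q ^ n * (K / (1 + c)))" using q by (intro summable_mult2 summable_geometric) auto
  qed
  have "w x - \<tau> * lap_h N w x = f x" if x: "x \<in> grid N" for x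
  proof -
    have "(\<lambda>n. q * nb (a n) x) sums (q * nb w x)"
      unfolding nb_def using x by (intro sums_mult sums_divide sums_sum sums_add sums) auto
    moreover have "q * nb (a n) x = a (Suc n) x" for n
    proof -
      have "nb (a n) x = q ^ n / (1 + c) * (nb ^^ Suc n) f x"
        using markov_cmult[OF mnb x, of "q ^ n / (1 + c)" "(nb ^^ n) f"] by (simp add: a_def[abs_def])
      then show ?thesis by (simp add: a_def)
    qed
    ultimately have "(\<lambda>n. a (Suc n) x) sums (q * nb w x)" by simp
    then have "(\<lambda>n. a n x) sums (q * nb w x + a 0 x)" by (rule sums_Suc)
    then have "w x = q * nb w x + f x / (1 + c)"
      using sums[OF x] by (simp add: sums_unique2 a_def)
    then have "(1 + c) * w x = ((1 + c) * q) * nb w x + (1 + c) * (f x / (1 + c))"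
      by (metis distrib_left mult.assoc)
    then have e: "(1 + c) * w x = c * nb w x + f x" using c0 by (simp add: q_def)
    have "c * nb w x - c * w x = \<tau> * lap_h N w x"
      by (simp add: c_def nb_def lap_h_alt sum_subtractf algebra_simps)
    with e show ?thesis by (simp add: algebra_simps)
  qed
  then show ?thesis by blast
qed

definition resolv :: "nat \<Rightarrow> real \<Rightarrow> (real ^ 'd::finite \<Rightarrow> real) \<Rightarrow> real ^ 'd \<Rightarrow> real" where
  "resolv N \<tau> f = (THE w. w \<in> grid_funs N \<and> (\<forall>x\<in>grid N. w x - \<tau> * lap_h N w x = f x))"

lemma half_step_resolv: "half_step D \<theta> T N = resolv N (\<theta> * sigma D * (1 / real T))"
  by (simp add: fun_eq_iff half_step_def resolv_def)

context
  fixes \<tau> :: real assumes \<tau>: "\<tau> \<ge> 0"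
begin

lemma implicit_unique:
  assumes "\<And>x. x \<in> grid N \<Longrightarrow> w x - \<tau> * lap_h N w x = w' x - \<tau> * lap_h N w' x" "x \<in> grid N"
  shows "w x = w' x"
proof -
  have 1: "0 \<le> w x - w' x"
    by (rule comparison[OF \<tau> _ assms(2)]) (use assms(1) in \<open>simp add: lap_h_diff algebra_simps\<close>)
  have 2: "0 \<le> w' x - w x"
    by (rule comparison[OF \<tau> _ assms(2)]) (use assms(1) in \<open>simp add: lap_h_diff algebra_simps\<close>)
  show ?thesis using 1 2 by simp
qed

lemma resolv_spec:
  "resolv N \<tau> f \<in> grid_funs N \<and> (\<forall>x\<in>grid N. resolv N \<tau> f x - \<tau> * lap_h N (resolv N \<tau> f) x = f x)"
proof -
  obtain w where w: "\<forall>x\<in>grid N. w x - \<tau> * lap_h N w x = f x" using implicit_solvable[OF \<tau>, of N f] by blast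
  define w' where "w' x = (if x \<in> grid N then w x else 0)" for x
  have l: "lap_h N w' x = lap_h N w x" if "x \<in> grid N" for x
    by (rule lap_h_cong[OF that]) (simp add: w'_def)
  have "\<exists>!w. w \<in> grid_funs N \<and> (\<forall>x\<in>grid N. w x - \<tau> * lap_h N w x = f x)"
  proof (rule ex1I[of _ w'])
    show "w' \<in> grid_funs N \<and> (\<forall>x\<in>grid N. w' x - \<tau> * lap_h N w' x = f x)"
      using w l by (auto simp: w'_def grid_funs_def)
    fix v assume v: "v \<in> grid_funs N \<and> (\<forall>x\<in>grid N. v x - \<tau> * lap_h N v x = f x)"
    show "v = w'"
    proof
      fix x show "v x = w' x"
      proof (cases "x \<in> grid N")
        case True
        then show ?thesis using v w l by (intro implicit_unique[of N v w' x]) (auto simp: w'_def)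
      qed (use v in \<open>auto simp: w'_def grid_funs_def\<close>)
    qed
  qed
  from theI'[OF this] show ?thesis unfolding resolv_def .
qed

lemma resolv_eq: "x \<in> grid N \<Longrightarrow> resolv N \<tau> f x - \<tau> * lap_h N (resolv N \<tau> f) x = f x"
  using resolv_spec by blast

lemma resolv_unique:
  assumes "\<And>x. x \<in> grid N \<Longrightarrow> w x - \<tau> * lap_h N w x = f x" "x \<in> grid N"
  shows "resolv N \<tau> f x = w x"
proof (rule implicit_unique[OF _ assms(2)])
  fix y :: "real ^ 'a" assume y: "y \<in> grid N"
  show "resolv N \<tau> f y - \<tau> * lap_h N (resolv N \<tau> f) y = w y - \<tau> * lap_h N w y"
    unfolding resolv_eq[OF y] assms(1)[OF y] ..
qed

lemma markov_resolv: "markov N (resolv N \<tau>)"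
  unfolding markov_def
proof (intro conjI allI ballI impI)
  fix f g :: "real ^ 'a \<Rightarrow> real" and a b and x :: "real ^ 'a" assume x: "x \<in> grid N"
  show "resolv N \<tau> (\<lambda>y. a * f y + b * g y) x = a * resolv N \<tau> f x + b * resolv N \<tau> g x"
  proof (rule resolv_unique[OF _ x])
    fix x :: "real ^ 'a" assume x: "x \<in> grid N"
    show "a * resolv N \<tau> f x + b * resolv N \<tau> g x - \<tau> * lap_h N (\<lambda>x. a * resolv N \<tau> f x + b * resolv N \<tau> g x) x
      = a * f x + b * g x"
      unfolding resolv_eq[OF x, of f, symmetric] resolv_eq[OF x, of g, symmetric] lap_h_lin
      by (simp only: algebra_simps)
  qed
next
  fix f :: "real ^ 'a \<Rightarrow> real" and x :: "real ^ 'a"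
  assume "\<forall>x\<in>grid N. 0 \<le> f x" "x \<in> grid N"
  then show "0 \<le> resolv N \<tau> f x"
    by (intro comparison[OF \<tau>, of N "resolv N \<tau> f"]) (auto simp: resolv_eq)
next
  fix x :: "real ^ 'a" assume x: "x \<in> grid N"
  show "resolv N \<tau> (\<lambda>_. 1) x = 1"
    by (rule resolv_unique[OF _ x]) (simp add: lap_h_def)
next
  fix f :: "real ^ 'a \<Rightarrow> real" and i and s :: real and x :: "real ^ 'a" assume s: "s \<in> \<int>" and x: "x \<in> grid N"
  show "resolv N \<tau> (\<lambda>y. f (shift N i s y)) x = resolv N \<tau> f (shift N i s x)"
    by (rule resolv_unique[OF _ x]) (simp add: lap_shift resolv_eq shift_grid[OF _ s])
qed

text \<open>
  Jensen's inequality together with its defect, which comes from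
  \<open>lap_h (w\<^sup>2) = 2 w lap_h w + Gam w\<close> for \<open>w = resolv f\<close>.
\<close>

lemma resolv_square:
  assumes x: "x \<in> grid N"
  shows "(resolv N \<tau> f x)\<^sup>2 + \<tau> * resolv N \<tau> (Gam N (resolv N \<tau> f)) x \<le> resolv N \<tau> (\<lambda>y. (f y)\<^sup>2) x"
proof -
  let ?B = "resolv N \<tau>"
  define w where "w = ?B f"
  define z where "z y = ?B (\<lambda>y. (f y)\<^sup>2) y - (w y)\<^sup>2 - \<tau> * ?B (Gam N w) y" for y
  have "0 \<le> z x"
  proof (rule comparison[OF \<tau> _ x])
    fix y :: "real ^ 'a" assume y: "y \<in> grid N"
    have f: "f y = w y - \<tau> * lap_h N w y" using resolv_eq[OF y, of f] by (simp add: w_def)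
    have "lap_h N z y = lap_h N (?B (\<lambda>y. (f y)\<^sup>2)) y - lap_h N (\<lambda>y. (w y)\<^sup>2) y - \<tau> * lap_h N (?B (Gam N w)) y"
      unfolding z_def by (simp only: lap_h_diff lap_h_cmult)
    note L = this
    have "z y - \<tau> * lap_h N z y = (?B (\<lambda>y. (f y)\<^sup>2) y - \<tau> * lap_h N (?B (\<lambda>y. (f y)\<^sup>2)) y)
       - (w y)\<^sup>2 + \<tau> * (2 * w y * lap_h N w y + Gam N w y)
       - \<tau> * (?B (Gam N w) y - \<tau> * lap_h N (?B (Gam N w)) y)"
      unfolding L lap_square z_def by (simp only: algebra_simps)
    also have "\<dots> = (\<tau> * lap_h N w y)\<^sup>2"
      unfolding resolv_eq[OF y] by (simp add: f power2_eq_square algebra_simps)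
    finally show "0 \<le> z y - \<tau> * lap_h N z y" by simp
  qed
  then show ?thesis by (simp add: z_def w_def)
qed

end

text \<open>
  Regularizing effect of the theta-scheme for the heat equation. The dissipation \<open>\<tau> Gam\<close> that
  \<open>resolv_square\<close> gains in each step is, by the commutation with translations, at least the
  dissipation of the last step; \<open>n\<close> steps gain \<open>n\<close> times this amount, while the square stays
  bounded.
\<close>

lemma smoothing:
  fixes f :: "real ^ 'd::finite \<Rightarrow> real"
  assumes \<tau>: "\<tau> \<ge> 0" and \<kappa>: "\<kappa> \<ge> 0" "2 * real CARD('d) * \<kappa> * (real N)\<^sup>2 \<le> 1"
    and x: "x \<in> grid N" and f: "\<And>y. y \<in> grid N \<Longrightarrow> \<bar>f y\<bar> \<le> K"
  shows "real n * \<tau> * Gam N (resolv N \<tau> (((\<lambda>f. resolv N \<tau> (expl N \<kappa> f)) ^^ n) f)) x \<le> K\<^sup>2"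
proof -
  let ?B = "resolv N \<tau>" and ?E = "expl N \<kappa>"
  define P where "P = (\<lambda>f::real ^ 'd \<Rightarrow> real. ?B (?E f))"
  note mE = markov_expl[OF \<kappa>] and mB = markov_resolv[OF \<tau>, of N]
  have mP: "markov N P" unfolding P_def by (rule markov_comp[OF mB mE])
  have BP: "P (?B g) y = ?B (P g) y" if y: "y \<in> grid N" for g y
  proof -
    have "?B (?E g) y = ?E (?B g) y" if y: "y \<in> grid N" for g y
      unfolding expl_def using markov_lap[OF mB y, of g]
        markov_add[OF mB y, of g "\<lambda>y. \<kappa> * lap_h N g y"] markov_cmult[OF mB y, of \<kappa> "lap_h N g"]
      by simp
    then show ?thesis unfolding P_def by (intro markov_cong[OF mB y]) (rule sym)
  qed
  have main: "\<forall>y\<in>grid N. real n * \<tau> * Gam N (?B ((P ^^ n) f)) y \<le> (P ^^ n) (\<lambda>y. (f y)\<^sup>2) y - ((P ^^ n) f y)\<^sup>2"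
  proof (induction n)
    case 0 show ?case by simp
  next
    case (Suc n)
    show ?case
    proof
      fix y :: "real ^ 'd" assume y: "y \<in> grid N"
      define g where "g = (P ^^ n) f"
      define G2 where "G2 = (P ^^ n) (\<lambda>y. (f y)\<^sup>2)"
      have "(P g y)\<^sup>2 + \<tau> * ?B (Gam N (P g)) y \<le> ?B (\<lambda>y. (?E g y)\<^sup>2) y"
        unfolding P_def by (rule resolv_square[OF \<tau> y])
      also have "\<dots> \<le> P (\<lambda>y. (g y)\<^sup>2) y"
        unfolding P_def by (rule markov_mono[OF mB y]) (rule markov_jensen[OF mE])
      finally have 1: "(P g y)\<^sup>2 + \<tau> * ?B (Gam N (P g)) y \<le> P (\<lambda>y. (g y)\<^sup>2) y" .
      have "\<tau> * Gam N (?B (P g)) y \<le> \<tau> * ?B (Gam N (P g)) y"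
        by (intro mult_left_mono markov_Gam[OF mB y] \<tau>)
      moreover have "real n * \<tau> * Gam N (?B (P g)) y \<le> P G2 y - P (\<lambda>y. (g y)\<^sup>2) y"
      proof -
        have "real n * \<tau> * Gam N (?B (P g)) y = real n * \<tau> * Gam N (P (?B g)) y"
          using Gam_cong[OF y, of "P (?B g)" "?B (P g)"] BP by simp
        also have "\<dots> \<le> real n * \<tau> * P (Gam N (?B g)) y"
          using \<tau> by (intro mult_left_mono markov_Gam[OF mP y]) auto
        also have "\<dots> = P (\<lambda>y. real n * \<tau> * Gam N (?B g) y) y" by (rule markov_cmult[OF mP y, symmetric])
        also have "\<dots> \<le> P (\<lambda>y. G2 y - (g y)\<^sup>2) y"
          by (rule markov_mono[OF mP y]) (use Suc in \<open>simp add: g_def G2_def\<close>)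
        also have "\<dots> = P G2 y - P (\<lambda>y. (g y)\<^sup>2) y" by (rule markov_diff[OF mP y])
        finally show ?thesis .
      qed
      ultimately have "real (Suc n) * \<tau> * Gam N (?B (P g)) y \<le> P G2 y - (P g y)\<^sup>2"
        using 1 by (simp add: algebra_simps)
      then show "real (Suc n) * \<tau> * Gam N (?B ((P ^^ Suc n) f)) y
          \<le> (P ^^ Suc n) (\<lambda>y. (f y)\<^sup>2) y - ((P ^^ Suc n) f y)\<^sup>2"
        by (simp add: g_def G2_def)
    qed
  qed
  have "(P ^^ n) (\<lambda>y. (f y)\<^sup>2) x \<le> K\<^sup>2"
  proof -
    have "\<bar>(P ^^ n) (\<lambda>y. (f y)\<^sup>2) x\<bar> \<le> K\<^sup>2"
    proof (rule markov_bound[OF markov_funpow[OF mP] x])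
      fix y :: "real ^ 'd" assume "y \<in> grid N"
      then have "\<bar>f y\<bar> \<le> \<bar>K\<bar>" using f by fastforce
      then show "\<bar>(f y)\<^sup>2\<bar> \<le> K\<^sup>2" using power2_le_iff_abs_le[of "\<bar>K\<bar>" "f y"] by simp
    qed
    then show ?thesis by simp
  qed
  moreover have "real n * \<tau> * Gam N (?B ((P ^^ n) f)) x \<le> (P ^^ n) (\<lambda>y. (f y)\<^sup>2) x - ((P ^^ n) f x)\<^sup>2"
    using main x by blast
  ultimately show ?thesis unfolding P_def by (smt (verit) zero_le_power2)
qed

section \<open>Gronwall inequalities\<close>

lemma exp_neg_le: assumes "x > 0" shows "exp (- x) \<le> 1 / (x::real)"
proof -
  have "x \<le> exp x" using exp_ge_add_one_self[of x] by linarith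
  then show ?thesis using assms by (simp add: exp_minus divide_simps)
qed

lemma sqrt_step:
  assumes "j \<ge> 1" "T > 0"
  shows "(1 / real T) / sqrt (real j / real T) \<le> 2 * (sqrt (real j / real T) - sqrt (real (j - 1) / real T))"
proof -
  define s s' where "s = sqrt (real j / real T)" and "s' = sqrt (real (j - 1) / real T)"
  have s: "s > 0" "s' \<ge> 0" "s' \<le> s" using assms by (auto simp: s_def s'_def divide_right_mono)
  have "s\<^sup>2 - s'\<^sup>2 = 1 / real T" using assms
    unfolding s_def s'_def by (subst real_sqrt_pow2, simp)+ (simp add: of_nat_diff diff_divide_distrib)
  then have "1 / real T = (s - s') * (s + s')" by (simp add: power2_eq_square algebra_simps)
  also have "\<dots> \<le> (s - s') * (2 * s)" using s by (intro mult_left_mono) auto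
  finally have "1 / real T \<le> (2 * (s - s')) * s" by (simp only: mult_ac)
  then have "(1 / real T) / s \<le> 2 * (s - s')" using s(1) by (simp only: pos_divide_le_eq)
  then show ?thesis by (simp add: s_def s'_def)
qed

lemma sum_kernel_le: 
  assumes "T > 0" shows "(\<Sum>j<n. (1 / real T) / sqrt (real (Suc j) / real T)) \<le> 2 * sqrt (real n / real T)"
proof (induction n)
  case (Suc n)
  then show ?case using sqrt_step[of "Suc n" T] assms by simp
qed simp

text \<open>
  The kernel has an integrable singularity. Its weighted integral is made small by splitting at
  \<open>\<delta>\<close>: near 0 the integral is at most \<open>2 sqrt \<delta>\<close>, and away from 0 the exponential weight
  is small.
\<close>

lemma sum_weighted_kernel_le:
  assumes T: "T > 0" and \<delta>: "\<delta> > 0" and L: "\<Lambda> > 0" and n: "n \<le> T"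
  shows "(\<Sum>j<n. exp (- \<Lambda> * (real (Suc j) / real T)) * ((1 / real T) / sqrt (real (Suc j) / real T)))
     \<le> 2 * sqrt \<delta> + 1 / (\<Lambda> * \<delta> * sqrt \<delta>)"
proof -
  define D where "D = 1 / (\<Lambda> * \<delta> * sqrt \<delta>)"
  have D0: "D > 0" using \<delta> L by (simp add: D_def)
  have "(\<Sum>j<n. exp (- \<Lambda> * (real (Suc j) / real T)) * ((1 / real T) / sqrt (real (Suc j) / real T)))
     \<le> 2 * sqrt (min (real n / real T) \<delta>) + (real n / real T) * D"
  proof (induction n)
    case 0 show ?case using \<delta> by simp
  next
    case (Suc n)
    define s where "s = real (Suc n) / real T"
    have s: "s > 0" using T by (simp add: s_def)
    define s' where "s' = real n / real T"
    have s': "s' \<ge> 0" "s' \<le> s" "s = s' + 1 / real T" using T by (auto simp: s_def s'_def divide_right_mono add_divide_distrib)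
    then have s'': "min s' \<delta> \<le> min s \<delta>" by (meson min.mono order_refl)
    have "exp (- \<Lambda> * s) * ((1 / real T) / sqrt s) \<le>
      2 * (sqrt (min s \<delta>) - sqrt (min s' \<delta>)) + (1 / real T) * D"
    proof (cases "s \<le> \<delta>")
      case True
      have "exp (- \<Lambda> * s) * ((1 / real T) / sqrt s) \<le> 1 * ((1 / real T) / sqrt s)"
        using s L T by (intro mult_right_mono) auto
      also have "\<dots> \<le> 2 * (sqrt s - sqrt s')"
        using sqrt_step[of "Suc n" T] T by (simp add: s_def s'_def)
      finally show ?thesis using True s' D0 T
        by (smt (verit) divide_nonneg_nonneg mult_nonneg_nonneg of_nat_0_le_iff)
    next
      case False
      have "exp (- \<Lambda> * s) \<le> 1 / (\<Lambda> * \<delta>)"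
      proof -
        have "exp (- (\<Lambda> * s)) \<le> 1 / (\<Lambda> * s)" using s L by (intro exp_neg_le) auto
        also have "\<dots> \<le> 1 / (\<Lambda> * \<delta>)" using False \<delta> L by (intro divide_left_mono) auto
        finally show ?thesis by simp
      qed
      moreover have "(1 / real T) / sqrt s \<le> (1 / real T) / sqrt \<delta>"
        using False \<delta> T by (intro divide_left_mono) auto
      ultimately have "exp (- \<Lambda> * s) * ((1 / real T) / sqrt s) \<le> (1 / (\<Lambda> * \<delta>)) * ((1 / real T) / sqrt \<delta>)"
        using s \<delta> L T by (intro mult_mono) auto
      also have "\<dots> = (1 / real T) * D" by (simp add: D_def)
      finally have le: "exp (- \<Lambda> * s) * ((1 / real T) / sqrt s) \<le> (1 / real T) * D" .
      have "0 \<le> 2 * (sqrt (min s \<delta>) - sqrt (min s' \<delta>))" using s'' by simp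
      from add_mono[OF this le] show ?thesis by (simp only: add_0)
    qed
    moreover have "(real (Suc n) / real T) * D = (real n / real T) * D + (1 / real T) * D"
      by (simp add: add_divide_distrib distrib_right)
    ultimately show ?case using Suc by (simp add: s_def s'_def)
  qed
  also have "\<dots> \<le> 2 * sqrt \<delta> + 1 * D"
    using n T D0 by (intro add_mono mult_left_mono mult_right_mono) auto
  finally show ?thesis by (simp add: D_def)
qed

text \<open>
  \<open>G\<close> bounds the solutions of the integral inequality with kernel \<open>C t\<^bsup>-1/2\<^esup>\<close> on the unit interval,
  discretized with any time step.
\<close>

definition gronwall_const :: "real \<Rightarrow> real \<Rightarrow> bool" where
  "gronwall_const C G \<longleftrightarrow> G > 0 \<and> (\<forall>T a K. T > 0 \<longrightarrow> (\<forall>t\<le>T. 0 \<le> a t) \<longrightarrow>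
    (\<forall>t\<le>T. a t \<le> K + C * (\<Sum>s<t. a s * ((1 / real T) / sqrt (real (t - s) / real T)))) \<longrightarrow>
    (\<forall>t\<le>T. a t \<le> G * (K::real)))"

lemma gronwall_constD:
  assumes "gronwall_const C G" "T > 0" "\<And>t. t \<le> T \<Longrightarrow> 0 \<le> a t"
    and "\<And>t. t \<le> T \<Longrightarrow> a t \<le> K + C * (\<Sum>s<t. a s * ((1 / real T) / sqrt (real (t - s) / real T)))" and "t \<le> T"
  shows "a t \<le> G * K"
  using assms unfolding gronwall_const_def by blast

text \<open>
  With the weight \<open>exp (- \<Lambda> t)\<close> for large \<open>\<Lambda>\<close>, the weighted integral of the kernel is so small
  that the maximum of the weighted solution absorbs the integral term.
\<close>

lemma singular_gronwall:
  assumes C: "C \<ge> 0"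
  shows "\<exists>G. gronwall_const C G"
proof -
  \<comment> \<open>With these choices, \<open>C\<close> times the bound of \<open>sum_weighted_kernel_le\<close> is at most 1/2.\<close>
  define \<delta> where "\<delta> = (1 / (8 * (C + 1)))\<^sup>2"
  have \<delta>: "\<delta> > 0" "sqrt \<delta> = 1 / (8 * (C + 1))" using C by (auto simp: \<delta>_def)
  define \<Lambda> where "\<Lambda> = 4 * (C + 1) / (\<delta> * sqrt \<delta>)"
  have L: "\<Lambda> > 0" using \<delta> C by (simp add: \<Lambda>_def)
  have "1 / (\<Lambda> * \<delta> * sqrt \<delta>) = 1 / (4 * (C + 1))" using \<delta>(1) C unfolding \<Lambda>_def by simp
  then have "C * (2 * sqrt \<delta> + 1 / (\<Lambda> * \<delta> * sqrt \<delta>)) = C * (2 * (1 / (8 * (C + 1))) + 1 / (4 * (C + 1)))"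
    by (simp only: \<delta>(2))
  also have "\<dots> = (C / (C + 1)) / 2" using C by (simp add: divide_simps)
  also have "\<dots> \<le> 1 / 2" using C by (simp add: divide_simps)
  finally have half: "C * (2 * sqrt \<delta> + 1 / (\<Lambda> * \<delta> * sqrt \<delta>)) \<le> 1 / 2" .
  show ?thesis unfolding gronwall_const_def
  proof (intro exI[of _ "2 * exp \<Lambda>"] conjI allI impI)
    fix T :: nat and a :: "nat \<Rightarrow> real" and K :: real and t
    assume T: "T > 0" and a: "\<forall>t\<le>T. 0 \<le> a t"
      and le: "\<forall>t\<le>T. a t \<le> K + C * (\<Sum>s<t. a s * ((1 / real T) / sqrt (real (t - s) / real T)))"
      and t: "t \<le> T"
    define e where "e t = exp (- \<Lambda> * (real t / real T))" for t
    define S where "S = Max ((\<lambda>t. a t * e t) ` {..T})"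
    have S: "a t * e t \<le> S" if "t \<le> T" for t unfolding S_def using that by (intro Max_ge) auto
    have "S \<in> (\<lambda>t. a t * e t) ` {..T}" unfolding S_def by (intro Max_in) auto
    then obtain t0 where t0: "t0 \<le> T" "S = a t0 * e t0" by auto
    have S0: "S \<ge> 0" unfolding t0(2) e_def using a t0 by simp
    have e1: "e t0 \<le> 1" using L by (simp add: e_def)
    have K0: "K \<ge> 0" using a le by force
    have "(\<Sum>s<t0. a s * ((1 / real T) / sqrt (real (t0 - s) / real T))) * e t0 \<le>
      (\<Sum>s<t0. S * (exp (- \<Lambda> * (real (t0 - s) / real T)) * ((1 / real T) / sqrt (real (t0 - s) / real T))))"
      unfolding sum_distrib_right
    proof (rule sum_mono)
      fix s assume s: "s \<in> {..<t0}"
      have "e t0 = e s * exp (- \<Lambda> * (real (t0 - s) / real T))"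
        using s by (simp add: e_def exp_add[symmetric] of_nat_diff field_simps add_divide_distrib[symmetric])
      then have "a s * ((1 / real T) / sqrt (real (t0 - s) / real T)) * e t0
         = (a s * e s) * (exp (- \<Lambda> * (real (t0 - s) / real T)) * ((1 / real T) / sqrt (real (t0 - s) / real T)))"
        by (simp add: mult_ac)
      also have "\<dots> \<le> S * (exp (- \<Lambda> * (real (t0 - s) / real T)) * ((1 / real T) / sqrt (real (t0 - s) / real T)))"
        using S[of s] s t0 by (intro mult_right_mono) auto
      finally show "a s * ((1 / real T) / sqrt (real (t0 - s) / real T)) * e t0 \<le> \<dots>" .
    qed
    also have "\<dots> = S * (\<Sum>j<t0. exp (- \<Lambda> * (real (Suc j) / real T)) * ((1 / real T) / sqrt (real (Suc j) / real T)))"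
      unfolding sum_distrib_left
      by (rule sum.reindex_bij_witness[of _ "\<lambda>j. t0 - Suc j" "\<lambda>s. t0 - Suc s"]) (auto simp: Suc_diff_Suc)
    also have "\<dots> \<le> S * (2 * sqrt \<delta> + 1 / (\<Lambda> * \<delta> * sqrt \<delta>))"
      using sum_weighted_kernel_le[OF T \<delta>(1) L t0(1)] S0 by (intro mult_left_mono)
    finally have *: "(\<Sum>s<t0. a s * ((1 / real T) / sqrt (real (t0 - s) / real T))) * e t0
       \<le> S * (2 * sqrt \<delta> + 1 / (\<Lambda> * \<delta> * sqrt \<delta>))" .
    have "S \<le> (K + C * (\<Sum>s<t0. a s * ((1 / real T) / sqrt (real (t0 - s) / real T)))) * e t0"
      unfolding t0(2) using le t0 by (intro mult_right_mono) (auto simp: e_def)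
    also have "\<dots> = K * e t0 + C * ((\<Sum>s<t0. a s * ((1 / real T) / sqrt (real (t0 - s) / real T))) * e t0)"
      by (simp add: algebra_simps)
    also have "\<dots> \<le> K * 1 + C * (S * (2 * sqrt \<delta> + 1 / (\<Lambda> * \<delta> * sqrt \<delta>)))"
      using * K0 C e1 by (intro add_mono mult_left_mono) auto
    also have "\<dots> = K + S * (C * (2 * sqrt \<delta> + 1 / (\<Lambda> * \<delta> * sqrt \<delta>)))" by simp
    also have "\<dots> \<le> K + S * (1 / 2)" using half S0 by (intro add_left_mono mult_left_mono) auto
    finally have S2: "S \<le> 2 * K" by simp
    have "a t * e t \<le> 2 * K" using S[OF t] S2 by linarith
    then have "a t \<le> 2 * K * exp (\<Lambda> * (real t / real T))"
      by (simp add: e_def exp_minus divide_simps)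
    also have "\<dots> \<le> 2 * K * exp (\<Lambda> * 1)"
    proof -
      have "\<Lambda> * (real t / real T) \<le> \<Lambda> * 1" using t T L by (intro mult_left_mono) auto
      then show ?thesis using K0 by (intro mult_left_mono) auto
    qed
    finally show "a t \<le> 2 * exp \<Lambda> * K" by (simp add: mult_ac)
  qed simp
qed

lemma discrete_gronwall:
  fixes b c :: "nat \<Rightarrow> real"
  assumes "A \<ge> 0" "b 0 \<le> 0" "\<And>n. n < m \<Longrightarrow> b (Suc n) \<le> (1 + A) * b n + c n" "\<And>n. n < m \<Longrightarrow> c n \<ge> 0"
    and "n \<le> m"
  shows "b n \<le> exp (A * real n) * (\<Sum>s<n. c s)"
  using \<open>n \<le> m\<close>
proof (induction n)
  case 0 then show ?case using assms(2) by simp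
next
  case (Suc n)
  have S0: "(\<Sum>s<n. c s) \<ge> 0" using assms(4) Suc by (intro sum_nonneg) auto
  have "b (Suc n) \<le> (1 + A) * b n + c n" using assms(3) Suc by simp
  also have "\<dots> \<le> (1 + A) * (exp (A * real n) * (\<Sum>s<n. c s)) + c n"
    using Suc assms(1) by (intro add_mono mult_left_mono) auto
  also have "\<dots> \<le> exp A * (exp (A * real n) * (\<Sum>s<n. c s)) + exp (A * real (Suc n)) * c n"
  proof (intro add_mono mult_right_mono)
    show "1 + A \<le> exp A" by (rule exp_ge_add_one_self)
    have "1 * c n \<le> exp (A * real (Suc n)) * c n"
      using assms(1) assms(4)[of n] Suc by (intro mult_right_mono) auto
    then show "c n \<le> exp (A * real (Suc n)) * c n" by simp
  qed (use S0 in auto)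
  also have "\<dots> = exp (A * real (Suc n)) * (\<Sum>s<Suc n. c s)"
    by (simp add: algebra_simps exp_add)
  finally show ?case .
qed

section \<open>Stability of the theta-scheme\<close>

definition supn :: "nat \<Rightarrow> (real ^ 'd::finite \<Rightarrow> real) \<Rightarrow> real" where
  "supn N f = Max ((\<lambda>x. \<bar>f x\<bar>) ` grid N)"

lemma le_supn: "x \<in> grid N \<Longrightarrow> \<bar>f x\<bar> \<le> supn N f"
  unfolding supn_def by (intro Max_ge) auto

lemma supn_le: "N > 0 \<Longrightarrow> (\<And>x. x \<in> grid N \<Longrightarrow> \<bar>f x\<bar> \<le> K) \<Longrightarrow> supn N f \<le> K"
  unfolding supn_def using grid_nonempty by (subst Max_le_iff) auto

lemma supn_nonneg: "N > 0 \<Longrightarrow> 0 \<le> supn N (f :: real ^ 'd::finite \<Rightarrow> real)"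
  using grid_nonempty[of N] le_supn[of _ N f] by (metis abs_ge_zero all_not_in_conv order_trans)

text \<open>
  Constant in the gradient estimate for the discrete heat semigroup in dimension \<open>d\<close>.
\<close>

definition heat_const :: "real \<Rightarrow> real \<Rightarrow> real \<Rightarrow> real" where
  "heat_const d \<sigma> \<theta> = sqrt (2 / (\<theta> * \<sigma>)) + 1 / sqrt (2 * d * (1 - \<theta>) * \<sigma>)"

locale theta_scheme =
  fixes N T :: nat and \<sigma> \<theta> :: real and dim :: "'d::finite itself"
  assumes N: "N > 0" and T: "T > 0" and \<sigma>: "\<sigma> > 0" and \<theta>: "1 / 2 < \<theta>" "\<theta> < 1"
    and cfl: "1 / real T \<le> (1 / real N)\<^sup>2 / (2 * real CARD('d) * (1 - \<theta>) * \<sigma>)"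
begin

abbreviation "dt \<equiv> 1 / real T"
definition "\<tau> = \<theta> * \<sigma> * (1 / real T)"
definition "\<kappa> = (1 - \<theta>) * \<sigma> * (1 / real T)"
abbreviation Bop :: "(real ^ 'd \<Rightarrow> real) \<Rightarrow> real ^ 'd \<Rightarrow> real" where "Bop \<equiv> resolv N \<tau>"
abbreviation Eop :: "(real ^ 'd \<Rightarrow> real) \<Rightarrow> real ^ 'd \<Rightarrow> real" where "Eop \<equiv> expl N \<kappa>"

definition Pop :: "(real ^ 'd \<Rightarrow> real) \<Rightarrow> real ^ 'd \<Rightarrow> real" where "Pop f = Bop (Eop f)"

lemma \<tau>: "\<tau> \<ge> 0" and \<kappa>: "\<kappa> \<ge> 0" using \<sigma> \<theta> by (auto simp: \<tau>_def \<kappa>_def)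

lemma cfl': "2 * real CARD('d) * \<kappa> * (real N)\<^sup>2 \<le> 1"
  using cfl N T \<sigma> \<theta> by (simp add: \<kappa>_def field_simps power2_eq_square)

lemma markov_B: "markov N Bop" by (rule markov_resolv[OF \<tau>])
lemma markov_E: "markov N Eop" by (rule markov_expl[OF \<kappa> cfl'])
lemma markov_P: "markov N Pop" unfolding Pop_def[abs_def] by (rule markov_comp[OF markov_B markov_E])

lemma markov_BP: "markov N (\<lambda>f. Bop ((Pop ^^ n) f))"
  by (rule markov_comp[OF markov_B markov_funpow[OF markov_P]])

lemma B_E_commute: assumes y: "y \<in> grid N" shows "Bop (Eop g) y = Eop (Bop g) y"
  unfolding expl_def using markov_lap[OF markov_B y, of g]
    markov_add[OF markov_B y, of g "\<lambda>y. \<kappa> * lap_h N g y"] markov_cmult[OF markov_B y, of \<kappa> "lap_h N g"]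
  by simp

lemma P_B_commute: assumes y: "y \<in> grid N" shows "Pop (Bop g) y = Bop (Pop g) y"
  unfolding Pop_def by (intro markov_cong[OF markov_B y] B_E_commute[symmetric])

definition C0 :: real where "C0 = heat_const (real CARD('d)) \<sigma> \<theta>"

lemma C0_pos: "C0 > 0" using \<sigma> \<theta> by (auto simp: C0_def heat_const_def intro!: add_nonneg_pos)

text \<open>
  The first step is not covered by \<open>smoothing\<close>, but there the mesh condition allows to replace
  \<open>1 / h\<close> by a multiple of \<open>1 / sqrt dt\<close>.
\<close>

lemma grad_smoothing:
  assumes x: "x \<in> grid N" and f: "\<And>y. y \<in> grid N \<Longrightarrow> \<bar>f y\<bar> \<le> K"
  shows "\<bar>grad_h N (Bop ((Pop ^^ n) f)) x $ i\<bar> \<le> C0 * K / sqrt (real (Suc n) / real T)"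
proof -
  have K0: "K \<ge> 0" using f[OF x] by linarith
  define p where "p = sqrt (real (Suc n) / real T)"
  have p: "p > 0" "p\<^sup>2 = real (Suc n) / real T" using T by (auto simp: p_def)
  show ?thesis
  proof (cases n)
    case 0
    define c where "c = 2 * real CARD('d) * (1 - \<theta>) * \<sigma>"
    have c: "c > 0" using \<theta> \<sigma> by (simp add: c_def)
    have b: "\<bar>Bop f y\<bar> \<le> K" if "y \<in> grid N" for y using markov_bound[OF markov_B that f] .
    have "\<bar>Bop f (up N i x) - Bop f (down N i x)\<bar> \<le> 2 * K"
      using b[of "up N i x"] b[of "down N i x"] x by force
    then have "\<bar>grad_h N (Bop f) x $ i\<bar> \<le> 2 * K * real N / 2"
      using mult_right_mono[of _ "2 * K" "real N / 2"] by (simp add: grad_h_nth abs_mult)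
    also have "\<dots> = K * real N" by simp
    also have "K * real N \<le> K * (1 / sqrt c / p)"
    proof (rule mult_left_mono[OF _ K0])
    show "real N \<le> 1 / sqrt c / p"
    proof (rule power2_le_imp_le)
      have "c * dt * (real N)\<^sup>2 \<le> 1" using cfl' by (simp add: c_def \<kappa>_def algebra_simps)
      then have "(real N)\<^sup>2 \<le> 1 / (c * dt)" using c T by (simp add: field_simps)
      also have "\<dots> = (1 / sqrt c / p)\<^sup>2" using c p 0 by (simp add: power_divide power_mult_distrib)
      finally show "(real N)\<^sup>2 \<le> (1 / sqrt c / p)\<^sup>2" .
    qed (use c p in auto)
    qed
    finally have "\<bar>grad_h N (Bop f) x $ i\<bar> \<le> K * (1 / sqrt c / p)" .
    also have "\<dots> \<le> K * (C0 / p)"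
      using K0 p \<theta> \<sigma> by (intro mult_left_mono divide_right_mono) (auto simp: C0_def heat_const_def c_def)
    finally show ?thesis using 0 by (simp add: p_def mult_ac)
  next
    case (Suc m)
    then have n: "n \<ge> 1" by simp
    have "(grad_h N (Bop ((Pop ^^ n) f)) x $ i)\<^sup>2 \<le> Gam N (Bop ((Pop ^^ n) f)) x"
      by (rule grad_le_Gam[OF x])
    also have "\<dots> \<le> K\<^sup>2 / (real n * \<tau>)"
    proof -
      have "real n * \<tau> * Gam N (Bop ((Pop ^^ n) f)) x \<le> K\<^sup>2"
        using smoothing[OF \<tau> \<kappa> cfl' x f, where n = n] unfolding Pop_def[abs_def] by simp
      moreover have "real n * \<tau> > 0" using n T \<sigma> \<theta> by (simp add: \<tau>_def)
      ultimately show ?thesis by (metis mult.commute pos_le_divide_eq)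
    qed
    also have "\<dots> \<le> K\<^sup>2 * (2 / (\<theta> * \<sigma>)) / p\<^sup>2"
    proof -
      define c where "c = \<theta> * \<sigma>"
      have c: "c > 0" using \<theta> \<sigma> by (simp add: c_def)
      have "1 / (real n * \<tau>) = (real T / c) * (1 / real n)" by (simp add: \<tau>_def c_def)
      also have "\<dots> \<le> (real T / c) * (2 / real (Suc n))"
        using n c T by (intro mult_left_mono) (auto simp: field_simps)
      also have "\<dots> = (2 / c) / p\<^sup>2" unfolding p(2) by simp
      finally have "1 / (real n * \<tau>) \<le> (2 / (\<theta> * \<sigma>)) / p\<^sup>2" by (simp add: c_def)
      then show ?thesis using mult_left_mono[of "1 / (real n * \<tau>)" _ "K\<^sup>2"] by fastforce
    qed
    also have "\<dots> = (K * sqrt (2 / (\<theta> * \<sigma>)) / p)\<^sup>2" using \<sigma> \<theta> by (simp add: power_divide power_mult_distrib)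
    finally have "\<bar>grad_h N (Bop ((Pop ^^ n) f)) x $ i\<bar> \<le> \<bar>K * sqrt (2 / (\<theta> * \<sigma>)) / p\<bar>"
      by (simp only: abs_le_square_iff)
    also have "\<dots> = K * sqrt (2 / (\<theta> * \<sigma>)) / p" using K0 p \<sigma> \<theta> by (intro abs_of_nonneg) auto
    finally have "\<bar>grad_h N (Bop ((Pop ^^ n) f)) x $ i\<bar> \<le> K * sqrt (2 / (\<theta> * \<sigma>)) / p" .
    also have "K * sqrt (2 / (\<theta> * \<sigma>)) / p \<le> K * C0 / p"
      using K0 p \<theta> \<sigma> by (intro mult_left_mono divide_right_mono) (auto simp: C0_def heat_const_def)
    finally show ?thesis by (simp add: p_def mult_ac)
  qed
qed

lemma duhamel:
  assumes step: "\<And>n x. n < m \<Longrightarrow> x \<in> grid N \<Longrightarrow> y (Suc n) x = Bop (\<lambda>x. Eop (y n) x + b * r n x) x"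
    and x: "x \<in> grid N" and n: "n \<le> m"
  shows "y n x = (Pop ^^ n) (y 0) x + b * (\<Sum>s<n. Bop ((Pop ^^ (n - Suc s)) (r s)) x)"
  using n x
proof (induction n arbitrary: x)
  case (Suc n)
  note x = \<open>x \<in> grid N\<close>
  have "y (Suc n) x = Bop (\<lambda>x. Eop (y n) x + b * r n x) x" using step Suc by simp
  also have "\<dots> = Bop (Eop (y n)) x + Bop (\<lambda>x. b * r n x) x" by (rule markov_add[OF markov_B x])
  also have "Bop (\<lambda>x. b * r n x) x = b * Bop (r n) x" by (rule markov_cmult[OF markov_B x])
  also have "Bop (Eop (y n)) x = Pop (\<lambda>x. (Pop ^^ n) (y 0) x + b * (\<Sum>s<n. Bop ((Pop ^^ (n - Suc s)) (r s)) x)) x"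
    unfolding Pop_def[of "y n", symmetric] by (rule markov_cong[OF markov_P x]) (use Suc in simp)
  also have "\<dots> = Pop ((Pop ^^ n) (y 0)) x + Pop (\<lambda>x. b * (\<Sum>s<n. Bop ((Pop ^^ (n - Suc s)) (r s)) x)) x"
    by (rule markov_add[OF markov_P x])
  also have "Pop (\<lambda>x. b * (\<Sum>s<n. Bop ((Pop ^^ (n - Suc s)) (r s)) x)) x =
      b * Pop (\<lambda>x. \<Sum>s<n. Bop ((Pop ^^ (n - Suc s)) (r s)) x) x" by (rule markov_cmult[OF markov_P x])
  also have "Pop (\<lambda>x. \<Sum>s<n. Bop ((Pop ^^ (n - Suc s)) (r s)) x) x =
      (\<Sum>s<n. Pop (Bop ((Pop ^^ (n - Suc s)) (r s))) x)" by (rule markov_sum[OF markov_P x]) simp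
  also have "\<dots> = (\<Sum>s<n. Bop ((Pop ^^ (Suc n - Suc s)) (r s)) x)"
  proof (rule sum.cong[OF refl])
    fix s assume "s \<in> {..<n}"
    then have "Suc n - Suc s = Suc (n - Suc s)" by auto
    then show "Pop (Bop ((Pop ^^ (n - Suc s)) (r s))) x = Bop ((Pop ^^ (Suc n - Suc s)) (r s)) x"
      by (simp add: P_B_commute[OF x] del: diff_Suc_Suc)
  qed
  finally show ?case by (simp add: algebra_simps)
qed simp

lemma duhamel_grad:
  assumes step: "\<And>n x. n < m \<Longrightarrow> x \<in> grid N \<Longrightarrow> y (Suc n) x = Bop (\<lambda>x. Eop (y n) x + b * r n x) x"
    and x: "x \<in> grid N" and n: "n \<le> m" and y0: "\<And>x. x \<in> grid N \<Longrightarrow> y 0 x = 0"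
  shows "grad_h N (y n) x $ i = b * (\<Sum>s<n. grad_h N (Bop ((Pop ^^ (n - Suc s)) (r s))) x $ i)"
proof -
  have z: "(Pop ^^ n) (y 0) x = 0" if "x \<in> grid N" for x
    using markov_bound[OF markov_funpow[OF markov_P] that, of "y 0" 0 n] y0 by simp
  have "grad_h N (y n) x = grad_h N (\<lambda>x. b * (\<Sum>s<n. Bop ((Pop ^^ (n - Suc s)) (r s)) x)) x"
  proof (rule grad_h_cong[OF x])
    fix x :: "real ^ 'd" assume x: "x \<in> grid N"
    show "y n x = b * (\<Sum>s<n. Bop ((Pop ^^ (n - Suc s)) (r s)) x)"
      using duhamel[where y = y and b = b and r = r, OF step x n] z[OF x] by simp
  qed
  then show ?thesis
    by (simp add: grad_h_nth sum_distrib_left sum_distrib_right sum_divide_distrib sum_subtractf algebra_simps diff_divide_distrib)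
qed

text \<open>
  Energy estimate: testing the equation with \<open>\<theta> e' + (1 - \<theta>) e\<close> gives a telescoping term since
  \<open>\<theta> \<ge> 1 / 2\<close>, and the diffusion absorbs the flux.
\<close>

lemma energy_step:
  fixes e e' R :: "real ^ 'd \<Rightarrow> real"
  defines "z \<equiv> (\<lambda>x. \<theta> * e' x + (1 - \<theta>) * e x)"
  assumes eq: "\<And>x. x \<in> grid N \<Longrightarrow> e' x - e x = dt * (\<sigma> * lap_h N z x - div_h N G x + R x)"
  shows "(\<Sum>x\<in>grid N. (e' x)\<^sup>2) \<le> (\<Sum>x\<in>grid N. (e x)\<^sup>2)
    + dt / (2 * \<sigma>) * (\<Sum>x\<in>grid N. (norm (G x))\<^sup>2) + 2 * dt * (\<Sum>x\<in>grid N. R x * z x)"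
proof -
  have "(\<Sum>x\<in>grid N. (e' x)\<^sup>2) - (\<Sum>x\<in>grid N. (e x)\<^sup>2) \<le> 2 * (\<Sum>x\<in>grid N. (e' x - e x) * z x)"
    unfolding sum_subtractf[symmetric] sum_distrib_left
  proof (rule sum_mono)
    fix x
    have "2 * ((e' x - e x) * z x) - ((e' x)\<^sup>2 - (e x)\<^sup>2) = (2 * \<theta> - 1) * (e' x - e x)\<^sup>2"
      by (simp add: z_def power2_eq_square algebra_simps)
    moreover have "\<dots> \<ge> 0" using \<theta> by simp
    ultimately show "(e' x)\<^sup>2 - (e x)\<^sup>2 \<le> 2 * ((e' x - e x) * z x)" by linarith
  qed
  also have "(\<Sum>x\<in>grid N. (e' x - e x) * z x) =
     dt * (\<sigma> * (\<Sum>x\<in>grid N. z x * lap_h N z x) - (\<Sum>x\<in>grid N. z x * div_h N G x) + (\<Sum>x\<in>grid N. R x * z x))"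
    unfolding sum_distrib_left sum_subtractf[symmetric] sum.distrib[symmetric]
    by (rule sum.cong) (simp_all add: eq algebra_simps)
  also have "\<dots> \<le> dt * ((\<Sum>x\<in>grid N. (norm (G x))\<^sup>2) / (4 * \<sigma>) + (\<Sum>x\<in>grid N. R x * z x))"
  proof (intro mult_left_mono add_right_mono)
    have "(\<Sum>x\<in>grid N. grad_h N z x \<bullet> G x) \<le> (\<Sum>x\<in>grid N. \<sigma> * (norm (grad_h N z x))\<^sup>2 + (norm (G x))\<^sup>2 / (4 * \<sigma>))"
    proof (rule sum_mono)
      fix x
      have "0 \<le> (2 * \<sigma> * norm (grad_h N z x) - norm (G x))\<^sup>2" by simp
      then have "norm (grad_h N z x) * norm (G x) \<le> \<sigma> * (norm (grad_h N z x))\<^sup>2 + (norm (G x))\<^sup>2 / (4 * \<sigma>)"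
        using \<sigma> by (simp add: power2_eq_square field_simps)
      then show "grad_h N z x \<bullet> G x \<le> \<sigma> * (norm (grad_h N z x))\<^sup>2 + (norm (G x))\<^sup>2 / (4 * \<sigma>)"
        using norm_cauchy_schwarz[of "grad_h N z x" "G x"] by linarith
    qed
    also have "\<dots> = \<sigma> * (\<Sum>x\<in>grid N. (norm (grad_h N z x))\<^sup>2) + (\<Sum>x\<in>grid N. (norm (G x))\<^sup>2) / (4 * \<sigma>)"
      by (simp add: sum.distrib sum_distrib_left sum_divide_distrib)
    also have "\<dots> \<le> \<sigma> * (\<Sum>i\<in>UNIV. \<Sum>x\<in>grid N. (dplus N i z x)\<^sup>2) + (\<Sum>x\<in>grid N. (norm (G x))\<^sup>2) / (4 * \<sigma>)"
      using sum_grad_sq_le[of N z] \<sigma> by (intro add_right_mono mult_left_mono) auto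
    finally show "\<sigma> * (\<Sum>x\<in>grid N. z x * lap_h N z x) - (\<Sum>x\<in>grid N. z x * div_h N G x)
        \<le> (\<Sum>x\<in>grid N. (norm (G x))\<^sup>2) / (4 * \<sigma>)"
      by (simp add: sum_mult_lap sum_mult_div power2_eq_square)
  qed simp
  finally show ?thesis using \<sigma> by (simp add: algebra_simps)
qed

text \<open>
  Of the flux, the part \<open>M |e|\<close> enters through Gronwall's inequality. The source \<open>R\<close> is paired with
  the solution; by Young's inequality with the small parameter \<open>exp (- A) / 2\<close>, this pairing is absorbed by the
  maximum of the energy.
\<close>

lemma energy_estimate:
  fixes e R :: "nat \<Rightarrow> real ^ 'd \<Rightarrow> real" and M :: real
  defines "A \<equiv> M\<^sup>2 / \<sigma>"
  assumes eq: "\<And>n x. n < T \<Longrightarrow> x \<in> grid N \<Longrightarrow> e (Suc n) x - e n x =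
      dt * (\<sigma> * lap_h N (\<lambda>x. \<theta> * e (Suc n) x + (1 - \<theta>) * e n x) x - div_h N (G n) x + R n x)"
    and e0: "\<And>x. x \<in> grid N \<Longrightarrow> e 0 x = 0"
    and M: "M \<ge> 0"
    and G: "\<And>n x. n < T \<Longrightarrow> x \<in> grid N \<Longrightarrow> norm (G n x) \<le> M * \<bar>e n x\<bar> + F n x"
    and R: "\<And>n. n < T \<Longrightarrow> (\<Sum>x\<in>grid N. (R n x)\<^sup>2) \<le> \<rho>"
    and n: "n \<le> T"
  shows "(\<Sum>x\<in>grid N. (e n x)\<^sup>2) \<le>
     4 * exp (2 * A) * (dt * (\<Sum>n<T. \<Sum>x\<in>grid N. (F n x)\<^sup>2) / \<sigma> + \<rho>)"
proof -
  define l where "l n = (\<Sum>x\<in>grid N. (e n x)\<^sup>2)" for n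
  define \<Phi> where "\<Phi> n = (\<Sum>x\<in>grid N. (F n x)\<^sup>2)" for n
  define Y where "Y = Max (l ` {..T})"
  have Y: "l n \<le> Y" if "n \<le> T" for n unfolding Y_def using that by (intro Max_ge) auto
  have "Y \<in> l ` {..T}" unfolding Y_def by (intro Max_in) auto
  then obtain n0 where n0: "n0 \<le> T" "Y = l n0" by auto
  have l0: "l n \<ge> 0" for n unfolding l_def by (intro sum_nonneg) auto
  have \<Phi>0: "\<Phi> n \<ge> 0" for n unfolding \<Phi>_def by (intro sum_nonneg) auto
  have \<rho>0: "\<rho> \<ge> 0" using R[of 0] T sum_nonneg[of "grid N" "\<lambda>x. (R 0 x)\<^sup>2"] by fastforce
  have A: "A \<ge> 0" using \<sigma> by (simp add: A_def)
  \<comment> \<open>Gronwall's inequality multiplies \<open>\<epsilon>\<close> by \<open>exp A\<close>, which leaves half of the maximum \<open>Y\<close>.\<close>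
  define \<epsilon> where "\<epsilon> = exp (- A) / 2"
  have \<epsilon>: "\<epsilon> > 0" by (simp add: \<epsilon>_def)
  have step: "l (Suc n) \<le> (1 + A * dt) * l n + dt * (\<Phi> n / \<sigma> + \<epsilon> * Y + \<rho> / \<epsilon>)" if n: "n < T" for n
  proof -
    let ?z = "\<lambda>x. \<theta> * e (Suc n) x + (1 - \<theta>) * e n x"
    let ?y = "\<lambda>x. \<theta> * (e (Suc n) x)\<^sup>2 + (1 - \<theta>) * (e n x)\<^sup>2"
    have "l (Suc n) \<le> l n + dt / (2 * \<sigma>) * (\<Sum>x\<in>grid N. (norm (G n x))\<^sup>2) + 2 * dt * (\<Sum>x\<in>grid N. R n x * ?z x)"
      unfolding l_def by (rule energy_step[OF eq[OF n]])
    also have "(\<Sum>x\<in>grid N. (norm (G n x))\<^sup>2) \<le> (\<Sum>x\<in>grid N. 2 * M\<^sup>2 * (e n x)\<^sup>2 + 2 * (F n x)\<^sup>2)"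
    proof (rule sum_mono)
      fix x :: "real ^ 'd" assume x: "x \<in> grid N"
      have "(norm (G n x))\<^sup>2 \<le> (M * \<bar>e n x\<bar> + F n x)\<^sup>2" using G[OF n x] by (intro power_mono) auto
      also have "\<dots> \<le> 2 * (M * \<bar>e n x\<bar>)\<^sup>2 + 2 * (F n x)\<^sup>2"
        using sum_squares_bound[of "M * \<bar>e n x\<bar>" "F n x"] by (simp add: power2_sum)
      finally show "(norm (G n x))\<^sup>2 \<le> 2 * M\<^sup>2 * (e n x)\<^sup>2 + 2 * (F n x)\<^sup>2" by (simp add: power_mult_distrib)
    qed
    also have "\<dots> = 2 * M\<^sup>2 * l n + 2 * \<Phi> n" by (simp add: l_def \<Phi>_def sum.distrib sum_distrib_left)
    also have "2 * dt * (\<Sum>x\<in>grid N. R n x * ?z x) \<le> 2 * dt * ((\<epsilon> * Y + \<rho> / \<epsilon>) / 2)"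
    proof (intro mult_left_mono)
      have "(\<Sum>x\<in>grid N. R n x * ?z x) \<le> (\<Sum>x\<in>grid N. (1 / (2 * \<epsilon>)) * (R n x)\<^sup>2 + (\<epsilon> / 2) * ?y x)"
      proof (rule sum_mono)
        fix x
        have "(?z x)\<^sup>2 \<le> ?y x"
        proof -
          have "?y x - (?z x)\<^sup>2 = \<theta> * (1 - \<theta>) * (e (Suc n) x - e n x)\<^sup>2"
            by (simp add: power2_eq_square algebra_simps)
          moreover have "\<dots> \<ge> 0" using \<theta> by simp
          ultimately show ?thesis by linarith
        qed
        then have "\<epsilon> / 2 * (?z x)\<^sup>2 \<le> \<epsilon> / 2 * ?y x"
          using \<epsilon> by (intro mult_left_mono) auto
        moreover have "R n x * ?z x \<le> (1 / (2 * \<epsilon>)) * (R n x)\<^sup>2 + (\<epsilon> / 2) * (?z x)\<^sup>2"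
        proof -
          have "0 \<le> (R n x - \<epsilon> * ?z x)\<^sup>2 / (2 * \<epsilon>)" using \<epsilon> by simp
          also have "\<dots> = (1 / (2 * \<epsilon>)) * (R n x)\<^sup>2 + (\<epsilon> / 2) * (?z x)\<^sup>2 - R n x * ?z x"
            using \<epsilon> by (simp add: power2_diff field_simps power2_eq_square)
          finally show ?thesis by linarith
        qed
        ultimately show "R n x * ?z x \<le> (1 / (2 * \<epsilon>)) * (R n x)\<^sup>2 + (\<epsilon> / 2) * ?y x"
          by linarith
      qed
      also have "\<dots> = (1 / (2 * \<epsilon>)) * (\<Sum>x\<in>grid N. (R n x)\<^sup>2) + (\<epsilon> / 2) * (\<theta> * l (Suc n) + (1 - \<theta>) * l n)"
        by (simp only: l_def sum.distrib sum_distrib_left[symmetric])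
      also have "\<dots> \<le> (1 / (2 * \<epsilon>)) * \<rho> + (\<epsilon> / 2) * (\<theta> * Y + (1 - \<theta>) * Y)"
        using R[OF n] Y[of n] Y[of "Suc n"] n \<epsilon> \<theta> by (intro add_mono mult_left_mono) auto
      finally show "(\<Sum>x\<in>grid N. R n x * ?z x) \<le> (\<epsilon> * Y + \<rho> / \<epsilon>) / 2"
        by (simp add: algebra_simps)
    qed simp
    finally have "l (Suc n) \<le> l n + dt / (2 * \<sigma>) * (2 * M\<^sup>2 * l n + 2 * \<Phi> n) + 2 * dt * ((\<epsilon> * Y + \<rho> / \<epsilon>) / 2)"
      using \<sigma> by (simp add: mult_left_mono divide_right_mono)
    also have "\<dots> = (1 + A * dt) * l n + dt * (\<Phi> n / \<sigma> + \<epsilon> * Y + \<rho> / \<epsilon>)"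
      using \<sigma> T by (simp add: A_def field_simps)
    finally show ?thesis .
  qed
  have bound: "l n \<le> exp A * (dt * (\<Sum>n<T. \<Phi> n) / \<sigma> + \<epsilon> * Y + \<rho> / \<epsilon>)" if n: "n \<le> T" for n
  proof -
    have Y0: "Y \<ge> 0" using n0 l0 by simp
    have c0: "dt * (\<Phi> n / \<sigma> + \<epsilon> * Y + \<rho> / \<epsilon>) \<ge> 0" for n
      using \<Phi>0[of n] \<sigma> \<epsilon> Y0 \<rho>0 by simp
    have "l n \<le> exp (A * dt * real n) * (\<Sum>s<n. dt * (\<Phi> s / \<sigma> + \<epsilon> * Y + \<rho> / \<epsilon>))"
      using e0 A c0 step n by (intro discrete_gronwall[where m = T]) (auto simp: l_def)
    also have "\<dots> \<le> exp A * (\<Sum>s<T. dt * (\<Phi> s / \<sigma> + \<epsilon> * Y + \<rho> / \<epsilon>))"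
    proof (intro mult_mono sum_mono2)
      have "A * (real n / real T) \<le> A * 1" using n T A by (intro mult_left_mono) auto
      then show "exp (A * dt * real n) \<le> exp A" by simp
    qed (use n c0 in \<open>auto intro!: sum_nonneg\<close>)
    also have "(\<Sum>s<T. dt * (\<Phi> s / \<sigma> + \<epsilon> * Y + \<rho> / \<epsilon>)) = dt * (\<Sum>n<T. \<Phi> n) / \<sigma> + \<epsilon> * Y + \<rho> / \<epsilon>"
      using T by (simp add: sum_distrib_left[symmetric] sum.distrib sum_divide_distrib[symmetric] field_simps)
    finally show ?thesis .
  qed
  have "Y \<le> exp A * (dt * (\<Sum>n<T. \<Phi> n) / \<sigma> + \<epsilon> * Y + \<rho> / \<epsilon>)" using bound[OF n0(1)] n0 by simp
  also have "\<dots> = exp A * (dt * (\<Sum>n<T. \<Phi> n) / \<sigma>) + (exp A * \<epsilon>) * Y + exp A * \<rho> / \<epsilon>"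
    by (simp add: algebra_simps)
  also have "exp A * \<epsilon> = 1 / 2" by (simp add: \<epsilon>_def exp_minus)
  also have "exp A * \<rho> / \<epsilon> = 2 * exp (2 * A) * \<rho>"
    by (simp add: \<epsilon>_def exp_minus field_simps mult_exp_exp)
  finally have "Y \<le> 2 * exp A * (dt * (\<Sum>n<T. \<Phi> n) / \<sigma>) + 4 * exp (2 * A) * \<rho>" by simp
  also have "\<dots> \<le> 4 * exp (2 * A) * (dt * (\<Sum>n<T. \<Phi> n) / \<sigma>) + 4 * exp (2 * A) * \<rho>"
    using A \<sigma> \<Phi>0 T by (intro add_right_mono mult_right_mono mult_mono) (auto intro!: divide_nonneg_pos sum_nonneg)
  finally show ?thesis using Y[OF n] by (simp add: l_def \<Phi>_def algebra_simps)
qed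

end

lemma sum_reverse: "(\<Sum>s<n. f (n - s)) = (\<Sum>j<n. f (Suc j))" for f :: "nat \<Rightarrow> 'a::comm_monoid_add"
  by (rule sum.reindex_bij_witness[of _ "\<lambda>j. n - Suc j" "\<lambda>s. n - Suc s"]) (auto simp: Suc_diff_Suc)

lemma expl_diff: "expl N \<kappa> (\<lambda>x. f x - g x) x = expl N \<kappa> f x - expl N \<kappa> g x"
  by (simp add: expl_def lap_h_diff algebra_simps)

lemma component_sum_le: "norm (v :: real ^ 'd::finite) \<le> (\<Sum>i\<in>UNIV. \<bar>v $ i\<bar>)"
  by (rule norm_le_l1_cart)

context theta_scheme
begin

definition ker :: "nat \<Rightarrow> real" where "ker n = dt / sqrt (real n / real T)"

lemma sum_ker_le: assumes "n \<le> T" shows "(\<Sum>s<n. ker (n - s)) \<le> 2"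
proof -
  have "(\<Sum>s<n. ker (n - s)) \<le> 2 * sqrt (real n / real T)"
    unfolding sum_reverse[of ker] unfolding ker_def by (rule sum_kernel_le[OF T])
  also have "\<dots> \<le> 2 * 1" using assms T by (intro mult_left_mono) auto
  finally show ?thesis by simp
qed

lemma grad_smoothing_ker:
  assumes x: "x \<in> grid N" and f: "\<And>y. y \<in> grid N \<Longrightarrow> \<bar>f y\<bar> \<le> K" and s: "s < n"
  shows "dt * (\<Sum>i\<in>UNIV. \<bar>grad_h N (Bop ((Pop ^^ (n - Suc s)) f)) x $ i\<bar>)
    \<le> real CARD('d) * C0 * K * ker (n - s)"
proof -
  have "(\<Sum>i\<in>UNIV. \<bar>grad_h N (Bop ((Pop ^^ (n - Suc s)) f)) x $ i\<bar>)
     \<le> (\<Sum>i\<in>(UNIV::'d set). C0 * K / sqrt (real (Suc (n - Suc s)) / real T))"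
    by (intro sum_mono grad_smoothing[OF x f])
  also have "\<dots> = real CARD('d) * (C0 * K / sqrt (real (n - s) / real T))"
    using s by (simp add: Suc_diff_Suc)
  finally have "dt * (\<Sum>i\<in>UNIV. \<bar>grad_h N (Bop ((Pop ^^ (n - Suc s)) f)) x $ i\<bar>)
     \<le> dt * (real CARD('d) * (C0 * K / sqrt (real (n - s) / real T)))" by (intro mult_left_mono) auto
  then show ?thesis by (simp add: ker_def mult_ac)
qed

lemma flow_singular_inequality:
  assumes step: "\<And>n x. n < T \<Longrightarrow> x \<in> grid N \<Longrightarrow>
      y (Suc n) x = Bop (\<lambda>x. Eop (y n) x - dt * div_h N (w n) x) x"
    and y0: "\<And>x. x \<in> grid N \<Longrightarrow> \<bar>y 0 x\<bar> \<le> K"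
    and w: "\<And>n x. n < T \<Longrightarrow> x \<in> grid N \<Longrightarrow> norm (w n x) \<le> M * \<bar>y n x\<bar>"
    and M: "M \<ge> 0" and n: "n \<le> T"
  shows "supn N (y n) \<le> K + (real CARD('d) * (real CARD('d) * C0 * M)) * (\<Sum>s<n. supn N (y s) * ker (n - s))"
proof (rule supn_le[OF N])
  let ?d = "real CARD('d)"
  fix x :: "real ^ 'd" assume x: "x \<in> grid N"
  let ?Q = "\<lambda>s f. Bop ((Pop ^^ (n - Suc s)) f)"
  have step': "y (Suc n) x = Bop (\<lambda>x. Eop (y n) x + (- dt) * div_h N (w n) x) x"
    if "n < T" "x \<in> grid N" for n x using step[OF that] by simp
  have "y n x = (Pop ^^ n) (y 0) x + (- dt) * (\<Sum>s<n. ?Q s (div_h N (w s)) x)"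
    by (rule duhamel[where m = T and y = y and b = "- dt" and r = "\<lambda>n. div_h N (w n)", OF step' x n])
  then have "\<bar>y n x\<bar> \<le> \<bar>(Pop ^^ n) (y 0) x\<bar> + \<bar>(- dt) * (\<Sum>s<n. ?Q s (div_h N (w s)) x)\<bar>" by linarith
  also have "\<bar>(Pop ^^ n) (y 0) x\<bar> \<le> K" by (rule markov_bound[OF markov_funpow[OF markov_P] x y0])
  also have "\<bar>(- dt) * (\<Sum>s<n. ?Q s (div_h N (w s)) x)\<bar> \<le> (\<Sum>s<n. dt * \<bar>?Q s (div_h N (w s)) x\<bar>)"
  proof -
    have "\<bar>(- dt) * (\<Sum>s<n. ?Q s (div_h N (w s)) x)\<bar> = dt * \<bar>\<Sum>s<n. ?Q s (div_h N (w s)) x\<bar>"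
      by (simp add: abs_mult)
    also have "\<dots> \<le> dt * (\<Sum>s<n. \<bar>?Q s (div_h N (w s)) x\<bar>)" by (intro mult_left_mono sum_abs) simp
    finally show ?thesis by (simp only: sum_distrib_left)
  qed
  also have "\<dots> \<le> (\<Sum>s<n. ?d * (?d * C0 * (M * supn N (y s)) * ker (n - s)))"
  proof (rule sum_mono)
    fix s assume s: "s \<in> {..<n}"
    then have sT: "s < T" using n by simp
    have wb: "\<bar>w s z $ i\<bar> \<le> M * supn N (y s)" if "z \<in> grid N" for z i
      using component_le_norm_cart[of "w s z" i] w[OF sT that] mult_left_mono[OF le_supn[OF that, of "y s"] M]
      by linarith
    have "\<bar>?Q s (div_h N (w s)) x\<bar> = \<bar>\<Sum>i\<in>UNIV. grad_h N (?Q s (\<lambda>y. w s y $ i)) x $ i\<bar>"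
      by (simp only: markov_div[OF markov_BP x])
    also have "\<dots> \<le> (\<Sum>i\<in>UNIV. \<bar>grad_h N (?Q s (\<lambda>y. w s y $ i)) x $ i\<bar>)" by (rule sum_abs)
    finally have "dt * \<bar>?Q s (div_h N (w s)) x\<bar> \<le> (\<Sum>i\<in>UNIV. dt * \<bar>grad_h N (?Q s (\<lambda>y. w s y $ i)) x $ i\<bar>)"
      unfolding sum_distrib_left[symmetric] by (intro mult_left_mono) auto
    also have "\<dots> \<le> (\<Sum>i\<in>(UNIV::'d set). ?d * C0 * (M * supn N (y s)) * ker (n - s))"
    proof (rule sum_mono)
      fix i :: 'd
      have "dt * \<bar>grad_h N (?Q s (\<lambda>y. w s y $ i)) x $ i\<bar> \<le>
        dt * (\<Sum>j\<in>UNIV. \<bar>grad_h N (?Q s (\<lambda>y. w s y $ i)) x $ j\<bar>)"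
        by (intro mult_left_mono member_le_sum[where f="\<lambda>j. \<bar>grad_h N (?Q s (\<lambda>y. w s y $ i)) x $ j\<bar>"]) auto
      also have "\<dots> \<le> ?d * C0 * (M * supn N (y s)) * ker (n - s)"
        using s by (intro grad_smoothing_ker[OF x wb]) auto
      finally show "dt * \<bar>grad_h N (?Q s (\<lambda>y. w s y $ i)) x $ i\<bar> \<le> ?d * C0 * (M * supn N (y s)) * ker (n - s)" .
    qed
    finally show "dt * \<bar>?Q s (div_h N (w s)) x\<bar> \<le> ?d * (?d * C0 * (M * supn N (y s)) * ker (n - s))"
      by simp
  qed
  also have "\<dots> = (?d * (?d * C0 * M)) * (\<Sum>s<n. supn N (y s) * ker (n - s))"
    by (simp add: sum_distrib_left mult_ac)
  finally show "\<bar>y n x\<bar> \<le> K + (?d * (?d * C0 * M)) * (\<Sum>s<n. supn N (y s) * ker (n - s))"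
    by simp
qed

text \<open>
  Applied to differences of solutions of the discrete HJB equation in reversed time: in Duhamel's
  formula the gradient falls on the heat kernel, so that only the size of the nonlinearity \<open>q\<close> enters.
\<close>

lemma backward_singular_inequality:
  fixes y q :: "nat \<Rightarrow> real ^ 'd \<Rightarrow> real"
  defines "a \<equiv> (\<lambda>n. supn N (\<lambda>x. \<Sum>i\<in>UNIV. \<bar>grad_h N (y n) x $ i\<bar>))"
  assumes step: "\<And>n x. n < m \<Longrightarrow> x \<in> grid N \<Longrightarrow>
      y (Suc n) x = Bop (\<lambda>x. Eop (y n) x + dt * q n x) x"
    and y0: "\<And>x. x \<in> grid N \<Longrightarrow> y 0 x = 0"
    and q: "\<And>n x. n < m \<Longrightarrow> x \<in> grid N \<Longrightarrow> \<bar>q n x\<bar> \<le> M * norm (grad_h N (y n) x) + D"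
    and M: "M \<ge> 0" and D: "D \<ge> 0" and n: "n \<le> m" and m: "m \<le> T"
  shows "a n \<le> 2 * (real CARD('d) * C0) * D + (real CARD('d) * C0 * M) * (\<Sum>s<n. a s * ker (n - s))"
  unfolding a_def
proof (rule supn_le[OF N])
  let ?d = "real CARD('d)"
  fix x :: "real ^ 'd" assume x: "x \<in> grid N"
  let ?Q = "\<lambda>s f. Bop ((Pop ^^ (n - Suc s)) f)"
  have a0: "a s \<ge> 0" for s unfolding a_def by (rule supn_nonneg[OF N])
  have "\<bar>\<Sum>i\<in>UNIV. \<bar>grad_h N (y n) x $ i\<bar>\<bar> = (\<Sum>i\<in>UNIV. \<bar>grad_h N (y n) x $ i\<bar>)"
    by (intro abs_of_nonneg sum_nonneg) auto
  also have "\<dots> = (\<Sum>i\<in>UNIV. \<bar>dt * (\<Sum>s<n. grad_h N (?Q s (q s)) x $ i)\<bar>)"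
    using duhamel_grad[where m = m and y = y and b = dt and r = q, OF step x n y0] by simp
  also have "\<dots> \<le> (\<Sum>i\<in>UNIV. \<Sum>s<n. dt * \<bar>grad_h N (?Q s (q s)) x $ i\<bar>)"
  proof (rule sum_mono)
    fix i
    have "\<bar>dt * (\<Sum>s<n. grad_h N (?Q s (q s)) x $ i)\<bar> = dt * \<bar>\<Sum>s<n. grad_h N (?Q s (q s)) x $ i\<bar>"
      by (simp add: abs_mult)
    also have "\<dots> \<le> dt * (\<Sum>s<n. \<bar>grad_h N (?Q s (q s)) x $ i\<bar>)" by (intro mult_left_mono sum_abs) simp
    finally show "\<bar>dt * (\<Sum>s<n. grad_h N (?Q s (q s)) x $ i)\<bar> \<le> (\<Sum>s<n. dt * \<bar>grad_h N (?Q s (q s)) x $ i\<bar>)"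
      by (simp only: sum_distrib_left)
  qed
  also have "\<dots> = (\<Sum>s<n. dt * (\<Sum>i\<in>UNIV. \<bar>grad_h N (?Q s (q s)) x $ i\<bar>))"
    by (subst sum.swap) (simp add: sum_distrib_left)
  also have "\<dots> \<le> (\<Sum>s<n. ?d * C0 * (M * a s + D) * ker (n - s))"
  proof (rule sum_mono)
    fix s assume s: "s \<in> {..<n}"
    show "dt * (\<Sum>i\<in>UNIV. \<bar>grad_h N (?Q s (q s)) x $ i\<bar>) \<le> ?d * C0 * (M * a s + D) * ker (n - s)"
    proof (rule grad_smoothing_ker[OF x])
      fix z :: "real ^ 'd" assume z: "z \<in> grid N"
      have "norm (grad_h N (y s) z) \<le> a s"
        using component_sum_le[of "grad_h N (y s) z"] le_supn[OF z, of "\<lambda>x. \<Sum>i\<in>UNIV. \<bar>grad_h N (y s) x $ i\<bar>"]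
        unfolding a_def by linarith
      then have "M * norm (grad_h N (y s) z) \<le> M * a s" using M by (intro mult_left_mono)
      then show "\<bar>q s z\<bar> \<le> M * a s + D" using q[of s z] s n z by simp
    qed (use s in simp)
  qed
  also have "\<dots> = (?d * C0) * D * (\<Sum>s<n. ker (n - s)) + (?d * C0 * M) * (\<Sum>s<n. a s * ker (n - s))"
    by (simp add: sum_distrib_left sum.distrib[symmetric] algebra_simps)
  also have "\<dots> \<le> (?d * C0) * D * 2 + (?d * C0 * M) * (\<Sum>s<n. a s * ker (n - s))"
    using n m D C0_pos by (intro add_right_mono mult_left_mono sum_ker_le) auto
  finally show "\<bar>\<Sum>i\<in>UNIV. \<bar>grad_h N (y n) x $ i\<bar>\<bar> \<le> 2 * (?d * C0) * D
      + (?d * C0 * M) * (\<Sum>s<n. supn N (\<lambda>x. \<Sum>i\<in>UNIV. \<bar>grad_h N (y s) x $ i\<bar>) * ker (n - s))"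
    by (simp add: a_def)
qed

text \<open>
  A density that is transported with bounded velocity stays bounded by a multiple of its initial
  maximum, uniformly in the mesh: in Duhamel's formula the divergence falls on the heat kernel, at
  the cost of the integrable factor \<open>(t - s)\<^bsup>-1/2\<^esup>\<close>.
\<close>

lemma flow_bound:
  assumes G: "gronwall_const (real CARD('d) * (real CARD('d) * C0 * M)) G"
    and step: "\<And>n x. n < T \<Longrightarrow> x \<in> grid N \<Longrightarrow>
      y (Suc n) x = Bop (\<lambda>x. Eop (y n) x - dt * div_h N (w n) x) x"
    and y0: "\<And>x. x \<in> grid N \<Longrightarrow> \<bar>y 0 x\<bar> \<le> K"
    and w: "\<And>n x. n < T \<Longrightarrow> x \<in> grid N \<Longrightarrow> norm (w n x) \<le> M * \<bar>y n x\<bar>"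
    and M: "M \<ge> 0" and n: "n \<le> T" and x: "x \<in> grid N"
  shows "\<bar>y n x\<bar> \<le> G * K"
proof -
  have "supn N (y n) \<le> G * K"
    by (rule gronwall_constD[OF G T supn_nonneg[OF N] flow_singular_inequality[OF step y0 w M, unfolded ker_def] n])
  then show ?thesis using le_supn[OF x, of "y n"] by linarith
qed

text \<open>
  The difference of the Hamiltonians is bounded by \<open>M\<close> times the gradient of the difference of
  the solutions. This gradient therefore satisfies a singular Gronwall inequality; once it is bounded,
  so is the source in the equation for the difference, and the maximum principle bounds the values.
\<close>

lemma hjb_stability:
  fixes u1 u2 F1 F2 :: "nat \<Rightarrow> real ^ 'd \<Rightarrow> real"
  assumes G: "gronwall_const (real CARD('d) * C0 * M) G" and M: "M \<ge> 0"
    and h: "\<And>t x p q. t < T \<Longrightarrow> x \<in> grid N \<Longrightarrow> \<bar>h t x p - h t x q\<bar> \<le> M * norm (p - q)"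
    and uT: "\<And>x. x \<in> grid N \<Longrightarrow> u1 T x = u2 T x"
    and eq: "\<And>t x. t < T \<Longrightarrow> x \<in> grid N \<Longrightarrow>
        u1 t x = Eop (Bop (u1 (Suc t))) x + dt * (F1 t x - h t x (grad_h N (Bop (u1 (Suc t))) x))"
      "\<And>t x. t < T \<Longrightarrow> x \<in> grid N \<Longrightarrow>
        u2 t x = Eop (Bop (u2 (Suc t))) x + dt * (F2 t x - h t x (grad_h N (Bop (u2 (Suc t))) x))"
    and F: "\<And>t x. t < T \<Longrightarrow> x \<in> grid N \<Longrightarrow> \<bar>F1 t x - F2 t x\<bar> \<le> D"
  defines "G1 \<equiv> G * (2 * (real CARD('d) * C0))"
  defines "G' \<equiv> M * G1 + 1 + G1"
  shows "t \<le> T \<Longrightarrow> x \<in> grid N \<Longrightarrow> \<bar>u1 t x - u2 t x\<bar> \<le> G' * D"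
    and "t < T \<Longrightarrow> x \<in> grid N \<Longrightarrow> \<bar>Bop (u1 (Suc t)) x - Bop (u2 (Suc t)) x\<bar> \<le> G' * D"
    and "t < T \<Longrightarrow> x \<in> grid N \<Longrightarrow> norm (grad_h N (Bop (u1 (Suc t))) x - grad_h N (Bop (u2 (Suc t))) x) \<le> G' * D"
proof -
  let ?d = "real CARD('d)"
  define C where "C = ?d * C0 * M"
  have c0: "C0 \<ge> 0" using C0_pos by simp
  have "C \<ge> 0" using M c0 by (auto simp: C_def)
  have G0: "G > 0" using G unfolding gronwall_const_def by blast
  have G10: "G1 \<ge> 0" using G0 c0 by (simp add: G1_def)
  obtain x0 :: "real ^ 'd" where x0: "x0 \<in> grid N" using grid_nonempty[OF N] by blast
  have D0: "D \<ge> 0" using order_trans[OF abs_ge_zero F[OF T x0]] .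
  define w1 w2 where "w1 t = Bop (u1 (Suc t))" and "w2 t = Bop (u2 (Suc t))" for t
  define z where "z t x = w1 t x - w2 t x" for t x
  define q where "q t x = (F1 t x - F2 t x) - (h t x (grad_h N (w1 t) x) - h t x (grad_h N (w2 t) x))" for t x
  have u: "u1 t x - u2 t x = Eop (z t) x + dt * q t x" if "t < T" "x \<in> grid N" for t x
  proof -
    have "u1 t x = Eop (w1 t) x + dt * (F1 t x - h t x (grad_h N (w1 t) x))"
      "u2 t x = Eop (w2 t) x + dt * (F2 t x - h t x (grad_h N (w2 t) x))"
      using eq[OF that] unfolding w1_def w2_def .
    then show ?thesis unfolding z_def q_def expl_diff by (simp add: algebra_simps)
  qed
  have z: "z t x = Bop (\<lambda>x. u1 (Suc t) x - u2 (Suc t) x) x" if "x \<in> grid N" for t x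
    unfolding z_def w1_def w2_def by (rule markov_diff[OF markov_B that, symmetric])
  have gz: "grad_h N (z t) x = grad_h N (w1 t) x - grad_h N (w2 t) x" for t x
    unfolding z_def grad_h_diff by (rule refl)
  have q: "\<bar>q t x\<bar> \<le> M * norm (grad_h N (z t) x) + D" if "t < T" "x \<in> grid N" for t x
    using h[OF that, of "grad_h N (w1 t) x" "grad_h N (w2 t) x"] F[OF that]
    unfolding gz q_def by linarith
  \<comment> \<open>Time is reversed, so that the terminal condition becomes an initial condition.\<close>
  define y where "y n = z (T - Suc n)" for n
  define a where "a n = (if n < T then supn N (\<lambda>x. \<Sum>i\<in>UNIV. \<bar>grad_h N (y n) x $ i\<bar>) else 0)" for n
  have y0: "y 0 x = 0" if x: "x \<in> grid N" for x
  proof -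
    have "\<bar>Bop (\<lambda>x. u1 T x - u2 T x) x\<bar> \<le> 0" by (rule markov_bound[OF markov_B x]) (use uT in simp)
    then show ?thesis using z[OF x, of "T - 1"] T by (simp add: y_def)
  qed
  have step: "y (Suc n) x = Bop (\<lambda>x. Eop (y n) x + dt * q (T - Suc n) x) x"
    if n: "n < T - 1" and x: "x \<in> grid N" for n x
  proof -
    have s: "Suc (T - Suc (Suc n)) = T - Suc n" using n by simp
    have "y (Suc n) x = Bop (\<lambda>x. u1 (T - Suc n) x - u2 (T - Suc n) x) x"
      unfolding y_def z[OF x] s ..
    also have "\<dots> = Bop (\<lambda>x. Eop (y n) x + dt * q (T - Suc n) x) x"
      by (rule markov_cong[OF markov_B x]) (use n in \<open>simp add: u y_def\<close>)
    finally show ?thesis .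
  qed
  have a0: "0 \<le> a n" for n by (simp add: a_def supn_nonneg[OF N])
  have "a n \<le> G * (2 * (?d * C0) * D)" if "n \<le> T" for n
  proof (rule gronwall_constD[OF G T a0 _ that])
    fix n assume n: "n \<le> T"
    show "a n \<le> 2 * (?d * C0) * D + ?d * C0 * M * (\<Sum>s<n. a s * ((1 / real T) / sqrt (real (n - s) / real T)))"
    proof (cases "n < T")
      case True
      then have "a n = supn N (\<lambda>x. \<Sum>i\<in>UNIV. \<bar>grad_h N (y n) x $ i\<bar>)" by (simp add: a_def)
      also have "\<dots> \<le> 2 * (?d * C0) * D + (?d * C0 * M) *
         (\<Sum>s<n. supn N (\<lambda>x. \<Sum>i\<in>UNIV. \<bar>grad_h N (y s) x $ i\<bar>) * ker (n - s))"
      proof (rule backward_singular_inequality[where m = "T - 1" and q = "\<lambda>n. q (T - Suc n)", OF step y0 _ M D0])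
        fix n and x :: "real ^ 'd" assume "n < T - 1" "x \<in> grid N"
        then show "\<bar>q (T - Suc n) x\<bar> \<le> M * norm (grad_h N (y n) x) + D"
          unfolding y_def by (intro q) auto
      qed (use True in auto)
      also have "(\<Sum>s<n. supn N (\<lambda>x. \<Sum>i\<in>UNIV. \<bar>grad_h N (y s) x $ i\<bar>) * ker (n - s))
         = (\<Sum>s<n. a s * ((1 / real T) / sqrt (real (n - s) / real T)))"
        by (rule sum.cong) (use True in \<open>auto simp: a_def ker_def\<close>)
      finally show ?thesis .
    next
      case False
      then show ?thesis using c0 D0 a0 \<open>C \<ge> 0\<close>[unfolded C_def]
        by (auto simp: a_def intro!: add_nonneg_nonneg mult_nonneg_nonneg sum_nonneg supn_nonneg[OF N])
    qed
  qed
  then have aG: "a n \<le> G1 * D" if "n \<le> T" for n using that by (simp add: G1_def mult_ac)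
  have grad: "norm (grad_h N (z t) x) \<le> G1 * D" if t: "t < T" and x: "x \<in> grid N" for t x
  proof -
    have "norm (grad_h N (z t) x) \<le> (\<Sum>i\<in>UNIV. \<bar>grad_h N (z t) x $ i\<bar>)" by (rule component_sum_le)
    also have "\<dots> \<le> a (T - Suc t)"
      using le_supn[OF x, of "\<lambda>x. \<Sum>i\<in>UNIV. \<bar>grad_h N (z t) x $ i\<bar>"] t
      by (simp add: a_def y_def Suc_diff_Suc)
    also have "\<dots> \<le> G1 * D" by (rule aG) simp
    finally show ?thesis .
  qed
  define Q where "Q = M * (G1 * D) + D"
  have Q0: "Q \<ge> 0" using M D0 G10 by (simp add: Q_def)
  have qQ: "\<bar>q t x\<bar> \<le> Q" if "t < T" "x \<in> grid N" for t x
    using q[OF that] mult_left_mono[OF grad[OF that] M] unfolding Q_def by linarith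
  have du: "\<forall>x\<in>grid N. \<bar>u1 (T - n) x - u2 (T - n) x\<bar> \<le> real n * dt * Q" if "n \<le> T" for n
    using that
  proof (induction n)
    case 0 then show ?case using uT by simp
  next
    case (Suc n)
    show ?case
    proof
      fix x :: "real ^ 'd" assume x: "x \<in> grid N"
      have s: "Suc (T - Suc n) = T - n" using Suc by simp
      have zb: "\<bar>z (T - Suc n) y\<bar> \<le> real n * dt * Q" if y: "y \<in> grid N" for y
        unfolding z[OF y] s by (rule markov_bound[OF markov_B y]) (use Suc in simp)
      have "\<bar>Eop (z (T - Suc n)) x\<bar> \<le> real n * dt * Q" by (rule markov_bound[OF markov_E x zb])
      moreover have "\<bar>dt * q (T - Suc n) x\<bar> \<le> dt * Q"
        unfolding abs_mult using qQ[of "T - Suc n" x] x Suc by (auto intro!: mult_mono divide_right_mono)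
      moreover have "u1 (T - Suc n) x - u2 (T - Suc n) x = Eop (z (T - Suc n)) x + dt * q (T - Suc n) x"
        using Suc x by (intro u) auto
      ultimately have "\<bar>u1 (T - Suc n) x - u2 (T - Suc n) x\<bar> \<le> real n * dt * Q + dt * Q" by linarith
      also have "\<dots> = real (Suc n) * dt * Q" by (simp add: algebra_simps add_divide_distrib)
      finally show "\<bar>u1 (T - Suc n) x - u2 (T - Suc n) x\<bar> \<le> real (Suc n) * dt * Q" .
    qed
  qed
  have uQ: "\<bar>u1 t x - u2 t x\<bar> \<le> Q" if t: "t \<le> T" and x: "x \<in> grid N" for t x
  proof -
    have "\<bar>u1 t x - u2 t x\<bar> \<le> real (T - t) * dt * Q" using du[of "T - t"] t x by simp
    also have "\<dots> \<le> 1 * Q" using t T Q0 by (intro mult_right_mono) auto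
    finally show ?thesis by simp
  qed
  have GD: "G' * D = Q + G1 * D" by (simp add: G'_def Q_def algebra_simps)
  show "\<bar>u1 t x - u2 t x\<bar> \<le> G' * D" if "t \<le> T" "x \<in> grid N"
    using uQ[OF that] mult_nonneg_nonneg[OF G10 D0] unfolding GD by linarith
  show "\<bar>Bop (u1 (Suc t)) x - Bop (u2 (Suc t)) x\<bar> \<le> G' * D" if t: "t < T" and x: "x \<in> grid N"
  proof -
    have "\<bar>z t x\<bar> \<le> Q" unfolding z[OF x] by (rule markov_bound[OF markov_B x]) (use uQ t in simp)
    then show ?thesis using mult_nonneg_nonneg[OF G10 D0] unfolding GD z_def w1_def w2_def by linarith
  qed
  show "norm (grad_h N (Bop (u1 (Suc t))) x - grad_h N (Bop (u2 (Suc t))) x) \<le> G' * D" if t: "t < T" and x: "x \<in> grid N"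
    using grad[OF t x] Q0 unfolding GD gz w1_def w2_def by linarith
qed

end

section \<open>Strongly convex running costs and their Hamiltonians\<close>

lemma GDERIV_unique: "GDERIV f x :> a \<Longrightarrow> GDERIV f x :> b \<Longrightarrow> a = b"
proof -
  assume "GDERIV f x :> a" "GDERIV f x :> b"
  then have "(\<lambda>h. h \<bullet> a) = (\<lambda>h. h \<bullet> b)" unfolding gderiv_def by (rule has_derivative_unique)
  then have "h \<bullet> (a - b) = 0" for h by (metis inner_diff_right right_minus_eq)
  from this[of "a - b"] show ?thesis by simp
qed

lemma gradient_eq: "GDERIV f x :> a \<Longrightarrow> gradient f x = a"
  unfolding gradient_def using GDERIV_unique by blast

lemma has_gradientD: "has_gradient f x \<Longrightarrow> GDERIV f x :> gradient f x"
  using gradient_eq unfolding has_gradient_def by blast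

locale strongly_convex_cost =
  fixes cost :: "'a::euclidean_space \<Rightarrow> real" and G :: "'a \<Rightarrow> 'a" and \<alpha> :: real
  assumes gderiv: "\<And>v. GDERIV cost v :> G v" and \<alpha>: "\<alpha> > 0"
    and convex_ineq: "\<And>v w. cost w \<ge> cost v + G v \<bullet> (w - v) + \<alpha> / 2 * (norm (w - v))\<^sup>2"
begin

lemma cont: "continuous_on A cost"
  by (rule continuous_at_imp_continuous_on, intro ballI, rule has_derivative_continuous)
    (rule gderiv[unfolded gderiv_def])

text \<open>
  Quadratic growth around the minimizer over a convex set is obtained from the strong convexity
  at the points of the segment to the minimizer.
\<close>

lemma minimizer_exists:
  assumes K: "closed K" "convex K" "K \<noteq> {}"
  shows "\<exists>V\<in>K. \<forall>v\<in>K. p \<bullet> V + cost V + \<alpha> / 2 * (norm (v - V))\<^sup>2 \<le> p \<bullet> v + cost v"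
proof -
  define \<phi> where "\<phi> v = p \<bullet> v + cost v" for v
  obtain v0 where v0: "v0 \<in> K" using K(3) by blast
  define R where "R = 2 * norm (p + G v0) / \<alpha>"
  have R: "R \<ge> 0" unfolding R_def by (rule divide_nonneg_pos[OF _ \<alpha>]) simp
  have R\<alpha>: "2 * norm (p + G v0) = \<alpha> * R" unfolding R_def using \<alpha> by (metis less_irrefl nonzero_mult_div_cancel_left times_divide_eq_right)
  have \<phi>_ineq: "\<phi> w \<ge> \<phi> v + (p + G v) \<bullet> (w - v) + \<alpha> / 2 * (norm (w - v))\<^sup>2" for v w
    using convex_ineq[of v w] unfolding \<phi>_def by (simp add: inner_diff_right inner_add_left)
  have c1: "compact (K \<inter> cball v0 R)" using K(1) by (simp add: closed_Int_compact)
  have c2: "continuous_on (K \<inter> cball v0 R) \<phi>" unfolding \<phi>_def by (intro continuous_intros cont)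
  have c3: "K \<inter> cball v0 R \<noteq> {}" using v0 R by auto
  from continuous_attains_inf[OF c1 c3 c2] obtain V where V: "V \<in> K \<inter> cball v0 R" "\<And>v. v \<in> K \<inter> cball v0 R \<Longrightarrow> \<phi> V \<le> \<phi> v"
    by blast
  have min: "\<phi> V \<le> \<phi> v" if v: "v \<in> K" for v
  proof (cases "v \<in> cball v0 R")
    case True then show ?thesis using V(2) v by blast
  next
    case False
    define n where "n = norm (v - v0)"
    have n: "n > R" using False by (simp add: n_def dist_norm norm_minus_commute)
    have "\<alpha> * n \<ge> 2 * norm (p + G v0)" 
    proof -
      have "\<alpha> * R \<le> \<alpha> * n" by (rule mult_left_mono) (use n \<alpha> in linarith)+
      then show ?thesis unfolding R\<alpha> .
    qed
    then have "norm (p + G v0) * n \<le> (\<alpha> * n / 2) * n" using n R by (intro mult_right_mono) auto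
    moreover have "- (norm (p + G v0) * n) \<le> (p + G v0) \<bullet> (v - v0)"
      using Cauchy_Schwarz_ineq2[of "p + G v0" "v - v0"] unfolding n_def by linarith
    ultimately have "(p + G v0) \<bullet> (v - v0) + \<alpha> / 2 * n\<^sup>2 \<ge> 0" by (simp add: power2_eq_square)
    then have "\<phi> v \<ge> \<phi> v0" using \<phi>_ineq[of v0 v] unfolding n_def by linarith
    then show ?thesis using V(2)[of v0] v0 R by simp
  qed
  have "\<phi> V + \<alpha> / 2 * (norm (v - V))\<^sup>2 \<le> \<phi> v" if v: "v \<in> K" for v
  proof -
    have "\<alpha> / 2 * (norm (v - V))\<^sup>2 \<le> \<phi> v - \<phi> V"
    proof (rule field_le_mult_one_interval)
      fix z :: real assume z: "0 < z" "z < 1"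
      define s where "s = 1 - z"
      have s: "0 < s" "s < 1" "z = 1 - s" using z by (auto simp: s_def)
      define W where "W = V + s *\<^sub>R (v - V)"
      have WK: "W \<in> K"
      proof -
        have "(1 - s) *\<^sub>R V + s *\<^sub>R v \<in> K" using K(2) V(1) v s unfolding convex_alt by auto
        then show ?thesis by (simp add: W_def algebra_simps)
      qed
      define n where "n = (norm (v - V))\<^sup>2"
      define g where "g = (p + G W) \<bullet> (v - V)"
      have vW: "v - W = (1 - s) *\<^sub>R (v - V)" and VW: "V - W = (- s) *\<^sub>R (v - V)"
        by (simp_all add: W_def algebra_simps)
      have 1: "\<phi> v \<ge> \<phi> W + (1 - s) * g + \<alpha> / 2 * ((1 - s)\<^sup>2 * n)"
        using \<phi>_ineq[of W v] unfolding vW by (simp add: g_def n_def power_mult_distrib)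
      have 2: "\<phi> V \<ge> \<phi> W - s * g + \<alpha> / 2 * (s\<^sup>2 * n)"
        using \<phi>_ineq[of W V] unfolding VW by (simp add: g_def n_def power_mult_distrib)
      have "s * \<phi> v + (1 - s) * \<phi> V \<ge> s * (\<phi> W + (1 - s) * g + \<alpha> / 2 * ((1 - s)\<^sup>2 * n))
          + (1 - s) * (\<phi> W - s * g + \<alpha> / 2 * (s\<^sup>2 * n))"
        using s 1 2 by (intro add_mono mult_left_mono) auto
      also have "s * (\<phi> W + (1 - s) * g + \<alpha> / 2 * ((1 - s)\<^sup>2 * n))
          + (1 - s) * (\<phi> W - s * g + \<alpha> / 2 * (s\<^sup>2 * n)) = \<phi> W + s * ((1 - s) * (\<alpha> / 2 * n))"
        by (simp add: power2_eq_square field_simps)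
      finally have "s * (\<phi> v - \<phi> V) \<ge> s * ((1 - s) * (\<alpha> / 2 * n))"
        using min[OF WK] by (simp add: algebra_simps)
      then show "z * (\<alpha> / 2 * (norm (v - V))\<^sup>2) \<le> \<phi> v - \<phi> V" using s by (simp add: n_def)
    qed
    then show ?thesis by simp
  qed
  then show ?thesis using V(1) unfolding \<phi>_def by blast
qed

definition vopt :: "'a set \<Rightarrow> 'a \<Rightarrow> 'a" where
  "vopt K p = (SOME V. V \<in> K \<and> (\<forall>v\<in>K. p \<bullet> V + cost V + \<alpha> / 2 * (norm (v - V))\<^sup>2 \<le> p \<bullet> v + cost v))"

text \<open>
  Legendre transform at \<open>- p\<close> of the cost restricted to \<open>K\<close>: the Hamiltonian with control
  constraint \<open>K\<close>.
\<close>

definition hval :: "'a set \<Rightarrow> 'a \<Rightarrow> real" where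
  "hval K p = - (p \<bullet> vopt K p) - cost (vopt K p)"

context
  fixes K :: "'a set" assumes K: "closed K" "convex K" "K \<noteq> {}"
begin

lemma vopt_spec: "vopt K p \<in> K \<and> (\<forall>v\<in>K. p \<bullet> vopt K p + cost (vopt K p) + \<alpha> / 2 * (norm (v - vopt K p))\<^sup>2 \<le> p \<bullet> v + cost v)"
  unfolding vopt_def by (rule someI_ex) (use minimizer_exists[OF K] in blast)

lemma vopt_in: "vopt K p \<in> K" using vopt_spec by blast

lemma hval_ineq: "v \<in> K \<Longrightarrow> \<alpha> / 2 * (norm (v - vopt K p))\<^sup>2 \<le> hval K p + p \<bullet> v + cost v"
  using vopt_spec[of p] unfolding hval_def by fastforce

lemma vopt_unique: assumes "V \<in> K" "\<And>v. v \<in> K \<Longrightarrow> p \<bullet> V + cost V \<le> p \<bullet> v + cost v" shows "vopt K p = V"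
proof -
  have "\<alpha> / 2 * (norm (V - vopt K p))\<^sup>2 \<le> 0"
    using hval_ineq[OF assms(1), of p] assms(2)[OF vopt_in[of p]] unfolding hval_def by linarith
  then have "(norm (V - vopt K p))\<^sup>2 \<le> 0" using \<alpha> by (simp add: mult_le_0_iff)
  then show ?thesis by simp
qed

lemma hval_ge: "v \<in> K \<Longrightarrow> - (p \<bullet> v) - cost v \<le> hval K p"
  using hval_ineq[of v p] \<alpha> zero_le_power2[of "norm (v - vopt K p)"]
  by (smt (verit) divide_pos_pos mult_nonneg_nonneg)

lemma vopt_lipschitz: "norm (vopt K p - vopt K q) \<le> norm (p - q) / \<alpha>"
proof -
  define d where "d = vopt K p - vopt K q"
  have 1: "\<alpha> / 2 * (norm d)\<^sup>2 \<le> hval K q + q \<bullet> vopt K p + cost (vopt K p)"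
    using hval_ineq[OF vopt_in, of p q] by (simp add: d_def)
  have 2: "\<alpha> / 2 * (norm d)\<^sup>2 \<le> hval K p + p \<bullet> vopt K q + cost (vopt K q)"
    using hval_ineq[OF vopt_in, of q p] by (simp add: d_def norm_minus_commute)
  have "\<alpha> * (norm d)\<^sup>2 \<le> - ((p - q) \<bullet> d)"
    using 1 2 unfolding hval_def d_def by (simp add: inner_diff_left inner_diff_right)
  also have "\<dots> \<le> norm (p - q) * norm d" using Cauchy_Schwarz_ineq2[of "p - q" d] by linarith
  finally have "\<alpha> * norm d * norm d \<le> norm (p - q) * norm d" by (simp add: power2_eq_square mult_ac)
  then have "\<alpha> * norm d \<le> norm (p - q)"
    by (cases "norm d = 0") (auto simp: mult_le_cancel_right)
  then show ?thesis using \<alpha> by (simp add: d_def pos_le_divide_eq mult.commute)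
qed

lemma hval_diff_bounds:
  "- ((q - p) \<bullet> vopt K p) \<le> hval K q - hval K p" "hval K q - hval K p \<le> - ((q - p) \<bullet> vopt K q)"
  using hval_ge[OF vopt_in, of p q] hval_ge[OF vopt_in, of q p]
  unfolding hval_def by (auto simp: inner_diff_left)

lemma gderiv_hval: "GDERIV (hval K) p :> - vopt K p"
  unfolding gderiv_def
proof (rule has_derivativeI_sandwich[where e = 1 and H = "\<lambda>q. norm (q - p) / \<alpha>"])
  show "bounded_linear (\<lambda>h. h \<bullet> - vopt K p)" by (rule bounded_linear_inner_left)
  fix q assume q: "q \<noteq> p" "dist q p < 1"
  have "\<bar>hval K q - hval K p - (q - p) \<bullet> - vopt K p\<bar> \<le> \<bar>(q - p) \<bullet> (vopt K p - vopt K q)\<bar>"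
    using hval_diff_bounds[of q p] by (simp add: inner_diff_right)
  also have "\<dots> \<le> norm (q - p) * norm (vopt K p - vopt K q)" by (rule Cauchy_Schwarz_ineq2)
  also have "\<dots> \<le> norm (q - p) * (norm (q - p) / \<alpha>)"
    using vopt_lipschitz[of p q] by (intro mult_left_mono) (auto simp: norm_minus_commute)
  finally show "norm (hval K q - hval K p - (q - p) \<bullet> - vopt K p) / norm (q - p) \<le> norm (q - p) / \<alpha>"
    using q(1) by (simp add: pos_divide_le_eq mult.commute)
next
  show "((\<lambda>q. norm (q - p) / \<alpha>) \<longlongrightarrow> 0) (at p)"
    using \<alpha> by (auto intro!: tendsto_eq_intros)
qed simp

lemma hval_lipschitz:
  assumes "\<And>v. v \<in> K \<Longrightarrow> norm v \<le> M" shows "\<bar>hval K p - hval K q\<bar> \<le> M * norm (p - q)"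
proof -
  have "\<bar>(p - q) \<bullet> vopt K z\<bar> \<le> M * norm (p - q)" for z
    using Cauchy_Schwarz_ineq2[of "p - q" "vopt K z"] mult_left_mono[OF assms[OF vopt_in[of z]], of "norm (p - q)"]
    by (simp add: mult.commute)
  from this[of p] this[of q] show ?thesis using hval_diff_bounds[of p q] by linarith
qed

end

lemma vopt_UNIV_bound: "norm (vopt UNIV p) \<le> (norm p + norm (G 0)) / \<alpha>"
proof -
  let ?V = "vopt UNIV p"
  have 1: "\<alpha> / 2 * (norm ?V)\<^sup>2 \<le> hval UNIV p + cost 0" using hval_ineq[of UNIV 0 p] by simp
  have "cost ?V \<ge> cost 0 + G 0 \<bullet> ?V + \<alpha> / 2 * (norm ?V)\<^sup>2" using convex_ineq[of 0 ?V] by simp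
  with 1 have "\<alpha> * (norm ?V)\<^sup>2 \<le> - ((p + G 0) \<bullet> ?V)" unfolding hval_def by (simp add: inner_add_left)
  also have "\<dots> \<le> (norm p + norm (G 0)) * norm ?V"
    using Cauchy_Schwarz_ineq2[of "p + G 0" ?V] norm_triangle_ineq[of p "G 0"]
      mult_right_mono[of "norm (p + G 0)" "norm p + norm (G 0)" "norm ?V"] by fastforce
  finally have "\<alpha> * norm ?V * norm ?V \<le> (norm p + norm (G 0)) * norm ?V" by (simp add: power2_eq_square mult_ac)
  then have "\<alpha> * norm ?V \<le> norm p + norm (G 0)"
    by (cases "norm ?V = 0") (auto simp: mult_le_cancel_right)
  then show ?thesis using \<alpha> by (simp add: pos_le_divide_eq mult.commute)
qed

text \<open>
  A minimizer without constraint that lies in the ball is a constrained one, and these are unique.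
\<close>

lemma vopt_cball_eq:
  assumes "norm (vopt UNIV p) \<le> M" shows "vopt (cball 0 M) p = vopt UNIV p" "hval (cball 0 M) p = hval UNIV p"
proof -
  have ne: "cball (0::'a) M \<noteq> {}" using order_trans[OF norm_ge_zero assms] by simp
  show "vopt (cball 0 M) p = vopt UNIV p"
  proof (rule vopt_unique[OF closed_cball convex_cball ne])
    fix v :: 'a
    show "p \<bullet> vopt UNIV p + cost (vopt UNIV p) \<le> p \<bullet> v + cost v"
      using hval_ge[of UNIV v p] by (simp add: hval_def)
  qed (use assms in simp)
  then show "hval (cball 0 M) p = hval UNIV p" by (simp add: hval_def)
qed

lemma SUP_hval: "(SUP v. (- p) \<bullet> v - cost v) = hval UNIV p"
proof (rule cSup_eq_maximum)
  show "hval UNIV p \<in> range (\<lambda>v. (- p) \<bullet> v - cost v)" by (auto simp: hval_def)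
  show "y \<le> hval UNIV p" if "y \<in> range (\<lambda>v. (- p) \<bullet> v - cost v)" for y
    using that hval_ge[of UNIV _ p] by auto
qed

lemma SUP_ereal_hval:
  assumes "M \<ge> 0"
  shows "(SUP v. ereal (- (p \<bullet> v)) - (if norm v \<le> M then ereal (cost v) else \<infinity>)) = ereal (hval (cball 0 M) p)"
proof (rule antisym)
  have ne: "cball (0::'a) M \<noteq> {}" using assms by simp
  note K = closed_cball convex_cball ne
  show "(SUP v. ereal (- (p \<bullet> v)) - (if norm v \<le> M then ereal (cost v) else \<infinity>)) \<le> ereal (hval (cball 0 M) p)"
    by (rule SUP_least) (use hval_ge[OF K, of _ p] in auto)
  have "norm (vopt (cball 0 M) p) \<le> M" using vopt_in[OF K, of p] by simp
  then show "ereal (hval (cball 0 M) p) \<le> (SUP v. ereal (- (p \<bullet> v)) - (if norm v \<le> M then ereal (cost v) else \<infinity>))"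
    by (intro SUP_upper2[where i = "vopt (cball 0 M) p"]) (auto simp: hval_def)
qed

end

section \<open>The torus\<close>

lemma zero_lattice: "0 \<in> lattice_Z" by (simp add: lattice_Z_def)

lemma tnorm_le_norm: "tnorm y \<le> norm y"
  unfolding tnorm_def using infdist_le[OF zero_lattice, of y] by simp

lemma tnorm_nonneg: "0 \<le> tnorm y" unfolding tnorm_def by (rule infdist_nonneg)

lemma tnorm_le_dim: "tnorm (y :: real ^ 'd::finite) \<le> real CARD('d)"
proof -
  have "tnorm y \<le> dist y (y - wrap y)"
    unfolding tnorm_def using lattice_uminus[OF wrap_diff[of y]] by (intro infdist_le) simp
  also have "\<dots> = norm (wrap y)" by (simp add: dist_norm)
  also have "\<dots> \<le> (\<Sum>i\<in>UNIV. \<bar>wrap y $ i\<bar>)" by (rule norm_le_l1_cart)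
  also have "\<dots> \<le> (\<Sum>i\<in>(UNIV::'d set). 1)"
    by (intro sum_mono) (simp add: wrap_def frac_ge_0 less_imp_le[OF frac_lt_1])
  finally show ?thesis by simp
qed

lemma torus_lipschitz_osc:
  assumes "torus_lipschitz L (f :: real ^ 'd::finite \<Rightarrow> real)" "L \<ge> 0" shows "\<bar>f x - f y\<bar> \<le> L * real CARD('d)"
  using assms(1)[unfolded torus_lipschitz_def, rule_format, of x y] mult_left_mono[OF tnorm_le_dim assms(2), of "x - y"]
  by linarith

lemma torus_lipschitz_norm:
  assumes "torus_lipschitz L (f :: real ^ 'd::finite \<Rightarrow> real)" "L \<ge> 0" shows "\<bar>f x - f y\<bar> \<le> L * norm (x - y)"
  using assms(1)[unfolded torus_lipschitz_def, rule_format, of x y] mult_left_mono[OF tnorm_le_norm assms(2), of "x - y"]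
  by linarith

lemma torus_lipschitz_continuous:
  assumes "torus_lipschitz L (f :: real ^ 'd::finite \<Rightarrow> real)" "L \<ge> 0" shows "continuous_on A f"
proof -
  have "L-lipschitz_on UNIV f"
    using torus_lipschitz_norm[OF assms] assms(2) by (auto simp: lipschitz_on_def dist_norm)
  then show ?thesis by (meson lipschitz_on_continuous_on continuous_on_subset subset_UNIV)
qed

section \<open>The Hamiltonian of the game\<close>

locale mfg =
  fixes D :: "'d::finite mfg_data" and \<theta> r :: real
    and us ms :: "real \<Rightarrow> real ^ 'd \<Rightarrow> real" and vs :: "real \<Rightarrow> real ^ 'd \<Rightarrow> real ^ 'd"
  assumes sigma_pos: "sigma D > 0" and th_half: "1 / 2 < \<theta>" and th_one: "\<theta> < 1" and r_pos: "0 < r" and r_one: "r < 1"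
    and torus: "data_on_torus D" and assA: "assumption_A D" and assB: "assumption_B D r us vs ms" and assC: "assumption_C D"
begin

abbreviation "\<alpha> \<equiv> alpha D"
abbreviation "M \<equiv> Mbound D"
abbreviation "\<sigma> \<equiv> sigma D"
abbreviation "tm T t \<equiv> real t * (1 / real T)"

lemma data_pos: "Lell D > 0" "Lg D > 0" "Lf D > 0" "alpha D > 0"
  using assA unfolding assumption_A_def by auto

lemma ell_convex:
  assumes "t \<in> {0..1}" shows "strongly_convex_cost (ellc D t x) (gradient (ellc D t x)) \<alpha>"
proof
  show "GDERIV (ellc D t x) v :> gradient (ellc D t x) v" for v
    using assA assms unfolding assumption_A_def by (intro has_gradientD) simp
qed (use assA assms in \<open>auto simp: assumption_A_def\<close>)

lemma A_parts:
  "\<forall>t\<in>{0..1}. \<forall>v. torus_lipschitz (Lell D) (\<lambda>x. ellc D t x v)"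
  "\<forall>x v. (Lell D)-lipschitz_on {0..1} (\<lambda>t. ellc D t x v)"
  "torus_lipschitz (Lg D) (gc D)"
  "\<forall>t\<in>{0..1}. \<forall>m\<in>densities. torus_lipschitz (Lf D) (\<lambda>x. fc D t x m)"
  "\<forall>t\<in>{0..1}. \<forall>x. \<forall>m1\<in>densities. \<forall>m2\<in>densities.
     \<bar>fc D t x m1 - fc D t x m2\<bar> \<le> Lf D * L2_dist m1 m2"
  "\<forall>t\<in>{0..1}. \<forall>m1\<in>densities. \<forall>m2\<in>densities.
     (LINT x:cube|lborel. (fc D t x m1 - fc D t x m2) * (m1 x - m2 x)) \<ge> 0"
  using assA unfolding assumption_A_def by - (elim conjE, assumption)+

lemmas ell_lip_x = A_parts(1)[rule_format] and ell_lip_t = A_parts(2)[rule_format]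
  and g_lip = A_parts(3) and f_lip_x = A_parts(4)[rule_format]
  and f_lip_m = A_parts(5)[rule_format] and f_mono = A_parts(6)[rule_format]

lemma ell_bounded: "\<exists>K. \<forall>t\<in>{0..1}. \<forall>x v. norm v \<le> R \<longrightarrow> \<bar>ellc D t x v\<bar> \<le> K"
proof -
  interpret c: strongly_convex_cost "ellc D 0 0" "gradient (ellc D 0 0)" \<alpha> by (rule ell_convex) simp
  have "compact (ellc D 0 0 ` cball 0 R)" by (intro compact_continuous_image c.cont) simp
  then have "bounded (ellc D 0 0 ` cball 0 R)" by (rule compact_imp_bounded)
  then obtain K where K: "\<And>v. norm v \<le> R \<Longrightarrow> \<bar>ellc D 0 0 v\<bar> \<le> K" unfolding bounded_iff by fastforce
  have "\<bar>ellc D t x v\<bar> \<le> K + Lell D + Lell D * real CARD('d)" if t: "t \<in> {0..1}" and v: "norm v \<le> R" for t x v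
  proof -
    have "\<bar>ellc D t x v - ellc D t 0 v\<bar> \<le> Lell D * real CARD('d)"
      using torus_lipschitz_osc[OF ell_lip_x[OF t, of v], of x 0] data_pos by simp
    moreover have "\<bar>ellc D t 0 v - ellc D 0 0 v\<bar> \<le> Lell D"
    proof -
      have "dist (ellc D t 0 v) (ellc D 0 0 v) \<le> Lell D * dist t 0"
        using t by (intro lipschitz_onD[OF ell_lip_t]) auto
      also have "\<dots> \<le> Lell D * 1" using t data_pos by (intro mult_left_mono) auto
      finally show ?thesis by (simp add: dist_real_def)
    qed
    ultimately show ?thesis using K[OF v] by linarith
  qed
  then show ?thesis by blast
qed

lemma grad_ell_bounded: "\<exists>K. \<forall>t\<in>{0..1}. \<forall>x. norm (gradient (ellc D t x) 0) \<le> K"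
proof -
  obtain K where K: "\<And>t x v. t \<in> {0..1} \<Longrightarrow> norm v \<le> 1 \<Longrightarrow> \<bar>ellc D t x v\<bar> \<le> K" using ell_bounded[of 1] by blast
  have "norm (gradient (ellc D t x) 0) \<le> 2 * K" if t: "t \<in> {0..1}" for t x
  proof -
    interpret c: strongly_convex_cost "ellc D t x" "gradient (ellc D t x)" \<alpha> by (rule ell_convex[OF t])
    define g where "g = gradient (ellc D t x) 0"
    define e where "e = sgn g"
    have e: "norm e \<le> 1" by (simp add: e_def norm_sgn)
    have "ellc D t x e \<ge> ellc D t x 0 + g \<bullet> e + \<alpha> / 2 * (norm e)\<^sup>2"
      using c.convex_ineq[of 0 e] by (simp add: g_def)
    then have "g \<bullet> e \<le> ellc D t x e - ellc D t x 0" using data_pos by (smt (verit) zero_le_power2 divide_pos_pos mult_nonneg_nonneg)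
    also have "\<dots> \<le> 2 * K" using K[OF t e, of x] K[OF t, of 0 x] by simp
    also have "g \<bullet> e = norm g" 
      by (cases "g = 0") (simp_all add: e_def sgn_div_norm dot_square_norm power2_eq_square)
    finally show ?thesis by (simp add: g_def)
  qed
  then show ?thesis by blast
qed

lemma Mbound_ge:
  assumes "t \<in> {0..1}" "norm p \<le> sqrt (real CARD('d)) * (Lell D + Lf D + Lg D)"
  shows "(norm p + norm (gradient (ellc D t x) 0)) / \<alpha> \<le> M"
proof -
  define S where "S = (SUP (t, x)\<in>{0..1} \<times> UNIV. norm (gradient (ellc D t x) 0))"
  have "norm (gradient (ellc D t x) 0) \<le> S"
    unfolding S_def using grad_ell_bounded assms(1)
    by (intro cSUP_upper2[where x = "(t, x)"]) (auto simp: bdd_above_def)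
  then have "norm (gradient (ellc D t x) 0) \<le> 2 * S" using norm_ge_zero[of "gradient (ellc D t x) 0"] by linarith
  then show ?thesis using assms(2) data_pos unfolding Mbound_def S_def[symmetric]
    by (simp add: divide_right_mono add_mono)
qed

lemma M_pos: "M > 0"
proof -
  let ?p = "(\<chi> i. Lell D + Lf D + Lg D) :: real ^ 'd"
  have "norm ?p \<le> sqrt (real CARD('d)) * (Lell D + Lf D + Lg D)"
    using data_pos by (simp add: norm_vec_def L2_set_def real_sqrt_mult)
  from Mbound_ge[OF _ this, of 0 0] have "(norm ?p + norm (gradient (ellc D 0 0) 0)) / \<alpha> \<le> M" by simp
  moreover have "norm ?p > 0" using data_pos by (simp add: vec_eq_iff)
  ultimately show ?thesis using data_pos by (smt (verit) divide_pos_pos norm_ge_zero)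
qed

definition Vopt :: "real \<Rightarrow> real ^ 'd \<Rightarrow> real ^ 'd \<Rightarrow> real ^ 'd" where
  "Vopt t x = strongly_convex_cost.vopt (ellc D t x) \<alpha> (cball 0 M)"

lemma cballM: "closed (cball (0::real^'d) M)" "convex (cball (0::real^'d) M)" "cball (0::real^'d) M \<noteq> {}"
  using M_pos by auto

lemma tm_in: "T > 0 \<Longrightarrow> t \<le> T \<Longrightarrow> tm T t \<in> {0..1}" by auto

context
  fixes T t :: nat and x :: "real ^ 'd" assumes T: "T > 0" and t: "t \<le> T"
begin

interpretation c: strongly_convex_cost "ellc D (tm T t) x" "gradient (ellc D (tm T t) x)" \<alpha>
  by (rule ell_convex[OF tm_in[OF T t]])

lemma Ham_hval: "Ham D T t x p = strongly_convex_cost.hval (ellc D (tm T t) x) \<alpha> (cball 0 M) p"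
  unfolding Ham_def ell_def using c.SUP_ereal_hval[of M p] M_pos by simp

lemma Vopt_bound: "norm (Vopt (tm T t) x p) \<le> M"
  using c.vopt_in[OF cballM] by (simp add: Vopt_def)

lemma Ham_eq: "Ham D T t x p = - (p \<bullet> Vopt (tm T t) x p) - ellc D (tm T t) x (Vopt (tm T t) x p)"
  unfolding Ham_hval Vopt_def c.hval_def ..

lemma Ham_ineq:
  assumes "norm v \<le> M"
  shows "\<alpha> / 2 * (norm (v - Vopt (tm T t) x p))\<^sup>2 \<le> Ham D T t x p + p \<bullet> v + ellc D (tm T t) x v"
  unfolding Ham_hval Vopt_def using c.hval_ineq[OF cballM, of v p] assms by simp

lemma Ham_lipschitz: "\<bar>Ham D T t x p - Ham D T t x q\<bar> \<le> M * norm (p - q)"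
  unfolding Ham_hval using c.hval_lipschitz[OF cballM, of M p q] by simp

lemma gradient_Ham: "gradient (Ham D T t x) p = - Vopt (tm T t) x p"
proof -
  have "Ham D T t x = c.hval (cball 0 M)" by (rule ext) (rule Ham_hval)
  then show ?thesis using gradient_eq[OF c.gderiv_hval[OF cballM, of p]] by (simp add: Vopt_def)
qed

lemma Vopt_lipschitz: "norm (Vopt (tm T t) x p - Vopt (tm T t) x q) \<le> norm (p - q) / \<alpha>"
  unfolding Vopt_def using c.vopt_lipschitz[OF cballM] by simp

text \<open>
  The bound \<open>M\<close> is such that the constraint is inactive for the gradients that occur in the
  continuous problem.
\<close>

lemma Hc_eq_Ham:
  assumes "norm p \<le> sqrt (real CARD('d)) * (Lell D + Lf D + Lg D)"
  shows "Hc D (tm T t) x p = Ham D T t x p" "gradient (Hc D (tm T t) x) p = - Vopt (tm T t) x p"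
proof -
  have Hc: "Hc D (tm T t) x q = c.hval UNIV q" for q unfolding Hc_def by (rule c.SUP_hval)
  have "norm (c.vopt UNIV p) \<le> M"
    using c.vopt_UNIV_bound[of p] Mbound_ge[OF tm_in[OF T t] assms, of x] by linarith
  note e = c.vopt_cball_eq[OF this]
  show "Hc D (tm T t) x p = Ham D T t x p" unfolding Hc Ham_hval using e by simp
  have "Hc D (tm T t) x = c.hval UNIV" by (rule ext) (rule Hc)
  then show "gradient (Hc D (tm T t) x) p = - Vopt (tm T t) x p"
    using gradient_eq[OF c.gderiv_hval[of UNIV p]] e unfolding Vopt_def by simp
qed

end

text \<open>Evaluate both Hamiltonians at the maximizer of one of them.\<close>

lemma Hc_diff_x:
  assumes t: "t \<in> {0..1}" shows "\<bar>Hc D t x p - Hc D t y p\<bar> \<le> Lell D * norm (x - y)"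
proof -
  have *: "Hc D t x p \<le> Hc D t y p + Lell D * norm (x - y)" for x y
  proof -
    interpret c: strongly_convex_cost "ellc D t x" "gradient (ellc D t x)" \<alpha> by (rule ell_convex[OF t])
    interpret c': strongly_convex_cost "ellc D t y" "gradient (ellc D t y)" \<alpha> by (rule ell_convex[OF t])
    have "\<bar>ellc D t x v - ellc D t y v\<bar> \<le> Lell D * norm (x - y)" for v
      using torus_lipschitz_norm[OF ell_lip_x[OF t, of v], of x y] data_pos by simp
    from this[of "c.vopt UNIV p"] show ?thesis
      using c'.hval_ge[of UNIV "c.vopt UNIV p" p] unfolding Hc_def c.SUP_hval c'.SUP_hval
      by (simp add: c.hval_def)
  qed
  show ?thesis using *[of x y] *[of y x] by (simp add: norm_minus_commute)
qed

end

section \<open>Integrals over the boxes of the grid\<close>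

definition bdd_borel :: "('a::euclidean_space \<Rightarrow> real) \<Rightarrow> bool" where
  "bdd_borel f \<longleftrightarrow> f \<in> borel_measurable borel \<and> (\<exists>B. \<forall>x. \<bar>f x\<bar> \<le> B)"

lemma bdd_borelI: "f \<in> borel_measurable borel \<Longrightarrow> (\<And>x. \<bar>f x\<bar> \<le> B) \<Longrightarrow> bdd_borel f"
  unfolding bdd_borel_def by blast

lemma bdd_borel_const: "bdd_borel (\<lambda>_. c)"
  by (rule bdd_borelI[where B = "\<bar>c\<bar>"]) auto

lemma bdd_borel_diff: "bdd_borel f \<Longrightarrow> bdd_borel g \<Longrightarrow> bdd_borel (\<lambda>x. f x - g x)"
proof -
  assume "bdd_borel f" "bdd_borel g"
  then obtain A B where a: "f \<in> borel_measurable borel" "g \<in> borel_measurable borel"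
    "\<And>x. \<bar>f x\<bar> \<le> A" "\<And>x. \<bar>g x\<bar> \<le> B" unfolding bdd_borel_def by blast
  have "\<bar>f x - g x\<bar> \<le> A + B" for x using a(3)[of x] a(4)[of x] by linarith
  then show ?thesis using a by (intro bdd_borelI) auto
qed

lemma bdd_borel_mult: "bdd_borel f \<Longrightarrow> bdd_borel g \<Longrightarrow> bdd_borel (\<lambda>x. f x * g x)"
proof -
  assume "bdd_borel f" "bdd_borel g"
  then obtain A B where a: "f \<in> borel_measurable borel" "g \<in> borel_measurable borel"
    "\<And>x. \<bar>f x\<bar> \<le> A" "\<And>x. \<bar>g x\<bar> \<le> B" unfolding bdd_borel_def by blast
  have "\<bar>f x * g x\<bar> \<le> A * B" for x unfolding abs_mult using a(3)[of x] a(4)[of x]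
    by (intro mult_mono) auto
  then show ?thesis using a by (intro bdd_borelI) auto
qed

lemma bdd_borel_shift: "bdd_borel f \<Longrightarrow> bdd_borel (\<lambda>x. f (k + x))"
  unfolding bdd_borel_def by (auto intro: measurable_compose[where g = f])

lemma bdd_borel_continuous:
  assumes "continuous_on UNIV f" "\<And>x. \<bar>f x\<bar> \<le> B" shows "bdd_borel f"
  using assms by (intro bdd_borelI borel_measurable_continuous_onI)

lemma bdd_set_integrable:
  assumes "bdd_borel f" "A \<in> sets borel" "bounded A" shows "set_integrable lborel A f"
proof -
  obtain B where "\<And>x. \<bar>f x\<bar> \<le> B" using assms(1) unfolding bdd_borel_def by blast
  moreover have "emeasure lborel A < \<infinity>" using assms(3) by (rule emeasure_bounded_finite)
  ultimately show ?thesis using assms unfolding set_integrable_def bdd_borel_def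
    by (intro integrableI_bounded_set_indicator[where B = B]) auto
qed

lemma set_integral_translate:
  fixes f :: "'a::euclidean_space \<Rightarrow> real"
  assumes f: "f \<in> borel_measurable borel" and A: "A \<in> sets borel"
  shows "(LINT x:A|lborel. f x) = (LINT x:(\<lambda>x. x - k) ` A|lborel. f (k + x))"
proof -
  have eq: "(\<lambda>x. x - k) ` A = (\<lambda>x. k + x) -` A" by (auto simp: image_iff) (metis add_diff_cancel_left' add.commute)
  have "(LINT x:A|lborel. f x) = integral\<^sup>L (distr lborel borel ((+) k)) (\<lambda>x. indicator A x *\<^sub>R f x)"
    unfolding lborel_distr_plus set_lebesgue_integral_def ..
  also have "\<dots> = (LINT x|lborel. indicator A (k + x) *\<^sub>R f (k + x))"
    using f A by (intro integral_distr) auto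
  also have "\<dots> = (LINT x:(\<lambda>x. x - k) ` A|lborel. f (k + x))"
    unfolding eq set_lebesgue_integral_def by (intro Bochner_Integration.integral_cong) (auto simp: indicator_def)
  finally show ?thesis .
qed

definition hcube :: "real \<Rightarrow> (real ^ 'd::finite) set" where
  "hcube a = {y. \<forall>i. a \<le> y $ i \<and> y $ i < a + 1}"

lemma half_open_borel: "{y :: real ^ 'd::finite. \<forall>i. a i \<le> y $ i \<and> y $ i < b i} \<in> sets borel"
proof -
  have "{y :: real ^ 'd. \<forall>i. a i \<le> y $ i \<and> y $ i < b i} = (\<Inter>i. {y. a i \<le> y $ i} \<inter> {y. y $ i < b i})" by auto
  also have "\<dots> \<in> sets borel"
    by (intro sets.finite_INT sets.Int borel_closed borel_open
        closed_halfspace_component_ge_cart open_halfspace_component_lt_cart) auto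
  finally show ?thesis .
qed

lemma half_open_bounded: "bounded {y :: real ^ 'd::finite. \<forall>i. a i \<le> y $ i \<and> y $ i < b i}"
  by (rule bounded_subset[OF bounded_cbox[of "\<chi> i. a i" "\<chi> i. b i"]]) (auto simp: mem_box_cart less_imp_le)

lemma hcube_borel [simp]: "hcube a \<in> sets borel" and hcube_bounded: "bounded (hcube a)"
  unfolding hcube_def by (rule half_open_borel half_open_bounded)+

lemma box_h_borel [simp]: "box_h N x \<in> sets borel" and box_h_bounded: "bounded (box_h N x)"
  unfolding box_h_def by (rule half_open_borel half_open_bounded)+

lemma lattice_finite: "finite {k :: real ^ 'd::finite. \<forall>i. k $ i \<in> {-1, 0, 1}}"
proof -
  have "{k :: real ^ 'd. \<forall>i. k $ i \<in> {-1, 0, 1}} \<subseteq> (\<lambda>f. \<chi> i. f i) ` (PiE UNIV (\<lambda>_. {-1, 0, 1}))"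
  proof
    fix k :: "real ^ 'd" assume "k \<in> {k. \<forall>i. k $ i \<in> {-1, 0, 1}}"
    then show "k \<in> (\<lambda>f. \<chi> i. f i) ` (PiE UNIV (\<lambda>_. {-1, 0, 1}))"
      by (intro image_eqI[of _ _ "\<lambda>i. k $ i"]) auto
  qed
  then show ?thesis by (rule finite_subset) (intro finite_imageI finite_PiE, auto)
qed

text \<open>
  Both half-open cubes are fundamental domains of the lattice: each is cut into pieces whose
  translates by lattice vectors form the other.
\<close>

lemma integral_hcube_shift:
  fixes \<phi> :: "real ^ 'd::finite \<Rightarrow> real"
  assumes \<phi>: "bdd_borel \<phi>" "periodic \<phi>" and a: "- 1 \<le> a" "a \<le> 0"
  shows "(LINT x:hcube 0|lborel. \<phi> x) = (LINT x:hcube a|lborel. \<phi> x)"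
proof -
  \<comment> \<open>Since \<open>\<bar>a\<bar> \<le> 1\<close>, these lattice vectors suffice.\<close>
  define K :: "(real ^ 'd) set" where "K = {k. \<forall>i. k $ i \<in> {-1, 0, 1}}"
  have K: "finite K" unfolding K_def by (rule lattice_finite)
  have KZ: "k \<in> lattice_Z" if "k \<in> K" for k using that unfolding K_def lattice_Z_def
    by (smt (verit) Ints_0 Ints_1 Ints_minus insertE mem_Collect_eq singletonD)
  define A where "A k = hcube 0 \<inter> {x. x - k \<in> hcube a}" for k :: "real ^ 'd"
  have eqA: "{x. x - k \<in> hcube a} = {y. \<forall>i. a + k $ i \<le> y $ i \<and> y $ i < a + 1 + k $ i}" for k :: "real ^ 'd"
    by (auto simp: hcube_def algebra_simps)
  have A: "A k \<in> sets borel" "bounded (A k)" for k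
    unfolding A_def eqA using hcube_bounded[of 0]
    by (auto intro!: half_open_borel sets.Int intro: bounded_subset[OF hcube_bounded[of 0]])
  define A' where "A' k = (\<lambda>x. x - k) ` A k" for k
  have A'_eq: "A' k = hcube a \<inter> {x. x + k \<in> hcube 0}" for k
  proof (intro equalityI subsetI)
    fix x assume "x \<in> hcube a \<inter> {x. x + k \<in> hcube 0}"
    then show "x \<in> A' k" unfolding A'_def A_def by (intro image_eqI[of _ _ "x + k"]) auto
  qed (auto simp: A'_def A_def)
  have eqA': "{x. x + k \<in> hcube 0} = {y. \<forall>i. - k $ i \<le> y $ i \<and> y $ i < 1 - k $ i}" for k :: "real ^ 'd"
    by (auto simp: hcube_def algebra_simps) (smt (verit))+
  have A': "A' k \<in> sets borel" "bounded (A' k)" for k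
    unfolding A'_eq eqA'
    by (auto intro!: half_open_borel sets.Int intro: bounded_subset[OF hcube_bounded[of a]])
  have uniq: "k $ i = l $ i" if "k \<in> K" "l \<in> K" "\<bar>k $ i - l $ i\<bar> < 1" for k l :: "real ^ 'd" and i
    using that unfolding K_def by (auto dest!: spec[of _ i])
  have disj: "disjoint_family_on S K"
    if S: "\<And>k x i. x \<in> S k \<Longrightarrow> b \<le> x $ i + s * k $ i \<and> x $ i + s * k $ i < b + 1" and s: "\<bar>s\<bar> = 1" for S b and s :: real
    unfolding disjoint_family_on_def
  proof (intro ballI impI)
    fix k l assume kl: "k \<in> K" "l \<in> K" "k \<noteq> l"
    then obtain i where "k $ i \<noteq> l $ i" by (auto simp: vec_eq_iff)
    then have "1 \<le> \<bar>k $ i - l $ i\<bar>" using uniq[OF kl(1,2), of i] by linarith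
    moreover have "\<bar>s\<bar> * \<bar>k $ i - l $ i\<bar> < 1" if "x \<in> S k" "x \<in> S l" for x
      using S[OF that(1), of i] S[OF that(2), of i] unfolding abs_mult[symmetric] right_diff_distrib by linarith
    ultimately show "S k \<inter> S l = {}" unfolding s by fastforce
  qed
  have d1: "disjoint_family_on A K"
    by (rule disj[of A a "- 1"]) (auto simp: A_def hcube_def)
  have d2: "disjoint_family_on A' K"
    by (rule disj[of A' 0 1]) (auto simp: A'_eq hcube_def)
  have u1: "(\<Union>k\<in>K. A k) = hcube 0"
  proof (intro equalityI subsetI)
    fix x :: "real ^ 'd" assume x: "x \<in> hcube 0"
    define k :: "real ^ 'd" where "k = (\<chi> i. if x $ i < a + 1 then 0 else 1)"
    have "k \<in> K" by (auto simp: K_def k_def)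
    moreover have "x \<in> A k" using x a unfolding A_def hcube_def k_def
      by (auto simp: split: if_splits dest: spec) (smt (verit))+
    ultimately show "x \<in> (\<Union>k\<in>K. A k)" by blast
  qed (auto simp: A_def)
  have u2: "(\<Union>k\<in>K. A' k) = hcube a"
  proof (intro equalityI subsetI)
    fix x :: "real ^ 'd" assume x: "x \<in> hcube a"
    define k :: "real ^ 'd" where "k = (\<chi> i. if x $ i < 0 then 1 else 0)"
    have "k \<in> K" by (auto simp: K_def k_def)
    moreover have "x \<in> A' k" using x a unfolding A'_eq hcube_def k_def
      by (auto simp: split: if_splits dest: spec) (smt (verit))+
    ultimately show "x \<in> (\<Union>k\<in>K. A' k)" by blast
  qed (auto simp: A'_eq)
  have "(LINT x:hcube 0|lborel. \<phi> x) = (\<Sum>k\<in>K. LINT x:A k|lborel. \<phi> x)"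
    unfolding u1[symmetric] using K d1 A \<phi>(1)
    by (intro set_integral_finite_Union) (auto intro!: bdd_set_integrable)
  also have "\<dots> = (\<Sum>k\<in>K. LINT x:A' k|lborel. \<phi> x)"
  proof (rule sum.cong[OF refl])
    fix k assume k: "k \<in> K"
    have "\<phi> (k + x) = \<phi> x" for x
      using \<phi>(2) KZ[OF k] unfolding periodic_def by (subst add.commute) blast
    then show "(LINT x:A k|lborel. \<phi> x) = (LINT x:A' k|lborel. \<phi> x)"
      using set_integral_translate[of \<phi> "A k" k] \<phi>(1) A unfolding A'_def bdd_borel_def by simp
  qed
  also have "\<dots> = (LINT x:hcube a|lborel. \<phi> x)"
    unfolding u2[symmetric] using K d2 A' \<phi>(1)
    by (intro set_integral_finite_Union[symmetric]) (auto intro!: bdd_set_integrable)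
  finally show ?thesis .
qed

lemma measure_half_open:
  fixes x y :: "real ^ 'd::finite"
  assumes "\<And>i. x $ i \<le> y $ i"
  shows "measure lborel {z. \<forall>i. x $ i \<le> z $ i \<and> z $ i < y $ i} = (\<Prod>i\<in>UNIV. y $ i - x $ i)"
proof -
  let ?S = "{z. \<forall>i. x $ i \<le> z $ i \<and> z $ i < y $ i}"
  have "x \<in> cbox x y" using assms by (auto simp: mem_box_cart)
  then have ne: "cbox x y \<noteq> {}" by blast
  have c: "measure lborel (cbox x y) = (\<Prod>i\<in>UNIV. y $ i - x $ i)" by (rule content_cbox_cart[OF ne])
  have sub: "box x y \<subseteq> ?S" "?S \<subseteq> cbox x y" by (auto simp: mem_box_cart less_imp_le)
  have b: "measure lborel (box x y) = measure lborel (cbox x y)"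
    by (simp add: measure_lborel_box_eq measure_lborel_cbox_eq)
  have S: "?S \<in> sets lborel" using half_open_borel[of "\<lambda>i. x $ i" "\<lambda>i. y $ i"] by simp
  have f: "emeasure lborel (cbox x y) < \<infinity>" by (rule emeasure_lborel_cbox_finite)
  have "measure lborel (box x y) \<le> measure lborel ?S"
    using sub S f by (intro measure_mono_fmeasurable) (auto simp: fmeasurable_def intro: le_less_trans[OF emeasure_mono])
  moreover have "measure lborel ?S \<le> measure lborel (cbox x y)"
    using sub S f by (intro measure_mono_fmeasurable) (auto simp: fmeasurable_def)
  ultimately show ?thesis using b c by linarith
qed

lemma measure_box_h:
  assumes "N > 0" shows "measure lborel (box_h N (x :: real ^ 'd::finite)) = (1 / real N) ^ CARD('d)"
proof -
  let ?h = "1 / real N"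
  have "box_h N x = {z. \<forall>i. (\<chi> j. x $ j - ?h / 2) $ i \<le> z $ i \<and> z $ i < (\<chi> j. x $ j + ?h / 2) $ i}"
    unfolding box_h_def by simp
  then have "measure lborel (box_h N x) = (\<Prod>i\<in>UNIV. (\<chi> j. x $ j + ?h / 2) $ i - (\<chi> j. x $ j - ?h / 2) $ i)"
    by (simp only:) (rule measure_half_open, simp)
  also have "\<dots> = (\<Prod>i\<in>(UNIV::'d set). ?h)" by (rule prod.cong) (auto simp: field_simps)
  finally show ?thesis by simp
qed

lemma integral_box_bound:
  assumes "N > 0" and f: "bdd_borel f" and b: "\<And>y. y \<in> box_h N x \<Longrightarrow> \<bar>f y\<bar> \<le> B"
  shows "\<bar>LINT y:box_h N (x :: real ^ 'd::finite)|lborel. f y\<bar> \<le> B * (1 / real N) ^ CARD('d)"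
proof -
  have fin: "emeasure lborel (box_h N x) < \<infinity>" by (rule emeasure_bounded_finite[OF box_h_bounded])
  have ci: "set_integrable lborel (box_h N x) (\<lambda>_. c)" for c :: real
    by (rule bdd_set_integrable[OF bdd_borel_const box_h_borel box_h_bounded])
  have fi: "set_integrable lborel (box_h N x) f" by (rule bdd_set_integrable[OF f box_h_borel box_h_bounded])
  have e: "(LINT y:box_h N x|lborel. (c::real)) = c * (1 / real N) ^ CARD('d)" for c
    using measure_box_h[OF assms(1), of x] fin by (subst set_integral_const) auto
  have "(LINT y:box_h N x|lborel. f y) \<le> (LINT y:box_h N x|lborel. B)"
    using b by (intro set_integral_mono fi ci) (auto simp: abs_le_iff)
  moreover have "(LINT y:box_h N x|lborel. - B) \<le> (LINT y:box_h N x|lborel. f y)"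
    using b by (intro set_integral_mono fi ci) (auto simp: abs_le_iff minus_le_iff)
  ultimately show ?thesis unfolding e by (auto simp: abs_le_iff)
qed

lemma integral_box_const:
  assumes "N > 0" shows "(LINT y:box_h N (x :: real ^ 'd::finite)|lborel. (c::real)) = c * (1 / real N) ^ CARD('d)"
proof -
  have fin: "emeasure lborel (box_h N x) < \<infinity>" by (rule emeasure_bounded_finite[OF box_h_bounded])
  then show ?thesis using measure_box_h[OF assms, of x] by (subst set_integral_const) auto
qed

lemma box_average_bound:
  assumes N: "N > 0" and f: "bdd_borel f" and b: "\<And>y. y \<in> box_h N x \<Longrightarrow> \<bar>f y - c\<bar> \<le> B"
  shows "\<bar>(LINT y:box_h N (x :: real ^ 'd::finite)|lborel. f y) / (1 / real N) ^ CARD('d) - c\<bar> \<le> B"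
proof -
  let ?V = "(1 / real N) ^ CARD('d)" and ?I = "LINT y:box_h N x|lborel. f y"
  have V: "?V > 0" using N by simp
  have "\<bar>LINT y:box_h N x|lborel. f y - c\<bar> \<le> B * ?V"
    by (rule integral_box_bound[OF N _ b]) (intro bdd_borel_diff f bdd_borel_const)
  also have "(LINT y:box_h N x|lborel. f y - c) = ?I - c * ?V"
    unfolding integral_box_const[OF N, where x = x and c = c, symmetric]
    by (intro set_integral_diff(2) bdd_set_integrable f bdd_borel_const box_h_borel box_h_bounded)
  also have "\<dots> = (?I / ?V - c) * ?V" using N by (simp add: left_diff_distrib)
  finally have "\<bar>?I / ?V - c\<bar> * ?V \<le> B * ?V" using V by (simp only: abs_mult abs_of_pos)
  then show ?thesis using V by (simp only: mult_le_cancel_right_pos)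
qed

lemma box_h_unique:
  assumes N: "N > 0" and x: "x \<in> grid N" "x' \<in> grid N" and k: "k \<in> lattice_Z"
    and y: "y \<in> box_h N x" "y + k \<in> box_h N (x' :: real ^ 'd::finite)"
  shows "x' = x"
proof -
  have "x' $ i = x $ i" for i
  proof -
    obtain a b where ab: "a < N" "x $ i = real a / real N" "b < N" "x' $ i = real b / real N"
      using x unfolding grid_def by blast
    obtain c where c: "k $ i = of_int c" using k unfolding lattice_Z_def by (blast elim: Ints_cases)
    have y1: "x $ i - (1 / real N) / 2 \<le> y $ i" "y $ i < x $ i + (1 / real N) / 2"
      using y(1) unfolding box_h_def by blast+
    have y2: "x' $ i - (1 / real N) / 2 \<le> y $ i + k $ i" "y $ i + k $ i < x' $ i + (1 / real N) / 2"
      using y(2) unfolding box_h_def by (auto dest!: spec[of _ i])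
    have "\<bar>x $ i + k $ i - x' $ i\<bar> < 1 / real N"
    proof -
      define h where "h = 1 / real N"
      show ?thesis using y1 y2 unfolding h_def[symmetric] by linarith
    qed
    then have "\<bar>x $ i + k $ i - x' $ i\<bar> * real N < 1" using N by (simp add: pos_less_divide_eq)
    then have "\<bar>(x $ i + k $ i - x' $ i) * real N\<bar> < 1" by (simp add: abs_mult)
    also have "(x $ i + k $ i - x' $ i) * real N = of_int (int a + c * int N - int b)"
      using N ab c by (simp add: field_simps)
    finally have "\<bar>int a + c * int N - int b\<bar> < 1" by linarith
    then have e: "int a + c * int N = int b" by linarith
    have "c = 0"
    proof (rule ccontr)
      assume "c \<noteq> 0"
      then have "c \<ge> 1 \<or> c \<le> -1" by linarith
      then show False
      proof
        assume "c \<ge> 1" then have "c * int N \<ge> 1 * int N" by (intro mult_right_mono) auto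
        then show False using e ab by linarith
      next
        assume "c \<le> -1" then have "c * int N \<le> (-1) * int N" by (intro mult_right_mono) auto
        then show False using e ab by linarith
      qed
    qed
    then show ?thesis using e ab by simp
  qed
  then show ?thesis by (simp add: vec_eq_iff)
qed

lemma union_boxes:
  assumes N: "N > 0" shows "(\<Union>x\<in>grid N. box_h N x) = hcube (- (1 / real N) / 2)"
proof (intro equalityI subsetI)
  fix y :: "real ^ 'a" assume "y \<in> (\<Union>x\<in>grid N. box_h N x)"
  then obtain x where x: "x \<in> grid N" "y \<in> box_h N x" by blast
  have "- (1 / real N) / 2 \<le> y $ i \<and> y $ i < - (1 / real N) / 2 + 1" for i
  proof -
    obtain a where a: "a < N" "x $ i = real a / real N" using x(1) unfolding grid_def by blast
    have y: "x $ i - (1 / real N) / 2 \<le> y $ i" "y $ i < x $ i + (1 / real N) / 2"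
      using x(2) unfolding box_h_def by blast+
    have "real a + 1 \<le> real N" using a by simp
    then have "(real a + 1) / real N \<le> 1" using N by simp
    then have x1: "x $ i + 1 / real N \<le> 1" "x $ i \<ge> 0" using a(2) by (simp_all add: add_divide_distrib)
    define h where "h = 1 / real N"
    show ?thesis using y x1 unfolding h_def[symmetric] by auto
  qed
  then show "y \<in> hcube (- (1 / real N) / 2)" by (simp add: hcube_def)
next
  fix y :: "real ^ 'a" assume y: "y \<in> hcube (- (1 / real N) / 2)"
  define c where "c i = nat \<lfloor>real N * y $ i + 1 / 2\<rfloor>" for i
  have c: "c i < N \<and> real (c i) / real N - (1 / real N) / 2 \<le> y $ i \<and> y $ i < real (c i) / real N + (1 / real N) / 2" for i
  proof -
    have y1: "- (1 / real N) / 2 \<le> y $ i" "y $ i < - (1 / real N) / 2 + 1"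
      using y unfolding hcube_def by blast+
    have "real N * (- (1 / real N) / 2) \<le> real N * y $ i" "real N * y $ i < real N * (- (1 / real N) / 2 + 1)"
      by (rule mult_left_mono[OF y1(1)], simp) (rule mult_strict_left_mono[OF y1(2)], use N in simp)
    note y2' = this
    have y2: "0 \<le> real N * y $ i + 1 / 2" "real N * y $ i + 1 / 2 < real N"
    proof -
      have "real N * (- (1 / real N) / 2) = - 1 / 2" "real N * (- (1 / real N) / 2 + 1) = real N - 1 / 2"
        using N by (simp_all add: field_simps)
      with y2' show "0 \<le> real N * y $ i + 1 / 2" "real N * y $ i + 1 / 2 < real N" by linarith+
    qed
    have fl: "0 \<le> \<lfloor>real N * y $ i + 1 / 2\<rfloor>" using y2(1) by simp
    have r: "real (c i) = of_int \<lfloor>real N * y $ i + 1 / 2\<rfloor>" using fl by (simp add: c_def)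
    have r1: "real (c i) \<le> real N * y $ i + 1 / 2" "real N * y $ i + 1 / 2 < real (c i) + 1"
      unfolding r by linarith+
    have "real (c i) < real N" using r1 y2 by linarith
    moreover have "(real (c i) - 1 / 2) / real N \<le> y $ i"
      using r1(1) N by (simp add: pos_divide_le_eq mult.commute)
    moreover have "y $ i < (real (c i) + 1 / 2) / real N"
      using r1(2) N by (simp add: pos_less_divide_eq mult.commute)
    ultimately show ?thesis by (simp add: add_divide_distrib diff_divide_distrib)
  qed
  have "(\<chi> i. real (c i) / real N) \<in> grid N" using c by (auto simp: grid_def)
  moreover have "y \<in> box_h N (\<chi> i. real (c i) / real N)" using c by (simp add: box_h_def)
  ultimately show "y \<in> (\<Union>x\<in>grid N. box_h N x)" by blast
qed

text \<open>The boxes tile the torus.\<close>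

lemma integral_cube_boxes:
  fixes \<phi> :: "real ^ 'd::finite \<Rightarrow> real"
  assumes N: "N > 0" and \<phi>: "bdd_borel \<phi>" "periodic \<phi>"
  shows "(LINT x:cube|lborel. \<phi> x) = (\<Sum>x\<in>grid N. LINT y:box_h N x|lborel. \<phi> y)"
proof -
  have "(LINT x:cube|lborel. \<phi> x) = (LINT x:hcube 0|lborel. \<phi> x)"
  proof (rule set_integral_cong_set)
    have m: "\<phi> \<in> borel_measurable borel" using \<phi> by (simp add: bdd_borel_def)
    show "set_borel_measurable lborel cube \<phi>" "set_borel_measurable lborel (hcube 0) \<phi>"
      unfolding set_borel_measurable_def cube_def using m
      by (intro borel_measurable_scaleR borel_measurable_indicator; simp)+
    have "emeasure lborel (cbox 0 1 - box 0 (1::real^'d)) = 0"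
      by (subst emeasure_Diff) (auto simp: emeasure_lborel_box_eq emeasure_lborel_cbox_eq box_subset_cbox)
    then have n: "cbox 0 1 - box 0 (1::real^'d) \<in> null_sets lborel" by auto
    show "AE x in lborel. (x \<in> hcube 0) = (x \<in> (cube :: (real ^ 'd) set))"
      using AE_not_in[OF n]
      by eventually_elim (auto simp: cube_def hcube_def mem_box_cart less_imp_le)
  qed
  also have "\<dots> = (LINT x:hcube (- (1 / real N) / 2)|lborel. \<phi> x)"
    using N by (intro integral_hcube_shift \<phi>) (auto simp: field_simps)
  also have "\<dots> = (\<Sum>x\<in>grid N. LINT y:box_h N x|lborel. \<phi> y)"
    unfolding union_boxes[OF N, symmetric]
  proof (rule set_integral_finite_Union)
    show "disjoint_family_on (box_h N) (grid N :: (real ^ 'd) set)"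
      unfolding disjoint_family_on_def using box_h_unique[OF N _ _ zero_lattice] by fastforce
  qed (auto intro!: bdd_set_integrable \<phi> box_h_bounded)
  finally show ?thesis .
qed

section \<open>Reconstruction of densities from grid functions\<close>

lemma lattice_countable: "countable (lattice_Z :: (real ^ 'd::finite) set)"
  unfolding lattice_Z_def by (rule countable_vector) (auto simp: Ints_def)

lemma R_h_box:
  assumes N: "N > 0" and x: "x \<in> grid N" and y: "y \<in> box_h N x"
  shows "R_h N m (y :: real ^ 'd::finite) = m x / (1 / real N) ^ CARD('d)"
proof -
  have "(\<exists>k\<in>lattice_Z. y + k \<in> box_h N x') \<longleftrightarrow> x' = x" if "x' \<in> grid N" for x'
    using box_h_unique[OF N x that _ y] y zero_lattice by force
  then have "R_h N m y = (\<Sum>x'\<in>grid N. if x' = x then m x' / (1 / real N) ^ CARD('d) else 0)"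
    unfolding R_h_def by (intro sum.cong) auto
  then show ?thesis using x by simp
qed

lemma R_h_periodic: "periodic (R_h N m)"
proof -
  have e: "(\<exists>l\<in>lattice_Z. y + k + l \<in> box_h N x) \<longleftrightarrow> (\<exists>l\<in>lattice_Z. y + l \<in> box_h N x)" if k: "k \<in> lattice_Z" for y k x
  proof
    assume "\<exists>l\<in>lattice_Z. y + k + l \<in> box_h N x"
    then obtain l where "l \<in> lattice_Z" "y + k + l \<in> box_h N x" by blast
    then show "\<exists>l\<in>lattice_Z. y + l \<in> box_h N x" using k
      by (intro bexI[of _ "k + l"]) (auto simp: lattice_Z_def add.assoc)
  next
    assume "\<exists>l\<in>lattice_Z. y + l \<in> box_h N x"
    then obtain l where "l \<in> lattice_Z" "y + l \<in> box_h N x" by blast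
    then show "\<exists>l\<in>lattice_Z. y + k + l \<in> box_h N x" using k
      by (intro bexI[of _ "l - k"]) (auto simp: lattice_Z_def)
  qed
  show ?thesis unfolding periodic_def R_h_def by (intro allI ballI sum.cong refl) (simp only: e)
qed

lemma R_h_bdd_borel: "bdd_borel (R_h N (m :: real ^ 'd::finite \<Rightarrow> real))"
proof (rule bdd_borelI)
  have "{y. \<exists>k\<in>lattice_Z. y + k \<in> box_h N x} \<in> sets borel" for x :: "real ^ 'd"
  proof -
    have "{y. \<exists>k\<in>lattice_Z. y + k \<in> box_h N x} =
       (\<Union>k\<in>lattice_Z. {y. \<forall>i. (x $ i - (1 / real N) / 2) - k $ i \<le> y $ i \<and> y $ i < (x $ i + (1 / real N) / 2) - k $ i})"
      unfolding box_h_def less_diff_eq diff_le_eq vector_add_component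
      by (simp only: Collect_bex_eq mem_Collect_eq vector_add_component)
    also have "\<dots> \<in> sets borel"
      by (rule sets.countable_UN'[OF lattice_countable], rule image_subsetI) (rule half_open_borel)
    finally show ?thesis .
  qed
  then show "R_h N m \<in> borel_measurable borel" unfolding R_h_def[abs_def]
    by (intro borel_measurable_sum measurable_If) (auto simp: pred_def)
  show "\<bar>R_h N m y\<bar> \<le> (\<Sum>x\<in>grid N. \<bar>m x / (1 / real N) ^ CARD('d)\<bar>)" for y
    unfolding R_h_def by (rule order_trans[OF sum_abs]) (intro sum_mono, auto)
qed

lemma R_h_nonneg: "(\<And>x. x \<in> grid N \<Longrightarrow> 0 \<le> m x) \<Longrightarrow> 0 \<le> R_h N m y"
  unfolding R_h_def by (intro sum_nonneg) auto

lemma R_h_affine: "R_h N (\<lambda>x. m1 x + s * (m2 x - m1 x)) y = R_h N m1 y + s * (R_h N m2 y - R_h N m1 y)"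
  unfolding R_h_def sum_subtractf[symmetric] sum_distrib_left sum.distrib[symmetric]
  by (rule sum.cong) (auto simp: algebra_simps add_divide_distrib diff_divide_distrib)

lemma integral_R_h:
  assumes N: "N > 0" and \<phi>: "bdd_borel \<phi>" "periodic \<phi>"
  shows "(LINT x:cube|lborel. \<phi> x * R_h N m x) =
    (\<Sum>x\<in>grid N. m x * (1 / (1 / real N) ^ CARD('d) * (LINT y:box_h N (x :: real ^ 'd::finite)|lborel. \<phi> y)))"
proof -
  have "periodic (\<lambda>x. \<phi> x * R_h N m x)" using \<phi>(2) R_h_periodic[of N m] unfolding periodic_def by simp
  then have "(LINT x:cube|lborel. \<phi> x * R_h N m x) = (\<Sum>x\<in>grid N. LINT y:box_h N x|lborel. \<phi> y * R_h N m y)"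
    by (intro integral_cube_boxes[OF N] bdd_borel_mult \<phi> R_h_bdd_borel)
  also have "\<dots> = (\<Sum>x\<in>grid N. LINT y:box_h N x|lborel. \<phi> y * (m x / (1 / real N) ^ CARD('d)))"
    by (intro sum.cong refl set_lebesgue_integral_cong) (auto simp: R_h_box[OF N])
  finally show ?thesis by (simp add: mult_ac)
qed

lemma R_h_density:
  assumes N: "N > 0" and m: "\<And>x. x \<in> grid N \<Longrightarrow> 0 \<le> m x" "(\<Sum>x\<in>grid N. m x) = 1"
  shows "R_h N m \<in> (densities :: (real ^ 'd::finite \<Rightarrow> real) set)"
proof -
  have p1: "periodic (\<lambda>_::real^'d. 1::real)" by (simp add: periodic_def)
  have "(LINT x:cube|lborel. 1 * R_h N m x) = 1"
    using N m(2) by (simp only: integral_R_h[OF N bdd_borel_const p1] integral_box_const[OF N]) simp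
  moreover have "set_integrable lborel cube (\<lambda>x. (R_h N m x)\<^sup>2)"
    unfolding power2_eq_square cube_def
    by (intro bdd_set_integrable bdd_borel_mult R_h_bdd_borel) auto
  moreover have "0 \<le> R_h N m x" for x by (rule R_h_nonneg[OF m(1)])
  ultimately show ?thesis using R_h_bdd_borel[of N m]
    unfolding densities_def bdd_borel_def by (auto simp: R_h_periodic)
qed

lemma L2_dist_R_h:
  assumes N: "N > 0"
  shows "L2_dist (R_h N m1) (R_h N (m2 :: real ^ 'd::finite \<Rightarrow> real)) =
    sqrt ((\<Sum>x\<in>grid N. (m1 x - m2 x)\<^sup>2) / (1 / real N) ^ CARD('d))"
proof -
  have "periodic (\<lambda>x. (R_h N m1 x - R_h N m2 x)\<^sup>2)"
    using R_h_periodic[of N m1] R_h_periodic[of N m2] unfolding periodic_def by simp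
  then have "(LINT x:cube|lborel. (R_h N m1 x - R_h N m2 x)\<^sup>2) =
     (\<Sum>x\<in>grid N. LINT y:box_h N x|lborel. (R_h N m1 y - R_h N m2 y)\<^sup>2)"
    unfolding power2_eq_square by (intro integral_cube_boxes[OF N] bdd_borel_mult bdd_borel_diff R_h_bdd_borel)
  also have "\<dots> = (\<Sum>x\<in>grid N. LINT y:box_h N x|lborel. ((m1 x - m2 x) / (1 / real N) ^ CARD('d))\<^sup>2)"
    by (intro sum.cong refl set_lebesgue_integral_cong) (auto simp: R_h_box[OF N] diff_divide_distrib)
  also have "\<dots> = (\<Sum>x\<in>grid N. (m1 x - m2 x)\<^sup>2) / (1 / real N) ^ CARD('d)"
    unfolding integral_box_const[OF N] sum_divide_distrib using N
    by (intro sum.cong) (auto simp: power2_eq_square power_divide)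
  finally show ?thesis by (simp add: L2_dist_def)
qed

text \<open>
  Cauchy-Schwarz inequality on the \<open>N\<^sup>d\<close> points of the grid.
\<close>

lemma sum_abs_le_sqrt:
  assumes "N > 0"
  shows "(\<Sum>x\<in>grid N. \<bar>f (x :: real ^ 'd::finite)\<bar>) \<le> sqrt ((\<Sum>x\<in>grid N. (f x)\<^sup>2) / (1 / real N) ^ CARD('d))"
proof (rule real_le_rsqrt)
  have "(\<Sum>x\<in>grid N. \<bar>f x\<bar> * 1)\<^sup>2 \<le> (\<Sum>x\<in>grid N. \<bar>f x\<bar>\<^sup>2) * (\<Sum>x\<in>(grid N :: (real ^ 'd) set). 1\<^sup>2)"
    by (rule Cauchy_Schwarz_ineq_sum)
  also have "(\<Sum>x\<in>(grid N :: (real ^ 'd) set). (1::real)\<^sup>2) = real N ^ CARD('d)" by (simp add: card_grid)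
  finally show "(\<Sum>x\<in>grid N. \<bar>f x\<bar>)\<^sup>2 \<le> (\<Sum>x\<in>grid N. (f x)\<^sup>2) / (1 / real N) ^ CARD('d)"
    using assms by (simp add: power_divide)
qed

definition prob :: "nat \<Rightarrow> (real ^ 'd::finite \<Rightarrow> real) \<Rightarrow> bool" where
  "prob N m \<longleftrightarrow> (\<forall>x\<in>grid N. 0 \<le> m x) \<and> (\<Sum>x\<in>grid N. m x) = 1"

lemma prob_convex:
  assumes "prob N m1" "prob N m2" "0 \<le> s" "s \<le> 1"
  shows "prob N (\<lambda>x. m1 x + s * (m2 x - m1 x))"
proof -
  have "m1 x + s * (m2 x - m1 x) = (1 - s) * m1 x + s * m2 x" for x by (simp add: algebra_simps)
  then show ?thesis using assms
    by (auto simp: prob_def sum.distrib sum_distrib_left[symmetric] intro!: add_nonneg_nonneg mult_nonneg_nonneg)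
qed

lemma prob_density: "N > 0 \<Longrightarrow> prob N m \<Longrightarrow> R_h N m \<in> densities"
  by (rule R_h_density) (auto simp: prob_def)

context mfg
begin

lemma fc_periodic: "t \<in> {0..1} \<Longrightarrow> \<mu> \<in> densities \<Longrightarrow> periodic (\<lambda>x. fc D t x \<mu>)"
  using torus unfolding data_on_torus_def by blast

lemma fc_bdd_borel:
  assumes "t \<in> {0..1}" "\<mu> \<in> densities" shows "bdd_borel (\<lambda>x. fc D t x \<mu>)"
proof (rule bdd_borel_continuous)
  show "continuous_on UNIV (\<lambda>x. fc D t x \<mu>)"
    using torus_lipschitz_continuous[OF f_lip_x[OF assms]] data_pos by simp
  show "\<bar>fc D t x \<mu>\<bar> \<le> \<bar>fc D t 0 \<mu>\<bar> + Lf D * real CARD('d)" for x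
    using torus_lipschitz_osc[OF f_lip_x[OF assms], of x 0] data_pos by linarith
qed

context
  fixes T N t :: nat assumes T: "T > 0" and N: "N > 0" and t: "t \<le> T"
begin

lemma vol_pos: "(1 / real N) ^ CARD('d) > 0" using N by simp

lemma f_disc_lipschitz:
  assumes m: "prob N m1" "prob N m2"
  shows "\<bar>f_disc D T N t x m1 - f_disc D T N t x m2\<bar> \<le> Lf D * sqrt ((\<Sum>x\<in>grid N. (m1 x - m2 x)\<^sup>2) / (1 / real N) ^ CARD('d))"
proof -
  let ?V = "(1 / real N) ^ CARD('d)"
  note d = prob_density[OF N m(1)] prob_density[OF N m(2)]
  define \<tau> where "\<tau> = tm T t"
  have tt: "\<tau> \<in> {0..1}" unfolding \<tau>_def by (rule tm_in[OF T t])
  note fd = f_disc_def[of D T N t, folded \<tau>_def]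
  let ?f = "\<lambda>m y. fc D \<tau> y (R_h N m)"
  have "f_disc D T N t x m1 - f_disc D T N t x m2 = 1 / ?V * (LINT y:box_h N x|lborel. ?f m1 y - ?f m2 y)"
    unfolding fd
    by (subst set_integral_diff) (auto intro!: bdd_set_integrable fc_bdd_borel d tt box_h_bounded simp: diff_divide_distrib)
  also have "\<bar>\<dots>\<bar> \<le> 1 / ?V * ((Lf D * L2_dist (R_h N m1) (R_h N m2)) * ?V)"
    unfolding abs_mult using vol_pos
    by (intro mult_mono integral_box_bound[OF N] bdd_borel_diff fc_bdd_borel d tt f_lip_m) auto
  finally show ?thesis using vol_pos N by (simp add: L2_dist_R_h[OF N])
qed

lemma f_disc_osc:
  assumes m: "prob N m"
  shows "\<bar>f_disc D T N t x m - f_disc D T N t y m\<bar> \<le> 2 * Lf D * real CARD('d)"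
proof -
  let ?V = "(1 / real N) ^ CARD('d)"
  note d = prob_density[OF N m]
  define \<tau> where "\<tau> = tm T t"
  have tt: "\<tau> \<in> {0..1}" unfolding \<tau>_def by (rule tm_in[OF T t])
  note fd = f_disc_def[of D T N t, folded \<tau>_def]
  let ?f = "\<lambda>y. fc D \<tau> y (R_h N m)"
  have "\<bar>f_disc D T N t x m - ?f 0\<bar> \<le> Lf D * real CARD('d)" for x
  proof -
    have "f_disc D T N t x m - ?f 0 = 1 / ?V * (LINT y:box_h N x|lborel. ?f y - ?f 0)"
      unfolding fd using vol_pos
      by (subst set_integral_diff)
        (use N in \<open>auto intro!: bdd_set_integrable fc_bdd_borel bdd_borel_const d tt box_h_bounded simp: diff_divide_distrib integral_box_const[OF N]\<close>)
    also have "\<bar>\<dots>\<bar> \<le> 1 / ?V * ((Lf D * real CARD('d)) * ?V)"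
      unfolding abs_mult using vol_pos data_pos
      by (intro mult_mono integral_box_bound[OF N] bdd_borel_diff bdd_borel_const fc_bdd_borel d tt
          torus_lipschitz_osc[OF f_lip_x[OF tt d]]) auto
    finally show ?thesis using vol_pos N by simp
  qed
  from this[of x] this[of y] show ?thesis by linarith
qed

lemma f_disc_pairing:
  assumes m: "prob N m"
  shows "(LINT x:cube|lborel. fc D (tm T t) x (R_h N m) * (R_h N m1 x - R_h N m2 x)) =
    (\<Sum>x\<in>grid N. f_disc D T N t x m * (m1 x - m2 x))"
proof -
  note d = prob_density[OF N m]
  define \<tau> where "\<tau> = tm T t"
  have tt: "\<tau> \<in> {0..1}" unfolding \<tau>_def by (rule tm_in[OF T t])
  note fd = f_disc_def[of D T N t, folded \<tau>_def]
  have i: "set_integrable lborel (cube :: (real ^ 'd) set) (\<lambda>x. fc D \<tau> x (R_h N m) * R_h N m' x)" for m'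
    unfolding cube_def by (intro bdd_set_integrable bdd_borel_mult fc_bdd_borel d tt R_h_bdd_borel) auto
  have "(LINT x:cube|lborel. fc D \<tau> x (R_h N m) * (R_h N m1 x - R_h N m2 x)) =
     (LINT x:cube|lborel. fc D \<tau> x (R_h N m) * R_h N m1 x) - (LINT x:cube|lborel. fc D \<tau> x (R_h N m) * R_h N m2 x)"
    unfolding right_diff_distrib by (rule set_integral_diff(2)[OF i i])
  also have "\<dots> = (\<Sum>x\<in>grid N. f_disc D T N t x m * (m1 x - m2 x))"
    unfolding integral_R_h[OF N fc_bdd_borel[OF tt d] fc_periodic[OF tt d]] fd[symmetric] sum_subtractf[symmetric]
    by (simp add: algebra_simps)
  finally show ?thesis by (simp only: \<tau>_def)
qed

lemma f_disc_monotone: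
  assumes m: "prob N m1" "prob N m2"
  shows "0 \<le> (\<Sum>x\<in>grid N. (f_disc D T N t x m1 - f_disc D T N t x m2) * (m1 x - m2 x))"
proof -
  note d = prob_density[OF N m(1)] prob_density[OF N m(2)]
  define \<tau> where "\<tau> = tm T t"
  have tt: "\<tau> \<in> {0..1}" unfolding \<tau>_def by (rule tm_in[OF T t])
  note fd = f_disc_def[of D T N t, folded \<tau>_def]
  have i: "set_integrable lborel (cube :: (real ^ 'd) set) (\<lambda>x. fc D \<tau> x (R_h N m) * (R_h N m1 x - R_h N m2 x))"
    if "prob N m" for m
    unfolding cube_def
    by (intro bdd_set_integrable bdd_borel_mult bdd_borel_diff fc_bdd_borel prob_density[OF N that] tt R_h_bdd_borel) auto
  have "0 \<le> (LINT x:cube|lborel. (fc D \<tau> x (R_h N m1) - fc D \<tau> x (R_h N m2)) * (R_h N m1 x - R_h N m2 x))"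
    by (rule f_mono[OF tt d])
  also have "\<dots> = (\<Sum>x\<in>grid N. (f_disc D T N t x m1 - f_disc D T N t x m2) * (m1 x - m2 x))"
    unfolding left_diff_distrib
    by (subst set_integral_diff(2)[OF i[OF m(1)] i[OF m(2)]])
      (simp only: f_disc_pairing[folded \<tau>_def, OF m(1)] f_disc_pairing[folded \<tau>_def, OF m(2)] sum_subtractf)
  finally show ?thesis .
qed

text \<open>
  The potential along a segment: its derivative is nondecreasing by monotonicity and Lipschitz
  by the Lipschitz property of the coupling, which gives a lower and an upper quadratic model.
\<close>

lemma F_disc_bounds:
  assumes m: "prob N m1" "prob N m2"
  defines "Q \<equiv> (\<Sum>x\<in>grid N. (m2 x - m1 x)\<^sup>2)"
  shows "(\<Sum>x\<in>grid N. f_disc D T N t x m1 * (m2 x - m1 x)) \<le> F_disc D T N t m2 - F_disc D T N t m1"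
    and "F_disc D T N t m2 - F_disc D T N t m1 \<le>
      (\<Sum>x\<in>grid N. f_disc D T N t x m1 * (m2 x - m1 x)) + Lf D * Q / (1 / real N) ^ CARD('d) / 2"
proof -
  let ?V = "(1 / real N) ^ CARD('d)"
  note d = prob_density[OF N m(1)] prob_density[OF N m(2)]
  define \<tau> where "\<tau> = tm T t"
  have tt: "\<tau> \<in> {0..1}" unfolding \<tau>_def by (rule tm_in[OF T t])
  note fd = f_disc_def[of D T N t, folded \<tau>_def]
  define ms where "ms s = (\<lambda>x. m1 x + s * (m2 x - m1 x))" for s :: real
  have ms: "prob N (ms s)" if "s \<in> {0..1}" for s unfolding ms_def using that m by (intro prob_convex) auto
  define G where "G s = (\<Sum>x\<in>grid N. f_disc D T N t x (ms s) * (m2 x - m1 x))" for s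
  have Q0: "Q \<ge> 0" unfolding Q_def by (intro sum_nonneg) auto
  have "F_disc D T N t m2 - F_disc D T N t m1 = (LINT s:{0..1}|lborel. LINT x:cube|lborel.
          fc D \<tau> x (\<lambda>y. R_h N m1 y + s * (R_h N m2 y - R_h N m1 y)) * (R_h N m2 x - R_h N m1 x))"
    unfolding F_disc_def \<tau>_def[symmetric] using assC tt d unfolding assumption_C_def by blast
  also have "\<dots> = (LINT s:{0..1}|lborel. G s)"
  proof (intro set_lebesgue_integral_cong ballI allI impI)
    fix s :: real assume s: "s \<in> {0..1}"
    have "(\<lambda>y. R_h N m1 y + s * (R_h N m2 y - R_h N m1 y)) = R_h N (ms s)"
      unfolding ms_def by (rule ext) (rule R_h_affine[symmetric])
    then show "(LINT x:cube|lborel. fc D \<tau> x (\<lambda>y. R_h N m1 y + s * (R_h N m2 y - R_h N m1 y)) * (R_h N m2 x - R_h N m1 x)) = G s"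
      using f_disc_pairing[folded \<tau>_def, OF ms[OF s], of m2 m1] by (simp add: G_def)
  qed simp
  finally have F: "F_disc D T N t m2 - F_disc D T N t m1 = (LINT s:{0..1}|lborel. G s)" .
  have S1: "(\<Sum>x\<in>grid N. \<bar>m2 x - m1 x\<bar>) \<le> sqrt (Q / ?V)" unfolding Q_def by (rule sum_abs_le_sqrt[OF N])
  have lip: "\<bar>G s - G s'\<bar> \<le> Lf D * Q / ?V * \<bar>s - s'\<bar>" if s: "s \<in> {0..1}" "s' \<in> {0..1}" for s s'
  proof -
    have "(\<Sum>x\<in>grid N. (ms s x - ms s' x)\<^sup>2) = (s - s')\<^sup>2 * Q"
    proof -
      have "ms s x - ms s' x = (s - s') * (m2 x - m1 x)" for x by (simp add: ms_def algebra_simps)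
      then show ?thesis by (simp add: Q_def power_mult_distrib sum_distrib_left)
    qed
    then have fb: "\<bar>f_disc D T N t x (ms s) - f_disc D T N t x (ms s')\<bar> \<le> Lf D * (\<bar>s - s'\<bar> * sqrt (Q / ?V))" for x
      using f_disc_lipschitz[OF ms[OF s(1)] ms[OF s(2)], of x] by (simp add: real_sqrt_mult real_sqrt_divide)
    have "G s - G s' = (\<Sum>x\<in>grid N. (f_disc D T N t x (ms s) - f_disc D T N t x (ms s')) * (m2 x - m1 x))"
      by (simp add: G_def sum_subtractf left_diff_distrib)
    also have "\<bar>\<dots>\<bar> \<le> (\<Sum>x\<in>grid N. (Lf D * (\<bar>s - s'\<bar> * sqrt (Q / ?V))) * \<bar>m2 x - m1 x\<bar>)"
      by (rule order_trans[OF sum_abs], rule sum_mono) (auto simp: abs_mult intro: mult_right_mono fb)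
    also have "\<dots> = (Lf D * (\<bar>s - s'\<bar> * sqrt (Q / ?V))) * (\<Sum>x\<in>grid N. \<bar>m2 x - m1 x\<bar>)"
      by (simp add: sum_distrib_left)
    also have "\<dots> \<le> (Lf D * (\<bar>s - s'\<bar> * sqrt (Q / ?V))) * sqrt (Q / ?V)"
      using S1 data_pos vol_pos Q0 by (intro mult_left_mono) auto
    also have "\<dots> = Lf D * \<bar>s - s'\<bar> * (sqrt (Q / ?V) * sqrt (Q / ?V))" by (simp add: mult_ac)
    also have "sqrt (Q / ?V) * sqrt (Q / ?V) = Q / ?V" using Q0 vol_pos by simp
    finally show ?thesis by (simp add: mult_ac)
  qed
  have "continuous_on {0..1} G"
  proof (rule lipschitz_on_continuous_on)
    show "(Lf D * Q / ?V)-lipschitz_on {0..1} G"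
      using lip data_pos Q0 vol_pos by (auto simp: lipschitz_on_def dist_real_def)
  qed
  then have Gi: "set_integrable lborel {0..1} G"
    unfolding set_integrable_def by (intro borel_integrable_compact) auto
  have ci: "set_integrable lborel {0..1} (\<lambda>s. b + s * c)" for b c :: real
    unfolding set_integrable_def by (intro borel_integrable_compact continuous_intros) auto
  have I: "(LINT s:{0..1}|lborel. G 0 + s * c) = G 0 + c / 2" for c :: real
  proof -
    have "(LINT s:{0..1}|lborel. (s::real)) = 1 / 2"
      using integral_power[of 0 1 1] by (simp add: set_lebesgue_integral_def mult.commute)
    then show ?thesis using set_integral_add(2)[OF ci[of "G 0" 0] ci[of 0 c]] by (simp add: set_integral_const)
  qed
  have G0: "G 0 = (\<Sum>x\<in>grid N. f_disc D T N t x m1 * (m2 x - m1 x))" by (simp add: G_def ms_def)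
  have mono: "G 0 \<le> G s" if s: "s \<in> {0..1}" for s
  proof (cases "s = 0")
    case False
    have "0 \<le> (\<Sum>x\<in>grid N. (f_disc D T N t x (ms s) - f_disc D T N t x (ms 0)) * (ms s x - ms 0 x))"
      using s by (intro f_disc_monotone ms) auto
    also have "\<dots> = s * (G s - G 0)"
      by (simp add: G_def ms_def sum_subtractf[symmetric] sum_distrib_left algebra_simps)
    finally show ?thesis using s False by (simp add: zero_le_mult_iff)
  qed simp
  have "(LINT s:{0..1}|lborel. G 0 + s * 0) \<le> (LINT s:{0..1}|lborel. G s)"
    using mono by (intro set_integral_mono Gi ci) auto
  then show "(\<Sum>x\<in>grid N. f_disc D T N t x m1 * (m2 x - m1 x)) \<le> F_disc D T N t m2 - F_disc D T N t m1"
    unfolding I[of 0] F G0[symmetric] by simp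
  have "(LINT s:{0..1}|lborel. G s) \<le> (LINT s:{0..1}|lborel. G 0 + s * (Lf D * Q / ?V))"
  proof (intro set_integral_mono Gi ci)
    fix s :: real assume s: "s \<in> {0..1}"
    show "G s \<le> G 0 + s * (Lf D * Q / ?V)" using lip[OF s, of 0] s by (simp add: mult.commute)
  qed
  then show "F_disc D T N t m2 - F_disc D T N t m1 \<le>
      (\<Sum>x\<in>grid N. f_disc D T N t x m1 * (m2 x - m1 x)) + Lf D * Q / ?V / 2"
    unfolding I[of "Lf D * Q / ?V"] F G0[symmetric] by simp
qed

end

end

section \<open>The discrete equations\<close>

lemma periodic_bounded:
  fixes g :: "real \<Rightarrow> real ^ 'd::finite \<Rightarrow> 'b::real_normed_vector"
  assumes c: "continuous_on ({0..1} \<times> UNIV) (\<lambda>(t, x). g t x)" and p: "\<And>t. t \<in> {0..1} \<Longrightarrow> periodic (g t)"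
  shows "\<exists>K. \<forall>t\<in>{0..1}. \<forall>x. norm (g t x) \<le> K"
proof -
  have "compact ((\<lambda>(t, x). g t x) ` ({0..1} \<times> cbox 0 1))"
    by (intro compact_continuous_image continuous_on_subset[OF c] compact_Times) auto
  then have "bounded ((\<lambda>(t, x). g t x) ` ({0..1} \<times> cbox 0 1))" by (rule compact_imp_bounded)
  then obtain K where K: "\<And>t x. t \<in> {0..1} \<Longrightarrow> x \<in> cbox 0 1 \<Longrightarrow> norm (g t x) \<le> K"
    unfolding bounded_iff by force
  have "norm (g t x) \<le> K" if t: "t \<in> {0..1}" for t x
  proof -
    have "wrap x \<in> cbox 0 1" by (simp add: mem_box_cart wrap_def frac_ge_0 less_imp_le[OF frac_lt_1])
    then show ?thesis using K[OF t, of "wrap x"] periodic_wrap[OF p[OF t], of x] by simp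
  qed
  then show ?thesis by blast
qed

lemma C_1_2_parts:
  assumes "C_1_2 u"
  shows "\<forall>t\<in>{0..1}. periodic (u t)"
     "\<forall>t\<in>{0..1}. \<forall>x. (\<lambda>s. u s x) differentiable (at t within {0..1})"
     "\<forall>t\<in>{0..1}. \<forall>x. has_gradient (u t) x"
     "\<forall>t\<in>{0..1}. \<forall>x i. has_gradient (\<lambda>y. gradient (u t) y $ i) x"
     "continuous_on ({0..1} \<times> UNIV) (\<lambda>(t, x). u t x)"
     "continuous_on ({0..1} \<times> UNIV) (\<lambda>(t, x). time_deriv u t x)"
     "continuous_on ({0..1} \<times> UNIV) (\<lambda>(t, x). gradient (u t) x)"
     "\<forall>i j. continuous_on ({0..1} \<times> UNIV) (\<lambda>(t, x). hessian i j (u t) x)"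
  using assms unfolding C_1_2_def by - (elim conjE, assumption)+

lemma parabolic_holder_C_1_2: "parabolic_holder r u \<Longrightarrow> C_1_2 u"
  unfolding parabolic_holder_def by (elim conjE)

context mfg
begin

definition cfl :: "nat \<Rightarrow> nat \<Rightarrow> bool" where
  "cfl T N \<longleftrightarrow> T \<ge> 1 \<and> N \<ge> 1 \<and>
      1 / real T \<le> (1 / real N)\<^sup>2 / (2 * real CARD('d) * (1 - \<theta>) * sigma D) \<and>
      1 / real N \<le> 2 * (1 - \<theta>) * sigma D / Mbound D"

lemma B_parts:
  "mfg_solution D us vs ms" "parabolic_holder r us" "parabolic_holder r ms"
  "\<forall>i. holder_Q r (\<lambda>t x. vs t x $ i) \<and> Linf_C_1_holder r (\<lambda>t x. vs t x $ i)"
  using assB unfolding assumption_B_def by - (elim conjE, assumption)+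

lemmas ms_C_1_2 = parabolic_holder_C_1_2[OF B_parts(3)] and us_C_1_2 = parabolic_holder_C_1_2[OF B_parts(2)]
lemmas ms_periodic = C_1_2_parts(1)[OF ms_C_1_2, rule_format] and us_periodic = C_1_2_parts(1)[OF us_C_1_2, rule_format]
  and ms_cont = C_1_2_parts(5)[OF ms_C_1_2] and us_cont = C_1_2_parts(5)[OF us_C_1_2]

lemma solution_parts:
  "\<forall>t\<in>{0..1}. periodic (vs t) \<and> ms t \<in> densities \<and>
        (\<forall>x i. has_gradient (\<lambda>y. (ms t y *\<^sub>R vs t y) $ i) x)"
  "\<forall>t\<in>{0..1}. \<forall>x.
        - time_deriv us t x - sigma D * laplacian (us t) x + Hc D t x (gradient (us t) x)
          = fc D t x (ms t) \<and>
        vs t x = - gradient (Hc D t x) (gradient (us t) x) \<and>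
        time_deriv ms t x - sigma D * laplacian (ms t) x + divergence (\<lambda>y. ms t y *\<^sub>R vs t y) x
          = 0"
  "AE x in lborel. ms 0 x = m0c D x" "\<forall>x. us 1 x = gc D x"
  using B_parts(1) unfolding mfg_solution_def by - (elim conjE, assumption)+

lemma ms_density: "t \<in> {0..1} \<Longrightarrow> ms t \<in> densities"
  using solution_parts(1) by simp

lemma ms_bdd_borel: assumes t: "t \<in> {0..1}" shows "bdd_borel (ms t)"
proof -
  have "continuous_on UNIV ((\<lambda>(t, x). ms t x) \<circ> (\<lambda>x. (t, x)))"
    using t by (intro continuous_on_compose continuous_intros continuous_on_subset[OF ms_cont]) auto
  then have "continuous_on UNIV (ms t)" by (simp add: comp_def)
  moreover obtain K where "\<forall>t\<in>{0..1}. \<forall>x. norm (ms t x) \<le> K" using periodic_bounded[OF ms_cont ms_periodic] by blast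
  ultimately show ?thesis using t by (intro bdd_borel_continuous[where B = K]) auto
qed

lemma ms_nonneg: assumes t: "t \<in> {0..1}" shows "0 \<le> ms t x"
proof (rule ccontr)
  assume "\<not> 0 \<le> ms t x"
  then have neg: "ms t x < 0" by simp
  have "continuous_on UNIV ((\<lambda>(t, x). ms t x) \<circ> (\<lambda>x. (t, x)))"
    using t by (intro continuous_on_compose continuous_intros continuous_on_subset[OF ms_cont]) auto
  then have "continuous_on UNIV (ms t)" by (simp add: comp_def)
  then have "open (ms t -` {..<0})" by (intro open_vimage) auto
  moreover have "x \<in> ms t -` {..<0}" using neg by simp
  ultimately obtain e where e: "e > 0" "ball x e \<subseteq> ms t -` {..<0}" unfolding open_contains_ball by blast
  have ae: "AE y in lborel. ms t y \<ge> 0" using ms_density[OF t] unfolding densities_def by blast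
  have "AE y in lborel. y \<notin> ball x e" using ae by eventually_elim (use e in force)
  then have "ball x e \<in> null_sets lborel" by (subst AE_iff_null_sets) auto
  then have "negligible (ball x e)" by (simp add: negligible_iff_null_sets null_sets_completionI)
  then show False using open_not_negligible[of "ball x e"] e by simp
qed

lemma I_h_initial: "I_h N (m0c D) x = I_h N (ms 0) x"
  unfolding I_h_def
proof (rule set_lebesgue_integral_cong_AE)
  have m0: "m0c D \<in> densities" using torus unfolding data_on_torus_def by blast
  show "m0c D \<in> borel_measurable lborel" using m0 unfolding densities_def by simp
  show "ms 0 \<in> borel_measurable lborel" using ms_bdd_borel[of 0] unfolding bdd_borel_def by simp
  have "AE x in lborel. ms 0 x = m0c D x" by (rule solution_parts(3))
  then show "AE x\<in>box_h N x in lborel. m0c D x = ms 0 x" by eventually_elim simp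
qed simp

lemma I_h_prob: assumes t: "t \<in> {0..1}" and N: "N > 0" shows "prob N (I_h N (ms t))"
  unfolding prob_def
proof (intro conjI ballI)
  fix x :: "real ^ 'd"
  have "(LINT y:box_h N x|lborel. (0::real)) \<le> (LINT y:box_h N x|lborel. ms t y)"
    using ms_nonneg[OF t] by (intro set_integral_mono bdd_set_integrable ms_bdd_borel t bdd_borel_const box_h_bounded) auto
  then show "0 \<le> I_h N (ms t) x" by (simp add: I_h_def)
next
  have "(\<Sum>x\<in>grid N. I_h N (ms t) x) = (LINT x:cube|lborel. ms t x)"
    unfolding I_h_def by (rule integral_cube_boxes[OF N ms_bdd_borel[OF t] ms_periodic[OF t], symmetric])
  then show "(\<Sum>x\<in>grid N. I_h N (ms t) x) = 1" using ms_density[OF t] unfolding densities_def by simp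
qed

lemma I_h_bound: "\<exists>K>0. \<forall>t\<in>{0..1}. \<forall>N>0. \<forall>x. I_h N (ms t) x \<le> K * (1 / real N) ^ CARD('d)"
proof -
  obtain K where K: "\<forall>t\<in>{0..1}. \<forall>x. norm (ms t x) \<le> K" using periodic_bounded[OF ms_cont ms_periodic] by blast
  have "I_h N (ms t) x \<le> (\<bar>K\<bar> + 1) * (1 / real N) ^ CARD('d)" if "t \<in> {0..1}" "N > 0" for t N x
  proof -
    have "\<bar>ms t y\<bar> \<le> \<bar>K\<bar> + 1" for y using K that(1) by (smt (verit) real_norm_def)
    then have "\<bar>I_h N (ms t) x\<bar> \<le> (\<bar>K\<bar> + 1) * (1 / real N) ^ CARD('d)"
      unfolding I_h_def by (intro integral_box_bound that ms_bdd_borel)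
    then show ?thesis by simp
  qed
  then show ?thesis by (intro exI[of _ "\<bar>K\<bar> + 1"]) auto
qed

end

locale mfg_grid = mfg D \<theta> r us ms vs
  for D :: "'d::finite mfg_data" and \<theta> r us ms vs +
  fixes T N :: nat
  assumes cfl: "cfl T N"
begin

lemma TN: "T > 0" "N > 0" using cfl unfolding cfl_def by auto

sublocale th: theta_scheme N T "sigma D" \<theta> "TYPE('d)"
  using cfl sigma_pos th_half th_one unfolding cfl_def by unfold_locales auto

abbreviation "B \<equiv> th.Bop"
abbreviation "E \<equiv> th.Eop"
abbreviation "dt \<equiv> 1 / real T"
abbreviation "hjb \<equiv> HJB D \<theta> T N"
abbreviation "feedback \<equiv> V_op D \<theta> T N"
abbreviation "fpk \<equiv> FP D \<theta> T N"

lemma half_step_B: "half_step D \<theta> T N = B"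
  by (simp add: half_step_resolv th.\<tau>_def)

lemma implicit_iff:
  "(\<forall>x\<in>grid N. m x - th.\<tau> * lap_h N m x = f x) \<longleftrightarrow> (\<forall>x\<in>grid N. m x = B f x)"
proof
  assume "\<forall>x\<in>grid N. m x - th.\<tau> * lap_h N m x = f x"
  then show "\<forall>x\<in>grid N. m x = B f x" using resolv_unique[OF th.\<tau>, of N m f] by simp
next
  assume a: "\<forall>x\<in>grid N. m x = B f x"
  show "\<forall>x\<in>grid N. m x - th.\<tau> * lap_h N m x = f x"
  proof
    fix x :: "real ^ 'd" assume x: "x \<in> grid N"
    have "lap_h N m x = lap_h N (B f) x" by (rule lap_h_cong[OF x]) (use a in simp)
    then show "m x - th.\<tau> * lap_h N m x = f x" using resolv_eq[OF th.\<tau> x, of f] a x by simp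
  qed
qed

lemma B_symmetric: "(\<Sum>x\<in>grid N. f x * B g x) = (\<Sum>x\<in>grid N. B f x * g x)"
proof -
  have "(\<Sum>x\<in>grid N. f x * B g x) = (\<Sum>x\<in>grid N. (B f x - th.\<tau> * lap_h N (B f) x) * B g x)"
    by (rule sum.cong) (simp_all only: resolv_eq[OF th.\<tau>])
  also have "\<dots> = (\<Sum>x\<in>grid N. B f x * B g x) - th.\<tau> * (\<Sum>x\<in>grid N. lap_h N (B f) x * B g x)"
    by (simp add: sum_subtractf sum_distrib_left algebra_simps)
  also have "(\<Sum>x\<in>grid N. lap_h N (B f) x * B g x) = (\<Sum>x\<in>grid N. B f x * lap_h N (B g) x)"
    by (rule sum_lap_symmetric[symmetric])
  also have "(\<Sum>x\<in>grid N. B f x * B g x) - th.\<tau> * (\<Sum>x\<in>grid N. B f x * lap_h N (B g) x) =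
     (\<Sum>x\<in>grid N. B f x * (B g x - th.\<tau> * lap_h N (B g) x))"
    by (simp add: sum_subtractf sum_distrib_left algebra_simps)
  also have "\<dots> = (\<Sum>x\<in>grid N. B f x * g x)"
    by (rule sum.cong) (simp_all only: resolv_eq[OF th.\<tau>])
  finally show ?thesis .
qed

lemma E_symmetric: "(\<Sum>x\<in>grid N. f x * E g x) = (\<Sum>x\<in>grid N. E f x * g x)"
proof -
  have "(\<Sum>x\<in>grid N. f x * E g x) = (\<Sum>x\<in>grid N. f x * g x) + th.\<kappa> * (\<Sum>x\<in>grid N. f x * lap_h N g x)"
    by (simp add: expl_def distrib_left sum.distrib sum_distrib_left mult_ac)
  also have "\<dots> = (\<Sum>x\<in>grid N. f x * g x) + th.\<kappa> * (\<Sum>x\<in>grid N. lap_h N f x * g x)"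
    by (simp only: sum_lap_symmetric[of f N g])
  also have "\<dots> = (\<Sum>x\<in>grid N. E f x * g x)"
    by (simp add: expl_def sum.distrib sum_distrib_left algebra_simps)
  finally show ?thesis .
qed

lemma sum_B: "(\<Sum>x\<in>grid N. B f x) = (\<Sum>x\<in>grid N. f x)"
  using B_symmetric[of "\<lambda>_. 1" f] by (simp add: markov_one[OF th.markov_B])

lemma sum_E: "(\<Sum>x\<in>grid N. E f x) = (\<Sum>x\<in>grid N. f x)"
  by (simp add: expl_def sum.distrib sum_distrib_left[symmetric] sum_lap)

text \<open>
  One backward step of the scheme with running cost \<open>F\<close>, solved for the value at the earlier
  time.
\<close>

definition hjb_eq :: "(nat \<Rightarrow> real ^ 'd \<Rightarrow> real) \<Rightarrow> (nat \<Rightarrow> real ^ 'd \<Rightarrow> real) \<Rightarrow> bool" where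
  "hjb_eq u F \<longleftrightarrow> (\<forall>x\<in>grid N. u T x = gc D x) \<and> (\<forall>t<T. \<forall>x\<in>grid N.
     u t x = E (B (u (Suc t))) x + dt * (F t x - Ham D T t x (grad_h N (B (u (Suc t))) x)))"

text \<open>
  One step of the discrete Fokker-Planck equation, solved for the density at the later time. The
  flux \<open>w\<close> is kept as a variable since the equation is linear in \<open>(m, w)\<close>.
\<close>

definition flow :: "(nat \<Rightarrow> real ^ 'd \<Rightarrow> real) \<Rightarrow> (nat \<Rightarrow> real ^ 'd \<Rightarrow> real ^ 'd) \<Rightarrow> bool" where
  "flow m w \<longleftrightarrow> (\<forall>x\<in>grid N. m 0 x = I_h N (m0c D) x) \<and> (\<forall>t<T. \<forall>x\<in>grid N.
     m (Suc t) x = B (\<lambda>x. E (m t) x - dt * div_h N (w t) x) x)"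

lemma HJB_spec: "hjb_eq (hjb m) (\<lambda>t x. f_disc D T N t x (m t))"
proof -
  define F where "F t x = f_disc D T N t x (m t)" for t x
  define P where "P u \<longleftrightarrow> u \<in> time_grid_funs {..T} N \<and>
     (\<forall>x\<in>grid N. u T x = gc D x) \<and>
     (\<forall>t<T. \<forall>x\<in>grid N. let w = half_step D \<theta> T N (u (t + 1)) in
        - (w x - u t x) / (1 / real T) - (1 - \<theta>) * sigma D * lap_h N w x
          + Ham D T t x (grad_h N w x) = f_disc D T N t x (m t))" for u
  have P: "P u \<longleftrightarrow> u \<in> time_grid_funs {..T} N \<and> hjb_eq u F" for u
  proof -
    have "(- (w - v) / (1 / real T) - (1 - \<theta>) * sigma D * l + H = f) \<longleftrightarrow> v = w + (1 - \<theta>) * sigma D * (1 / real T) * l + dt * (f - H)"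
      for w v l H f :: real
    proof -
      have "(- (w - v) / (1 / real T) - (1 - \<theta>) * sigma D * l + H) - f =
          real T * (v - (w + (1 - \<theta>) * sigma D * (1 / real T) * l + dt * (f - H)))"
        using TN(1) by (simp add: field_simps)
      then show ?thesis using TN(1) by (metis eq_iff_diff_eq_0 mult_eq_0_iff of_nat_0_less_iff less_irrefl)
    qed
    then show ?thesis
      unfolding P_def hjb_eq_def Let_def half_step_B expl_def th.\<kappa>_def F_def Suc_eq_plus1 by simp
  qed
  define step where "step t v x = (if x \<in> grid N then E (B v) x + dt * (F t x - Ham D T t x (grad_h N (B v) x)) else 0)" for t v x
  define U where "U = rec_nat (\<lambda>x. if x \<in> grid N then gc D x else 0) (\<lambda>n v. step (T - Suc n) v)"
  define u where "u t = (if t \<le> T then U (T - t) else (\<lambda>_. 0))" for t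
  have U0: "U 0 = (\<lambda>x. if x \<in> grid N then gc D x else 0)" and US: "U (Suc n) = step (T - Suc n) (U n)" for n
    by (simp_all add: U_def)
  have "P u"
    unfolding P
  proof
    have "U n x = 0" if "x \<notin> grid N" for n x using that by (cases n) (auto simp: U0 US step_def)
    then show "u \<in> time_grid_funs {..T} N" by (auto simp: time_grid_funs_def u_def)
    show "hjb_eq u F"
      unfolding hjb_eq_def
    proof (intro conjI ballI allI impI)
      fix t and x :: "real ^ 'd" assume t: "t < T" and x: "x \<in> grid N"
      have "u t = step t (u (Suc t))"
        using t US[of "T - Suc t"] by (simp add: u_def Suc_diff_Suc)
      then show "u t x = E (B (u (Suc t))) x + dt * (F t x - Ham D T t x (grad_h N (B (u (Suc t))) x))"
        using x by (simp add: step_def)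
    qed (simp add: u_def U0)
  qed
  moreover have "u' = u" if u': "P u'" for u'
  proof -
    have *: "u' (T - n) = u (T - n)" if "n \<le> T" for n
      using that
    proof (induction n)
      case 0
      show ?case
      proof
        fix x show "u' (T - 0) x = u (T - 0) x"
          using u' \<open>P u\<close> unfolding P hjb_eq_def time_grid_funs_def by (cases "x \<in> grid N") simp_all
      qed
    next
      case (Suc n)
      have s: "Suc (T - Suc n) = T - n" using Suc by simp
      show ?case
      proof
        fix x show "u' (T - Suc n) x = u (T - Suc n) x"
        proof (cases "x \<in> grid N")
          case True
          then show ?thesis using u' \<open>P u\<close> Suc s unfolding P hjb_eq_def by simp
        next
          case False
          then show ?thesis using u' \<open>P u\<close> unfolding P time_grid_funs_def by simp
        qed
      qed
    qed
    show ?thesis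
    proof
      fix t show "u' t = u t"
      proof (cases "t \<le> T")
        case True then show ?thesis using *[of "T - t"] by simp
      next
        case False
        then have "u' t x = 0" "u t x = 0" for x using u' \<open>P u\<close> unfolding P time_grid_funs_def by simp_all
        then show ?thesis by (simp add: fun_eq_iff)
      qed
    qed
  qed
  ultimately have "\<exists>!u. P u" by blast
  from theI'[OF this] have "P (hjb m)" unfolding HJB_def P_def .
  then show ?thesis unfolding P F_def by blast
qed

lemma V_op_eq: "feedback u t x = (if t < T \<and> x \<in> grid N then Vopt (tm T t) x (grad_h N (B (u (Suc t))) x) else 0)"
  by (auto simp: V_op_def half_step_B gradient_Ham[OF TN(1)])

lemma V_op_bound: "norm (feedback u t x) \<le> M"
  using Vopt_bound[OF TN(1), of t x] M_pos by (auto simp: V_op_eq)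

lemma FP_spec: "fpk v \<in> time_grid_funs {..T} N" "flow (fpk v) (\<lambda>t x. fpk v t x *\<^sub>R v t x)"
proof -
  define P where "P m \<longleftrightarrow> m \<in> time_grid_funs {..T} N \<and>
     (\<forall>x\<in>grid N. m 0 x = I_h N (m0c D) x) \<and>
     (\<forall>t<T. \<forall>x\<in>grid N.
        (m (t + 1) x - m t x) / (1 / real T) - \<theta> * sigma D * lap_h N (m (t + 1)) x
          - (1 - \<theta>) * sigma D * lap_h N (m t) x + div_h N (\<lambda>y. m t y *\<^sub>R v t y) x = 0)" for m
  have P: "P m \<longleftrightarrow> m \<in> time_grid_funs {..T} N \<and> flow m (\<lambda>t x. m t x *\<^sub>R v t x)" for m
  proof -
    have "((a - b) / (1 / real T) - \<theta> * sigma D * l - (1 - \<theta>) * sigma D * l' + d = 0) \<longleftrightarrow>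
       a - th.\<tau> * l = (b + th.\<kappa> * l') - dt * d"
      for a b l l' d :: real
    proof -
      have "(a - b) / (1 / real T) - \<theta> * sigma D * l - (1 - \<theta>) * sigma D * l' + d =
          real T * ((a - th.\<tau> * l) - ((b + th.\<kappa> * l') - dt * d))"
        using TN(1) unfolding th.\<tau>_def th.\<kappa>_def by (simp add: algebra_simps)
      then show ?thesis using TN(1) by simp
    qed
    then show ?thesis
      unfolding P_def flow_def implicit_iff[symmetric] Suc_eq_plus1 expl_def by simp
  qed
  define step where "step t m x = (if x \<in> grid N then B (\<lambda>x. E m x - dt * div_h N (\<lambda>x. m x *\<^sub>R v t x) x) x else 0)" for t m x
  define U where "U = rec_nat (\<lambda>x. if x \<in> grid N then I_h N (m0c D) x else 0) (\<lambda>n m. step n m)"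
  define m where "m t = (if t \<le> T then U t else (\<lambda>_. 0))" for t
  have U0: "U 0 = (\<lambda>x. if x \<in> grid N then I_h N (m0c D) x else 0)" and US: "U (Suc n) = step n (U n)" for n
    by (simp_all add: U_def)
  have "P m"
    unfolding P
  proof
    have "U n x = 0" if "x \<notin> grid N" for n x using that by (cases n) (auto simp: U0 US step_def)
    then show "m \<in> time_grid_funs {..T} N" by (auto simp: time_grid_funs_def m_def)
    show "flow m (\<lambda>t x. m t x *\<^sub>R v t x)"
      unfolding flow_def
    proof (intro conjI ballI allI impI)
      fix t and x :: "real ^ 'd" assume t: "t < T" and x: "x \<in> grid N"
      then have "m (Suc t) x = step t (U t) x" by (simp add: m_def US)
      also have "\<dots> = B (\<lambda>x. E (m t) x - dt * div_h N (\<lambda>x. m t x *\<^sub>R v t x) x) x"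
        using t x unfolding step_def m_def by simp
      finally show "m (Suc t) x = \<dots>" .
    qed (simp add: m_def U0)
  qed
  moreover have "m' = m" if m': "P m'" for m'
  proof -
    have *: "m' n = m n" if "n \<le> T" for n
      using that
    proof (induction n)
      case 0
      show ?case
      proof
        fix x show "m' 0 x = m 0 x"
          using m' \<open>P m\<close> unfolding P flow_def time_grid_funs_def by (cases "x \<in> grid N") simp_all
      qed
    next
      case (Suc n)
      show ?case
      proof
        fix x show "m' (Suc n) x = m (Suc n) x"
        proof (cases "x \<in> grid N")
          case True
          then show ?thesis using m' \<open>P m\<close> Suc unfolding P flow_def by simp
        next
          case False
          then show ?thesis using m' \<open>P m\<close> unfolding P time_grid_funs_def by simp
        qed
      qed
    qed
    show ?thesis
    proof
      fix t show "m' t = m t"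
      proof (cases "t \<le> T")
        case True then show ?thesis using * by simp
      next
        case False
        then have "m' t x = 0" "m t x = 0" for x using m' \<open>P m\<close> unfolding P time_grid_funs_def by simp_all
        then show ?thesis by (simp add: fun_eq_iff)
      qed
    qed
  qed
  ultimately have "\<exists>!m. P m" by blast
  from theI'[OF this] have "P (fpk v)" unfolding FP_def P_def .
  then show "fpk v \<in> time_grid_funs {..T} N" "flow (fpk v) (\<lambda>t x. fpk v t x *\<^sub>R v t x)"
    unfolding P by blast+
qed

text \<open>
  Under the bound on \<open>h\<close> the explicit part of the Fokker-Planck step has nonnegative coefficients.
\<close>

lemma explicit_flow_nonneg:
  assumes m: "\<And>x. x \<in> grid N \<Longrightarrow> 0 \<le> m x" and v: "\<And>x. norm (v x) \<le> M" and x: "x \<in> grid N"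
  shows "0 \<le> E m x - dt * div_h N (\<lambda>x. m x *\<^sub>R v x) x"
proof -
  define a where "a = (1 - \<theta>) * sigma D"
  have h: "M \<le> 2 * a * real N"
    using cfl M_pos TN unfolding cfl_def a_def by (simp add: field_simps)
  define c where "c = dt * real N"
  have c0: "c \<ge> 0" by (simp add: c_def)
  have v1: "\<bar>v y $ i\<bar> \<le> 2 * a * real N" for y i using component_le_norm_cart[of "v y" i] v[of y] h by linarith
  have e1: "E m x = (1 - 2 * real CARD('d) * th.\<kappa> * (real N)\<^sup>2) * m x
     + c * (\<Sum>i\<in>UNIV. a * real N * (m (up N i x) + m (down N i x)))"
    by (simp add: expl_def lap_h_alt th.\<kappa>_def a_def c_def sum_subtractf sum.distrib sum_distrib_left[symmetric]
        power2_eq_square algebra_simps)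
  have e2: "dt * div_h N (\<lambda>x. m x *\<^sub>R v x) x = c * (\<Sum>i\<in>UNIV. (m (up N i x) * v (up N i x) $ i - m (down N i x) * v (down N i x) $ i) / 2)"
    by (simp add: div_h_alt c_def sum_divide_distrib[symmetric])
  have e: "E m x - dt * div_h N (\<lambda>x. m x *\<^sub>R v x) x = (1 - 2 * real CARD('d) * th.\<kappa> * (real N)\<^sup>2) * m x
     + c * (\<Sum>i\<in>UNIV. m (up N i x) * (a * real N - v (up N i x) $ i / 2) + m (down N i x) * (a * real N + v (down N i x) $ i / 2))"
    unfolding e1 e2 add_diff_eq[symmetric] right_diff_distrib[symmetric] sum_subtractf[symmetric]
    by (simp add: algebra_simps diff_divide_distrib)
  have p: "0 \<le> a * real N - v y $ i / 2" "0 \<le> a * real N + v y $ i / 2" for y i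
    using v1[of y i] by linarith+
  show ?thesis unfolding e using th.cfl' m x c0
    by (intro add_nonneg_nonneg mult_nonneg_nonneg sum_nonneg p) auto
qed

lemma FP_prob:
  assumes v: "\<And>t x. norm (v t x) \<le> M"
  shows "fpk v \<in> prob_flows T N"
proof -
  let ?m = "fpk v"
  note f = FP_spec(2)[of v]
  have "prob N (?m t)" if "t \<le> T" for t
    using that
  proof (induction t)
    case 0
    have "?m 0 x = I_h N (ms 0) x" if "x \<in> grid N" for x using f that unfolding flow_def by (simp add: I_h_initial)
    then show ?case using I_h_prob[of 0 N] TN by (simp add: prob_def)
  next
    case (Suc t)
    let ?g = "\<lambda>x. E (?m t) x - dt * div_h N (\<lambda>x. ?m t x *\<^sub>R v t x) x"
    have s: "?m (Suc t) x = B ?g x" if "x \<in> grid N" for x using f that Suc unfolding flow_def by simp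
    have m: "prob N (?m t)" using Suc by simp
    have "0 \<le> ?m (Suc t) x" if x: "x \<in> grid N" for x
      unfolding s[OF x] by (intro markov_nonneg[OF th.markov_B x] explicit_flow_nonneg v) (use m in \<open>auto simp: prob_def\<close>)
    moreover have "(\<Sum>x\<in>grid N. ?m (Suc t) x) = (\<Sum>x\<in>grid N. ?g x)"
      unfolding sum_B[of ?g, symmetric] by (rule sum.cong) (simp_all add: s)
    moreover have "(\<Sum>x\<in>grid N. ?g x) = 1"
      using m unfolding prob_def sum_subtractf sum_distrib_left[symmetric] sum_E sum_div by simp
    ultimately show ?case by (simp add: prob_def)
  qed
  then show ?thesis using FP_spec(1)[of v] unfolding prob_flows_def prob_def by auto
qed

section \<open>Duality between the two equations\<close>

text \<open>
  Summation by parts in time and space: \<open>B\<close> and \<open>E\<close> are symmetric, and \<open>- div_h\<close> is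
  adjoint to \<open>grad_h\<close>. The equation for \<open>m\<close> may have a source \<open>\<rho>\<close>.
\<close>

lemma duality:
  assumes u: "hjb_eq u F"
    and m: "\<And>t x. t < T \<Longrightarrow> x \<in> grid N \<Longrightarrow>
      m (Suc t) x = B (\<lambda>x. E (m t) x - dt * div_h N (w t) x + dt * \<rho> t x) x"
  shows "(\<Sum>x\<in>grid N. gc D x * m T x) - (\<Sum>x\<in>grid N. u 0 x * m 0 x) =
    dt * (\<Sum>t<T. \<Sum>x\<in>grid N. (Ham D T t x (grad_h N (B (u (Suc t))) x) - F t x) * m t x
       + grad_h N (B (u (Suc t))) x \<bullet> w t x + B (u (Suc t)) x * \<rho> t x)"
proof -
  have step: "(\<Sum>x\<in>grid N. u (Suc t) x * m (Suc t) x) - (\<Sum>x\<in>grid N. u t x * m t x) =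
     dt * (\<Sum>x\<in>grid N. (Ham D T t x (grad_h N (B (u (Suc t))) x) - F t x) * m t x
       + grad_h N (B (u (Suc t))) x \<bullet> w t x + B (u (Suc t)) x * \<rho> t x)" if t: "t < T" for t
  proof -
    define z where "z = B (u (Suc t))"
    have "(\<Sum>x\<in>grid N. u (Suc t) x * m (Suc t) x) =
       (\<Sum>x\<in>grid N. u (Suc t) x * B (\<lambda>x. E (m t) x - dt * div_h N (w t) x + dt * \<rho> t x) x)"
      by (rule sum.cong) (simp_all add: m[OF t])
    also have "\<dots> = (\<Sum>x\<in>grid N. z x * (E (m t) x - dt * div_h N (w t) x + dt * \<rho> t x))"
      unfolding z_def by (rule B_symmetric)
    also have "\<dots> = (\<Sum>x\<in>grid N. z x * E (m t) x) - dt * (\<Sum>x\<in>grid N. z x * div_h N (w t) x) + dt * (\<Sum>x\<in>grid N. z x * \<rho> t x)"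
      by (simp only: sum_distrib_left sum_subtractf[symmetric] sum.distrib[symmetric]) (simp add: algebra_simps)
    also have "\<dots> = (\<Sum>x\<in>grid N. E z x * m t x) + dt * (\<Sum>x\<in>grid N. grad_h N z x \<bullet> w t x) + dt * (\<Sum>x\<in>grid N. z x * \<rho> t x)"
      unfolding sum_mult_div E_symmetric by simp
    finally have 1: "(\<Sum>x\<in>grid N. u (Suc t) x * m (Suc t) x) = \<dots>" .
    have "(\<Sum>x\<in>grid N. u t x * m t x) = (\<Sum>x\<in>grid N. (E z x + dt * (F t x - Ham D T t x (grad_h N z x))) * m t x)"
      by (rule sum.cong) (use u t in \<open>simp_all add: hjb_eq_def z_def\<close>)
    then show ?thesis unfolding 1 z_def[symmetric]
      by (simp only: sum_distrib_left sum_subtractf[symmetric] sum.distrib[symmetric])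
        (simp add: sum_subtractf[symmetric] sum.distrib[symmetric] algebra_simps)
  qed
  have "(\<Sum>t<T. (\<Sum>x\<in>grid N. u (Suc t) x * m (Suc t) x) - (\<Sum>x\<in>grid N. u t x * m t x)) =
     (\<Sum>x\<in>grid N. u T x * m T x) - (\<Sum>x\<in>grid N. u 0 x * m 0 x)"
    by (rule sum_lessThan_telescope)
  also have "(\<Sum>x\<in>grid N. u T x * m T x) = (\<Sum>x\<in>grid N. gc D x * m T x)"
    by (rule sum.cong) (use u in \<open>simp_all add: hjb_eq_def\<close>)
  finally show ?thesis using step by (simp add: sum_distrib_left)
qed

text \<open>
  Cost of the control problem that is linear in the density and whose value function solves \<open>hjb_eq\<close>.
\<close>

definition lincost :: "(nat \<Rightarrow> real ^ 'd \<Rightarrow> real) \<Rightarrow> (nat \<Rightarrow> real ^ 'd \<Rightarrow> real) \<Rightarrow> (nat \<Rightarrow> real ^ 'd \<Rightarrow> real ^ 'd) \<Rightarrow> real" where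
  "lincost F m v = dt * (\<Sum>t<T. \<Sum>x\<in>grid N. m t x * ellc D (tm T t) x (v t x) + F t x * m t x)
     + (\<Sum>x\<in>grid N. gc D x * m T x)"

lemma lincost_eq:
  assumes u: "hjb_eq u F" and m: "flow m w" and w: "\<And>t x. t < T \<Longrightarrow> x \<in> grid N \<Longrightarrow> w t x = m t x *\<^sub>R v t x"
  shows "lincost F m v = (\<Sum>x\<in>grid N. u 0 x * I_h N (m0c D) x) + dt * (\<Sum>t<T. \<Sum>x\<in>grid N.
     m t x * (Ham D T t x (grad_h N (B (u (Suc t))) x) + grad_h N (B (u (Suc t))) x \<bullet> v t x + ellc D (tm T t) x (v t x)))"
proof -
  let ?p = "\<lambda>t x. grad_h N (B (u (Suc t))) x"
  have m': "m (Suc t) x = B (\<lambda>x. E (m t) x - dt * div_h N (w t) x + dt * 0) x" if "t < T" "x \<in> grid N" for t x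
    using m that unfolding flow_def by simp
  have "(\<Sum>x\<in>grid N. gc D x * m T x) = (\<Sum>x\<in>grid N. u 0 x * m 0 x) +
    dt * (\<Sum>t<T. \<Sum>x\<in>grid N. (Ham D T t x (?p t x) - F t x) * m t x + ?p t x \<bullet> w t x + B (u (Suc t)) x * 0)"
    using duality[where m = m and w = w and \<rho> = "\<lambda>_ _. 0", OF u m'] by simp
  also have "(\<Sum>x\<in>grid N. u 0 x * m 0 x) = (\<Sum>x\<in>grid N. u 0 x * I_h N (m0c D) x)"
    by (rule sum.cong) (use m in \<open>simp_all add: flow_def\<close>)
  also have "(\<Sum>t<T. \<Sum>x\<in>grid N. (Ham D T t x (?p t x) - F t x) * m t x + ?p t x \<bullet> w t x + B (u (Suc t)) x * 0) =
     (\<Sum>t<T. \<Sum>x\<in>grid N. m t x * (Ham D T t x (?p t x) + ?p t x \<bullet> v t x + ellc D (tm T t) x (v t x)))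
     - (\<Sum>t<T. \<Sum>x\<in>grid N. m t x * ellc D (tm T t) x (v t x) + F t x * m t x)"
    unfolding sum_subtractf[symmetric] by (intro sum.cong refl) (simp add: w algebra_simps)
  finally show ?thesis unfolding lincost_def by (simp only: right_diff_distrib)
qed

text \<open>
  The feedback of the discrete HJB equation is optimal for the linearized problem, with quadratic
  growth of the cost.
\<close>

lemma lincost_gap:
  assumes u: "hjb_eq u F" and m: "flow m w" "\<And>t x. t < T \<Longrightarrow> x \<in> grid N \<Longrightarrow> w t x = m t x *\<^sub>R v t x"
    and pos: "\<And>t x. t < T \<Longrightarrow> x \<in> grid N \<Longrightarrow> 0 \<le> m t x" and v: "\<And>t x. norm (v t x) \<le> M"
    and m': "flow m' w'" "\<And>t x. t < T \<Longrightarrow> x \<in> grid N \<Longrightarrow> w' t x = m' t x *\<^sub>R feedback u t x"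
  shows "\<alpha> / 2 * (dt * (\<Sum>t<T. \<Sum>x\<in>grid N. m t x * (norm (v t x - feedback u t x))\<^sup>2))
     \<le> lincost F m v - lincost F m' (feedback u)"
proof -
  let ?p = "\<lambda>t x. grad_h N (B (u (Suc t))) x" and ?V = "feedback u"
  have 1: "lincost F m' ?V = (\<Sum>x\<in>grid N. u 0 x * I_h N (m0c D) x)"
  proof -
    have "Ham D T t x (?p t x) + ?p t x \<bullet> ?V t x + ellc D (tm T t) x (?V t x) = 0" if "t < T" "x \<in> grid N" for t x
      using that Ham_eq[OF TN(1), of t x "?p t x"] by (simp add: V_op_eq)
    then have Z: "(\<Sum>t<T. \<Sum>x\<in>grid N. m' t x * (Ham D T t x (?p t x) + ?p t x \<bullet> ?V t x + ellc D (tm T t) x (?V t x))) = 0"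
      by (intro sum.neutral ballI) (simp del: times_divide_eq_right)
    have "lincost F m' ?V = (\<Sum>x\<in>grid N. u 0 x * I_h N (m0c D) x) + dt * (\<Sum>t<T. \<Sum>x\<in>grid N.
        m' t x * (Ham D T t x (?p t x) + ?p t x \<bullet> ?V t x + ellc D (tm T t) x (?V t x)))"
      by (rule lincost_eq[OF u m'(1)]) (rule m'(2))
    then show ?thesis unfolding Z by simp
  qed
  have "\<alpha> / 2 * (dt * (\<Sum>t<T. \<Sum>x\<in>grid N. m t x * (norm (v t x - ?V t x))\<^sup>2)) =
     dt * (\<Sum>t<T. \<Sum>x\<in>grid N. m t x * (\<alpha> / 2 * (norm (v t x - ?V t x))\<^sup>2))"
    by (simp add: sum_distrib_left mult_ac)
  also have "\<dots> \<le> dt * (\<Sum>t<T. \<Sum>x\<in>grid N. m t x * (Ham D T t x (?p t x) + ?p t x \<bullet> v t x + ellc D (tm T t) x (v t x)))"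
  proof (intro mult_left_mono sum_mono)
    fix t and x :: "real ^ 'd" assume t: "t \<in> {..<T}" and x: "x \<in> grid N"
    then show "\<alpha> / 2 * (norm (v t x - ?V t x))\<^sup>2 \<le> Ham D T t x (?p t x) + ?p t x \<bullet> v t x + ellc D (tm T t) x (v t x)"
      using Ham_ineq[OF TN(1), of t "v t x" x "?p t x"] v[of t x] by (simp add: V_op_eq)
    show "0 \<le> m t x" using pos t x by simp
  qed simp
  also have "\<dots> = lincost F m v - lincost F m' ?V"
    unfolding 1 by (subst lincost_eq[OF u m(1), where v = v]) (simp_all add: m(2))
  finally show ?thesis .
qed

end

section \<open>Norms of grid functions\<close>

lemma norm_p_2: "norm_p N 2 (\<nu> :: real ^ 'd::finite \<Rightarrow> real) = sqrt (\<Sum>x\<in>grid N. (\<nu> x)\<^sup>2)"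
proof -
  have "(2::ereal) \<noteq> \<infinity>" by simp
  moreover have "\<bar>y\<bar> powr 2 = y\<^sup>2" for y :: real by (cases "y = 0") (auto simp: powr_numeral)
  ultimately show ?thesis unfolding norm_p_def by (simp add: powr_half_sqrt sum_nonneg)
qed

lemma norm_p_1: "norm_p N 1 (\<nu> :: real ^ 'd::finite \<Rightarrow> real) = (\<Sum>x\<in>grid N. \<bar>\<nu> x\<bar>)"
  unfolding norm_p_def by (simp add: sum_nonneg)

lemma norm_p_inf_le:
  "N > 0 \<Longrightarrow> (\<And>x. x \<in> grid N \<Longrightarrow> \<bar>\<nu> x\<bar> \<le> c) \<Longrightarrow> norm_p N \<infinity> (\<nu> :: real ^ 'd::finite \<Rightarrow> real) \<le> c"
  unfolding norm_p_def using grid_nonempty[of N] by (simp, subst Max_le_iff) auto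

lemma norm_inf_p_le: "(\<And>t. t \<le> T \<Longrightarrow> norm_p N p (\<nu> t) \<le> c) \<Longrightarrow> norm_inf_p T N p \<nu> \<le> c"
  unfolding norm_inf_p_def by (subst Max_le_iff) auto

lemma norm_p_le_norm_inf_p: "t \<le> T \<Longrightarrow> norm_p N p (\<nu> t) \<le> norm_inf_p T N p \<nu>"
  unfolding norm_inf_p_def by (intro Max_ge) auto

lemma norm_inf_p_inf_le:
  "N > 0 \<Longrightarrow> (\<And>t x. t \<le> T \<Longrightarrow> x \<in> grid N \<Longrightarrow> \<bar>\<nu> t x\<bar> \<le> c) \<Longrightarrow>
    norm_inf_p T N \<infinity> (\<nu> :: nat \<Rightarrow> real ^ 'd::finite \<Rightarrow> real) \<le> c"
  by (intro norm_inf_p_le norm_p_inf_le) auto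

lemma norm_inf_p_1_le:
  "(\<And>t. t \<le> T \<Longrightarrow> (\<Sum>x\<in>grid N. \<bar>\<nu> t x\<bar>) \<le> c) \<Longrightarrow>
    norm_inf_p T N 1 (\<nu> :: nat \<Rightarrow> real ^ 'd::finite \<Rightarrow> real) \<le> c"
  by (intro norm_inf_p_le) (simp add: norm_p_1)

lemma norm_inf_p_2_bounds:
  fixes \<nu> :: "nat \<Rightarrow> real ^ 'd::finite \<Rightarrow> real"
  shows "t \<le> T \<Longrightarrow> (\<Sum>x\<in>grid N. (\<nu> t x)\<^sup>2) \<le> (norm_inf_p T N 2 \<nu>)\<^sup>2"
    and "(\<And>t. t \<le> T \<Longrightarrow> (\<Sum>x\<in>grid N. (\<nu> t x)\<^sup>2) \<le> c) \<Longrightarrow> (norm_inf_p T N 2 \<nu>)\<^sup>2 \<le> c"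
proof -
  assume "t \<le> T"
  from norm_p_le_norm_inf_p[OF this, of N 2 \<nu>]
  have "sqrt (\<Sum>x\<in>grid N. (\<nu> t x)\<^sup>2) \<le> norm_inf_p T N 2 \<nu>" unfolding norm_p_2 .
  then show "(\<Sum>x\<in>grid N. (\<nu> t x)\<^sup>2) \<le> (norm_inf_p T N 2 \<nu>)\<^sup>2" by (rule sqrt_le_D)
next
  assume c: "\<And>t. t \<le> T \<Longrightarrow> (\<Sum>x\<in>grid N. (\<nu> t x)\<^sup>2) \<le> c"
  have c0: "c \<ge> 0" using c[of 0] sum_nonneg[of "grid N" "\<lambda>x. (\<nu> 0 x)\<^sup>2"] by force
  have "norm_inf_p T N 2 \<nu> \<le> sqrt c" using c by (intro norm_inf_p_le) (simp only: norm_p_2 real_sqrt_le_mono)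
  moreover have "0 \<le> norm_inf_p T N 2 \<nu>"
    using norm_p_le_norm_inf_p[of 0 T N 2 \<nu>] real_sqrt_ge_zero[OF sum_nonneg[of "grid N" "\<lambda>x. (\<nu> 0 x)\<^sup>2"]]
    unfolding norm_p_2 by (meson order_trans zero_le zero_le_power2)
  ultimately have "(norm_inf_p T N 2 \<nu>)\<^sup>2 \<le> (sqrt c)\<^sup>2" by (intro power_mono) auto
  then show "(norm_inf_p T N 2 \<nu>)\<^sup>2 \<le> c" using c0 by simp
qed

section \<open>Convergence of the Frank-Wolfe iteration\<close>

context mfg
begin

abbreviation "c0 \<equiv> heat_const (real CARD('d)) \<sigma> \<theta>"

lemma c0_pos: "c0 > 0" using sigma_pos th_half th_one by (auto simp: heat_const_def intro!: add_nonneg_pos)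

end

context mfg_grid
begin

lemma FP_flow_bound:
  assumes G: "gronwall_const (real CARD('d) * (real CARD('d) * c0 * M)) G"
    and K: "\<forall>t\<in>{0..1}. \<forall>N>0. \<forall>x. I_h N (ms t) x \<le> K * (1 / real N) ^ CARD('d)"
    and v: "\<And>t x. norm (v t x) \<le> M" and t: "t \<le> T" and x: "x \<in> grid N"
  shows "fpk v t x \<le> G * (K * (1 / real N) ^ CARD('d))"
proof -
  let ?m = "fpk v"
  note f = FP_spec(2)[of v]
  have "\<bar>?m t x\<bar> \<le> G * (K * (1 / real N) ^ CARD('d))"
  proof (rule th.flow_bound[OF G[folded th.C0_def], where w = "\<lambda>t x. ?m t x *\<^sub>R v t x"])
    show "?m (Suc n) x = B (\<lambda>x. E (?m n) x - dt * div_h N (\<lambda>x. ?m n x *\<^sub>R v n x) x) x" if "n < T" "x \<in> grid N" for n x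
      using f that unfolding flow_def by blast
    show "\<bar>?m 0 x\<bar> \<le> K * (1 / real N) ^ CARD('d)" if x: "x \<in> grid N" for x
    proof -
      have "?m 0 x = I_h N (ms 0) x" using f x unfolding flow_def by (simp add: I_h_initial)
      then show ?thesis using K TN I_h_prob[of 0 N] x unfolding prob_def by simp
    qed
    show "norm (?m n x *\<^sub>R v n x) \<le> M * \<bar>?m n x\<bar>" for n x
      using mult_left_mono[OF v[of n x], of "\<bar>?m n x\<bar>"] by (simp add: mult.commute)
  qed (use M_pos t x in auto)
  then show ?thesis by simp
qed

end

context mfg
begin

lemma FP_bound:
  "\<exists>K>0. \<forall>T N v. cfl T N \<longrightarrow> (\<forall>t x. norm (v t x) \<le> M) \<longrightarrow>
     (\<forall>t\<le>T. \<forall>x\<in>grid N. FP D \<theta> T N v t x \<le> K * (1 / real N) ^ CARD('d))"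
proof -
  let ?d = "real CARD('d)"
  obtain K where K: "K > 0" "\<forall>t\<in>{0..1}. \<forall>N>0. \<forall>x. I_h N (ms t) x \<le> K * (1 / real N) ^ CARD('d)"
    using I_h_bound by blast
  have "?d * (?d * c0 * M) \<ge> 0" using M_pos c0_pos by simp
  from singular_gronwall[OF this] obtain G where G: "gronwall_const (?d * (?d * c0 * M)) G" ..
  have G0: "G > 0" using G unfolding gronwall_const_def by blast
  show ?thesis
  proof (intro exI[of _ "G * K"] conjI allI impI ballI)
    fix T N :: nat and v :: "nat \<Rightarrow> real ^ 'd \<Rightarrow> real ^ 'd" and t and x :: "real ^ 'd"
    assume cfl: "cfl T N" and v: "\<forall>t x. norm (v t x) \<le> M" and t: "t \<le> T" and x: "x \<in> grid N"
    interpret mfg_grid D \<theta> r us ms vs T N by unfold_locales (rule cfl)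
    show "FP D \<theta> T N v t x \<le> G * K * (1 / real N) ^ CARD('d)"
      using FP_flow_bound[OF G K(2), of v t x] v t x by (simp add: mult.assoc)
  qed (use G0 K in simp)
qed

end

context mfg_grid
begin

text \<open>
  The velocity is 0 where the density vanishes, by division by zero.
\<close>

definition vel :: "(nat \<Rightarrow> real ^ 'd \<Rightarrow> real) \<Rightarrow> (nat \<Rightarrow> real ^ 'd \<Rightarrow> real ^ 'd) \<Rightarrow> nat \<Rightarrow> real ^ 'd \<Rightarrow> real ^ 'd" where
  "vel m w t x = (if t < T \<and> x \<in> grid N then w t x /\<^sub>R m t x else 0)"

text \<open>
  Admissible pairs: they contain the best responses, are closed under convex combinations, and
  have a density with respect to the cell volume that is bounded by \<open>K\<close>.
\<close>

definition adm :: "real \<Rightarrow> (nat \<Rightarrow> real ^ 'd \<Rightarrow> real) \<Rightarrow> (nat \<Rightarrow> real ^ 'd \<Rightarrow> real ^ 'd) \<Rightarrow> bool" where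
  "adm K m w \<longleftrightarrow> m \<in> prob_flows T N \<and> flow m w \<and> (\<forall>t<T. \<forall>x\<in>grid N. norm (w t x) \<le> M * m t x) \<and>
     (\<forall>t\<le>T. \<forall>x\<in>grid N. m t x \<le> K * (1 / real N) ^ CARD('d))"

lemma prob_flowsD: assumes "m \<in> prob_flows T N" "t \<le> T" shows "prob N (m t)"
  using assms unfolding prob_flows_def prob_def by simp

lemma adm_prob: "adm K m w \<Longrightarrow> t \<le> T \<Longrightarrow> prob N (m t)"
  unfolding adm_def using prob_flowsD by blast

lemma adm_nonneg: "adm K m w \<Longrightarrow> t \<le> T \<Longrightarrow> x \<in> grid N \<Longrightarrow> 0 \<le> m t x"
  using adm_prob unfolding prob_def by blast

lemma vel_bound: assumes "adm K m w" shows "norm (vel m w t x) \<le> M"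
proof (cases "t < T \<and> x \<in> grid N \<and> m t x \<noteq> 0")
  case True
  then have p: "m t x > 0" using adm_nonneg[OF assms, of t x] by simp
  have "norm (w t x) \<le> M * m t x" using assms True unfolding adm_def by blast
  then show ?thesis using p True by (simp add: vel_def inverse_eq_divide pos_divide_le_eq)
next
  case False
  then show ?thesis using M_pos by (auto simp: vel_def)
qed

lemma vel_eq: assumes "adm K m w" "t < T" "x \<in> grid N" shows "w t x = m t x *\<^sub>R vel m w t x"
proof (cases "m t x = 0")
  case True
  then show ?thesis using assms unfolding adm_def by force
qed (use assms in \<open>simp add: vel_def\<close>)

lemma flow_convex:
  assumes "flow m w" "flow m' w'"
  shows "flow (\<lambda>t x. (1 - s) * m t x + s * m' t x) (\<lambda>t x. (1 - s) *\<^sub>R w t x + s *\<^sub>R w' t x)"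
  unfolding flow_def
proof (intro conjI ballI allI impI)
  fix x :: "real ^ 'd" assume x: "x \<in> grid N"
  have "m 0 x = I_h N (m0c D) x" "m' 0 x = I_h N (m0c D) x" using assms x unfolding flow_def by blast+
  then show "(1 - s) * m 0 x + s * m' 0 x = I_h N (m0c D) x" by (simp add: algebra_simps)
next
  fix t and x :: "real ^ 'd" assume t: "t < T" and x: "x \<in> grid N"
  let ?g = "\<lambda>m w x. E (m t) x - dt * div_h N (w t) x"
  have "m (Suc t) x = B (?g m w) x" "m' (Suc t) x = B (?g m' w') x" using assms t x unfolding flow_def by blast+
  then have "(1 - s) * m (Suc t) x + s * m' (Suc t) x = B (\<lambda>y. (1 - s) * ?g m w y + s * ?g m' w' y) x"
    by (simp only: markov_lin[OF th.markov_B x])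
  also have "(\<lambda>y. (1 - s) * ?g m w y + s * ?g m' w' y) =
     (\<lambda>x. E (\<lambda>x. (1 - s) * m t x + s * m' t x) x - dt * div_h N (\<lambda>x. (1 - s) *\<^sub>R w t x + s *\<^sub>R w' t x) x)"
    by (rule ext) (simp only: expl_def lap_h_lin div_h_add div_h_scaleR, simp add: algebra_simps diff_divide_distrib)
  finally show "(1 - s) * m (Suc t) x + s * m' (Suc t) x = B \<dots> x" .
qed

lemma adm_convex:
  assumes a: "adm K m w" and a': "adm K m' w'" and s: "0 \<le> s" "s \<le> 1"
  shows "adm K (\<lambda>t x. (1 - s) * m t x + s * m' t x) (\<lambda>t x. (1 - s) *\<^sub>R w t x + s *\<^sub>R w' t x)"
  unfolding adm_def
proof (intro conjI allI impI ballI)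
  have tg: "m \<in> time_grid_funs {..T} N" "m' \<in> time_grid_funs {..T} N"
    using a a' unfolding adm_def prob_flows_def by blast+
  have "prob N (\<lambda>x. (1 - s) * m t x + s * m' t x)" if "t \<le> T" for t
    using prob_convex[OF adm_prob[OF a that] adm_prob[OF a' that] s] by (simp add: algebra_simps)
  then show "(\<lambda>t x. (1 - s) * m t x + s * m' t x) \<in> prob_flows T N"
    using tg unfolding prob_flows_def prob_def time_grid_funs_def by simp
  show "flow (\<lambda>t x. (1 - s) * m t x + s * m' t x) (\<lambda>t x. (1 - s) *\<^sub>R w t x + s *\<^sub>R w' t x)"
    using a a' unfolding adm_def by (intro flow_convex) blast+
next
  fix t and x :: "real ^ 'd" assume t: "t < T" and x: "x \<in> grid N"
  have "norm (w t x) \<le> M * m t x" "norm (w' t x) \<le> M * m' t x" using a a' t x unfolding adm_def by blast+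
  then have "norm ((1 - s) *\<^sub>R w t x) \<le> (1 - s) * (M * m t x)" "norm (s *\<^sub>R w' t x) \<le> s * (M * m' t x)"
    using s by (auto intro: mult_left_mono)
  then show "norm ((1 - s) *\<^sub>R w t x + s *\<^sub>R w' t x) \<le> M * ((1 - s) * m t x + s * m' t x)"
    using norm_triangle_ineq[of "(1 - s) *\<^sub>R w t x" "s *\<^sub>R w' t x"] by (simp add: algebra_simps)
next
  fix t and x :: "real ^ 'd" assume t: "t \<le> T" and x: "x \<in> grid N"
  let ?k = "K * (1 / real N) ^ CARD('d)"
  have "m t x \<le> ?k" "m' t x \<le> ?k" using a a' t x unfolding adm_def by blast+
  then have "(1 - s) * m t x + s * m' t x \<le> (1 - s) * ?k + s * ?k" using s by (intro add_mono mult_left_mono) auto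
  then show "(1 - s) * m t x + s * m' t x \<le> ?k" by (simp add: algebra_simps)
qed

definition bounded_by :: "real \<Rightarrow> bool" where
  "bounded_by K \<longleftrightarrow> (\<forall>v. (\<forall>t x. norm (v t x) \<le> M) \<longrightarrow>
     (\<forall>t\<le>T. \<forall>x\<in>grid N. fpk v t x \<le> K * (1 / real N) ^ CARD('d)))"

lemma BR_adm:
  assumes K: "bounded_by K" and v: "\<And>t x. norm (v t x) \<le> M"
  shows "adm K (fpk v) (\<lambda>t x. fpk v t x *\<^sub>R v t x)"
  unfolding adm_def
proof (intro conjI allI impI ballI)
  fix t and x :: "real ^ 'd" assume t: "t < T" and x: "x \<in> grid N"
  have "0 \<le> fpk v t x" using prob_flowsD[OF FP_prob[OF v], of t] t x unfolding prob_def by simp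
  then show "norm (fpk v t x *\<^sub>R v t x) \<le> M * fpk v t x"
    using mult_left_mono[OF v[of t x], of "fpk v t x"] by (metis abs_of_nonneg mult.commute norm_scaleR)
next
  fix t and x :: "real ^ 'd" assume "t \<le> T" "x \<in> grid N"
  then show "fpk v t x \<le> K * (1 / real N) ^ CARD('d)" using K v unfolding bounded_by_def by blast
qed (use FP_prob[OF v] FP_spec(2) in auto)

text \<open>
  The energy estimate for the difference of two flows, whose fluxes differ by at most \<open>M\<close> times the
  difference of the densities plus \<open>F\<close>.
\<close>

lemma flow_energy:
  assumes ma: "\<And>t x. t < T \<Longrightarrow> x \<in> grid N \<Longrightarrow> ma (Suc t) x = B (\<lambda>x. E (ma t) x - dt * div_h N (wa t) x + dt * ra t x) x"
    and mb: "\<And>t x. t < T \<Longrightarrow> x \<in> grid N \<Longrightarrow> mb (Suc t) x = B (\<lambda>x. E (mb t) x - dt * div_h N (wb t) x + dt * rb t x) x"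
    and init: "\<And>x. x \<in> grid N \<Longrightarrow> ma 0 x = mb 0 x"
    and w: "\<And>t x. t < T \<Longrightarrow> x \<in> grid N \<Longrightarrow> norm (wa t x - wb t x) \<le> M * \<bar>ma t x - mb t x\<bar> + F t x"
    and \<rho>: "\<And>t. t < T \<Longrightarrow> (\<Sum>x\<in>grid N. (ra t x - rb t x)\<^sup>2) \<le> R"
    and t: "t \<le> T"
  shows "(\<Sum>x\<in>grid N. (ma t x - mb t x)\<^sup>2) \<le>
     4 * exp (2 * (M\<^sup>2 / \<sigma>)) * (dt * (\<Sum>t<T. \<Sum>x\<in>grid N. (F t x)\<^sup>2) / \<sigma> + R)"
proof (rule th.energy_estimate[where e = "\<lambda>t x. ma t x - mb t x" and G = "\<lambda>t x. wa t x - wb t x" and R = "\<lambda>t x. ra t x - rb t x"])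
  fix n and x :: "real ^ 'd" assume n: "n < T" and x: "x \<in> grid N"
  have i1: "ma (Suc n) x - th.\<tau> * lap_h N (ma (Suc n)) x = E (ma n) x - dt * div_h N (wa n) x + dt * ra n x"
    using ma n x implicit_iff[of "ma (Suc n)" "\<lambda>x. E (ma n) x - dt * div_h N (wa n) x + dt * ra n x"] by blast
  have i2: "mb (Suc n) x - th.\<tau> * lap_h N (mb (Suc n)) x = E (mb n) x - dt * div_h N (wb n) x + dt * rb n x"
    using mb n x implicit_iff[of "mb (Suc n)" "\<lambda>x. E (mb n) x - dt * div_h N (wb n) x + dt * rb n x"] by blast
  have "lap_h N (\<lambda>x. \<theta> * (ma (Suc n) x - mb (Suc n) x) + (1 - \<theta>) * (ma n x - mb n x)) x =
     \<theta> * (lap_h N (ma (Suc n)) x - lap_h N (mb (Suc n)) x) + (1 - \<theta>) * (lap_h N (ma n) x - lap_h N (mb n) x)"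
    by (simp only: lap_h_lin lap_h_diff)
  note L = this
  show "ma (Suc n) x - mb (Suc n) x - (ma n x - mb n x) =
     dt * (\<sigma> * lap_h N (\<lambda>x. \<theta> * (ma (Suc n) x - mb (Suc n) x) + (1 - \<theta>) * (ma n x - mb n x)) x
        - div_h N (\<lambda>x. wa n x - wb n x) x + (ra n x - rb n x))"
    using i1 i2 unfolding L div_h_diff expl_def th.\<tau>_def th.\<kappa>_def by (simp add: algebra_simps)
qed (use init w \<rho> t M_pos in auto)

abbreviation fd :: "(nat \<Rightarrow> real ^ 'd \<Rightarrow> real) \<Rightarrow> nat \<Rightarrow> real ^ 'd \<Rightarrow> real" where
  "fd m \<equiv> (\<lambda>t x. f_disc D T N t x (m t))"

text \<open>
  The real value of the cost functional on admissible pairs.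
\<close>

definition Jr :: "(nat \<Rightarrow> real ^ 'd \<Rightarrow> real) \<Rightarrow> (nat \<Rightarrow> real ^ 'd \<Rightarrow> real ^ 'd) \<Rightarrow> real" where
  "Jr m w = dt * (\<Sum>t<T. \<Sum>x\<in>grid N. m t x * ellc D (tm T t) x (vel m w t x))
     + dt * (\<Sum>t<T. F_disc D T N t (m t)) + (\<Sum>x\<in>grid N. gc D x * m T x)"

lemma ell_tilde_eq:
  assumes a: "adm K m w" and t: "t < T" and x: "x \<in> grid N"
  shows "ell_tilde D T m w t x = ereal (m t x * ellc D (tm T t) x (vel m w t x))"
proof (cases "m t x = 0")
  case True
  then have "w t x = 0" using vel_eq[OF a t x] by simp
  then show ?thesis using True by (simp add: ell_tilde_def zero_ereal_def)
next
  case False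
  have "norm (w t x /\<^sub>R m t x) \<le> M" using vel_bound[OF a, of t x] t x unfolding vel_def by simp
  then show ?thesis using False t x unfolding ell_tilde_def ell_def vel_def by (simp add: mult.commute)
qed

lemma J_tilde_eq: assumes a: "adm K m w" shows "J_tilde D T N m w = ereal (Jr m w)"
proof -
  have "(\<Sum>t<T. \<Sum>x\<in>grid N. ell_tilde D T m w t x) =
      (\<Sum>t<T. \<Sum>x\<in>grid N. ereal (m t x * ellc D (tm T t) x (vel m w t x)))"
    by (intro sum.cong refl ell_tilde_eq[OF a]) auto
  then show ?thesis unfolding J_tilde_def Jr_def by simp
qed

lemma J_lin_eq: assumes a: "adm K m w" shows "J_lin D T N m' m w = ereal (lincost (fd m') m (vel m w))"
proof -
  have "(\<Sum>t<T. \<Sum>x\<in>grid N. ell_tilde D T m w t x + ereal (f_disc D T N t x (m' t) * m t x)) =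
      (\<Sum>t<T. \<Sum>x\<in>grid N. ereal (m t x * ellc D (tm T t) x (vel m w t x) + f_disc D T N t x (m' t) * m t x))"
    by (intro sum.cong refl) (simp add: ell_tilde_eq[OF a])
  then show ?thesis unfolding J_lin_def lincost_def by simp
qed

lemma lincost_vel:
  assumes a: "adm K m w" and w: "\<And>t x. t < T \<Longrightarrow> x \<in> grid N \<Longrightarrow> w t x = m t x *\<^sub>R v t x"
  shows "lincost F m (vel m w) = lincost F m v"
proof -
  have "m t x * ellc D (tm T t) x (vel m w t x) = m t x * ellc D (tm T t) x (v t x)" if "t < T" "x \<in> grid N" for t x
    using that w[OF that] by (cases "m t x = 0") (simp_all add: vel_def)
  then have "(\<Sum>t<T. \<Sum>x\<in>grid N. m t x * ellc D (tm T t) x (vel m w t x) + F t x * m t x) =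
     (\<Sum>t<T. \<Sum>x\<in>grid N. m t x * ellc D (tm T t) x (v t x) + F t x * m t x)"
    by (intro sum.cong refl) (simp only: lessThan_iff)
  then show ?thesis unfolding lincost_def by (simp only:)
qed

text \<open>
  The optimality gap of the linearized problem controls the distance to its solution in
  \<open>L\<^sup>2\<close>, uniformly in the mesh; this is where the bound on the densities enters.
\<close>

lemma gap_controls_distance:
  fixes m' :: "nat \<Rightarrow> real ^ 'd \<Rightarrow> real"
  defines "V \<equiv> feedback (hjb m')"
  defines "mb \<equiv> fpk V" and "C1 \<equiv> (\<lambda>K. 8 * exp (2 * (M\<^sup>2 / \<sigma>)) * K / (\<sigma> * \<alpha>))"
  assumes K: "K > 0" "bounded_by K" and a: "adm K m w" and t: "t \<le> T"
  shows "(\<Sum>x\<in>grid N. (m t x - mb t x)\<^sup>2) \<le> C1 K * (1 / real N) ^ CARD('d) *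
      (lincost (fd m') m (vel m w) - lincost (fd m') mb (vel mb (\<lambda>t x. mb t x *\<^sub>R V t x)))"
    and "0 \<le> lincost (fd m') m (vel m w) - lincost (fd m') mb (vel mb (\<lambda>t x. mb t x *\<^sub>R V t x))"
proof -
  let ?wb = "\<lambda>t x. mb t x *\<^sub>R V t x"
  have V: "norm (V t x) \<le> M" for t x unfolding V_def by (rule V_op_bound)
  have ab: "adm K mb ?wb" unfolding mb_def by (rule BR_adm[OF K(2) V])
  define S where "S = dt * (\<Sum>t<T. \<Sum>x\<in>grid N. m t x * (norm (vel m w t x - V t x))\<^sup>2)"
  define g where "g = lincost (fd m') m (vel m w) - lincost (fd m') mb (vel mb ?wb)"
  have "\<alpha> / 2 * S \<le> lincost (fd m') m (vel m w) - lincost (fd m') mb V"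
    unfolding S_def V_def
  proof (rule lincost_gap[OF HJB_spec])
    show "flow m w" using a unfolding adm_def by blast
    show "flow mb ?wb" using ab unfolding adm_def by blast
  qed (use vel_eq[OF a] vel_bound[OF a] adm_nonneg[OF a] in \<open>auto simp: V_def\<close>)
  also have "\<dots> = g" unfolding g_def by (subst lincost_vel[OF ab, where v = V]) simp_all
  finally have Sg: "\<alpha> / 2 * S \<le> g" .
  have S0: "S \<ge> 0" unfolding S_def using adm_nonneg[OF a]
    by (intro mult_nonneg_nonneg sum_nonneg) auto
  then show "0 \<le> lincost (fd m') m (vel m w) - lincost (fd m') mb (vel mb ?wb)"
    using Sg data_pos unfolding g_def by (smt (verit) divide_pos_pos mult_nonneg_nonneg)
  let ?h = "(1 / real N) ^ CARD('d)"
  have hp: "?h > 0" using TN by simp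
  have fl: "m (Suc t) x = B (\<lambda>x. E (m t) x - dt * div_h N (w t) x + dt * 0) x" if "t < T" "x \<in> grid N" for t x
    using a that unfolding adm_def flow_def by simp
  have flb: "mb (Suc t) x = B (\<lambda>x. E (mb t) x - dt * div_h N (?wb t) x + dt * 0) x" if "t < T" "x \<in> grid N" for t x
    using ab that unfolding adm_def flow_def by simp
  have "(\<Sum>x\<in>grid N. (m t x - mb t x)\<^sup>2) \<le> 4 * exp (2 * (M\<^sup>2 / \<sigma>)) *
     (dt * (\<Sum>t<T. \<Sum>x\<in>grid N. (m t x * norm (vel m w t x - V t x))\<^sup>2) / \<sigma> + 0)"
  proof (rule flow_energy[where ma = m and mb = mb and wa = w and wb = ?wb and ra = "\<lambda>_ _. 0" and rb = "\<lambda>_ _. 0", OF fl flb])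
    show "m 0 x = mb 0 x" if "x \<in> grid N" for x
      using a ab that unfolding adm_def flow_def by simp
    fix t and x :: "real ^ 'd" assume t: "t < T" and x: "x \<in> grid N"
    have "w t x - ?wb t x = (m t x - mb t x) *\<^sub>R V t x + m t x *\<^sub>R (vel m w t x - V t x)"
      using vel_eq[OF a t x] by (simp add: algebra_simps)
    then have "norm (w t x - ?wb t x) \<le> \<bar>m t x - mb t x\<bar> * norm (V t x) + \<bar>m t x\<bar> * norm (vel m w t x - V t x)"
      by (metis norm_triangle_ineq norm_scaleR)
    moreover have "\<bar>m t x - mb t x\<bar> * norm (V t x) \<le> M * \<bar>m t x - mb t x\<bar>"
      using mult_left_mono[OF V[of t x], of "\<bar>m t x - mb t x\<bar>"] by (simp add: mult.commute)
    ultimately show "norm (w t x - ?wb t x) \<le> M * \<bar>m t x - mb t x\<bar> + m t x * norm (vel m w t x - V t x)"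
      using adm_nonneg[OF a, of t x] t x by simp
  qed (use t in auto)
  also have "dt * (\<Sum>t<T. \<Sum>x\<in>grid N. (m t x * norm (vel m w t x - V t x))\<^sup>2)
     \<le> dt * (\<Sum>t<T. \<Sum>x\<in>grid N. (K * ?h) * (m t x * (norm (vel m w t x - V t x))\<^sup>2))"
  proof (intro mult_left_mono sum_mono)
    fix t and x :: "real ^ 'd" assume t: "t \<in> {..<T}" and x: "x \<in> grid N"
    have "m t x \<le> K * ?h" "0 \<le> m t x" using a adm_nonneg[OF a, of t x] t x unfolding adm_def by auto
    then have "m t x * (m t x * (norm (vel m w t x - V t x))\<^sup>2) \<le> (K * ?h) * (m t x * (norm (vel m w t x - V t x))\<^sup>2)"
      by (intro mult_right_mono) auto
    then show "(m t x * norm (vel m w t x - V t x))\<^sup>2 \<le> (K * ?h) * (m t x * (norm (vel m w t x - V t x))\<^sup>2)"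
      by (simp add: power_mult_distrib power2_eq_square mult_ac)
  qed simp
  also have "\<dots> = K * ?h * S" by (simp add: S_def sum_distrib_left mult_ac)
  also have "K * ?h * S \<le> K * ?h * (2 / \<alpha> * g)"
    using Sg data_pos K hp by (intro mult_left_mono) (auto simp: field_simps)
  finally have "(\<Sum>x\<in>grid N. (m t x - mb t x)\<^sup>2) \<le> 4 * exp (2 * (M\<^sup>2 / \<sigma>)) * (K * ?h * (2 / \<alpha> * g) / \<sigma> + 0)"
    using sigma_pos by (simp add: divide_right_mono)
  then show "(\<Sum>x\<in>grid N. (m t x - mb t x)\<^sup>2) \<le> C1 K * ?h * (lincost (fd m') m (vel m w) - lincost (fd m') mb (vel mb ?wb))"
    unfolding g_def[symmetric] C1_def by (simp add: mult_ac)
qed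

text \<open>
  For positive densities the velocity \<open>w / m\<close> of the combination is a convex combination of the two velocities, with
  weights proportional to the densities.
\<close>

lemma perspective_convex:
  assumes a: "adm K m w" and a': "adm K m' w'" and s: "0 \<le> s" "s \<le> 1" and t: "t < T" and x: "x \<in> grid N"
  defines "m2 \<equiv> (\<lambda>t x. (1 - s) * m t x + s * m' t x)" and "w2 \<equiv> (\<lambda>t x. (1 - s) *\<^sub>R w t x + s *\<^sub>R w' t x)"
  shows "m2 t x * ellc D (tm T t) x (vel m2 w2 t x) \<le>
    (1 - s) * (m t x * ellc D (tm T t) x (vel m w t x)) + s * (m' t x * ellc D (tm T t) x (vel m' w' t x))"
proof -
  interpret c: strongly_convex_cost "ellc D (tm T t) x" "gradient (ellc D (tm T t) x)" \<alpha>
    using t by (intro ell_convex tm_in TN) auto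
  define p q where "p = (1 - s) * m t x" and "q = s * m' t x"
  have pq: "p \<ge> 0" "q \<ge> 0" using adm_nonneg[OF a, of t x] adm_nonneg[OF a', of t x] s t x by (auto simp: p_def q_def)
  let ?V = "vel m2 w2 t x" and ?v = "vel m w t x" and ?v' = "vel m' w' t x"
  let ?g = "gradient (ellc D (tm T t) x) ?V"
  have lo: "ellc D (tm T t) x z \<ge> ellc D (tm T t) x ?V + ?g \<bullet> (z - ?V)" for z
    using c.convex_ineq[of ?V z] data_pos by (smt (verit) divide_pos_pos mult_nonneg_nonneg zero_le_power2)
  have "w2 t x = m2 t x *\<^sub>R ?V" by (rule vel_eq[OF adm_convex[OF a a' s, folded m2_def w2_def] t x])
  then have "p *\<^sub>R ?v + q *\<^sub>R ?v' = (p + q) *\<^sub>R ?V"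
    using vel_eq[OF a t x] vel_eq[OF a' t x] unfolding m2_def w2_def p_def q_def by simp
  then have z: "p *\<^sub>R (?v - ?V) + q *\<^sub>R (?v' - ?V) = 0" by (simp add: algebra_simps)
  have "p * (?g \<bullet> (?v - ?V)) + q * (?g \<bullet> (?v' - ?V)) = ?g \<bullet> (p *\<^sub>R (?v - ?V) + q *\<^sub>R (?v' - ?V))"
    by (simp add: inner_add_right)
  then have "p * (?g \<bullet> (?v - ?V)) + q * (?g \<bullet> (?v' - ?V)) = 0" unfolding z by simp
  moreover have "p * ellc D (tm T t) x ?v + q * ellc D (tm T t) x ?v' \<ge>
     p * (ellc D (tm T t) x ?V + ?g \<bullet> (?v - ?V)) + q * (ellc D (tm T t) x ?V + ?g \<bullet> (?v' - ?V))"
    using pq lo by (intro add_mono mult_left_mono) auto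
  ultimately have "p * ellc D (tm T t) x ?v + q * ellc D (tm T t) x ?v' \<ge> (p + q) * ellc D (tm T t) x ?V"
    by (simp add: algebra_simps)
  then show ?thesis unfolding p_def q_def m2_def by (simp add: mult_ac)
qed

text \<open>
  The potential is convex, so that the cost lies above its linearization at \<open>m\<close>.
\<close>

lemma Jr_lower:
  assumes a: "adm K m w" and a': "adm K m' w'"
  shows "lincost (fd m) m' (vel m' w') - lincost (fd m) m (vel m w) \<le> Jr m' w' - Jr m w"
proof -
  have "(\<Sum>t<T. \<Sum>x\<in>grid N. f_disc D T N t x (m t) * (m' t x - m t x)) \<le> (\<Sum>t<T. F_disc D T N t (m' t) - F_disc D T N t (m t))"
    by (intro sum_mono F_disc_bounds(1) TN adm_prob[OF a] adm_prob[OF a']) auto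
  then have "dt * (\<Sum>t<T. \<Sum>x\<in>grid N. f_disc D T N t x (m t) * (m' t x - m t x)) \<le> dt * (\<Sum>t<T. F_disc D T N t (m' t) - F_disc D T N t (m t))"
    by (intro mult_left_mono) auto
  then show ?thesis unfolding lincost_def Jr_def
    by (simp add: sum.distrib sum_subtractf right_diff_distrib distrib_left del: times_divide_eq_left)
qed

text \<open>
  Upper quadratic model of the potential along the segment, and convexity of the running cost in
  \<open>(m, w)\<close>.
\<close>

lemma Jr_descent:
  assumes a: "adm K m w" and a': "adm K m' w'" and s: "0 \<le> s" "s \<le> 1"
    and X: "\<And>t. t \<le> T \<Longrightarrow> (\<Sum>x\<in>grid N. (m t x - m' t x)\<^sup>2) \<le> X"
  shows "Jr (\<lambda>t x. (1 - s) * m t x + s * m' t x) (\<lambda>t x. (1 - s) *\<^sub>R w t x + s *\<^sub>R w' t x) \<le>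
    Jr m w - s * (lincost (fd m) m (vel m w) - lincost (fd m) m' (vel m' w'))
      + s\<^sup>2 / 2 * (Lf D * X / (1 / real N) ^ CARD('d))"
proof -
  let ?h = "(1 / real N) ^ CARD('d)"
  have hp: "?h > 0" using TN by simp
  define m2 where "m2 = (\<lambda>t x. (1 - s) * m t x + s * m' t x)"
  define w2 where "w2 = (\<lambda>t x. (1 - s) *\<^sub>R w t x + s *\<^sub>R w' t x)"
  have a2: "adm K m2 w2" unfolding m2_def w2_def by (rule adm_convex[OF a a' s])
  have d: "m2 t x - m t x = s * (m' t x - m t x)" for t x by (simp add: m2_def algebra_simps)
  have 1: "(\<Sum>t<T. \<Sum>x\<in>grid N. m2 t x * ellc D (tm T t) x (vel m2 w2 t x)) \<le>
    (\<Sum>t<T. \<Sum>x\<in>grid N. (1 - s) * (m t x * ellc D (tm T t) x (vel m w t x)) + s * (m' t x * ellc D (tm T t) x (vel m' w' t x)))"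
    unfolding m2_def w2_def by (intro sum_mono perspective_convex[OF a a' s]) auto
  have 2: "(\<Sum>t<T. F_disc D T N t (m2 t) - F_disc D T N t (m t)) \<le>
     (\<Sum>t<T. (\<Sum>x\<in>grid N. s * (f_disc D T N t x (m t) * (m' t x - m t x))) + s\<^sup>2 / 2 * (Lf D * X / ?h))"
  proof (rule sum_mono)
    fix t assume "t \<in> {..<T}"
    then have t: "t \<le> T" by simp
    have "F_disc D T N t (m2 t) - F_disc D T N t (m t) \<le>
      (\<Sum>x\<in>grid N. f_disc D T N t x (m t) * (m2 t x - m t x)) + Lf D * (\<Sum>x\<in>grid N. (m2 t x - m t x)\<^sup>2) / ?h / 2"
      by (intro F_disc_bounds(2) TN t adm_prob[OF a] adm_prob[OF a2])
    also have "(\<Sum>x\<in>grid N. (m2 t x - m t x)\<^sup>2) = s\<^sup>2 * (\<Sum>x\<in>grid N. (m t x - m' t x)\<^sup>2)"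
      unfolding d power_mult_distrib sum_distrib_left by (simp add: power2_commute)
    also have "Lf D * (s\<^sup>2 * (\<Sum>x\<in>grid N. (m t x - m' t x)\<^sup>2)) / ?h / 2 \<le> Lf D * (s\<^sup>2 * X) / ?h / 2"
      using X[OF t] data_pos hp by (intro divide_right_mono mult_left_mono) auto
    finally show "F_disc D T N t (m2 t) - F_disc D T N t (m t) \<le>
       (\<Sum>x\<in>grid N. s * (f_disc D T N t x (m t) * (m' t x - m t x))) + s\<^sup>2 / 2 * (Lf D * X / ?h)"
      unfolding d by (simp add: mult_ac)
  qed
  have 3: "(\<Sum>x\<in>grid N. gc D x * m2 T x) = (1 - s) * (\<Sum>x\<in>grid N. gc D x * m T x) + s * (\<Sum>x\<in>grid N. gc D x * m' T x)"
    unfolding sum_distrib_left sum.distrib[symmetric] m2_def by (rule sum.cong) (auto simp: algebra_simps)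
  define A A' where "A = (\<Sum>t<T. \<Sum>x\<in>grid N. m t x * ellc D (tm T t) x (vel m w t x))"
    and "A' = (\<Sum>t<T. \<Sum>x\<in>grid N. m' t x * ellc D (tm T t) x (vel m' w' t x))"
  define f f' where "f = (\<Sum>t<T. \<Sum>x\<in>grid N. f_disc D T N t x (m t) * m t x)"
    and "f' = (\<Sum>t<T. \<Sum>x\<in>grid N. f_disc D T N t x (m t) * m' t x)"
  have le1: "(\<Sum>t<T. \<Sum>x\<in>grid N. m2 t x * ellc D (tm T t) x (vel m2 w2 t x)) \<le> (1 - s) * A + s * A'"
    using 1 by (simp add: A_def A'_def sum.distrib sum_distrib_left)
  have le2: "(\<Sum>t<T. F_disc D T N t (m2 t)) \<le> (\<Sum>t<T. F_disc D T N t (m t)) + s * (f' - f) + real T * (s\<^sup>2 / 2 * (Lf D * X / ?h))"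
    using 2 unfolding sum_subtractf sum.distrib
    by (simp add: f_def f'_def sum_subtractf sum_distrib_left right_diff_distrib)
  define g g' where "g = (\<Sum>x\<in>grid N. gc D x * m T x)" and "g' = (\<Sum>x\<in>grid N. gc D x * m' T x)"
  have l: "lincost (fd m) m (vel m w) = dt * (A + f) + g" "lincost (fd m) m' (vel m' w') = dt * (A' + f') + g'"
    unfolding lincost_def A_def A'_def f_def f'_def g_def g'_def by (simp_all add: sum.distrib)
  have "Jr m2 w2 \<le> dt * ((1 - s) * A + s * A') + dt * ((\<Sum>t<T. F_disc D T N t (m t)) + s * (f' - f) + real T * (s\<^sup>2 / 2 * (Lf D * X / ?h)))
     + ((1 - s) * g + s * g')"
    unfolding Jr_def 3 g_def[symmetric] g'_def[symmetric] using le1 le2 by (intro add_right_mono add_mono mult_left_mono) auto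
  also have "\<dots> = (dt * A + dt * (\<Sum>t<T. F_disc D T N t (m t)) + g) - s * ((dt * (A + f) + g) - (dt * (A' + f') + g'))
     + (dt * real T) * (s\<^sup>2 / 2 * (Lf D * X / ?h))"
    by (simp add: ring_distribs)
  also have "dt * real T = 1" using TN by simp
  finally show ?thesis unfolding l Jr_def[of m w] A_def[symmetric] g_def[symmetric] m2_def[symmetric] w2_def[symmetric] by simp
qed

lemma lincost_diff_bound:
  assumes a: "adm K m w" and a': "adm K m' w'" and pr: "\<And>t. t < T \<Longrightarrow> prob N (m'' t)"
    and L: "\<forall>t\<in>{0..1}. \<forall>x v. norm v \<le> M \<longrightarrow> \<bar>ellc D t x v\<bar> \<le> L"
  shows "lincost (fd m'') m (vel m w) - lincost (fd m'') m' (vel m' w') \<le>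
    2 * L + 4 * Lf D * real CARD('d) + 2 * Lg D * real CARD('d)"
proof -
  let ?d = "real CARD('d)"
  obtain x0 :: "real ^ 'd" where x0: "x0 \<in> grid N" using grid_nonempty[OF TN(2)] by blast
  have osc: "(\<Sum>x\<in>grid N. \<phi> x * (p x - q x)) \<le> c * 2"
    if p: "prob N p" and q: "prob N q" and \<phi>: "\<And>x. \<bar>\<phi> x - \<phi> x0\<bar> \<le> c" for \<phi> p q and c :: real
  proof -
    have "(\<Sum>x\<in>grid N. \<phi> x * (p x - q x)) = (\<Sum>x\<in>grid N. (\<phi> x - \<phi> x0) * (p x - q x)) + \<phi> x0 * ((\<Sum>x\<in>grid N. p x) - (\<Sum>x\<in>grid N. q x))"
      by (simp add: sum_subtractf sum_distrib_left algebra_simps sum.distrib)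
    also have "\<dots> = (\<Sum>x\<in>grid N. (\<phi> x - \<phi> x0) * (p x - q x))" using p q by (simp add: prob_def)
    also have "\<dots> \<le> (\<Sum>x\<in>grid N. c * (p x + q x))"
    proof (rule sum_mono)
      fix x :: "real ^ 'd" assume x: "x \<in> grid N"
      have "(\<phi> x - \<phi> x0) * (p x - q x) \<le> \<bar>\<phi> x - \<phi> x0\<bar> * \<bar>p x - q x\<bar>" by (metis abs_ge_self abs_mult)
      also have "\<dots> \<le> c * (p x + q x)"
      proof -
        have "0 \<le> p x" "0 \<le> q x" using p q x unfolding prob_def by blast+
        then show ?thesis using \<phi>[of x] by (intro mult_mono) auto
      qed
      finally show "(\<phi> x - \<phi> x0) * (p x - q x) \<le> c * (p x + q x)" .
    qed
    also have "\<dots> = c * 2" using p q by (simp add: sum_distrib_left[symmetric] sum.distrib prob_def)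
    finally show ?thesis .
  qed
  have ell: "\<bar>\<Sum>x\<in>grid N. m t x * ellc D (tm T t) x (vel m w t x)\<bar> \<le> L" if t: "t < T" and a: "adm K m w" for t m w
  proof -
    have "\<bar>\<Sum>x\<in>grid N. m t x * ellc D (tm T t) x (vel m w t x)\<bar> \<le> (\<Sum>x\<in>grid N. m t x * L)"
    proof (rule order_trans[OF sum_abs], rule sum_mono)
      fix x :: "real ^ 'd" assume x: "x \<in> grid N"
      have "\<bar>ellc D (tm T t) x (vel m w t x)\<bar> \<le> L"
        using L tm_in[OF TN(1), of t] t vel_bound[OF a, of t x] by simp
      then show "\<bar>m t x * ellc D (tm T t) x (vel m w t x)\<bar> \<le> m t x * L"
        using adm_nonneg[OF a, of t x] t x unfolding abs_mult by (simp add: mult_left_mono)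
    qed
    then show ?thesis using adm_prob[OF a, of t] t by (simp add: sum_distrib_right[symmetric] prob_def)
  qed
  have "lincost (fd m'') m (vel m w) - lincost (fd m'') m' (vel m' w') =
     dt * (\<Sum>t<T. (\<Sum>x\<in>grid N. m t x * ellc D (tm T t) x (vel m w t x)) - (\<Sum>x\<in>grid N. m' t x * ellc D (tm T t) x (vel m' w' t x))
        + (\<Sum>x\<in>grid N. f_disc D T N t x (m'' t) * (m t x - m' t x))) + (\<Sum>x\<in>grid N. gc D x * (m T x - m' T x))"
    unfolding lincost_def by (simp add: sum.distrib sum_subtractf right_diff_distrib algebra_simps diff_divide_distrib add_divide_distrib)
  also have "\<dots> \<le> dt * (\<Sum>t<T. 2 * L + (2 * Lf D * ?d) * 2) + (Lg D * ?d) * 2"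
  proof (intro add_mono mult_left_mono sum_mono)
    fix t assume "t \<in> {..<T}"
    then have t: "t < T" "t \<le> T" by auto
    show "(\<Sum>x\<in>grid N. m t x * ellc D (tm T t) x (vel m w t x)) - (\<Sum>x\<in>grid N. m' t x * ellc D (tm T t) x (vel m' w' t x)) \<le> 2 * L"
      using ell[OF t(1) a] ell[OF t(1) a'] by linarith
    show "(\<Sum>x\<in>grid N. f_disc D T N t x (m'' t) * (m t x - m' t x)) \<le> (2 * Lf D * ?d) * 2"
      by (intro osc adm_prob[OF a t(2)] adm_prob[OF a' t(2)] f_disc_osc TN t pr)
  next
    show "(\<Sum>x\<in>grid N. gc D x * (m T x - m' T x)) \<le> (Lg D * ?d) * 2"
      using data_pos by (intro osc adm_prob[OF a] adm_prob[OF a'] torus_lipschitz_osc[OF g_lip]) auto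
  qed simp
  also have "\<dots> = 2 * L + 4 * Lf D * ?d + 2 * Lg D * ?d" using TN by simp
  finally show ?thesis .
qed

end

context mfg
begin

definition hjb_const :: "real \<Rightarrow> bool" where
  "hjb_const G' \<longleftrightarrow> (\<exists>G. gronwall_const (real CARD('d) * c0 * M) G \<and>
     G' = M * (G * (2 * (real CARD('d) * c0))) + 1 + G * (2 * (real CARD('d) * c0)))"

lemma hjb_const_exists: "\<exists>G>0. hjb_const G"
proof -
  let ?d = "real CARD('d)"
  have "?d * c0 * M \<ge> 0" using M_pos c0_pos by simp
  from singular_gronwall[OF this] obtain G where G: "gronwall_const (?d * c0 * M) G" ..
  then have "G > 0" unfolding gronwall_const_def by blast
  then have "M * (G * (2 * (?d * c0))) + 1 + G * (2 * (?d * c0)) > 0"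
    using M_pos c0_pos by (intro add_pos_nonneg add_nonneg_pos) auto
  then show ?thesis using G unfolding hjb_const_def by blast
qed

end

context mfg_grid
begin

lemma hjb_stable:
  assumes G: "hjb_const G" and u: "hjb_eq u1 F1" "hjb_eq u2 F2"
    and F: "\<And>t x. t < T \<Longrightarrow> x \<in> grid N \<Longrightarrow> \<bar>F1 t x - F2 t x\<bar> \<le> D'"
  shows "t \<le> T \<Longrightarrow> x \<in> grid N \<Longrightarrow> \<bar>u1 t x - u2 t x\<bar> \<le> G * D'"
    and "t < T \<Longrightarrow> x \<in> grid N \<Longrightarrow> \<bar>B (u1 (Suc t)) x - B (u2 (Suc t)) x\<bar> \<le> G * D'"
    and "t < T \<Longrightarrow> x \<in> grid N \<Longrightarrow> norm (grad_h N (B (u1 (Suc t))) x - grad_h N (B (u2 (Suc t))) x) \<le> G * D'"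
proof -
  obtain G0 where G0: "gronwall_const (real CARD('d) * th.C0 * M) G0"
    "G = M * (G0 * (2 * (real CARD('d) * th.C0))) + 1 + G0 * (2 * (real CARD('d) * th.C0))"
    using G unfolding hjb_const_def th.C0_def by blast
  have uT: "u1 T x = u2 T x" if "x \<in> grid N" for x using u that unfolding hjb_eq_def by simp
  have eq: "v t x = E (B (v (Suc t))) x + dt * (F t x - Ham D T t x (grad_h N (B (v (Suc t))) x))"
    if "hjb_eq v F" "t < T" "x \<in> grid N" for v F t x using that unfolding hjb_eq_def by blast
  have M: "M \<ge> 0" using M_pos by simp
  have H: "\<bar>Ham D T t x p - Ham D T t x q\<bar> \<le> M * norm (p - q)" if "t < T" for t x p q
    using that by (intro Ham_lipschitz TN) simp
  note R = th.hjb_stability[OF G0(1) M, where h = "Ham D T", folded G0(2), OF H uT eq[OF u(1)] eq[OF u(2)] F]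
  show "t \<le> T \<Longrightarrow> x \<in> grid N \<Longrightarrow> \<bar>u1 t x - u2 t x\<bar> \<le> G * D'" by (rule R(1))
  show "t < T \<Longrightarrow> x \<in> grid N \<Longrightarrow> \<bar>B (u1 (Suc t)) x - B (u2 (Suc t)) x\<bar> \<le> G * D'" by (rule R(2))
  show "t < T \<Longrightarrow> x \<in> grid N \<Longrightarrow> norm (grad_h N (B (u1 (Suc t))) x - grad_h N (B (u2 (Suc t))) x) \<le> G * D'" by (rule R(3))
qed

lemma step_size_denominator:
  "(1 / real N) powr (- (real CARD('d) / 2)) * real (card (grid N :: (real ^ 'd) set)) powr (1 / 2)
     = 1 / (1 / real N) ^ CARD('d)"
proof -
  let ?d = "real CARD('d)"
  have N: "real N > 0" using TN by simp
  have "(1 / real N) powr (- (?d / 2)) = real N powr (?d / 2)"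
    using N by (simp add: powr_divide powr_minus_divide)
  moreover have "real (N ^ CARD('d)) powr (1 / 2) = real N powr (?d / 2)"
    using N by (simp add: powr_realpow[symmetric] powr_powr)
  moreover have "real N powr (?d / 2) * real N powr (?d / 2) = real N ^ CARD('d)"
    using N by (simp add: powr_add[symmetric] powr_realpow)
  ultimately show ?thesis by (simp add: card_grid power_divide)
qed

text \<open>
  The numerator of the step size is the gap, which controls the squared distance in the
  denominator; hence the lower bound.
\<close>

lemma step_size_bounds:
  assumes K: "K > 0" "bounded_by K" and a: "adm K m w"
  defines "V \<equiv> feedback (hjb m)"
  defines "mb \<equiv> fpk V" and "C1 \<equiv> 8 * exp (2 * (M\<^sup>2 / \<sigma>)) * K / (\<sigma> * \<alpha>)"
  defines "wb \<equiv> (\<lambda>t x. mb t x *\<^sub>R V t x)"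
  defines "g \<equiv> lincost (fd m) m (vel m w) - lincost (fd m) mb (vel mb wb)"
    and "X \<equiv> (norm_inf_p T N 2 (\<lambda>t x. m t x - mb t x))\<^sup>2"
    and "lam \<equiv> step_size D T N m w mb wb"
  shows "0 \<le> lam" "lam \<le> 1" "min 1 (1 / (Lf D * C1)) \<le> lam" "lam * (Lf D * X / (1 / real N) ^ CARD('d)) \<le> g"
    "0 \<le> g" "adm K mb wb"
proof -
  let ?h = "(1 / real N) ^ CARD('d)"
  have hp: "?h > 0" using TN by simp
  have V: "norm (V t x) \<le> M" for t x unfolding V_def by (rule V_op_bound)
  show ab: "adm K mb wb" unfolding mb_def wb_def by (rule BR_adm[OF K(2) V])
  have C1: "C1 > 0" using K sigma_pos data_pos by (simp add: C1_def)
  show g0: "0 \<le> g"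
    using gap_controls_distance(2)[OF K a, of 0 m] unfolding g_def wb_def mb_def V_def by simp
  have Xle: "X \<le> C1 * ?h * g"
    unfolding X_def
    by (rule norm_inf_p_2_bounds(2), unfold g_def wb_def mb_def V_def C1_def) (rule gap_controls_distance(1)[OF K a])
  define c where "c = Lf D * X / ?h"
  have c: "c \<le> Lf D * C1 * g"
  proof -
    have "c \<le> Lf D * (C1 * ?h * g) / ?h"
      unfolding c_def using Xle data_pos hp by (intro divide_right_mono mult_left_mono) auto
    then show ?thesis using hp TN by (simp add: mult_ac)
  qed
  have "0 \<le> lam \<and> lam \<le> 1 \<and> min 1 (1 / (Lf D * C1)) \<le> lam \<and> lam * c \<le> g"
  proof (cases "m = mb")
    case True
    have "X \<le> 0" unfolding X_def True by (rule norm_inf_p_2_bounds(2)) simp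
    then have X0: "X = 0" unfolding X_def by simp
    have "lam = 1" using True by (simp add: lam_def step_size_def)
    then show ?thesis using g0 X0 by (simp add: c_def)
  next
    case False
    have tg: "m \<in> time_grid_funs {..T} N" "mb \<in> time_grid_funs {..T} N"
      using a ab unfolding adm_def prob_flows_def by blast+
    obtain t x where tx: "m t x \<noteq> mb t x" using False by (auto simp: fun_eq_iff)
    have z: "m t x = 0 \<and> mb t x = 0" if "\<not> (t \<le> T \<and> x \<in> grid N)"
      using tg that unfolding time_grid_funs_def mem_Collect_eq by (metis atMost_iff)
    have tx': "t \<le> T \<and> x \<in> grid N" by (rule ccontr) (use z tx in simp)
    then have t: "t \<le> T" and x: "x \<in> grid N" by simp_all
    have "0 < (m t x - mb t x)\<^sup>2" using tx by simp
    also have "\<dots> \<le> (\<Sum>x\<in>grid N. (m t x - mb t x)\<^sup>2)"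
      using x by (intro member_le_sum[where f = "\<lambda>x. (m t x - mb t x)\<^sup>2"]) auto
    also have "\<dots> \<le> X" unfolding X_def by (rule norm_inf_p_2_bounds(1)[OF t])
    finally have X: "X > 0" .
    have cp: "c > 0" using X data_pos hp by (simp add: c_def)
    have "Lf D * (1 / real N) powr (- (real CARD('d) / 2))
                * real (card (grid N :: (real ^ 'd) set)) powr (1 / 2)
                * (norm_inf_p T N 2 (\<lambda>t x. m t x - mb t x))\<^sup>2 = c"
      unfolding c_def X_def using step_size_denominator by (simp add: mult_ac)
    then have "lam = real_of_ereal (min ((ereal (lincost (fd m) m (vel m w)) - ereal (lincost (fd m) mb (vel mb wb))) / ereal c) 1)"
      unfolding lam_def step_size_def J_lin_eq[OF a] J_lin_eq[OF ab] using False by simp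
    also have "\<dots> = min (g / c) 1" using cp unfolding g_def by (simp add: min_def one_ereal_def)
    finally have lam: "lam = min (g / c) 1" .
    have gp: "g > 0"
    proof (rule ccontr)
      assume "\<not> g > 0" then have "g = 0" using g0 by simp
      then show False using c cp by simp
    qed
    have "1 / (Lf D * C1) \<le> g / c"
      using c cp C1 data_pos gp by (simp add: field_simps)
    moreover have "lam * c \<le> g / c * c" unfolding lam using cp by (intro mult_right_mono) auto
    ultimately show ?thesis using g0 cp unfolding lam by auto
  qed
  then show "0 \<le> lam" "lam \<le> 1" "min 1 (1 / (Lf D * C1)) \<le> lam" "lam * (Lf D * X / ?h) \<le> g"
    unfolding c_def by auto
qed

lemma BR_eq: "BR D \<theta> T N m' = (fpk (feedback (hjb m')),
   \<lambda>t x. fpk (feedback (hjb m')) t x *\<^sub>R feedback (hjb m') t x)"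
  by (simp add: BR_def Let_def)

text \<open>
  Linear rate. The gap of the linearized problem is at least the optimality gap \<open>\<gamma>\<close>, the step
  size is bounded from below since the gap controls the squared distance, and each step gains
  half of its size times the gap.
\<close>

lemma frank_wolfe_rate:
  assumes K: "K > 0" "bounded_by K" and sol: "theta_mfg_solution D \<theta> T N uh vh mh" and fw: "frank_wolfe D \<theta> T N m w"
    and L: "\<forall>t\<in>{0..1}. \<forall>x v. norm v \<le> M \<longrightarrow> \<bar>ellc D t x v\<bar> \<le> L"
  defines "C1 \<equiv> 8 * exp (2 * (M\<^sup>2 / \<sigma>)) * K / (\<sigma> * \<alpha>)"
  defines "c \<equiv> 1 - min 1 (1 / (Lf D * C1)) / 2"
    and "C \<equiv> 2 * L + 4 * Lf D * real CARD('d) + 2 * Lg D * real CARD('d)"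
    and "wh \<equiv> (\<lambda>t x. mh t x *\<^sub>R vh t x)"
  assumes k: "k \<ge> 1"
  shows "adm K (m k) (w k)" "adm K mh wh" "Jr (m k) (w k) - Jr mh wh \<le> C * c ^ (k - 1)"
    "t \<le> T \<Longrightarrow> (\<Sum>x\<in>grid N. (m k t x - mh t x)\<^sup>2) \<le> C1 * (1 / real N) ^ CARD('d) * (Jr (m k) (w k) - Jr mh wh)"
proof -
  let ?V = "(1 / real N) ^ CARD('d)"
  have h': "uh = hjb mh" "vh = feedback uh" "mh = fpk vh"
    using sol unfolding theta_mfg_solution_def by - (elim conjE, assumption)+
  have h: "vh = feedback (hjb mh)" "mh = fpk vh"
    by (rule h'(2)[unfolded h'(1)]) (rule h'(3))
  have vh: "norm (vh t x) \<le> M" for t x unfolding h(1) by (rule V_op_bound)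
  show ah: "adm K mh wh" using BR_adm[where v = vh, OF K(2) vh] unfolding wh_def h(2)[symmetric] .
  define mb where "mb k = fpk (feedback (hjb (m k)))" for k
  define wb where "wb k = (\<lambda>t x. mb k t x *\<^sub>R feedback (hjb (m k)) t x)" for k
  define lam where "lam k = step_size D T N (m k) (w k) (mb k) (wb k)" for k
  have BR: "BR D \<theta> T N (m k) = (mb k, wb k)" for k unfolding mb_def wb_def by (rule BR_eq)
  have fw1: "m 1 = mb 0" "w 1 = wb 0"
  proof -
    have "(m 1, w 1) = (mb 0, wb 0)" using fw unfolding frank_wolfe_def BR by (elim conjE)
    then show "m 1 = mb 0" "w 1 = wb 0" by simp_all
  qed
  have fwS: "m (Suc k) = (\<lambda>t x. (1 - lam k) * m k t x + lam k * mb k t x)"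
     "w (Suc k) = (\<lambda>t x. (1 - lam k) *\<^sub>R w k t x + lam k *\<^sub>R wb k t x)" if "k \<ge> 1" for k
  proof -
    have "\<forall>k\<ge>1. let (mb', wb') = (mb k, wb k); lam = step_size D T N (m k) (w k) mb' wb'
            in m (k + 1) = (\<lambda>t x. (1 - lam) * m k t x + lam * mb' t x) \<and>
               w (k + 1) = (\<lambda>t x. (1 - lam) *\<^sub>R w k t x + lam *\<^sub>R wb' t x)"
      using fw unfolding frank_wolfe_def BR by (elim conjE)
    from this[rule_format, OF that]
    show "m (Suc k) = (\<lambda>t x. (1 - lam k) * m k t x + lam k * mb k t x)"
     "w (Suc k) = (\<lambda>t x. (1 - lam k) *\<^sub>R w k t x + lam k *\<^sub>R wb k t x)"
      unfolding Let_def case_prod_conv lam_def[symmetric] Suc_eq_plus1 by - (elim conjE, assumption)+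
  qed
  have a1: "adm K (m 1) (w 1)"
    unfolding fw1 mb_def wb_def by (rule BR_adm[OF K(2) V_op_bound])
  note sb = step_size_bounds[OF K, of "m k" "w k" for k, folded mb_def, folded wb_def, folded lam_def C1_def]
  have a: "adm K (m (Suc j)) (w (Suc j))" for j
  proof (induction j)
    case 0 then show ?case using a1 by simp
  next
    case (Suc j)
    then show ?case unfolding fwS[of "Suc j", simplified] by (intro adm_convex sb Suc.IH)
  qed
  then have a': "adm K (m k) (w k)" if "k \<ge> 1" for k using that by (cases k) auto
  show "adm K (m k) (w k)" by (rule a'[OF k])
  define g where "g k = lincost (fd (m k)) (m k) (vel (m k) (w k)) - lincost (fd (m k)) (mb k) (vel (mb k) (wb k))" for k
  define \<gamma> where "\<gamma> k = Jr (m k) (w k) - Jr mh wh" for k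
  have \<gamma>g: "\<gamma> k \<le> g k" if k: "k \<ge> 1" for k
  proof -
    have "lincost (fd (m k)) mh (vel mh wh) - lincost (fd (m k)) (m k) (vel (m k) (w k)) \<le> Jr mh wh - Jr (m k) (w k)"
      by (rule Jr_lower[OF a'[OF k] ah])
    moreover have "0 \<le> lincost (fd (m k)) mh (vel mh wh) - lincost (fd (m k)) (mb k) (vel (mb k) (wb k))"
      unfolding wb_def mb_def by (rule gap_controls_distance(2)[OF K ah, of 0]) simp
    ultimately show ?thesis unfolding \<gamma>_def g_def by linarith
  qed
  have dist: "(\<Sum>x\<in>grid N. (m k t x - mh t x)\<^sup>2) \<le> C1 * ?V * \<gamma> k" "0 \<le> \<gamma> k"
    if k: "k \<ge> 1" and t: "t \<le> T" for k t
  proof -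
    let ?G = "lincost (fd mh) (m k) (vel (m k) (w k)) - lincost (fd mh) mh (vel mh wh)"
    note gc = gap_controls_distance[OF K a'[OF k] t, of mh, folded h(1), folded h(2), folded wh_def C1_def]
    have le: "?G \<le> \<gamma> k" unfolding \<gamma>_def by (rule Jr_lower[OF ah a'[OF k]])
    show "0 \<le> \<gamma> k" using le gc(2) by linarith
    have "C1 * ?V \<ge> 0" using K sigma_pos data_pos by (simp add: C1_def)
    from mult_left_mono[OF le this] show "(\<Sum>x\<in>grid N. (m k t x - mh t x)\<^sup>2) \<le> C1 * ?V * \<gamma> k"
      using gc(1) by linarith
  qed
  show "t \<le> T \<Longrightarrow> (\<Sum>x\<in>grid N. (m k t x - mh t x)\<^sup>2) \<le> C1 * ?V * (Jr (m k) (w k) - Jr mh wh)"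
    using dist(1)[OF k] unfolding \<gamma>_def .
  have rec: "\<gamma> (Suc k) \<le> c * \<gamma> k" if k: "k \<ge> 1" for k
  proof -
    let ?X = "(norm_inf_p T N 2 (\<lambda>t x. m k t x - mb k t x))\<^sup>2"
    define q where "q = Lf D * ?X / ?V"
    note s = sb[OF a'[OF k], folded g_def, folded q_def]
    have "\<gamma> (Suc k) \<le> \<gamma> k - lam k * g k + (lam k)\<^sup>2 / 2 * q"
      unfolding \<gamma>_def fwS[OF k] g_def q_def
      using Jr_descent[OF a'[OF k] s(6) s(1,2), where X = ?X] norm_inf_p_2_bounds(1)[where T = T and N = N and \<nu> = "\<lambda>t x. m k t x - mb k t x"]
      by fastforce
    also have "(lam k)\<^sup>2 / 2 * q = lam k / 2 * (lam k * q)" by (simp add: power2_eq_square)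
    also have "\<dots> \<le> lam k / 2 * g k" using s by (intro mult_left_mono) auto
    finally have 1: "\<gamma> (Suc k) \<le> \<gamma> k - lam k / 2 * g k" by (simp add: mult.commute)
    have "min 1 (1 / (Lf D * C1)) / 2 * \<gamma> k \<le> lam k / 2 * g k"
      using s \<gamma>g[OF k] dist(2)[OF k, of 0] by (intro mult_mono) auto
    then show ?thesis using 1 unfolding c_def by (simp add: left_diff_distrib)
  qed
  have c0: "c \<ge> 0" unfolding c_def by (simp add: min_def)
  have "\<gamma> (Suc j) \<le> C * c ^ j" for j
  proof (induction j)
    case 0
    have "g 1 \<le> C" unfolding g_def C_def
      by (rule lincost_diff_bound[OF a'[of 1] sb(6)[OF a'[of 1]] adm_prob[OF a'[of 1]] L]) auto
    then show ?case using \<gamma>g[of 1] by simp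
  next
    case (Suc j)
    have "\<gamma> (Suc (Suc j)) \<le> c * \<gamma> (Suc j)" by (rule rec) simp
    also have "\<dots> \<le> c * (C * c ^ j)" using Suc c0 by (intro mult_left_mono)
    finally show ?case by (simp add: mult_ac)
  qed
  from this[of "k - 1"] show "Jr (m k) (w k) - Jr mh wh \<le> C * c ^ (k - 1)" using k by (simp add: \<gamma>_def)
qed

end

context mfg
begin

lemma frank_wolfe_convergence:
  obtains (rates) c C Cb where "0 < c" "c < 1" "C > 0" "Cb > 0"
    and "\<And>T N uh vh mh m w k. cfl T N \<Longrightarrow> theta_mfg_solution D \<theta> T N uh vh mh \<Longrightarrow> frank_wolfe D \<theta> T N m w \<Longrightarrow> k \<ge> 1 \<Longrightarrow>
      J_tilde D T N (m k) (w k) - J_tilde D T N mh (\<lambda>t x. mh t x *\<^sub>R vh t x) \<le> ereal (C * c ^ k) \<and>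
      (\<forall>t\<le>T. \<forall>x\<in>grid N. \<bar>HJB D \<theta> T N (m k) t x - uh t x\<bar> \<le> Cb * c powr (real k / 2)) \<and>
      (\<forall>t\<le>T. (\<Sum>x\<in>grid N. \<bar>m k t x - mh t x\<bar>) \<le> Cb * c powr (real k / 2))"
proof -
  obtain K where K: "K > 0" "\<forall>T N v. cfl T N \<longrightarrow> (\<forall>t x. norm (v t x) \<le> M) \<longrightarrow>
     (\<forall>t\<le>T. \<forall>x\<in>grid N. FP D \<theta> T N v t x \<le> K * (1 / real N) ^ CARD('d))" using FP_bound by blast
  obtain L where L: "\<forall>t\<in>{0..1}. \<forall>x v. norm v \<le> M \<longrightarrow> \<bar>ellc D t x v\<bar> \<le> L" using ell_bounded by blast
  obtain G where G: "G > 0" "hjb_const G" using hjb_const_exists by blast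
  define C1 where "C1 = 8 * exp (2 * (M\<^sup>2 / \<sigma>)) * K / (\<sigma> * \<alpha>)"
  have C1: "C1 > 0" using K sigma_pos data_pos by (simp add: C1_def)
  define c where "c = 1 - min 1 (1 / (Lf D * C1)) / 2"
  have "0 < 1 / (Lf D * C1)" using C1 data_pos by simp
  then have "0 < min 1 (1 / (Lf D * C1))" by simp
  moreover have "min 1 (1 / (Lf D * C1)) \<le> 1" by simp
  moreover have "0 < 1 - q / 2 \<and> 1 - q / 2 < 1" if "0 < q" "q \<le> 1" for q :: real using that by simp
  ultimately have c: "0 < c" "c < 1" unfolding c_def by blast+
  define C' where "C' = 2 * L + 4 * Lf D * real CARD('d) + 2 * Lg D * real CARD('d)"
  have "norm (0 :: real ^ 'd) \<le> M" "(0::real) \<in> {0..1}" using M_pos by auto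
  then have "\<bar>ellc D 0 0 0\<bar> \<le> L" using L by blast
  then have "L \<ge> 0" by linarith
  then have C': "C' > 0" using data_pos by (simp add: C'_def add_nonneg_pos)
  \<comment> \<open>The rate holds with exponent \<open>k - 1\<close>; the missing factor goes into the constant.\<close>
  define C where "C = C' / c"
  have C: "C > 0" using C' c by (simp add: C_def)
  define Cb where "Cb = (G * Lf D + 1) * sqrt (C1 * C)"
  have Cb: "Cb > 0" using G data_pos C1 C by (simp add: Cb_def add_pos_pos)
  show ?thesis
  proof (rule rates[OF c C Cb])
    fix T N uh vh mh m w k
    assume cfl: "cfl T N" and sol: "theta_mfg_solution D \<theta> T N uh vh mh" and fw: "frank_wolfe D \<theta> T N m w" and k: "1 \<le> (k::nat)"
    interpret mfg_grid D \<theta> r us ms vs T N by unfold_locales (rule cfl)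
    have Kb: "bounded_by K" using K(2) cfl unfolding bounded_by_def by simp
    let ?wh = "\<lambda>t x. mh t x *\<^sub>R vh t x" and ?h = "(1 / real N) ^ CARD('d)"
    have hp: "?h > 0" using TN by simp
    note R = frank_wolfe_rate[OF K(1) Kb sol fw L k, folded C1_def, folded c_def C'_def]
    define \<gamma> where "\<gamma> = Jr (m k) (w k) - Jr mh ?wh"
    have "C' * c ^ (k - 1) = C * c ^ k" using c k by (cases k) (auto simp: C_def)
    then have \<gamma>: "\<gamma> \<le> C * c ^ k" using R(3) by (simp add: \<gamma>_def)
    have rA: "J_tilde D T N (m k) (w k) - J_tilde D T N mh ?wh \<le> ereal (C * c ^ k)"
      unfolding J_tilde_eq[OF R(1)] J_tilde_eq[OF R(2)] using \<gamma> by (simp add: \<gamma>_def)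
    let ?s = "sqrt (C1 * C) * c powr (real k / 2)"
    have pw: "sqrt (c ^ k) = c powr (real k / 2)"
      using c by (simp add: powr_half_sqrt[symmetric] powr_realpow[symmetric] powr_powr)
    have d2: "sqrt ((\<Sum>x\<in>grid N. (m k t x - mh t x)\<^sup>2) / ?h) \<le> ?s" if t: "t \<le> T" for t
    proof -
      have "(\<Sum>x\<in>grid N. (m k t x - mh t x)\<^sup>2) \<le> C1 * ?h * (C * c ^ k)"
        by (rule order_trans[OF R(4)[OF t, folded \<gamma>_def] mult_left_mono[OF \<gamma>]]) (use C1 hp in simp)
      then have "(\<Sum>x\<in>grid N. (m k t x - mh t x)\<^sup>2) / ?h \<le> (C1 * ?h * (C * c ^ k)) / ?h"
        using hp by (intro divide_right_mono) auto
      also have "\<dots> = C1 * C * c ^ k" using TN by simp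
      finally show ?thesis unfolding pw[symmetric] real_sqrt_mult[symmetric] by (rule real_sqrt_le_mono)
    qed
    have p0: "?s \<ge> 0" using C1 C by simp
    have rC: "\<forall>t\<le>T. (\<Sum>x\<in>grid N. \<bar>m k t x - mh t x\<bar>) \<le> Cb * c powr (real k / 2)"
    proof (intro allI impI)
      fix t assume t: "t \<le> T"
      have "(\<Sum>x\<in>grid N. \<bar>m k t x - mh t x\<bar>) \<le> sqrt ((\<Sum>x\<in>grid N. (m k t x - mh t x)\<^sup>2) / ?h)"
        by (rule sum_abs_le_sqrt[OF TN(2)])
      also have "\<dots> \<le> 1 * ?s" using d2[OF t] by simp
      also have "\<dots> \<le> (G * Lf D + 1) * ?s"
        using G data_pos p0 by (intro mult_right_mono) auto
      finally show "(\<Sum>x\<in>grid N. \<bar>m k t x - mh t x\<bar>) \<le> Cb * c powr (real k / 2)" by (simp add: Cb_def mult_ac)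
    qed
    have rB: "\<forall>t\<le>T. \<forall>x\<in>grid N. \<bar>HJB D \<theta> T N (m k) t x - uh t x\<bar> \<le> Cb * c powr (real k / 2)"
    proof (intro allI impI ballI)
      fix t and x :: "real ^ 'd" assume t: "t \<le> T" and x: "x \<in> grid N"
      have uh: "uh = HJB D \<theta> T N mh" using sol unfolding theta_mfg_solution_def by (elim conjE)
      have "\<bar>HJB D \<theta> T N (m k) t x - HJB D \<theta> T N mh t x\<bar> \<le> G * (Lf D * ?s)"
      proof (rule hjb_stable(1)[OF G(2) HJB_spec HJB_spec _ t x])
        fix t and x :: "real ^ 'd" assume t: "t < T" and x: "x \<in> grid N"
        have "\<bar>fd (m k) t x - fd mh t x\<bar> \<le> Lf D * sqrt ((\<Sum>x\<in>grid N. (m k t x - mh t x)\<^sup>2) / ?h)"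
          using t by (intro f_disc_lipschitz TN adm_prob[OF R(1)] adm_prob[OF R(2)]) auto
        also have "\<dots> \<le> Lf D * ?s" using d2[of t] t data_pos by (intro mult_left_mono) auto
        finally show "\<bar>fd (m k) t x - fd mh t x\<bar> \<le> Lf D * ?s" .
      qed
      also have "\<dots> = (G * Lf D) * ?s" by simp
      also have "\<dots> \<le> (G * Lf D + 1) * ?s" using p0 by (intro mult_right_mono) auto
      finally show "\<bar>HJB D \<theta> T N (m k) t x - uh t x\<bar> \<le> Cb * c powr (real k / 2)" unfolding uh by (simp add: Cb_def mult_ac)
    qed
    show "J_tilde D T N (m k) (w k) - J_tilde D T N mh ?wh \<le> ereal (C * c ^ k) \<and>
        (\<forall>t\<le>T. \<forall>x\<in>grid N. \<bar>HJB D \<theta> T N (m k) t x - uh t x\<bar> \<le> Cb * c powr (real k / 2)) \<and>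
        (\<forall>t\<le>T. (\<Sum>x\<in>grid N. \<bar>m k t x - mh t x\<bar>) \<le> Cb * c powr (real k / 2))"
      by (intro conjI rA rB rC)
  qed
qed

end

section \<open>Difference quotients of smooth functions\<close>

text \<open>
  By Taylor's theorem, the difference quotient is a mean of two values of the second derivative.
\<close>

lemma second_difference:
  fixes \<phi> :: "real \<Rightarrow> real"
  assumes d1: "\<And>s. (\<phi> has_real_derivative \<phi>' s) (at s)" and d2: "\<And>s. (\<phi>' has_real_derivative \<phi>'' s) (at s)"
    and h: "h > 0" and e: "\<And>s. \<bar>s\<bar> \<le> h \<Longrightarrow> \<bar>\<phi>'' s - \<phi>'' 0\<bar> \<le> \<epsilon>"
  shows "\<bar>(\<phi> h + \<phi> (- h) - 2 * \<phi> 0) / h\<^sup>2 - \<phi>'' 0\<bar> \<le> \<epsilon>"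
proof -
  define diff where "diff m = (if m = 0 then \<phi> else if m = 1 then \<phi>' else \<phi>'')" for m :: nat
  have D: "\<forall>m t. m < 2 \<and> - h \<le> t \<and> t \<le> h \<longrightarrow> DERIV (diff m) t :> diff (Suc m) t"
    using d1 d2 by (auto simp: diff_def less_Suc_eq numeral_2_eq_2)
  have D0: "diff 0 = \<phi>" by (simp add: diff_def)
  have T: "\<exists>t. \<bar>t\<bar> \<le> h \<and> \<phi> y = \<phi> 0 + \<phi>' 0 * y + \<phi>'' t / 2 * y\<^sup>2" if y: "y = h \<or> y = - h" for y
  proof -
    have "\<exists>t. (if y < 0 then y < t \<and> t < 0 else 0 < t \<and> t < y) \<and>
      \<phi> y = (\<Sum>m<2. diff m 0 / fact m * (y - 0) ^ m) + diff 2 t / fact 2 * (y - 0) ^ 2"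
      by (rule Taylor[OF _ D0 D]) (use y h in auto)
    then obtain t where t: "if y < 0 then y < t \<and> t < 0 else 0 < t \<and> t < y"
      "\<phi> y = (\<Sum>m<2. diff m 0 / fact m * (y - 0) ^ m) + diff 2 t / fact 2 * (y - 0) ^ 2" by blast
    have "\<bar>t\<bar> \<le> h" using t(1) y h by (auto split: if_splits)
    then show ?thesis using t(2) by (intro exI[of _ t]) (simp add: diff_def numeral_2_eq_2)
  qed
  obtain t1 where t1: "\<bar>t1\<bar> \<le> h" "\<phi> h = \<phi> 0 + \<phi>' 0 * h + \<phi>'' t1 / 2 * h\<^sup>2" using T[of h] by blast
  obtain t2 where t2: "\<bar>t2\<bar> \<le> h" "\<phi> (- h) = \<phi> 0 + \<phi>' 0 * (- h) + \<phi>'' t2 / 2 * h\<^sup>2" using T[of "- h"] by auto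
  have "\<phi> h + \<phi> (- h) - 2 * \<phi> 0 = ((\<phi>'' t1 + \<phi>'' t2) / 2) * h\<^sup>2" unfolding t1(2) t2(2) by (simp add: algebra_simps)
  then have "(\<phi> h + \<phi> (- h) - 2 * \<phi> 0) / h\<^sup>2 = (\<phi>'' t1 + \<phi>'' t2) / 2" using h by simp
  moreover have "\<bar>(\<phi>'' t1 + \<phi>'' t2) / 2 - \<phi>'' 0\<bar> \<le> \<epsilon>" 
  proof -
    have "\<bar>(a + b) / 2 - c\<bar> \<le> \<epsilon>" if "\<bar>a - c\<bar> \<le> \<epsilon>" "\<bar>b - c\<bar> \<le> \<epsilon>" for a b c :: real
      using that by (auto simp: abs_le_iff field_simps)
    from this[OF e[OF t1(1)] e[OF t2(1)]] show ?thesis .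
  qed
  ultimately show ?thesis by (simp only:)
qed

lemma first_difference:
  fixes \<phi> :: "real \<Rightarrow> real"
  assumes d1: "\<And>s. (\<phi> has_real_derivative \<phi>' s) (at s)"
    and h: "h > 0" and e: "\<And>s. \<bar>s\<bar> \<le> h \<Longrightarrow> \<bar>\<phi>' s - \<phi>' 0\<bar> \<le> \<epsilon>"
  shows "\<bar>(\<phi> h - \<phi> (- h)) / (2 * h) - \<phi>' 0\<bar> \<le> \<epsilon>"
proof -
  have "\<exists>z. - h < z \<and> z < h \<and> \<phi> h - \<phi> (- h) = (h - - h) * \<phi>' z"
    using h d1 by (intro MVT2) auto
  then obtain z where z: "- h < z" "z < h" "\<phi> h - \<phi> (- h) = (2 * h) * \<phi>' z" by auto
  then have "(\<phi> h - \<phi> (- h)) / (2 * h) = \<phi>' z" using h by simp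
  then show ?thesis using e[of z] z by simp
qed

lemma GDERIV_line:
  assumes "GDERIV f (x + s *\<^sub>R e) :> g" shows "((\<lambda>s. f (x + s *\<^sub>R e)) has_real_derivative (g \<bullet> e)) (at s)"
proof -
  have "((\<lambda>s. x + s *\<^sub>R e) has_derivative (\<lambda>h. h *\<^sub>R e)) (at s)" by (auto intro!: derivative_eq_intros)
  moreover have "(f has_derivative (\<lambda>h. h \<bullet> g)) (at (x + s *\<^sub>R e))" using assms unfolding gderiv_def .
  ultimately have "((\<lambda>s. f (x + s *\<^sub>R e)) has_derivative (\<lambda>h. (h *\<^sub>R e) \<bullet> g)) (at s)"
    by (rule has_derivative_compose)
  moreover have "(\<lambda>h. (h *\<^sub>R e) \<bullet> g) = (*) (g \<bullet> e)"
    by (rule ext) (simp only: inner_scaleR_left inner_commute[of e g] mult.commute)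
  ultimately show ?thesis unfolding has_field_derivative_def by simp
qed

lemma GDERIV_axis:
  fixes x :: "real ^ 'd::finite"
  assumes "GDERIV f (x + s *\<^sub>R axis i 1) :> g"
  shows "((\<lambda>s. f (x + s *\<^sub>R axis i 1)) has_real_derivative (g $ i)) (at s)"
  using GDERIV_line[OF assms] by (simp add: inner_axis)

lemma gradient_periodic: assumes "periodic f" shows "periodic (gradient f)"
  unfolding periodic_def
proof (intro allI ballI)
  fix x k :: "real ^ 'a" assume k: "k \<in> lattice_Z"
  have p: "f (y + k) = f y" for y using assms k unfolding periodic_def by blast
  have "GDERIV f (x + k) :> g \<longleftrightarrow> GDERIV f x :> g" for g
  proof
    assume "GDERIV f (x + k) :> g"
    then have "((\<lambda>y. f (y + k)) has_derivative (\<lambda>h. h \<bullet> g)) (at x)"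
      unfolding gderiv_def by (intro has_derivative_compose[where f = "\<lambda>y. y + k" and g = f, of "\<lambda>h. h"]) (auto intro!: derivative_eq_intros)
    then show "GDERIV f x :> g" unfolding gderiv_def p .
  next
    assume "GDERIV f x :> g"
    then have "((\<lambda>y. f (y + (- k))) has_derivative (\<lambda>h. h \<bullet> g)) (at (x + k))"
      unfolding gderiv_def by (intro has_derivative_compose[where f = "\<lambda>y. y + (- k)" and g = f, of "\<lambda>h. h"]) (auto intro!: derivative_eq_intros)
    moreover have "f (y + (- k)) = f y" for y using p[of "y + (- k)"] by simp
    ultimately show "GDERIV f (x + k) :> g" unfolding gderiv_def by simp
  qed
  then show "gradient f (x + k) = gradient f x" unfolding gradient_def by (intro arg_cong[where f = The] ext)
qed

lemma periodic_component: "periodic f \<Longrightarrow> periodic (\<lambda>x. f x $ i)"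
  unfolding periodic_def by simp

lemma hessian_periodic: "periodic f \<Longrightarrow> periodic (hessian i j f)"
  unfolding hessian_def[abs_def] by (intro periodic_component gradient_periodic)

context
  fixes u :: "real \<Rightarrow> real ^ 'd::finite \<Rightarrow> real" and t :: real
  assumes u: "C_1_2 u" and t: "t \<in> {0..1}"
begin

lemma C12_line: "((\<lambda>s. u t (x + s *\<^sub>R axis i 1)) has_real_derivative (gradient (u t) (x + s *\<^sub>R axis i 1) $ i)) (at s)"
  by (intro GDERIV_axis has_gradientD) (use C_1_2_parts(3)[OF u] t in blast)

lemma C12_line2: "((\<lambda>s. gradient (u t) (x + s *\<^sub>R axis i 1) $ i) has_real_derivative (hessian i i (u t) (x + s *\<^sub>R axis i 1))) (at s)"
  unfolding hessian_def
  by (rule GDERIV_axis[where f = "\<lambda>y. gradient (u t) y $ i"], rule has_gradientD) (use C_1_2_parts(4)[OF u] t in blast)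

lemma C12_time: "((\<lambda>s. u s x) has_real_derivative time_deriv u t x) (at t within {0..1})"
proof -
  have "(\<lambda>s. u s x) differentiable (at t within {0..1})" using C_1_2_parts(2)[OF u] t by blast
  then show ?thesis unfolding time_deriv_def has_real_derivative_iff_has_vector_derivative
    by (simp add: vector_derivative_works)
qed

end

definition lapc :: "nat \<Rightarrow> (real ^ 'd::finite \<Rightarrow> real) \<Rightarrow> real ^ 'd \<Rightarrow> real" where
  "lapc N f x = (\<Sum>i\<in>UNIV. (f (x + (1 / real N) *\<^sub>R axis i 1) + f (x - (1 / real N) *\<^sub>R axis i 1) - 2 * f x) / (1 / real N)\<^sup>2)"

definition gradc :: "nat \<Rightarrow> (real ^ 'd::finite \<Rightarrow> real) \<Rightarrow> real ^ 'd \<Rightarrow> real ^ 'd" where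
  "gradc N f x = (\<chi> i. (f (x + (1 / real N) *\<^sub>R axis i 1) - f (x - (1 / real N) *\<^sub>R axis i 1)) / (2 * (1 / real N)))"

lemma periodic_up_down:
  assumes "periodic f"
  shows "f (up N i x) = f (x + (1 / real N) *\<^sub>R axis i 1)" "f (down N i x) = f (x - (1 / real N) *\<^sub>R axis i 1)"
  unfolding shift_def using periodic_wrap[OF assms] by simp_all

lemma lap_h_lapc: "periodic f \<Longrightarrow> lap_h N f x = lapc N f x"
  unfolding lap_h_def lapc_def by (simp add: periodic_up_down)

lemma grad_h_gradc: "periodic f \<Longrightarrow> grad_h N f x = gradc N f x"
  unfolding grad_h_def gradc_def by (simp add: periodic_up_down)

definition abs_total :: "('d::finite \<Rightarrow> real) \<Rightarrow> real" where "abs_total k = (\<Sum>i\<in>UNIV. \<bar>k i\<bar>)"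

lemma abs_le_abs_total: "\<bar>k i\<bar> \<le> abs_total k"
  unfolding abs_total_def by (rule member_le_sum[where f = "\<lambda>i. \<bar>k i\<bar>"]) auto

lemma le_abs_total: "k i \<le> abs_total k" and abs_total_nonneg: "0 \<le> abs_total k"
  using abs_le_abs_total[of k i] by linarith (simp add: abs_total_def sum_nonneg)

text \<open>
  The constants of the parabolic Hoelder space, for all components together.
\<close>

definition holder_const :: "real \<Rightarrow> real \<Rightarrow> (real \<Rightarrow> real ^ 'd::finite \<Rightarrow> real) \<Rightarrow> bool" where
  "holder_const r K u \<longleftrightarrow> K > 0 \<and>
    (\<forall>t\<in>{0..1}. \<forall>s\<in>{0..1}. \<forall>x. \<bar>time_deriv u t x - time_deriv u s x\<bar> \<le> K * \<bar>t - s\<bar> powr (r / 2)) \<and>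
    (\<forall>t\<in>{0..1}. \<forall>s\<in>{0..1}. \<forall>x i. \<bar>gradient (u t) x $ i - gradient (u s) x $ i\<bar> \<le> K * \<bar>t - s\<bar> powr ((1 + r) / 2)) \<and>
    (\<forall>t\<in>{0..1}. \<forall>s\<in>{0..1}. \<forall>x i. \<bar>hessian i i (u t) x - hessian i i (u s) x\<bar> \<le> K * \<bar>t - s\<bar> powr (r / 2)) \<and>
    (\<forall>t\<in>{0..1}. \<forall>x y i. \<bar>hessian i i (u t) x - hessian i i (u t) y\<bar> \<le> K * tnorm (x - y) powr r) \<and>
    (\<forall>t\<in>{0..1}. \<forall>x i. \<bar>hessian i i (u t) x\<bar> \<le> K) \<and> (\<forall>t\<in>{0..1}. \<forall>x. norm (gradient (u t) x) \<le> K) \<and>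
    (\<forall>t\<in>{0..1}. \<forall>x. \<bar>u t x\<bar> \<le> K)"

lemma holder_const_exists:
  fixes u :: "real \<Rightarrow> real ^ 'd::finite \<Rightarrow> real"
  assumes "parabolic_holder r u" shows "\<exists>K. holder_const r K u"
proof -
  have u: "C_1_2 u" by (rule parabolic_holder_C_1_2[OF assms])
  have p: "periodic (u t)" if "t \<in> {0..1}" for t using C_1_2_parts(1)[OF u] that by blast
  have P: "time_holder (r / 2) (time_deriv u)" "\<forall>i. time_holder ((1 + r) / 2) (\<lambda>t x. gradient (u t) x $ i)"
     "\<forall>i j. time_holder (r / 2) (\<lambda>t. hessian i j (u t)) \<and> space_holder r (\<lambda>t. hessian i j (u t))"
    using assms unfolding parabolic_holder_def by - (elim conjE, assumption)+
  obtain K1 where K1: "\<forall>t\<in>{0..1}. \<forall>s\<in>{0..1}. \<forall>x. \<bar>time_deriv u t x - time_deriv u s x\<bar> \<le> K1 * \<bar>t - s\<bar> powr (r / 2)"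
    using P(1) unfolding time_holder_def by blast
  have "\<forall>i. \<exists>K. \<forall>t\<in>{0..1}. \<forall>s\<in>{0..1}. \<forall>x. \<bar>gradient (u t) x $ i - gradient (u s) x $ i\<bar> \<le> K * \<bar>t - s\<bar> powr ((1 + r) / 2)"
    using P(2) unfolding time_holder_def .
  from choice[OF this] obtain K2 where K2: "\<forall>i. \<forall>t\<in>{0..1}. \<forall>s\<in>{0..1}. \<forall>x. \<bar>gradient (u t) x $ i - gradient (u s) x $ i\<bar> \<le> K2 i * \<bar>t - s\<bar> powr ((1 + r) / 2)"
    by (rule exE)
  have "\<forall>i. \<exists>K. \<forall>t\<in>{0..1}. \<forall>s\<in>{0..1}. \<forall>x. \<bar>hessian i i (u t) x - hessian i i (u s) x\<bar> \<le> K * \<bar>t - s\<bar> powr (r / 2)"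
    using P(3) unfolding time_holder_def by blast
  from choice[OF this] obtain K3 where K3: "\<forall>i. \<forall>t\<in>{0..1}. \<forall>s\<in>{0..1}. \<forall>x. \<bar>hessian i i (u t) x - hessian i i (u s) x\<bar> \<le> K3 i * \<bar>t - s\<bar> powr (r / 2)"
    by (rule exE)
  have "\<forall>i. \<exists>K. \<forall>t\<in>{0..1}. \<forall>x y. \<bar>hessian i i (u t) x - hessian i i (u t) y\<bar> \<le> K * tnorm (x - y) powr r"
    using P(3) unfolding space_holder_def by blast
  from choice[OF this] obtain K4 where K4: "\<forall>i. \<forall>t\<in>{0..1}. \<forall>x y. \<bar>hessian i i (u t) x - hessian i i (u t) y\<bar> \<le> K4 i * tnorm (x - y) powr r"
    by (rule exE)
  have "\<forall>i. \<exists>K. \<forall>t\<in>{0..1}. \<forall>x. norm (hessian i i (u t) x) \<le> K"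
    using C_1_2_parts(8)[OF u] by (intro allI periodic_bounded hessian_periodic p) blast+
  from choice[OF this] obtain K5 where K5: "\<forall>i. \<forall>t\<in>{0..1}. \<forall>x. norm (hessian i i (u t) x) \<le> K5 i"
    by (rule exE)
  obtain K6 where K6: "\<forall>t\<in>{0..1}. \<forall>x. norm (gradient (u t) x) \<le> K6"
    using periodic_bounded[OF C_1_2_parts(7)[OF u] gradient_periodic[OF p]] by blast
  obtain K7 where K7: "\<forall>t\<in>{0..1}. \<forall>x. norm (u t x) \<le> K7"
    using periodic_bounded[OF C_1_2_parts(5)[OF u] p] by blast
  note S = le_abs_total abs_total_nonneg
  define K where "K = \<bar>K1\<bar> + abs_total K2 + abs_total K3 + abs_total K4 + abs_total K5 + \<bar>K6\<bar> + \<bar>K7\<bar> + 1"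
  note SS = S(2)[of K2] S(2)[of K3] S(2)[of K4] S(2)[of K5]
  have le: "K1 \<le> K" "K6 \<le> K" "K7 \<le> K" "K > 0" "abs_total K2 \<le> K" "abs_total K3 \<le> K" "abs_total K4 \<le> K" "abs_total K5 \<le> K"
    unfolding K_def using SS by linarith+
  have le': "K2 i \<le> K" "K3 i \<le> K" "K4 i \<le> K" "K5 i \<le> K" for i
    using S(1)[of K2 i] S(1)[of K3 i] S(1)[of K4 i] S(1)[of K5 i] le by linarith+
  have up: "a \<le> K * (b powr q)" if "a \<le> k * (b powr q)" "k \<le> K" for a b q k :: real
    using that mult_right_mono[OF that(2), of "b powr q"] by simp
  have "holder_const r K u"
    unfolding holder_const_def
  proof (intro conjI ballI allI)
    show "K > 0" by (rule le)
  next
    fix t s :: real and x :: "real ^ 'd" assume a: "t \<in> {0..1}" "s \<in> {0..1}"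
    show "\<bar>time_deriv u t x - time_deriv u s x\<bar> \<le> K * \<bar>t - s\<bar> powr (r / 2)"
      by (rule up[OF _ le(1)]) (use K1 a in blast)
    fix i
    show "\<bar>gradient (u t) x $ i - gradient (u s) x $ i\<bar> \<le> K * \<bar>t - s\<bar> powr ((1 + r) / 2)"
      by (rule up[OF _ le'(1)]) (use K2 a in blast)
    show "\<bar>hessian i i (u t) x - hessian i i (u s) x\<bar> \<le> K * \<bar>t - s\<bar> powr (r / 2)"
      by (rule up[OF _ le'(2)]) (use K3 a in blast)
  next
    fix t :: real and x y :: "real ^ 'd" and i assume a: "t \<in> {0..1}"
    show "\<bar>hessian i i (u t) x - hessian i i (u t) y\<bar> \<le> K * tnorm (x - y) powr r"
      by (rule up[OF _ le'(3)]) (use K4 a in blast)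
  next
    fix t :: real and x :: "real ^ 'd" and i assume a: "t \<in> {0..1}"
    have "norm (hessian i i (u t) x) \<le> K5 i" using K5 a by blast
    then show "\<bar>hessian i i (u t) x\<bar> \<le> K" using le'(4)[of i] by simp
    have "norm (gradient (u t) x) \<le> K6" "norm (u t x) \<le> K7" using K6 K7 a by blast+
    then show "norm (gradient (u t) x) \<le> K" "\<bar>u t x\<bar> \<le> K" using le by simp_all
  qed
  then show ?thesis by blast
qed

lemma holder_constD:
  assumes "holder_const r K u"
  shows "K > 0"
    "t \<in> {0..1} \<Longrightarrow> s \<in> {0..1} \<Longrightarrow> \<bar>time_deriv u t x - time_deriv u s x\<bar> \<le> K * \<bar>t - s\<bar> powr (r / 2)"
    "t \<in> {0..1} \<Longrightarrow> s \<in> {0..1} \<Longrightarrow> \<bar>gradient (u t) x $ i - gradient (u s) x $ i\<bar> \<le> K * \<bar>t - s\<bar> powr ((1 + r) / 2)"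
    "t \<in> {0..1} \<Longrightarrow> s \<in> {0..1} \<Longrightarrow> \<bar>hessian i i (u t) x - hessian i i (u s) x\<bar> \<le> K * \<bar>t - s\<bar> powr (r / 2)"
    "t \<in> {0..1} \<Longrightarrow> \<bar>hessian i i (u t) x - hessian i i (u t) y\<bar> \<le> K * tnorm (x - y) powr r"
    "t \<in> {0..1} \<Longrightarrow> \<bar>hessian i i (u t) x\<bar> \<le> K" "t \<in> {0..1} \<Longrightarrow> norm (gradient (u t) x) \<le> K"
    "t \<in> {0..1} \<Longrightarrow> \<bar>u t x\<bar> \<le> K"
  using assms unfolding holder_const_def by simp_all

context
  fixes u :: "real \<Rightarrow> real ^ 'd::finite \<Rightarrow> real" and K r :: real
  assumes u: "C_1_2 u" and K: "holder_const r K u" and r: "0 < r" "r < 1"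
begin

lemma lapc_consistent:
  assumes t: "t \<in> {0..1}" and N: "N > 0"
  shows "\<bar>lapc N (u t) x - laplacian (u t) x\<bar> \<le> real CARD('d) * K * (1 / real N) powr r"
proof -
  let ?h = "1 / real N"
  have h: "?h > 0" using N by simp
  have "\<bar>(u t (x + ?h *\<^sub>R axis i 1) + u t (x - ?h *\<^sub>R axis i 1) - 2 * u t x) / ?h\<^sup>2 - hessian i i (u t) x\<bar> \<le> K * ?h powr r" for i
  proof -
    let ?\<phi> = "\<lambda>s. u t (x + s *\<^sub>R axis i 1)"
    have "\<bar>(?\<phi> ?h + ?\<phi> (- ?h) - 2 * ?\<phi> 0) / ?h\<^sup>2 - hessian i i (u t) (x + 0 *\<^sub>R axis i 1)\<bar> \<le> K * ?h powr r"
    proof (rule second_difference[OF C12_line[OF u t] C12_line2[OF u t] h])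
      fix s :: real assume s: "\<bar>s\<bar> \<le> ?h"
      have "\<bar>hessian i i (u t) (x + s *\<^sub>R axis i 1) - hessian i i (u t) (x + 0 *\<^sub>R axis i 1)\<bar>
         \<le> K * tnorm (x + s *\<^sub>R axis i 1 - (x + 0 *\<^sub>R axis i 1)) powr r" by (rule holder_constD(5)[OF K t])
      also have "tnorm (x + s *\<^sub>R axis i 1 - (x + 0 *\<^sub>R axis i 1)) \<le> ?h"
        using tnorm_le_norm[of "s *\<^sub>R axis i 1 :: real ^ 'd"] s by simp
      then have "K * tnorm (x + s *\<^sub>R axis i 1 - (x + 0 *\<^sub>R axis i 1)) powr r \<le> K * ?h powr r"
        using r holder_constD(1)[OF K] tnorm_nonneg by (intro mult_left_mono powr_mono2) auto
      finally show "\<bar>hessian i i (u t) (x + s *\<^sub>R axis i 1) - hessian i i (u t) (x + 0 *\<^sub>R axis i 1)\<bar> \<le> K * ?h powr r" .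
    qed
    then show ?thesis by simp
  qed
  then have "(\<Sum>i\<in>UNIV. \<bar>(u t (x + ?h *\<^sub>R axis i 1) + u t (x - ?h *\<^sub>R axis i 1) - 2 * u t x) / ?h\<^sup>2 - hessian i i (u t) x\<bar>)
     \<le> (\<Sum>i\<in>(UNIV::'d set). K * ?h powr r)" by (intro sum_mono)
  then show ?thesis unfolding lapc_def laplacian_def sum_subtractf[symmetric]
    by (intro order_trans[OF sum_abs]) simp
qed

lemma gradient_line_lipschitz:
  assumes t: "t \<in> {0..1}"
  shows "\<bar>gradient (u t) (x + s *\<^sub>R axis i 1) $ i - gradient (u t) x $ i\<bar> \<le> K * \<bar>s\<bar>"
proof -
  have "norm (gradient (u t) (x + s *\<^sub>R axis i 1) $ i - gradient (u t) (x + 0 *\<^sub>R axis i 1) $ i) \<le> K * norm (s - 0)"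
    using holder_constD(6)[OF K t]
    by (intro field_differentiable_bound[OF convex_UNIV, where f' = "\<lambda>s. hessian i i (u t) (x + s *\<^sub>R axis i 1)"])
      (auto intro: has_field_derivative_at_within C12_line2[OF u t])
  then show ?thesis by simp
qed

lemma gradc_consistent:
  assumes t: "t \<in> {0..1}" and N: "N > 0"
  shows "\<bar>gradc N (u t) x $ i - gradient (u t) x $ i\<bar> \<le> K * (1 / real N)"
proof -
  let ?h = "1 / real N" let ?\<phi> = "\<lambda>s. u t (x + s *\<^sub>R axis i 1)"
  have h: "?h > 0" using N by simp
  have "\<bar>(?\<phi> ?h - ?\<phi> (- ?h)) / (2 * ?h) - gradient (u t) (x + 0 *\<^sub>R axis i 1) $ i\<bar> \<le> K * ?h"
  proof (rule first_difference[OF C12_line[OF u t] h])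
    fix s :: real assume s: "\<bar>s\<bar> \<le> ?h"
    show "\<bar>gradient (u t) (x + s *\<^sub>R axis i 1) $ i - gradient (u t) (x + 0 *\<^sub>R axis i 1) $ i\<bar> \<le> K * ?h"
      using gradient_line_lipschitz[OF t, of x s i] mult_left_mono[OF s, of K] holder_constD(1)[OF K] by simp
  qed
  then show ?thesis by (simp add: gradc_def)
qed

lemma laplacian_time:
  assumes "t \<in> {0..1}" "s \<in> {0..1}"
  shows "\<bar>laplacian (u t) x - laplacian (u s) x\<bar> \<le> real CARD('d) * K * \<bar>t - s\<bar> powr (r / 2)"
proof -
  have "(\<Sum>i\<in>UNIV. \<bar>hessian i i (u t) x - hessian i i (u s) x\<bar>) \<le> (\<Sum>i\<in>(UNIV::'d set). K * \<bar>t - s\<bar> powr (r / 2))"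
    by (intro sum_mono holder_constD(4)[OF K assms])
  then show ?thesis unfolding laplacian_def sum_subtractf[symmetric] by (intro order_trans[OF sum_abs]) simp
qed

lemma laplacian_space:
  assumes "t \<in> {0..1}"
  shows "\<bar>laplacian (u t) x - laplacian (u t) y\<bar> \<le> real CARD('d) * K * tnorm (x - y) powr r"
proof -
  have "(\<Sum>i\<in>UNIV. \<bar>hessian i i (u t) x - hessian i i (u t) y\<bar>) \<le> (\<Sum>i\<in>(UNIV::'d set). K * tnorm (x - y) powr r)"
    by (intro sum_mono holder_constD(5)[OF K assms])
  then show ?thesis unfolding laplacian_def sum_subtractf[symmetric] by (intro order_trans[OF sum_abs]) simp
qed

lemma laplacian_bound:
  assumes "t \<in> {0..1}" shows "\<bar>laplacian (u t) x\<bar> \<le> real CARD('d) * K"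
proof -
  have "(\<Sum>i\<in>UNIV. \<bar>hessian i i (u t) x\<bar>) \<le> (\<Sum>i\<in>(UNIV::'d set). K)"
    by (intro sum_mono holder_constD(6)[OF K assms])
  then show ?thesis unfolding laplacian_def by (intro order_trans[OF sum_abs]) simp
qed

lemma time_difference:
  assumes t: "t \<in> {0..1}" "s \<in> {0..1}" "t < s"
  shows "\<bar>(u s x - u t x) / (s - t) - time_deriv u t x\<bar> \<le> K * (s - t) powr (r / 2)"
proof -
  have "\<exists>z\<in>{t..s}. u s x - u t x = (\<lambda>h. h * time_deriv u z x) (s - t)"
  proof (rule mvt_very_simple)
    fix z assume "t \<le> z" "z \<le> s"
    then have z: "z \<in> {0..1}" using t by auto
    have "((\<lambda>s. u s x) has_real_derivative time_deriv u z x) (at z within {t..s})"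
      by (rule has_field_derivative_subset[OF C12_time[OF u z]]) (use t in auto)
    moreover have "(\<lambda>h. h * time_deriv u z x) = (*) (time_deriv u z x)" by (rule ext) (rule mult.commute)
    ultimately show "((\<lambda>s. u s x) has_derivative (\<lambda>h. h * time_deriv u z x)) (at z within {t..s})"
      unfolding has_field_derivative_def by simp
  qed (use t in simp)
  then obtain z where z: "z \<in> {t..s}" "u s x - u t x = (s - t) * time_deriv u z x" by auto
  have "(u s x - u t x) / (s - t) = time_deriv u z x" using z(2) t by simp
  then have "\<bar>(u s x - u t x) / (s - t) - time_deriv u t x\<bar> \<le> K * \<bar>z - t\<bar> powr (r / 2)"
    using holder_constD(2)[OF K, of z t x] z t by simp
  also have "\<dots> \<le> K * (s - t) powr (r / 2)"
    using z r holder_constD(1)[OF K] by (intro mult_left_mono powr_mono2) auto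
  finally show ?thesis .
qed

lemma space_lipschitz:
  assumes t: "t \<in> {0..1}" shows "\<bar>u t x - u t y\<bar> \<le> K * norm (x - y)"
proof -
  have "norm (u t x - u t y) \<le> K * norm (x - y)"
  proof (rule differentiable_bound[OF convex_UNIV, where f' = "\<lambda>x h. h \<bullet> gradient (u t) x"])
    fix z :: "real ^ 'd"
    have "GDERIV (u t) z :> gradient (u t) z" using C_1_2_parts(3)[OF u] t by (intro has_gradientD) blast
    then show "(u t has_derivative (\<lambda>h. h \<bullet> gradient (u t) z)) (at z within UNIV)" unfolding gderiv_def by simp
    show "onorm (\<lambda>h. h \<bullet> gradient (u t) z) \<le> K"
    proof (rule onorm_le)
      fix h
      have "norm (h \<bullet> gradient (u t) z) \<le> norm h * norm (gradient (u t) z)" using Cauchy_Schwarz_ineq2 by simp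
      also have "\<dots> \<le> norm h * K" by (intro mult_left_mono holder_constD(7)[OF K t]) simp
      also have "\<dots> = K * norm h" by (rule mult.commute)
      finally show "norm (h \<bullet> gradient (u t) z) \<le> K * norm h" .
    qed
  qed auto
  then show ?thesis by simp
qed

end

section \<open>Lipschitz estimate for the value function\<close>

lemma second_derivative_max:
  fixes \<phi> :: "real \<Rightarrow> real"
  assumes d1: "\<And>s. (\<phi> has_real_derivative \<phi>' s) (at s)" and d2: "(\<phi>' has_real_derivative c) (at 0)"
    and max: "\<And>s. \<phi> s \<le> \<phi> 0"
  shows "\<phi>' 0 = 0" "c \<le> 0"
proof -
  show z: "\<phi>' 0 = 0" by (rule DERIV_local_max[OF d1, of 1]) (use max in auto)
  show "c \<le> 0"
  proof (rule ccontr)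
    assume "\<not> c \<le> 0"
    then obtain d where d: "d > 0" "\<And>h. 0 < h \<Longrightarrow> h < d \<Longrightarrow> \<phi>' 0 < \<phi>' (0 + h)"
      using DERIV_pos_inc_right[OF d2] by force
    have "\<exists>w. 0 < w \<and> w < d / 2 \<and> \<phi> (d / 2) - \<phi> 0 = (d / 2 - 0) * \<phi>' w"
      using d(1) d1 by (intro MVT2) auto
    then obtain w where w: "0 < w" "w < d / 2" "\<phi> (d / 2) - \<phi> 0 = (d / 2) * \<phi>' w" by auto
    have "\<phi>' w > 0" using d(2)[of w] w d(1) z by simp
    then have "(d / 2) * \<phi>' w > 0" using d(1) by (intro mult_pos_pos) auto
    then have "\<phi> (d / 2) - \<phi> 0 > 0" unfolding w(3) .
    then show False using max[of "d / 2"] by linarith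
  qed
qed

context mfg
begin

text \<open>
  Maximum principle: where \<open>u(t, x + z) - u(t, x)\<close> is maximal, the gradients at the two points
  agree, so that the Hamiltonians differ only through their dependence on \<open>x\<close>.
\<close>

lemma us_lipschitz:
  assumes t: "t \<in> {0..1}"
  shows "us t (x + z) - us t x \<le> (Lell D + Lf D + Lg D) * norm z"
proof (rule field_le_epsilon)
  fix \<epsilon> :: real assume \<epsilon>: "\<epsilon> > 0"
  \<comment> \<open>The term \<open>c t\<close> forces the maximum to the final time.\<close>
  define c where "c = (Lell D + Lf D) * norm z + \<epsilon>"
  have c0: "c > 0" using data_pos \<epsilon> by (simp add: c_def add_nonneg_pos)
  define W where "W t x = us t (x + z) - us t x + c * t" for t x
  have "continuous_on ({0..1} \<times> UNIV) (\<lambda>p. (case (fst p, snd p + z) of (t, x) \<Rightarrow> us t x) - (case p of (t, x) \<Rightarrow> us t x) + c * fst p)"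
    by (intro continuous_intros continuous_on_compose2[OF us_cont, where f = "\<lambda>p. (fst p, snd p + z)"] us_cont) auto
  then have "continuous_on ({0..1} \<times> UNIV) (\<lambda>(t, x). W t x)"
    by (rule continuous_on_eq) (auto simp: W_def)
  then have Wc: "continuous_on ({0..1} \<times> cbox 0 1) (\<lambda>(t, x). W t x)" by (rule continuous_on_subset) auto
  have comp: "compact ({0..1::real} \<times> cbox 0 (1 :: real ^ 'd))" by (intro compact_Times) auto
  have "(0, 0) \<in> {0..1::real} \<times> cbox 0 (1 :: real ^ 'd)" by (simp add: mem_box_cart)
  then have ne: "{0..1::real} \<times> cbox 0 (1 :: real ^ 'd) \<noteq> {}" by blast
  from continuous_attains_sup[OF comp ne Wc] obtain t0 x0 where
    m0: "t0 \<in> {0..1}" and mx: "\<And>t x. t \<in> {0..1} \<Longrightarrow> x \<in> cbox 0 1 \<Longrightarrow> W t x \<le> W t0 x0" by fastforce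
  have max: "W t x \<le> W t0 x0" if t: "t \<in> {0..1}" for t x
  proof -
    have "wrap x \<in> cbox 0 1" by (simp add: mem_box_cart wrap_def frac_ge_0 less_imp_le[OF frac_lt_1])
    moreover have "W t (wrap x) = W t x"
    proof -
      have "us t (wrap x + z) = us t (wrap (wrap x + z))" by (rule periodic_wrap[OF us_periodic[OF t], symmetric])
      also have "\<dots> = us t (x + z)" unfolding wrap_add by (rule periodic_wrap[OF us_periodic[OF t]])
      finally show ?thesis using periodic_wrap[OF us_periodic[OF t], of x] by (simp add: W_def)
    qed
    ultimately show ?thesis using mx[OF t, of "wrap x"] by simp
  qed
  have "t0 = 1"
  proof (rule ccontr)
    assume "t0 \<noteq> 1"
    then have t1: "t0 < 1" using m0 by simp
    let ?y = "x0 + z"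
    have td: "time_deriv us t0 ?y - time_deriv us t0 x0 + c \<le> 0"
    proof (rule ccontr)
      assume "\<not> ?thesis"
      then have pos: "time_deriv us t0 ?y - time_deriv us t0 x0 + c > 0" by simp
      have "((\<lambda>s. W s x0) has_real_derivative (time_deriv us t0 ?y - time_deriv us t0 x0 + c)) (at t0 within {0..1})"
        unfolding W_def by (auto intro!: derivative_eq_intros C12_time[OF us_C_1_2 m0])
      from has_real_derivative_pos_inc_right[OF this pos] obtain d where
        d: "d > 0" "\<And>h. 0 < h \<Longrightarrow> t0 + h \<in> {0..1} \<Longrightarrow> h < d \<Longrightarrow> W t0 x0 < W (t0 + h) x0" by blast
      define h where "h = min (d / 2) (1 - t0)"
      have "0 < h" "h < d" "t0 + h \<in> {0..1}" using d(1) t1 m0 by (auto simp: h_def min_def)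
      then show False using d(2)[of h] max[of "t0 + h" x0] by simp
    qed
    have line: "\<And>s. W t0 (x0 + s *\<^sub>R axis i 1) \<le> W t0 (x0 + 0 *\<^sub>R axis i 1)" for i using max[OF m0] by simp
    have gh: "gradient (us t0) ?y $ i = gradient (us t0) x0 $ i \<and> hessian i i (us t0) ?y \<le> hessian i i (us t0) x0" for i
    proof -
      let ?\<phi> = "\<lambda>s. us t0 (?y + s *\<^sub>R axis i 1) - us t0 (x0 + s *\<^sub>R axis i 1)"
      have d1: "(?\<phi> has_real_derivative (gradient (us t0) (?y + s *\<^sub>R axis i 1) $ i - gradient (us t0) (x0 + s *\<^sub>R axis i 1) $ i)) (at s)" for s
        by (intro DERIV_diff C12_line[OF us_C_1_2 m0])
      have d2: "((\<lambda>s. gradient (us t0) (?y + s *\<^sub>R axis i 1) $ i - gradient (us t0) (x0 + s *\<^sub>R axis i 1) $ i)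
         has_real_derivative (hessian i i (us t0) (?y + 0 *\<^sub>R axis i 1) - hessian i i (us t0) (x0 + 0 *\<^sub>R axis i 1))) (at 0)"
        by (intro DERIV_diff C12_line2[OF us_C_1_2 m0])
      have "?\<phi> s \<le> ?\<phi> 0" for s using line[of s i] by (simp add: W_def algebra_simps)
      from second_derivative_max[OF d1 d2 this] show ?thesis by simp
    qed
    have p: "gradient (us t0) ?y = gradient (us t0) x0" using gh by (simp add: vec_eq_iff)
    have lap: "laplacian (us t0) ?y \<le> laplacian (us t0) x0" unfolding laplacian_def using gh by (intro sum_mono) blast
    have e1: "- time_deriv us t0 ?y - sigma D * laplacian (us t0) ?y + Hc D t0 ?y (gradient (us t0) ?y) = fc D t0 ?y (ms t0)"
      and e2: "- time_deriv us t0 x0 - sigma D * laplacian (us t0) x0 + Hc D t0 x0 (gradient (us t0) x0) = fc D t0 x0 (ms t0)"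
      using solution_parts(2) m0 by blast+
    have H: "\<bar>Hc D t0 ?y (gradient (us t0) x0) - Hc D t0 x0 (gradient (us t0) x0)\<bar> \<le> Lell D * norm z"
      using Hc_diff_x[OF m0, of ?y _ x0] by simp
    have F: "\<bar>fc D t0 ?y (ms t0) - fc D t0 x0 (ms t0)\<bar> \<le> Lf D * norm z"
      using torus_lipschitz_norm[OF f_lip_x[OF m0 ms_density[OF m0]], of ?y x0] data_pos by simp
    have "sigma D * laplacian (us t0) ?y \<le> sigma D * laplacian (us t0) x0" using lap sigma_pos by (intro mult_left_mono) auto
    then have "- time_deriv us t0 ?y + time_deriv us t0 x0 \<le> Lell D * norm z + Lf D * norm z"
      using e1 e2 H F unfolding p by linarith
    then show False using td \<epsilon> unfolding c_def by (simp add: algebra_simps)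
  qed
  have "W t x \<le> W 1 x0" using max[OF t, of x] \<open>t0 = 1\<close> by simp
  moreover have "us 1 (x0 + z) - us 1 x0 \<le> Lg D * norm z"
    using torus_lipschitz_norm[OF g_lip, of "x0 + z" x0] data_pos solution_parts(4) by (simp add: abs_le_iff)
  ultimately have "us t (x + z) - us t x \<le> Lg D * norm z + c * (1 - t)" unfolding W_def by (simp add: algebra_simps)
  also have "c * (1 - t) \<le> c * 1" using t c0 by (intro mult_left_mono) auto
  finally show "us t (x + z) - us t x \<le> (Lell D + Lf D + Lg D) * norm z + \<epsilon>" by (simp add: c_def algebra_simps)
qed

text \<open>
  The slope of \<open>us t\<close> in the direction of its own gradient is the norm of the gradient.
\<close>

lemma us_gradient_bound:
  assumes t: "t \<in> {0..1}"
  shows "norm (gradient (us t) x) \<le> sqrt (real CARD('d)) * (Lell D + Lf D + Lg D)"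
proof -
  define g where "g = gradient (us t) x"
  define L where "L = Lell D + Lf D + Lg D"
  have L: "L > 0" using data_pos by (simp add: L_def)
  have "norm g \<le> L"
  proof (rule ccontr)
    assume "\<not> norm g \<le> L"
    then have gL: "norm g > L" by simp
    define e where "e = sgn g"
    have g0: "g \<noteq> 0" using gL L by auto
    have e: "norm e = 1" using g0 by (simp add: e_def norm_sgn)
    have ge: "g \<bullet> e = norm g" using g0 by (simp add: e_def sgn_div_norm dot_square_norm power2_eq_square)
    have "GDERIV (us t) (x + 0 *\<^sub>R e) :> g" unfolding g_def
      using C_1_2_parts(3)[OF us_C_1_2] t has_gradientD[of "us t" x] by simp
    from GDERIV_line[OF this] have "((\<lambda>s. us t (x + s *\<^sub>R e)) has_real_derivative norm g) (at 0)" unfolding ge .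
    then have "((\<lambda>s. us t (x + s *\<^sub>R e) - L * s) has_real_derivative (norm g - L)) (at 0)"
      by (auto intro!: derivative_eq_intros)
    from DERIV_pos_inc_right[OF this] gL obtain d where
      d: "d > 0" "\<And>h. 0 < h \<Longrightarrow> h < d \<Longrightarrow> us t (x + 0 *\<^sub>R e) - L * 0 < us t (x + (0 + h) *\<^sub>R e) - L * (0 + h)" by force
    have "us t (x + (d / 2) *\<^sub>R e) - us t x > L * (d / 2)" using d(2)[of "d / 2"] d(1) by simp
    moreover have "us t (x + (d / 2) *\<^sub>R e) - us t x \<le> L * norm ((d / 2) *\<^sub>R e)"
      using us_lipschitz[OF t] unfolding L_def by blast
    ultimately show False using e d(1) by simp
  qed
  also have "L \<le> sqrt (real CARD('d)) * L"
  proof -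
    have "1 \<le> sqrt (real CARD('d))" by (simp add: Suc_leI)
    from mult_right_mono[OF this, of L] L show ?thesis by simp
  qed
  finally show ?thesis by (simp add: g_def L_def)
qed

end

section \<open>Consistency of the scheme\<close>

lemma laplacian_periodic: "periodic f \<Longrightarrow> periodic (laplacian f)"
  using hessian_periodic[of f] unfolding periodic_def laplacian_def by simp

lemma lap_h_osc:
  fixes f :: "real ^ 'd::finite \<Rightarrow> real"
  assumes "\<And>i. \<bar>f (up N i x) - f x\<bar> \<le> b" "\<And>i. \<bar>f (down N i x) - f x\<bar> \<le> b"
  shows "\<bar>lap_h N f x\<bar> \<le> (real N)\<^sup>2 * (2 * real CARD('d) * b)"
proof -
  have "\<bar>f (up N i x) + f (down N i x) - 2 * f x\<bar> \<le> 2 * b" for i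
    using assms(1)[of i] assms(2)[of i] by linarith
  then have "(\<Sum>i\<in>UNIV. \<bar>f (up N i x) + f (down N i x) - 2 * f x\<bar>) \<le> (\<Sum>i\<in>(UNIV::'d set). 2 * b)" by (intro sum_mono)
  then have "\<bar>\<Sum>i\<in>UNIV. f (up N i x) + f (down N i x) - 2 * f x\<bar> \<le> 2 * real CARD('d) * b"
    by (intro order_trans[OF sum_abs]) simp
  then show ?thesis unfolding lap_h_alt abs_mult by (simp add: mult_left_mono)
qed

lemma axis_step_tnorm: "tnorm (x + a *\<^sub>R axis i 1 - x :: real ^ 'd::finite) \<le> \<bar>a\<bar>" "tnorm (x - a *\<^sub>R axis i 1 - x :: real ^ 'd::finite) \<le> \<bar>a\<bar>"
  using tnorm_le_norm[of "a *\<^sub>R axis i 1 :: real ^ 'd"] tnorm_le_norm[of "- (a *\<^sub>R axis i 1) :: real ^ 'd"] by auto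

context mfg
begin

text \<open>
  The mesh condition reads \<open>dt \<le> Ct h\<^sup>2\<close>.
\<close>

definition Ct :: real where "Ct = 1 / (2 * real CARD('d) * (1 - \<theta>) * \<sigma>)"

lemma Ct_pos: "Ct > 0" using th_one sigma_pos by (simp add: Ct_def)

text \<open>
  Consistency constants, each for an error of order \<open>h\<^sup>r\<close>: \<open>CL\<close> for the Laplacian and \<open>CG\<close> for
  the gradient of the value function after the implicit half step, \<open>CH\<close> for the right-hand side of the
  HJB equation.
\<close>

definition CL :: "real \<Rightarrow> real" where
  "CL K = real CARD('d) * K * (1 + 2 * \<theta> * \<sigma> * Ct * real CARD('d) + Ct powr (r / 2))"

definition CG :: "real \<Rightarrow> real" where
  "CG K = real CARD('d) * (K * (2 * real CARD('d) * \<theta> * \<sigma> * Ct + 1 + Ct powr (r / 2)))"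

definition CH :: "real \<Rightarrow> real \<Rightarrow> real" where
  "CH K Km = K * Ct powr (r / 2) + \<sigma> * CL K + M * CG K + Lf D * (real CARD('d) + Km * real CARD('d))"

lemma us_C: "holder_const r K us \<Longrightarrow> t \<in> {0..1} \<Longrightarrow> \<bar>laplacian (us t) x\<bar> \<le> real CARD('d) * K"
  by (rule laplacian_bound[OF us_C_1_2 _ r_pos r_one])

end

lemma box_h_norm:
  fixes x :: "real ^ 'd::finite"
  assumes "y \<in> box_h N x" "y' \<in> box_h N x" shows "norm (y - y') \<le> real CARD('d) * (1 / real N)"
proof -
  have "\<bar>(y - y') $ i\<bar> \<le> 1 / real N" for i
  proof -
    define a where "a = 1 / real N"
    have "x $ i - a / 2 \<le> y $ i" "y $ i < x $ i + a / 2" "x $ i - a / 2 \<le> y' $ i" "y' $ i < x $ i + a / 2"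
      using assms unfolding box_h_def a_def by auto
    then have "\<bar>(y - y') $ i\<bar> \<le> a" by (simp add: abs_le_iff)
    then show ?thesis by (simp add: a_def)
  qed
  then have "(\<Sum>i\<in>UNIV. \<bar>(y - y') $ i\<bar>) \<le> (\<Sum>i\<in>(UNIV::'d set). 1 / real N)" by (intro sum_mono)
  then show ?thesis by (intro order_trans[OF norm_le_l1_cart]) simp
qed

lemma box_h_center: "N > 0 \<Longrightarrow> x \<in> box_h N x" by (simp add: box_h_def)

context mfg_grid
begin

abbreviation "h \<equiv> 1 / real N"
abbreviation "\<rho> \<equiv> (1 / real N) powr r"

lemma h_facts: "0 < h" "h \<le> 1" "h \<le> \<rho>" "0 < \<rho>" "\<rho> \<le> 1" "dt \<le> Ct * h\<^sup>2"
   "dt powr (r / 2) \<le> Ct powr (r / 2) * \<rho>" "dt powr ((1 + r) / 2) \<le> Ct powr (r / 2) * \<rho>"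
proof -
  show h: "0 < h" "h \<le> 1" using TN by simp_all
  have "h powr 1 \<le> \<rho>" using h r_one by (intro powr_mono') auto
  then show "h \<le> \<rho>" using h by simp
  show "0 < \<rho>" using h by simp
  show "\<rho> \<le> 1" using h r_pos powr_mono2[of r h 1] by simp
  show dt: "dt \<le> Ct * h\<^sup>2" using cfl unfolding cfl_def Ct_def by simp
  have "dt powr (r / 2) \<le> (Ct * h\<^sup>2) powr (r / 2)" using dt TN r_pos by (intro powr_mono2) auto
  also have "\<dots> = Ct powr (r / 2) * (h powr 2) powr (r / 2)"
    using Ct_pos h(1) by (simp only: powr_mult powr_numeral less_imp_le zero_le_power2)
  also have "(h powr 2) powr (r / 2) = \<rho>" by (simp only: powr_powr) simp
  finally show d: "dt powr (r / 2) \<le> Ct powr (r / 2) * \<rho>" .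
  have "dt powr ((1 + r) / 2) \<le> dt powr (r / 2)" using TN by (intro powr_mono') auto
  then show "dt powr ((1 + r) / 2) \<le> Ct powr (r / 2) * \<rho>" using d by linarith
qed

lemma tm_step: "tm T (Suc t) - tm T t = dt" "tm T t < tm T (Suc t)"
  using TN by (simp_all add: field_simps)

lemma \<tau>_bounds: "th.\<tau> * (real N)\<^sup>2 \<le> \<theta> * \<sigma> * Ct" "th.\<tau> * real N \<le> \<theta> * \<sigma> * Ct * h" "th.\<tau> \<ge> 0"
proof -
  have pos: "\<theta> * \<sigma> \<ge> 0" using th_half sigma_pos by simp
  have "dt * (real N)\<^sup>2 \<le> Ct * h\<^sup>2 * (real N)\<^sup>2" by (intro mult_right_mono h_facts(6)) simp
  also have "\<dots> = Ct" using TN by (simp add: power_divide)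
  finally have "\<theta> * \<sigma> * (dt * (real N)\<^sup>2) \<le> \<theta> * \<sigma> * Ct" by (rule mult_left_mono[OF _ pos])
  then show "th.\<tau> * (real N)\<^sup>2 \<le> \<theta> * \<sigma> * Ct" by (simp add: th.\<tau>_def mult_ac)
  have "dt * real N \<le> Ct * h\<^sup>2 * real N" by (intro mult_right_mono h_facts(6)) simp
  also have "\<dots> = Ct * h" using TN by (simp add: power2_eq_square)
  finally have "\<theta> * \<sigma> * (dt * real N) \<le> \<theta> * \<sigma> * (Ct * h)" by (rule mult_left_mono[OF _ pos])
  then show "th.\<tau> * real N \<le> \<theta> * \<sigma> * Ct * h" by (simp add: th.\<tau>_def mult_ac)
  show "th.\<tau> \<ge> 0" by (rule th.\<tau>)
qed

text \<open>
  \<open>B g - g = \<tau> lap_h (B g)\<close>, and \<open>B\<close> commutes with the discrete Laplacian.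
\<close>

lemma B_minus_id: 
  assumes x: "x \<in> grid N" and b: "\<And>y. y \<in> grid N \<Longrightarrow> \<bar>lap_h N g y\<bar> \<le> b"
  shows "\<bar>B g x - g x\<bar> \<le> th.\<tau> * b"
proof -
  have "B g x - th.\<tau> * lap_h N (B g) x = g x" by (rule resolv_eq[OF th.\<tau> x])
  then have "B g x - g x = th.\<tau> * B (lap_h N g) x" using markov_lap[OF th.markov_B x, of g] by simp
  moreover have "\<bar>B (lap_h N g) x\<bar> \<le> b" by (rule markov_bound[OF th.markov_B x b])
  ultimately show ?thesis using th.\<tau> by (simp add: abs_mult mult_left_mono)
qed

context
  fixes K :: real and t :: nat
  assumes K: "holder_const r K us" and t: "t < T"
begin

lemma tm01: "tm T t \<in> {0..1}" "tm T (Suc t) \<in> {0..1}"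
  using tm_in[OF TN(1), of t] tm_in[OF TN(1), of "Suc t"] t by simp_all

text \<open>
  The implicit half step commutes with the discrete Laplacian. It moves a function that is Hoelder
  continuous with exponent \<open>r\<close> by at most a multiple of \<open>h\<^sup>r\<close>, since the discrete Laplacian of such a
  function is of order \<open>h\<^bsup>r-2\<^esup>\<close> and \<open>\<tau>\<close> is of order \<open>h\<^sup>2\<close>.
\<close>

lemma lap_halfstep:
  assumes x: "x \<in> grid N"
  shows "\<bar>lap_h N (B (us (tm T (Suc t)))) x - laplacian (us (tm T t)) x\<bar> \<le> CL K * \<rho>"
proof -
  define \<tau>1 where "\<tau>1 = tm T (Suc t)"
  define \<tau>0 where "\<tau>0 = tm T t"
  note t01 = tm01[folded \<tau>1_def \<tau>0_def]
  have K0: "K > 0" by (rule holder_constD(1)[OF K])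
  let ?l = "laplacian (us \<tau>1)" let ?d = "real CARD('d)"
  have lp: "periodic ?l" by (intro laplacian_periodic us_periodic t01)
  have e1: "\<bar>lap_h N (us \<tau>1) y - ?l y\<bar> \<le> ?d * K * \<rho>" for y
    unfolding lap_h_lapc[OF us_periodic[OF t01(2)]]
    by (rule lapc_consistent[OF us_C_1_2 K r_pos r_one t01(2) TN(2)])
  have "\<bar>B (\<lambda>y. lap_h N (us \<tau>1) y - ?l y) x\<bar> \<le> ?d * K * \<rho>"
    by (rule markov_bound[OF th.markov_B x e1])
  then have a1: "\<bar>B (lap_h N (us \<tau>1)) x - B ?l x\<bar> \<le> ?d * K * \<rho>"
    by (simp only: markov_diff[OF th.markov_B x])
  have osc: "\<bar>?l (up N i y) - ?l y\<bar> \<le> ?d * K * \<rho>" "\<bar>?l (down N i y) - ?l y\<bar> \<le> ?d * K * \<rho>" for i y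
  proof -
    have *: "\<bar>?l z - ?l y\<bar> \<le> ?d * K * \<rho>" if "tnorm (z - y) \<le> h" for z
    proof -
      have "\<bar>?l z - ?l y\<bar> \<le> ?d * K * tnorm (z - y) powr r" by (rule laplacian_space[OF us_C_1_2 K r_pos r_one t01(2)])
      also have "\<dots> \<le> ?d * K * \<rho>" using that tnorm_nonneg r_pos K0 by (intro mult_left_mono powr_mono2) auto
      finally show ?thesis .
    qed
    show "\<bar>?l (up N i y) - ?l y\<bar> \<le> ?d * K * \<rho>" "\<bar>?l (down N i y) - ?l y\<bar> \<le> ?d * K * \<rho>"
      unfolding periodic_up_down[OF lp] using axis_step_tnorm(1)[of y h i] axis_step_tnorm(2)[of y h i] by (intro *; simp)+
  qed
  have "\<bar>B ?l x - ?l x\<bar> \<le> th.\<tau> * ((real N)\<^sup>2 * (2 * ?d * (?d * K * \<rho>)))"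
    by (rule B_minus_id[OF x lap_h_osc]) (rule osc)+
  also have "\<dots> = (th.\<tau> * (real N)\<^sup>2) * (2 * ?d * (?d * K * \<rho>))" by (simp only: mult_ac)
  also have "\<dots> \<le> (\<theta> * \<sigma> * Ct) * (2 * ?d * (?d * K * \<rho>))"
    using K0 by (intro mult_right_mono \<tau>_bounds) simp_all
  finally have a2: "\<bar>B ?l x - ?l x\<bar> \<le> (\<theta> * \<sigma> * Ct) * (2 * ?d * (?d * K * \<rho>))" .
  have "\<bar>?l x - laplacian (us \<tau>0) x\<bar> \<le> ?d * K * \<bar>\<tau>1 - \<tau>0\<bar> powr (r / 2)"
    by (rule laplacian_time[OF us_C_1_2 K r_pos r_one t01(2,1)])
  also have "\<bar>\<tau>1 - \<tau>0\<bar> = dt" unfolding \<tau>1_def \<tau>0_def tm_step(1) by simp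
  also have "?d * K * dt powr (r / 2) \<le> ?d * K * (Ct powr (r / 2) * \<rho>)" using K0 by (intro mult_left_mono h_facts) simp
  finally have a3: "\<bar>?l x - laplacian (us \<tau>0) x\<bar> \<le> ?d * K * (Ct powr (r / 2) * \<rho>)" .
  have "CL K * \<rho> = ?d * K * \<rho> + (\<theta> * \<sigma> * Ct) * (2 * ?d * (?d * K * \<rho>)) + ?d * K * (Ct powr (r / 2) * \<rho>)"
    unfolding CL_def by (simp only: algebra_simps)
  moreover have "lap_h N (B (us \<tau>1)) x = B (lap_h N (us \<tau>1)) x" by (rule markov_lap[OF th.markov_B x, symmetric])
  ultimately show ?thesis unfolding \<tau>1_def[symmetric] \<tau>0_def[symmetric] using a1 a2 a3 by linarith
qed

text \<open>
  The half step changes the value function by \<open>\<tau> lap_h w\<close> with \<open>lap_h w\<close> bounded. The gradient of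
  this costs a factor \<open>1 / h\<close>, and \<open>\<tau> / h\<close> is of order \<open>h\<close>.
\<close>

lemma grad_halfstep:
  assumes x: "x \<in> grid N"
  shows "norm (grad_h N (B (us (tm T (Suc t)))) x - gradient (us (tm T t)) x) \<le> CG K * \<rho>"
proof -
  define \<tau>1 where "\<tau>1 = tm T (Suc t)"
  define \<tau>0 where "\<tau>0 = tm T t"
  note t01 = tm01[folded \<tau>1_def \<tau>0_def]
  have K0: "K > 0" by (rule holder_constD(1)[OF K])
  let ?d = "real CARD('d)" and ?w = "B (us \<tau>1)"
  have "\<bar>lap_h N (us \<tau>1) y\<bar> \<le> 2 * ?d * K" for y
  proof -
    have "\<bar>lap_h N (us \<tau>1) y - laplacian (us \<tau>1) y\<bar> \<le> ?d * K * \<rho>"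
      unfolding lap_h_lapc[OF us_periodic[OF t01(2)]]
      by (rule lapc_consistent[OF us_C_1_2 K r_pos r_one t01(2) TN(2)])
    moreover have "?d * K * \<rho> \<le> ?d * K * 1" using K0 by (intro mult_left_mono h_facts) simp
    moreover have "\<bar>laplacian (us \<tau>1) y\<bar> \<le> ?d * K" by (rule us_C[OF K t01(2)])
    ultimately show ?thesis by linarith
  qed
  then have lw: "\<bar>lap_h N ?w y\<bar> \<le> 2 * ?d * K" if "y \<in> grid N" for y
    unfolding markov_lap[OF th.markov_B that, symmetric] by (intro markov_bound[OF th.markov_B that])
  have "\<bar>(grad_h N ?w x - gradient (us \<tau>0) x) $ i\<bar> \<le> K * (2 * ?d * \<theta> * \<sigma> * Ct + 1 + Ct powr (r / 2)) * \<rho>" for i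
  proof -
    have "grad_h N (\<lambda>y. ?w y - us \<tau>1 y) x = grad_h N (\<lambda>y. th.\<tau> * lap_h N ?w y) x"
      by (rule grad_h_cong[OF x]) (use resolv_eq[OF th.\<tau>, of _ N "us \<tau>1"] in \<open>simp add: algebra_simps\<close>)
    then have "grad_h N ?w x $ i - grad_h N (us \<tau>1) x $ i = th.\<tau> * (lap_h N ?w (up N i x) - lap_h N ?w (down N i x)) * real N / 2"
      unfolding grad_h_diff by (simp add: vec_eq_iff grad_h_nth algebra_simps)
    also have "\<dots> = (th.\<tau> * real N) * ((lap_h N ?w (up N i x) - lap_h N ?w (down N i x)) / 2)" by simp
    finally have eq: "grad_h N ?w x $ i - grad_h N (us \<tau>1) x $ i = (th.\<tau> * real N) * ((lap_h N ?w (up N i x) - lap_h N ?w (down N i x)) / 2)" .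
    have leK: "\<bar>(lap_h N ?w (up N i x) - lap_h N ?w (down N i x)) / 2\<bar> \<le> 2 * ?d * K"
    proof -
      have *: "\<bar>(a - b) / 2\<bar> \<le> c" if "\<bar>a\<bar> \<le> c" "\<bar>b\<bar> \<le> c" for a b c :: real
        using that by (auto simp: abs_le_iff field_simps)
      show ?thesis by (rule *[OF lw[OF up_grid[OF x, of i]] lw[OF down_grid[OF x, of i]]])
    qed
    have "\<bar>grad_h N ?w x $ i - grad_h N (us \<tau>1) x $ i\<bar> \<le> (th.\<tau> * real N) * (2 * ?d * K)"
    proof -
      have nn: "th.\<tau> * real N \<ge> 0" using th.\<tau> by simp
      have le: "\<bar>(lap_h N ?w (up N i x) - lap_h N ?w (down N i x)) / 2\<bar> \<le> 2 * ?d * K"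
        by (rule leK)
      show ?thesis unfolding eq abs_mult[of "th.\<tau> * real N"] abs_of_nonneg[OF nn] by (rule mult_left_mono[OF le nn])
    qed
    also have "\<dots> \<le> (\<theta> * \<sigma> * Ct * h) * (2 * ?d * K)" using K0 by (intro mult_right_mono \<tau>_bounds) simp
    also have "\<dots> \<le> (\<theta> * \<sigma> * Ct * \<rho>) * (2 * ?d * K)"
      using K0 Ct_pos sigma_pos th_half by (intro mult_right_mono mult_left_mono h_facts) simp_all
    finally have b1: "\<bar>grad_h N ?w x $ i - grad_h N (us \<tau>1) x $ i\<bar> \<le> (\<theta> * \<sigma> * Ct * \<rho>) * (2 * ?d * K)" .
    have "\<bar>grad_h N (us \<tau>1) x $ i - gradient (us \<tau>1) x $ i\<bar> \<le> K * h"
      unfolding grad_h_gradc[OF us_periodic[OF t01(2)]] by (rule gradc_consistent[OF us_C_1_2 K r_pos r_one t01(2) TN(2)])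
    moreover have "K * h \<le> K * \<rho>" using K0 by (intro mult_left_mono h_facts) simp
    ultimately have b2: "\<bar>grad_h N (us \<tau>1) x $ i - gradient (us \<tau>1) x $ i\<bar> \<le> K * \<rho>" by linarith
    have "\<bar>gradient (us \<tau>1) x $ i - gradient (us \<tau>0) x $ i\<bar> \<le> K * \<bar>\<tau>1 - \<tau>0\<bar> powr ((1 + r) / 2)"
      by (rule holder_constD(3)[OF K t01(2,1)])
    also have "\<bar>\<tau>1 - \<tau>0\<bar> = dt" unfolding \<tau>1_def \<tau>0_def tm_step(1) by simp
    also have "K * dt powr ((1 + r) / 2) \<le> K * (Ct powr (r / 2) * \<rho>)" using K0 by (intro mult_left_mono h_facts) simp
    finally have b3: "\<bar>gradient (us \<tau>1) x $ i - gradient (us \<tau>0) x $ i\<bar> \<le> K * (Ct powr (r / 2) * \<rho>)" .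
    have "K * (2 * ?d * \<theta> * \<sigma> * Ct + 1 + Ct powr (r / 2)) * \<rho> =
      (\<theta> * \<sigma> * Ct * \<rho>) * (2 * ?d * K) + K * \<rho> + K * (Ct powr (r / 2) * \<rho>)" by (simp only: algebra_simps)
    then show ?thesis using b1 b2 b3 by (simp only: vector_minus_component)
  qed
  then have "(\<Sum>i\<in>UNIV. \<bar>(grad_h N ?w x - gradient (us \<tau>0) x) $ i\<bar>) \<le>
     (\<Sum>i\<in>(UNIV::'d set). K * (2 * ?d * \<theta> * \<sigma> * Ct + 1 + Ct powr (r / 2)) * \<rho>)" by (intro sum_mono)
  also have "\<dots> = CG K * \<rho>" unfolding CG_def by simp
  finally show ?thesis unfolding \<tau>1_def[symmetric] \<tau>0_def[symmetric] by (intro order_trans[OF norm_le_l1_cart])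
qed

text \<open>
  By the gradient bound for \<open>us\<close>, both velocities are the same Lipschitz function of the respective
  gradients.
\<close>

lemma velocity_consistent:
  assumes x: "x \<in> grid N"
  shows "norm (feedback (\<lambda>t. us (tm T t)) t x - vs (tm T t) x) \<le> CG K / \<alpha> * \<rho>"
proof -
  have tT: "t \<le> T" using t by simp
  have "vs (tm T t) x = - gradient (Hc D (tm T t) x) (gradient (us (tm T t)) x)"
    using solution_parts(2) tm01(1) by blast
  also have "\<dots> = Vopt (tm T t) x (gradient (us (tm T t)) x)"
    unfolding Hc_eq_Ham(2)[OF TN(1) tT us_gradient_bound[OF tm01(1)]] by simp
  finally have v: "vs (tm T t) x = Vopt (tm T t) x (gradient (us (tm T t)) x)" .
  have "norm (Vopt (tm T t) x (grad_h N (B (us (tm T (Suc t)))) x) - Vopt (tm T t) x (gradient (us (tm T t)) x))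
     \<le> norm (grad_h N (B (us (tm T (Suc t)))) x - gradient (us (tm T t)) x) / \<alpha>"
    by (rule Vopt_lipschitz[OF TN(1) tT])
  also have "\<dots> \<le> CG K * \<rho> / \<alpha>" using data_pos by (intro divide_right_mono grad_halfstep x) simp
  finally show ?thesis using t x unfolding V_op_eq v by simp
qed

end

lemma L2_dist_average:
  assumes K: "holder_const r K ms" and t: "t \<in> {0..1}"
  shows "L2_dist (R_h N (I_h N (ms t))) (ms t) \<le> K * (real CARD('d) * h)"
proof -
  let ?m = "I_h N (ms t)" let ?c = "K * (real CARD('d) * h)" let ?V = "h ^ CARD('d)"
  have K0: "K > 0" by (rule holder_constD(1)[OF K])
  have bb: "bdd_borel (\<lambda>y. R_h N ?m y - ms t y)" by (intro bdd_borel_diff R_h_bdd_borel ms_bdd_borel t)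
  have pp: "periodic (\<lambda>y. R_h N ?m y - ms t y)" using R_h_periodic[of N ?m] ms_periodic[OF t] unfolding periodic_def by simp
  have close: "\<bar>R_h N ?m y - ms t y\<bar> \<le> ?c" if x: "x \<in> grid N" and y: "y \<in> box_h N x" for x y
  proof -
    have "\<bar>?m x / ?V - ms t y\<bar> \<le> ?c"
      unfolding I_h_def
    proof (rule box_average_bound[OF TN(2) ms_bdd_borel[OF t]])
      fix z assume "z \<in> box_h N x"
      have "\<bar>ms t z - ms t y\<bar> \<le> K * norm (z - y)" by (rule space_lipschitz[OF ms_C_1_2 K r_pos r_one t])
      also have "\<dots> \<le> ?c" using K0 box_h_norm[OF \<open>z \<in> box_h N x\<close> y] by (intro mult_left_mono) auto
      finally show "\<bar>ms t z - ms t y\<bar> \<le> ?c" .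
    qed
    then show ?thesis unfolding R_h_box[OF TN(2) x y] .
  qed
  have "(LINT y:cube|lborel. (R_h N ?m y - ms t y)\<^sup>2) = (\<Sum>x\<in>grid N. LINT y:box_h N x|lborel. (R_h N ?m y - ms t y)\<^sup>2)"
    using bdd_borel_mult[OF bb bb] pp unfolding power2_eq_square
    by (intro integral_cube_boxes TN) (simp_all add: periodic_def)
  also have "\<dots> \<le> (\<Sum>x\<in>(grid N :: (real ^ 'd) set). ?c\<^sup>2 * ?V)"
  proof (rule sum_mono)
    fix x :: "real ^ 'd" assume x: "x \<in> grid N"
    have "\<bar>LINT y:box_h N x|lborel. (R_h N ?m y - ms t y)\<^sup>2\<bar> \<le> ?c\<^sup>2 * ?V"
    proof (rule integral_box_bound[OF TN(2)])
      show "bdd_borel (\<lambda>y. (R_h N ?m y - ms t y)\<^sup>2)" using bdd_borel_mult[OF bb bb] by (simp only: power2_eq_square)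
      fix y assume "y \<in> box_h N x"
      show "\<bar>(R_h N ?m y - ms t y)\<^sup>2\<bar> \<le> ?c\<^sup>2" using power_mono[OF close[OF x \<open>y \<in> box_h N x\<close>], of 2] by simp
    qed
    then show "(LINT y:box_h N x|lborel. (R_h N ?m y - ms t y)\<^sup>2) \<le> ?c\<^sup>2 * ?V" by linarith
  qed
  also have "\<dots> = ?c\<^sup>2" using TN(2) by (simp add: card_grid power_divide)
  finally have "L2_dist (R_h N ?m) (ms t) \<le> sqrt (?c\<^sup>2)" unfolding L2_dist_def by (rule real_sqrt_le_mono)
  also have "sqrt (?c\<^sup>2) = ?c" using K0 by simp
  finally show ?thesis .
qed

lemma f_disc_consistent:
  assumes K: "holder_const r K ms" and t: "t \<le> T"
  shows "\<bar>f_disc D T N t x (I_h N (ms (tm T t))) - fc D (tm T t) x (ms (tm T t))\<bar> \<le> Lf D * (real CARD('d) + K * real CARD('d)) * h"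
proof -
  let ?d = "real CARD('d)"
  define \<tau>0 where "\<tau>0 = tm T t"
  have t0: "\<tau>0 \<in> {0..1}" unfolding \<tau>0_def by (rule tm_in[OF TN(1) t])
  let ?R = "R_h N (I_h N (ms \<tau>0))" let ?V = "h ^ CARD('d)"
  have R: "?R \<in> densities" by (intro prob_density TN I_h_prob t0)
  let ?c = "Lf D * (?d + K * ?d) * h"
  have "\<bar>(LINT y:box_h N x|lborel. fc D \<tau>0 y ?R) / ?V - fc D \<tau>0 x (ms \<tau>0)\<bar> \<le> ?c"
  proof (rule box_average_bound[OF TN(2) fc_bdd_borel[OF t0 R]])
    fix y assume y: "y \<in> box_h N x"
    have "\<bar>fc D \<tau>0 y ?R - fc D \<tau>0 x ?R\<bar> \<le> Lf D * norm (y - x)"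
      using data_pos by (intro torus_lipschitz_norm[OF f_lip_x[OF t0 R]]) simp
    also have "\<dots> \<le> Lf D * (?d * h)" using data_pos box_h_norm[OF y box_h_center[OF TN(2)]] by (intro mult_left_mono) auto
    finally have 1: "\<bar>fc D \<tau>0 y ?R - fc D \<tau>0 x ?R\<bar> \<le> Lf D * (?d * h)" .
    have "\<bar>fc D \<tau>0 x ?R - fc D \<tau>0 x (ms \<tau>0)\<bar> \<le> Lf D * L2_dist ?R (ms \<tau>0)"
      by (rule f_lip_m[OF t0 R ms_density[OF t0]])
    also have "\<dots> \<le> Lf D * (K * (?d * h))" using data_pos by (intro mult_left_mono L2_dist_average K t0) simp
    finally have 2: "\<bar>fc D \<tau>0 x ?R - fc D \<tau>0 x (ms \<tau>0)\<bar> \<le> Lf D * (K * (?d * h))" .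
    have "?c = Lf D * (?d * h) + Lf D * (K * (?d * h))" by (simp only: algebra_simps)
    then show "\<bar>fc D \<tau>0 y ?R - fc D \<tau>0 x (ms \<tau>0)\<bar> \<le> ?c" using 1 2 by linarith
  qed
  then show ?thesis unfolding f_disc_def \<tau>0_def by (simp only: mult_1_left times_divide_eq_left)
qed

text \<open>
  The running cost for which the restriction of \<open>us\<close> to the grid solves the discrete
  Hamilton-Jacobi-Bellman equation exactly.
\<close>

definition Fhat :: "nat \<Rightarrow> real ^ 'd \<Rightarrow> real" where
  "Fhat t x = (us (tm T t) x - E (B (us (tm T (Suc t)))) x) / dt + Ham D T t x (grad_h N (B (us (tm T (Suc t)))) x)"

lemma hjb_eq_trace: "hjb_eq (\<lambda>t. us (tm T t)) Fhat"
  unfolding hjb_eq_def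
proof (intro conjI ballI allI impI)
  fix x :: "real ^ 'd"
  have "tm T T = 1" using TN by simp
  then show "us (tm T T) x = gc D x" using solution_parts(4) by (simp only:)
next
  fix t x
  show "us (tm T t) x = E (B (us (tm T (Suc t)))) x
      + dt * (Fhat t x - Ham D T t x (grad_h N (B (us (tm T (Suc t)))) x))"
    using TN unfolding Fhat_def by (simp only: add_diff_cancel_right') simp
qed

lemma hjb_consistent:
  assumes K: "holder_const r K us" and Km: "holder_const r Km ms" and t: "t < T" and x: "x \<in> grid N"
  shows "\<bar>Fhat t x - f_disc D T N t x (I_h N (ms (tm T t)))\<bar> \<le> CH K Km * \<rho>"
proof -
  let ?d = "real CARD('d)"
  define \<tau>1 where "\<tau>1 = tm T (Suc t)"
  define \<tau>0 where "\<tau>0 = tm T t"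
  note t01 = tm01[OF K t, folded \<tau>1_def \<tau>0_def]
  have K0: "K > 0" by (rule holder_constD(1)[OF K])
  have Km0: "Km > 0" by (rule holder_constD(1)[OF Km])
  have tT: "t \<le> T" using t by simp
  let ?w = "B (us \<tau>1)" let ?p = "grad_h N ?w x" let ?q = "gradient (us \<tau>0) x"
  have dtpos: "dt > 0" using TN by simp
  have "?w x - th.\<tau> * lap_h N ?w x = us \<tau>1 x" by (rule resolv_eq[OF th.\<tau> x])
  then have "E ?w x = us \<tau>1 x + (th.\<tau> + th.\<kappa>) * lap_h N ?w x" unfolding expl_def by (simp add: algebra_simps)
  also have "th.\<tau> + th.\<kappa> = \<sigma> * dt" unfolding th.\<tau>_def th.\<kappa>_def by (simp add: algebra_simps)
  finally have "(us \<tau>0 x - E ?w x) / dt = - ((us \<tau>1 x - us \<tau>0 x) / dt) - \<sigma> * lap_h N ?w x"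
    using dtpos TN by (simp add: field_simps)
  then have F: "Fhat t x = - ((us \<tau>1 x - us \<tau>0 x) / dt) - \<sigma> * lap_h N ?w x + Ham D T t x ?p"
    unfolding Fhat_def \<tau>1_def[symmetric] \<tau>0_def[symmetric] by simp
  have eq: "- time_deriv us \<tau>0 x - \<sigma> * laplacian (us \<tau>0) x + Hc D \<tau>0 x ?q = fc D \<tau>0 x (ms \<tau>0)"
    using solution_parts(2) t01(1) by blast
  have H: "Hc D \<tau>0 x ?q = Ham D T t x ?q"
    unfolding \<tau>0_def by (rule Hc_eq_Ham(1)[OF TN(1) tT us_gradient_bound[OF tm01(1)[OF K t]]])
  have d: "\<tau>1 - \<tau>0 = dt" "\<tau>0 < \<tau>1" unfolding \<tau>1_def \<tau>0_def by (rule tm_step)+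
  have "\<bar>(us \<tau>1 x - us \<tau>0 x) / (\<tau>1 - \<tau>0) - time_deriv us \<tau>0 x\<bar> \<le> K * (\<tau>1 - \<tau>0) powr (r / 2)"
    by (rule time_difference[OF us_C_1_2 K r_pos r_one t01(1,2) d(2)])
  also have "\<dots> \<le> K * (Ct powr (r / 2) * \<rho>)" unfolding d(1) using K0 by (intro mult_left_mono h_facts) simp
  finally have a1: "\<bar>(us \<tau>1 x - us \<tau>0 x) / dt - time_deriv us \<tau>0 x\<bar> \<le> K * (Ct powr (r / 2) * \<rho>)" unfolding d(1) .
  have "\<bar>lap_h N ?w x - laplacian (us \<tau>0) x\<bar> \<le> CL K * \<rho>"
    unfolding \<tau>1_def \<tau>0_def by (rule lap_halfstep[OF K t x])
  then have "\<bar>\<sigma> * (lap_h N ?w x - laplacian (us \<tau>0) x)\<bar> \<le> \<sigma> * (CL K * \<rho>)" using sigma_pos by (simp add: abs_mult)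
  then have a2: "\<bar>\<sigma> * lap_h N ?w x - \<sigma> * laplacian (us \<tau>0) x\<bar> \<le> \<sigma> * (CL K * \<rho>)" by (simp only: right_diff_distrib)
  have "\<bar>Ham D T t x ?p - Ham D T t x ?q\<bar> \<le> M * norm (?p - ?q)" by (rule Ham_lipschitz[OF TN(1) tT])
  also have "\<dots> \<le> M * (CG K * \<rho>)" using M_pos grad_halfstep[OF K t x] unfolding \<tau>1_def \<tau>0_def by (intro mult_left_mono) auto
  finally have a3: "\<bar>Ham D T t x ?p - Ham D T t x ?q\<bar> \<le> M * (CG K * \<rho>)" .
  have "\<bar>f_disc D T N t x (I_h N (ms \<tau>0)) - fc D \<tau>0 x (ms \<tau>0)\<bar> \<le> Lf D * (?d + Km * ?d) * h"
    unfolding \<tau>0_def by (rule f_disc_consistent[OF Km tT])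
  also have "\<dots> \<le> Lf D * (?d + Km * ?d) * \<rho>" using data_pos Km0 by (intro mult_left_mono h_facts) simp
  finally have a4: "\<bar>f_disc D T N t x (I_h N (ms \<tau>0)) - fc D \<tau>0 x (ms \<tau>0)\<bar> \<le> Lf D * (?d + Km * ?d) * \<rho>" .
  have "CH K Km * \<rho> = K * (Ct powr (r / 2) * \<rho>) + \<sigma> * (CL K * \<rho>) + M * (CG K * \<rho>) + Lf D * (?d + Km * ?d) * \<rho>"
    unfolding CH_def by (simp only: algebra_simps)
  then show ?thesis unfolding F \<tau>0_def[symmetric] using a1 a2 a3 a4 eq H by linarith
qed

end

text \<open>
  A nonempty open set is not negligible.
\<close>

lemma AE_le_imp_le:
  fixes G :: "real \<Rightarrow> real"
  assumes c: "continuous_on {0..1} G" and ae: "AE t in lborel. t \<in> {0..1} \<longrightarrow> G t \<le> b" and t: "t \<in> {0..1}"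
  shows "G t \<le> b"
proof -
  let ?U = "{t \<in> {0<..<1}. b < G t}"
  have "open ?U"
  proof -
    have "open ({0<..<1} \<inter> G -` {b<..})"
      by (intro continuous_open_preimage continuous_on_subset[OF c]) auto
    moreover have "?U = {0<..<1} \<inter> G -` {b<..}" by auto
    ultimately show ?thesis by simp
  qed
  then have U: "open ?U" .
  have "?U = {}"
  proof (rule ccontr)
    assume "?U \<noteq> {}"
    then have nn: "\<not> negligible ?U" using U open_not_negligible by blast
    have "AE t in lborel. t \<notin> ?U" using ae by eventually_elim auto
    then have "AE t in lebesgue. t \<notin> ?U" by (rule AE_completion)
    moreover have "?U \<in> sets lebesgue" using U by simp
    ultimately have "negligible ?U" unfolding negligible_iff_null_sets using AE_iff_null_sets[of ?U lebesgue] by blast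
    then show False using nn by blast
  qed
  then have le: "G s \<le> b" if "s \<in> {0<..<1}" for s using that by force
  have "closure {0<..<1::real} = {0..1}" by simp
  then show ?thesis using continuous_le_on_closure[of "{0<..<1::real}" G t b] c t le by simp
qed

section \<open>Integrals over boxes and difference operators\<close>

lemma I_h_shift:
  fixes f :: "real ^ 'd::finite \<Rightarrow> real"
  assumes f: "bdd_borel f" "periodic f"
  shows "I_h N f (shift N i s x) = I_h N (\<lambda>y. f (y + (s / real N) *\<^sub>R axis i 1)) x"
proof -
  define a where "a = (s / real N) *\<^sub>R (axis i 1 :: real ^ 'd)"
  define k where "k = wrap (x + a) - (x + a)"
  have k: "k \<in> lattice_Z" unfolding k_def by (rule wrap_diff)
  have sh: "shift N i s x = x + (a + k)" unfolding shift_def k_def a_def by simp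
  have im: "(\<lambda>y. y - (a + k)) ` box_h N (x + (a + k)) = box_h N x"
  proof (intro equalityI subsetI)
    fix y assume "y \<in> box_h N x"
    then have "y + (a + k) \<in> box_h N (x + (a + k))" by (auto simp: box_h_def)
    then show "y \<in> (\<lambda>y. y - (a + k)) ` box_h N (x + (a + k))" by (intro image_eqI[of _ _ "y + (a + k)"]) auto
  next
    fix y assume "y \<in> (\<lambda>y. y - (a + k)) ` box_h N (x + (a + k))"
    then obtain z where z: "y = z - (a + k)" "z \<in> box_h N (x + (a + k))" by blast
    have "x $ i - 1 / real N / 2 \<le> y $ i \<and> y $ i < x $ i + 1 / real N / 2" for i
    proof -
      have "(x + (a + k)) $ i - 1 / real N / 2 \<le> z $ i \<and> z $ i < (x + (a + k)) $ i + 1 / real N / 2"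
        using z(2) unfolding box_h_def by blast
      then show ?thesis unfolding z(1) by (simp only: vector_add_component vector_minus_component) linarith
    qed
    then show "y \<in> box_h N x" unfolding box_h_def by blast
  qed
  have "I_h N f (x + (a + k)) = (LINT y:box_h N x|lborel. f ((a + k) + y))"
    unfolding I_h_def using set_integral_translate[where f = f and A = "box_h N (x + (a + k))" and k = "a + k"] f(1)
    by (simp add: im bdd_borel_def)
  also have "\<dots> = I_h N (\<lambda>y. f (y + a)) x"
  proof -
    have "f ((a + k) + y) = f (y + a)" for y
    proof -
      have "f ((y + a) + k) = f (y + a)" using f(2) k unfolding periodic_def by blast
      then show ?thesis by (simp add: add_ac)
    qed
    then show ?thesis unfolding I_h_def by simp
  qed
  finally show ?thesis unfolding sh a_def .
qed

lemma I_h_lin: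
  fixes f g :: "real ^ 'd::finite \<Rightarrow> real"
  assumes f: "bdd_borel f" and g: "bdd_borel g"
  shows "I_h N (\<lambda>y. a * f y + b * g y) x = a * I_h N f x + b * I_h N g x"
proof -
  have "set_integrable lborel (box_h N x) f" "set_integrable lborel (box_h N x) g"
    by (intro bdd_set_integrable f g box_h_borel box_h_bounded)+
  then show ?thesis unfolding I_h_def by (simp add: set_integral_add)
qed

lemma bdd_borel_lin: "bdd_borel f \<Longrightarrow> bdd_borel g \<Longrightarrow> bdd_borel (\<lambda>x. a * f x + b * g x :: real)"
  using bdd_borel_diff[OF bdd_borel_mult[OF bdd_borel_const, of f a] bdd_borel_mult[OF bdd_borel_const, of g "- b"]] by simp

lemma bdd_borel_sum: "finite A \<Longrightarrow> (\<And>i. i \<in> A \<Longrightarrow> bdd_borel (f i)) \<Longrightarrow> bdd_borel (\<lambda>x. \<Sum>i\<in>A. f i x :: real)"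
proof (induction rule: finite_induct)
  case empty
  then show ?case by (simp add: bdd_borel_const)
next
  case (insert i A)
  then have "bdd_borel (\<lambda>x. 1 * f i x + 1 * (\<Sum>i\<in>A. f i x))" by (intro bdd_borel_lin) auto
  then show ?case using insert by simp
qed

lemma I_h_sum:
  assumes "finite A" "\<And>i. i \<in> A \<Longrightarrow> bdd_borel (f i)"
  shows "I_h N (\<lambda>y. \<Sum>i\<in>A. f i y :: real) x = (\<Sum>i\<in>A. I_h N (f i) x)"
  using assms
proof (induction rule: finite_induct)
  case empty
  then show ?case by (simp add: I_h_def)
next
  case (insert i A)
  then have "I_h N (\<lambda>y. 1 * f i y + 1 * (\<Sum>i\<in>A. f i y)) x = 1 * I_h N (f i) x + 1 * I_h N (\<lambda>y. \<Sum>i\<in>A. f i y) x"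
    by (intro I_h_lin bdd_borel_sum) auto
  then show ?case using insert by simp
qed

lemma bdd_borel_translate: "bdd_borel f \<Longrightarrow> bdd_borel (\<lambda>y. f (y + a))"
  using bdd_borel_shift[of f a] by (simp add: add.commute)

context
  fixes f :: "real ^ 'd::finite \<Rightarrow> real" and N :: nat
  assumes f: "bdd_borel f" "periodic f"
begin

lemma lapc_bdd_borel: "bdd_borel (lapc N f)" and I_h_lap: "lap_h N (I_h N f) x = I_h N (lapc N f) x"
proof -
  let ?e = "\<lambda>i. (1 / real N) *\<^sub>R (axis i 1 :: real ^ 'd)"
  define q where "q i y = (real N)\<^sup>2 * (1 * f (y + ?e i) + 1 * f (y + (- ?e i))) + (- 2 * (real N)\<^sup>2) * f y" for i y
  have q: "bdd_borel (q i)" for i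
    unfolding q_def[abs_def] by (intro bdd_borel_lin bdd_borel_translate f)
  have eq: "lapc N f = (\<lambda>y. \<Sum>i\<in>UNIV. q i y)"
  proof -
    have gen: "(A + B - 2 * C) / (1 / real N)\<^sup>2 = (real N)\<^sup>2 * (1 * A + 1 * B) + (- 2 * (real N)\<^sup>2) * C" for A B C :: real
      by (simp add: power_divide algebra_simps)
    show ?thesis unfolding lapc_def[abs_def] q_def gen diff_conv_add_uminus[of _ "?e _"] ..
  qed
  show "bdd_borel (lapc N f)" unfolding eq by (intro bdd_borel_sum q) simp
  have "I_h N (q i) x = (real N)\<^sup>2 * (1 * I_h N f (up N i x) + 1 * I_h N f (down N i x)) + (- 2 * (real N)\<^sup>2) * I_h N f x" for i
    unfolding q_def[abs_def] I_h_shift[OF f] using f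
    by (simp only: I_h_lin bdd_borel_lin bdd_borel_translate minus_divide_left[symmetric] scaleR_minus_left)
  then have "I_h N (lapc N f) x = (\<Sum>i\<in>UNIV. (real N)\<^sup>2 * (1 * I_h N f (up N i x) + 1 * I_h N f (down N i x)) + (- 2 * (real N)\<^sup>2) * I_h N f x)"
    unfolding eq by (subst I_h_sum) (auto intro: q)
  then show "lap_h N (I_h N f) x = I_h N (lapc N f) x"
    unfolding lap_h_alt sum_distrib_left by (simp add: algebra_simps)
qed

lemma gradc_bdd_borel: "bdd_borel (\<lambda>y. gradc N f y $ i)"
  and I_h_grad: "grad_h N (I_h N f) x $ i = I_h N (\<lambda>y. gradc N f y $ i) x"
proof -
  let ?e = "(1 / real N) *\<^sub>R (axis i 1 :: real ^ 'd)"
  have eq: "(\<lambda>y. gradc N f y $ i) = (\<lambda>y. (real N / 2) * f (y + ?e) + (- (real N / 2)) * f (y + (- ?e)))"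
  proof -
    have gen: "(A - B) / (2 * (1 / real N)) = (real N / 2) * A + (- (real N / 2)) * B" for A B :: real
      by (simp add: right_diff_distrib diff_divide_distrib mult.commute)
    show ?thesis unfolding gradc_def vec_lambda_beta gen diff_conv_add_uminus[of _ ?e] ..
  qed
  show "bdd_borel (\<lambda>y. gradc N f y $ i)" unfolding eq by (intro bdd_borel_lin bdd_borel_translate f)
  have "I_h N (\<lambda>y. gradc N f y $ i) x = (real N / 2) * I_h N f (up N i x) + (- (real N / 2)) * I_h N f (down N i x)"
    unfolding eq I_h_shift[OF f] using f
    by (simp only: I_h_lin bdd_borel_translate minus_divide_left[symmetric] scaleR_minus_left)
  then show "grad_h N (I_h N f) x $ i = I_h N (\<lambda>y. gradc N f y $ i) x"
    unfolding grad_h_nth by (simp add: algebra_simps)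
qed

end

section \<open>Regularity of the flux\<close>

context mfg
begin

text \<open>
  Common constant of the two regularity properties of the velocity and of a bound, for all components.
\<close>

definition holder_v :: "real \<Rightarrow> bool" where
  "holder_v K \<longleftrightarrow> K > 0 \<and> (\<forall>t\<in>{0..1}. \<forall>s\<in>{0..1}. \<forall>x y i.
     \<bar>vs t x $ i - vs s y $ i\<bar> \<le> K * norm (t - s, tnorm (x - y)) powr r) \<and>
   (AE t in lborel. t \<in> {0..1} \<longrightarrow> (\<forall>i. C_1_holder_bound r K (\<lambda>x. vs t x $ i))) \<and>
   (\<forall>t\<in>{0..1}. \<forall>x i. \<bar>vs t x $ i\<bar> \<le> K)"

lemma C_1_holder_bound_mono:
  assumes "C_1_holder_bound r K w" "K \<le> K'" shows "C_1_holder_bound r K' w"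
proof -
  have up: "a \<le> K' * b" if "a \<le> K * b" "0 \<le> b" for a b :: real
    using that mult_right_mono[OF assms(2), of b] by linarith
  have "periodic w" "\<forall>x. has_gradient w x \<and> \<bar>w x\<bar> \<le> K \<and> norm (gradient w x) \<le> K"
     "\<forall>x y. norm (gradient w x - gradient w y) \<le> K * tnorm (x - y) powr r"
    using assms(1) unfolding C_1_holder_bound_def by auto
  then show ?thesis unfolding C_1_holder_bound_def using assms(2) up by (meson order_trans powr_ge_zero)
qed

lemma holder_v_exists: "\<exists>K. holder_v K"
proof -
  let ?d = "real CARD('d)"
  have "\<forall>i. \<exists>K. \<forall>t\<in>{0..1}. \<forall>s\<in>{0..1}. \<forall>x y. \<bar>vs t x $ i - vs s y $ i\<bar> \<le> K * norm (t - s, tnorm (x - y)) powr r"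
    using B_parts(4) unfolding holder_Q_def by blast
  from choice[OF this] obtain K1 where K1: "\<forall>i. \<forall>t\<in>{0..1}. \<forall>s\<in>{0..1}. \<forall>x y.
     \<bar>vs t x $ i - vs s y $ i\<bar> \<le> K1 i * norm (t - s, tnorm (x - y)) powr r" by (rule exE)
  have "\<forall>i. \<exists>K. AE t in lborel. t \<in> {0..1} \<longrightarrow> C_1_holder_bound r K (\<lambda>x. vs t x $ i)"
    using B_parts(4) unfolding Linf_C_1_holder_def by blast
  from choice[OF this] obtain K2 where K2: "\<forall>i. AE t in lborel. t \<in> {0..1} \<longrightarrow> C_1_holder_bound r (K2 i) (\<lambda>x. vs t x $ i)"
    by (rule exE)
  note S = le_abs_total abs_total_nonneg
  define b where "b = abs_total (\<lambda>i. vs 0 0 $ i)"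
  define K where "K = abs_total K1 * norm (1::real, ?d) powr r + abs_total K1 + abs_total K2 + b + 1"
  have le: "abs_total K1 * norm (1::real, ?d) powr r + b \<le> K" "abs_total K1 \<le> K" "abs_total K2 \<le> K" "K > 0"
  proof -
    have "0 \<le> abs_total K1 * norm (1::real, ?d) powr r" "0 \<le> b" by (simp_all add: S b_def)
    then show "abs_total K1 * norm (1::real, ?d) powr r + b \<le> K" "abs_total K1 \<le> K" "abs_total K2 \<le> K" "K > 0"
      using S(2)[of K1] S(2)[of K2] unfolding K_def by linarith+
  qed
  have H: "\<bar>vs t x $ i - vs s y $ i\<bar> \<le> abs_total K1 * norm (t - s, tnorm (x - y)) powr r" if "t \<in> {0..1}" "s \<in> {0..1}" for t s x y i
  proof -
    have "\<bar>vs t x $ i - vs s y $ i\<bar> \<le> K1 i * norm (t - s, tnorm (x - y)) powr r" using K1 that by blast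
    also have "\<dots> \<le> abs_total K1 * norm (t - s, tnorm (x - y)) powr r" by (intro mult_right_mono S) simp
    finally show ?thesis .
  qed
  have "holder_v K"
    unfolding holder_v_def
  proof (intro conjI ballI allI le)
    fix t s x y i assume ts: "t \<in> {0..1::real}" "s \<in> {0..1::real}"
    show "\<bar>vs t x $ i - vs s y $ i\<bar> \<le> K * norm (t - s, tnorm (x - y)) powr r"
      by (rule order_trans[OF H[OF ts] mult_right_mono[OF le(2)]]) simp
  next
    have "AE t in lborel. \<forall>i. t \<in> {0..1} \<longrightarrow> C_1_holder_bound r (K2 i) (\<lambda>x. vs t x $ i)"
      using K2 by (intro eventually_all_finite) blast
    then show "AE t in lborel. t \<in> {0..1} \<longrightarrow> (\<forall>i. C_1_holder_bound r K (\<lambda>x. vs t x $ i))"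
    proof (rule eventually_mono, intro impI allI)
      fix t i assume "\<forall>i. t \<in> {0..1} \<longrightarrow> C_1_holder_bound r (K2 i) (\<lambda>x. vs t x $ i)" "t \<in> {0..1}"
      then have "C_1_holder_bound r (K2 i) (\<lambda>x. vs t x $ i)" by blast
      then show "C_1_holder_bound r K (\<lambda>x. vs t x $ i)"
        by (rule C_1_holder_bound_mono) (rule order_trans[OF S(1) le(3)])
    qed
  next
    fix t x i assume t: "t \<in> {0..1::real}"
    have "\<bar>vs t x $ i - vs 0 0 $ i\<bar> \<le> abs_total K1 * norm (t - 0, tnorm (x - 0)) powr r" by (rule H[OF t]) simp
    also have "norm (t - 0, tnorm (x - 0)) \<le> norm (1::real, ?d)"
      unfolding norm_prod_def using t tnorm_le_dim[of x] tnorm_nonneg[of x]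
      by (intro real_sqrt_le_mono add_mono) (simp_all add: power_mono power_le_one)
    then have "abs_total K1 * norm (t - 0, tnorm (x - 0)) powr r \<le> abs_total K1 * norm (1::real, ?d) powr r"
      using r_pos by (intro mult_left_mono powr_mono2 S) auto
    finally have 1: "\<bar>vs t x $ i - vs 0 0 $ i\<bar> \<le> abs_total K1 * norm (1::real, ?d) powr r" .
    have "\<bar>vs 0 0 $ i\<bar> \<le> b" unfolding b_def by (rule abs_le_abs_total)
    then show "\<bar>vs t x $ i\<bar> \<le> K" using 1 le(1) by linarith
  qed
  then show ?thesis by blast
qed

lemma holder_vD:
  assumes "holder_v K"
  shows "K > 0" "t \<in> {0..1} \<Longrightarrow> s \<in> {0..1} \<Longrightarrow> \<bar>vs t x $ i - vs s y $ i\<bar> \<le> K * norm (t - s, tnorm (x - y)) powr r"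
    "AE t in lborel. t \<in> {0..1} \<longrightarrow> (\<forall>i. C_1_holder_bound r K (\<lambda>x. vs t x $ i))"
    "t \<in> {0..1} \<Longrightarrow> \<bar>vs t x $ i\<bar> \<le> K"
  using assms unfolding holder_v_def by simp_all

lemma holder_v_space:
  assumes K: "holder_v K" and t: "t \<in> {0..1}"
  shows "\<bar>vs t x $ i - vs t y $ i\<bar> \<le> K * norm (x - y) powr r"
proof -
  have "\<bar>vs t x $ i - vs t y $ i\<bar> \<le> K * norm (t - t, tnorm (x - y)) powr r" by (rule holder_vD(2)[OF K t t])
  also have "norm (t - t, tnorm (x - y)) = tnorm (x - y)" using tnorm_nonneg[of "x - y"] by (simp add: norm_prod_def)
  also have "K * tnorm (x - y) powr r \<le> K * norm (x - y) powr r"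
    using holder_vD(1)[OF K] r_pos by (intro mult_left_mono powr_mono2 tnorm_le_norm tnorm_nonneg) auto
  finally show ?thesis .
qed

lemma holder_continuous:
  fixes g :: "'a::real_normed_vector \<Rightarrow> real"
  assumes "\<And>x y. x \<in> S \<Longrightarrow> y \<in> S \<Longrightarrow> \<bar>g x - g y\<bar> \<le> K * norm (x - y) powr r"
  shows "continuous_on S g"
  unfolding continuous_on_def
proof
  fix x assume x: "x \<in> S"
  have "((\<lambda>y. K * norm (y - x) powr r) \<longlongrightarrow> K * 0) (at x within S)"
  proof (intro tendsto_mult tendsto_const)
    have "((\<lambda>y. norm (y - x)) \<longlongrightarrow> norm (x - x)) (at x within S)" by (intro tendsto_intros)
    then have n: "((\<lambda>y. norm (y - x)) \<longlongrightarrow> 0) (at x within S)" by simp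
    show "((\<lambda>y. norm (y - x) powr r) \<longlongrightarrow> 0) (at x within S)"
      by (rule tendsto_zero_powrI[OF n tendsto_const]) (use r_pos in auto)
  qed
  then have lim: "((\<lambda>y. K * norm (y - x) powr r) \<longlongrightarrow> 0) (at x within S)" by simp
  have "((\<lambda>y. g y - g x) \<longlongrightarrow> 0) (at x within S)"
  proof (rule Lim_null_comparison[OF _ lim])
    show "\<forall>\<^sub>F y in at x within S. norm (g y - g x) \<le> K * norm (y - x) powr r"
      unfolding eventually_at_filter by (rule always_eventually) (use assms x in auto)
  qed
  then show "(g \<longlongrightarrow> g x) (at x within S)" by (rule Lim_null[THEN iffD2])
qed

lemma vs_continuous: assumes t: "t \<in> {0..1}" shows "continuous_on UNIV (\<lambda>x. vs t x $ i)"
proof -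
  obtain K where K: "holder_v K" using holder_v_exists by blast
  show ?thesis by (rule holder_continuous[OF holder_v_space[OF K t]])
qed

lemma vs_continuous_time: "continuous_on {0..1} (\<lambda>t. vs t x $ i)"
proof -
  obtain K where K: "holder_v K" using holder_v_exists by blast
  have "tnorm (x - x) = 0" unfolding tnorm_def using infdist_zero[OF zero_lattice] by simp
  then have "\<bar>vs t x $ i - vs s x $ i\<bar> \<le> K * norm (t - s) powr r" if "t \<in> {0..1}" "s \<in> {0..1}" for t s
    using holder_vD(2)[OF K that, of x i x] by (simp add: norm_prod_def)
  then show ?thesis by (rule holder_continuous)
qed

lemma flux_bdd_borel: assumes t: "t \<in> {0..1}" shows "bdd_borel (\<lambda>x. vs t x $ i)" "bdd_borel (\<lambda>x. ms t x * vs t x $ i)"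
proof -
  obtain K where K: "holder_v K" using holder_v_exists by blast
  show 1: "bdd_borel (\<lambda>x. vs t x $ i)" by (rule bdd_borel_continuous[OF vs_continuous[OF t] holder_vD(4)[OF K t]])
  show "bdd_borel (\<lambda>x. ms t x * vs t x $ i)" by (rule bdd_borel_mult[OF ms_bdd_borel[OF t] 1])
qed

lemma flux_periodic: assumes t: "t \<in> {0..1}" shows "periodic (\<lambda>x. ms t x * vs t x $ i)"
proof -
  have "periodic (vs t)" using solution_parts(1) t by blast
  then show ?thesis using ms_periodic[OF t] unfolding periodic_def by simp
qed

definition divc :: "nat \<Rightarrow> real \<Rightarrow> real ^ 'd \<Rightarrow> real" where
  "divc N t x = (\<Sum>i\<in>UNIV. gradc N (\<lambda>y. ms t y * vs t y $ i) x $ i)"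

text \<open>
  Along a coordinate line the derivative of the flux is a sum of two products, and each factor is
  bounded and Hoelder continuous with exponent \<open>r\<close>.
\<close>

lemma divc_consistent_regular:
  assumes Km: "holder_const r Km ms" and t: "t \<in> {0..1}" and N: "N > 0"
    and V: "\<And>i. C_1_holder_bound r Kv (\<lambda>x. vs t x $ i)" and Kv: "Kv > 0"
  shows "\<bar>divc N t x - divergence (\<lambda>y. ms t y *\<^sub>R vs t y) x\<bar> \<le> real CARD('d) * (4 * Km * Kv) * (1 / real N) powr r"
proof -
  define a where "a = 1 / real N"
  have a: "a > 0" "a \<le> 1" using N by (simp_all add: a_def)
  have Km0: "Km > 0" by (rule holder_constD(1)[OF Km])
  have ar: "a \<le> a powr r" using powr_mono'[of r 1 a] r_one a by simp
  have each: "\<bar>gradc N (\<lambda>y. ms t y * vs t y $ i) x $ i - gradient (\<lambda>y. (ms t y *\<^sub>R vs t y) $ i) x $ i\<bar> \<le> 4 * Km * Kv * a powr r" for i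
  proof -
    have Vi: "has_gradient (\<lambda>x. vs t x $ i) y" "\<bar>vs t y $ i\<bar> \<le> Kv" "norm (gradient (\<lambda>x. vs t x $ i) y) \<le> Kv"
      "norm (gradient (\<lambda>x. vs t x $ i) y - gradient (\<lambda>x. vs t x $ i) z) \<le> Kv * tnorm (y - z) powr r" for y z
      using V[of i] unfolding C_1_holder_bound_def by blast+
    let ?g = "gradient (\<lambda>x. vs t x $ i)" and ?m = "gradient (ms t)"
    let ?l = "\<lambda>s. x + s *\<^sub>R axis i (1::real)"
    define \<phi> where "\<phi> s = ms t (?l s) * vs t (?l s) $ i" for s
    define \<phi>' where "\<phi>' s = ?m (?l s) $ i * vs t (?l s) $ i + ?g (?l s) $ i * ms t (?l s)" for s
    have dv: "((\<lambda>s. vs t (?l s) $ i) has_real_derivative ?g (?l s) $ i) (at s)" for s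
      by (rule GDERIV_axis[where f = "\<lambda>y. vs t y $ i"], rule has_gradientD, rule Vi)
    have d: "(\<phi> has_real_derivative \<phi>' s) (at s)" for s
      unfolding \<phi>_def[abs_def] \<phi>'_def by (rule DERIV_mult'[THEN DERIV_cong, OF C12_line[OF ms_C_1_2 t] dv]) simp
    have "gradient (\<lambda>y. (ms t y *\<^sub>R vs t y) $ i) x $ i = \<phi>' 0"
    proof -
      have "has_gradient (\<lambda>y. (ms t y *\<^sub>R vs t y) $ i) (x + 0 *\<^sub>R axis i 1)" using solution_parts(1) t by blast
      then have "((\<lambda>s. (ms t (?l s) *\<^sub>R vs t (?l s)) $ i) has_real_derivative gradient (\<lambda>y. (ms t y *\<^sub>R vs t y) $ i) (x + 0 *\<^sub>R axis i 1) $ i) (at 0)"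
        by (intro GDERIV_axis[where f = "\<lambda>y. (ms t y *\<^sub>R vs t y) $ i"] has_gradientD)
      then have "(\<phi> has_real_derivative gradient (\<lambda>y. (ms t y *\<^sub>R vs t y) $ i) x $ i) (at 0)" unfolding \<phi>_def[abs_def] by simp
      then show ?thesis using d[of 0] by (rule DERIV_unique)
    qed
    moreover have "gradc N (\<lambda>y. ms t y * vs t y $ i) x $ i = (\<phi> a - \<phi> (- a)) / (2 * a)"
      unfolding gradc_def \<phi>_def a_def by simp
    moreover have "\<bar>(\<phi> a - \<phi> (- a)) / (2 * a) - \<phi>' 0\<bar> \<le> 4 * Km * Kv * a powr r"
    proof (rule first_difference[OF d a(1)])
      fix s :: real assume s: "\<bar>s\<bar> \<le> a"
      have b1: "\<bar>?m (?l s) $ i - ?m x $ i\<bar> \<le> Km * a powr r"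
      proof -
        have "\<bar>?m (?l s) $ i - ?m x $ i\<bar> \<le> Km * \<bar>s\<bar>" by (rule gradient_line_lipschitz[OF ms_C_1_2 Km r_pos r_one t])
        also have "\<dots> \<le> Km * a powr r" using s ar Km0 by (intro mult_left_mono) auto
        finally show ?thesis .
      qed
      have b2: "\<bar>vs t (?l s) $ i - vs t x $ i\<bar> \<le> Kv * a powr r"
      proof -
        have "norm (vs t (?l s) $ i - vs t (?l 0) $ i) \<le> Kv * norm (s - 0)"
        proof (rule field_differentiable_bound[OF convex_UNIV])
          fix z :: real
          show "((\<lambda>s. vs t (?l s) $ i) has_field_derivative ?g (?l z) $ i) (at z within UNIV)" using dv by simp
          show "norm (?g (?l z) $ i) \<le> Kv" using component_le_norm_cart[of "?g (?l z)" i] Vi(3)[of "?l z"] by simp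
        qed auto
        also have "\<dots> \<le> Kv * a powr r" using s ar Kv by (intro mult_left_mono) auto
        finally show ?thesis by simp
      qed
      have b3: "\<bar>?g (?l s) $ i - ?g x $ i\<bar> \<le> Kv * a powr r"
      proof -
        have "\<bar>?g (?l s) $ i - ?g x $ i\<bar> \<le> norm (?g (?l s) - ?g x)"
          using component_le_norm_cart[of "?g (?l s) - ?g x" i] by simp
        also have "\<dots> \<le> Kv * tnorm (?l s - x) powr r" by (rule Vi)
        also have "\<dots> \<le> Kv * a powr r" using Kv r_pos tnorm_nonneg axis_step_tnorm(1)[of x s i] s by (intro mult_left_mono powr_mono2) auto
        finally show ?thesis .
      qed
      have b4: "\<bar>ms t (?l s) - ms t x\<bar> \<le> Km * a powr r"
      proof -
        have "\<bar>ms t (?l s) - ms t x\<bar> \<le> Km * norm (?l s - x)" by (rule space_lipschitz[OF ms_C_1_2 Km r_pos r_one t])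
        also have "\<dots> \<le> Km * a powr r" using s ar Km0 by (intro mult_left_mono) auto
        finally show ?thesis .
      qed
      have c1: "\<bar>?m x $ i\<bar> \<le> Km" using component_le_norm_cart[of "?m x" i] holder_constD(7)[OF Km t, of x] by simp
      have c2: "\<bar>?g x $ i\<bar> \<le> Kv" using component_le_norm_cart[of "?g x" i] Vi(3)[of x] by simp
      have prod: "\<bar>p * q - p0 * q0\<bar> \<le> \<epsilon> * K2 + K1 * \<delta>"
        if "\<bar>p - p0\<bar> \<le> \<epsilon>" "\<bar>q\<bar> \<le> K2" "\<bar>p0\<bar> \<le> K1" "\<bar>q - q0\<bar> \<le> \<delta>" for p q p0 q0 \<epsilon> \<delta> K1 K2 :: real
      proof -
        have "p * q - p0 * q0 = (p - p0) * q + p0 * (q - q0)" by (simp add: algebra_simps)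
        moreover have "\<bar>(p - p0) * q\<bar> \<le> \<epsilon> * K2" "\<bar>p0 * (q - q0)\<bar> \<le> K1 * \<delta>"
          unfolding abs_mult using that by (intro mult_mono; linarith)+
        ultimately show ?thesis by linarith
      qed
      have p1: "\<bar>?m (?l s) $ i * vs t (?l s) $ i - ?m x $ i * vs t x $ i\<bar> \<le> (Km * a powr r) * Kv + Km * (Kv * a powr r)"
        by (rule prod[OF b1 Vi(2) c1 b2])
      have p2: "\<bar>?g (?l s) $ i * ms t (?l s) - ?g x $ i * ms t x\<bar> \<le> (Kv * a powr r) * Km + Kv * (Km * a powr r)"
        by (rule prod[OF b3 holder_constD(8)[OF Km t] c2 b4])
      have "4 * Km * Kv * a powr r = (Km * a powr r) * Kv + Km * (Kv * a powr r) + ((Kv * a powr r) * Km + Kv * (Km * a powr r))" by simp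
      then show "\<bar>\<phi>' s - \<phi>' 0\<bar> \<le> 4 * Km * Kv * a powr r"
        using p1 p2 unfolding \<phi>'_def by simp
    qed
    ultimately show ?thesis by simp
  qed
  have "\<bar>divc N t x - divergence (\<lambda>y. ms t y *\<^sub>R vs t y) x\<bar> \<le>
     (\<Sum>i\<in>UNIV. \<bar>gradc N (\<lambda>y. ms t y * vs t y $ i) x $ i - gradient (\<lambda>y. (ms t y *\<^sub>R vs t y) $ i) x $ i\<bar>)"
    unfolding divc_def divergence_def sum_subtractf[symmetric] by (rule sum_abs)
  also have "\<dots> \<le> (\<Sum>i\<in>(UNIV :: 'd set). 4 * Km * Kv * a powr r)" by (intro sum_mono each)
  finally show ?thesis unfolding a_def by (simp add: mult_ac)
qed

text \<open>
  Only for almost every time is the velocity differentiable in space with uniform bounds. By the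
  Fokker-Planck equation the divergence of the flux is continuous in time, which gives the estimate
  for every time.
\<close>

lemma divc_consistent:
  assumes Km: "holder_const r Km ms" and Kv: "holder_v Kv" and t: "t \<in> {0..1}" and N: "N > 0"
  shows "\<bar>divc N t x - (\<sigma> * laplacian (ms t) x - time_deriv ms t x)\<bar> \<le> real CARD('d) * (4 * Km * Kv) * (1 / real N) powr r"
proof -
  define G where "G t = \<bar>divc N t x - (\<sigma> * laplacian (ms t) x - time_deriv ms t x)\<bar>" for t
  have sec: "continuous_on {0..1} (\<lambda>t. F t y)" if "continuous_on ({0..1} \<times> UNIV) (\<lambda>(t, x). F t x)" for F :: "real \<Rightarrow> real ^ 'd \<Rightarrow> real" and y
      proof -
    have "continuous_on {0..1} (\<lambda>t. (\<lambda>(t, x). F t x) (t, y))"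
      by (rule continuous_on_compose2[OF that]) (auto intro!: continuous_intros)
    then show ?thesis by simp
  qed
  have lapl: "continuous_on {0..1} (\<lambda>t. laplacian (ms t) x)"
    unfolding laplacian_def using C_1_2_parts(8)[OF ms_C_1_2] by (intro continuous_on_sum sec) blast
  have td: "continuous_on {0..1} (\<lambda>t. time_deriv ms t x)" by (rule sec[OF C_1_2_parts(6)[OF ms_C_1_2]])
  have fl: "continuous_on {0..1} (\<lambda>t. ms t y * vs t y $ i)" for y i
    by (intro continuous_on_mult sec[OF C_1_2_parts(5)[OF ms_C_1_2]] vs_continuous_time)
  have "continuous_on {0..1} (\<lambda>t. divc N t x)"
    unfolding divc_def gradc_def vec_lambda_beta using N by (intro continuous_on_sum continuous_on_divide continuous_on_diff fl continuous_on_const) simp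
  then have c: "continuous_on {0..1} G" unfolding G_def by (intro continuous_intros lapl td)
  have "AE t in lborel. t \<in> {0..1} \<longrightarrow> G t \<le> real CARD('d) * (4 * Km * Kv) * (1 / real N) powr r"
    using holder_vD(3)[OF Kv]
  proof (rule eventually_mono, intro impI)
    fix t assume h: "t \<in> {0..1} \<longrightarrow> (\<forall>i. C_1_holder_bound r Kv (\<lambda>x. vs t x $ i))" and t: "t \<in> {0..1}"
    have V: "\<And>i. C_1_holder_bound r Kv (\<lambda>x. vs t x $ i)" using h t by blast
    have eq: "time_deriv ms t x - \<sigma> * laplacian (ms t) x + divergence (\<lambda>y. ms t y *\<^sub>R vs t y) x = 0"
      using solution_parts(2) t by blast
    then have "divergence (\<lambda>y. ms t y *\<^sub>R vs t y) x = \<sigma> * laplacian (ms t) x - time_deriv ms t x" by linarith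
    then show "G t \<le> real CARD('d) * (4 * Km * Kv) * (1 / real N) powr r"
      using divc_consistent_regular[OF Km t N V holder_vD(1)[OF Kv], of x] unfolding G_def by simp
  qed
  from AE_le_imp_le[OF c this t] show ?thesis unfolding G_def .
qed

end

section \<open>Consistency of the Fokker-Planck equation\<close>

context mfg
begin

text \<open>
  Consistency constants of the Fokker-Planck equation: \<open>CR\<close> for the right-hand side and \<open>CE\<close> for
  the flux.
\<close>

definition CR :: "real \<Rightarrow> real \<Rightarrow> real" where
  "CR Km Kv = Km * Ct powr (r / 2) + \<theta> * \<sigma> * (real CARD('d) * Km + real CARD('d) * Km * Ct powr (r / 2))
     + (1 - \<theta>) * \<sigma> * (real CARD('d) * Km) + real CARD('d) * (4 * Km * Kv)"

definition CE :: "real \<Rightarrow> real \<Rightarrow> real \<Rightarrow> real" where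
  "CE Ku Km Kv = Km * (CG Ku / \<alpha>) + real CARD('d) * (Km * (Kv * real CARD('d)))"

end

context mfg_grid
begin

lemma cell_volume: "h ^ CARD('d) > 0" "real (card (grid N :: (real ^ 'd) set)) * h ^ CARD('d) = 1"
  using TN by (simp_all add: card_grid power_divide)

definition mhat :: "nat \<Rightarrow> real ^ 'd \<Rightarrow> real" where "mhat t = I_h N (ms (tm T t))"

text \<open>
  The flux of the exact solution, averaged over the boxes.
\<close>

definition Phi :: "nat \<Rightarrow> real ^ 'd \<Rightarrow> real ^ 'd" where
  "Phi t x = (\<chi> i. I_h N (\<lambda>y. ms (tm T t) y * vs (tm T t) y $ i) x)"

text \<open>The defect of the cell averages of the exact density in the discrete Fokker-Planck equation.\<close>

definition Res :: "nat \<Rightarrow> real ^ 'd \<Rightarrow> real" where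
  "Res t x = (mhat (Suc t) x - mhat t x) / dt - \<theta> * \<sigma> * lap_h N (mhat (Suc t)) x
     - (1 - \<theta>) * \<sigma> * lap_h N (mhat t) x + div_h N (Phi t) x"

lemma flow_trace:
  assumes x: "x \<in> grid N"
  shows "mhat (Suc t) x = B (\<lambda>x. E (mhat t) x - dt * div_h N (Phi t) x + dt * Res t x) x"
proof -
  have "\<forall>x\<in>grid N. mhat (Suc t) x - th.\<tau> * lap_h N (mhat (Suc t)) x = E (mhat t) x - dt * div_h N (Phi t) x + dt * Res t x"
    using TN unfolding Res_def expl_def th.\<tau>_def th.\<kappa>_def by (simp add: field_simps)
  then show ?thesis using x unfolding implicit_iff by blast
qed

lemma mhat_prob: "t \<le> T \<Longrightarrow> prob N (mhat t)"
  unfolding mhat_def by (intro I_h_prob tm_in TN)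

lemma mhat_0: "mhat 0 x = I_h N (m0c D) x"
  unfolding mhat_def I_h_initial by simp

lemma mhat_bound:
  assumes K: "holder_const r K ms" and t: "t \<le> T" shows "\<bar>mhat t x\<bar> \<le> K * h ^ CARD('d)"
  unfolding mhat_def I_h_def
  by (rule integral_box_bound[OF TN(2) ms_bdd_borel[OF tm_in[OF TN(1) t]] holder_constD(8)[OF K tm_in[OF TN(1) t]]])

text \<open>
  The residual is the average over a box of the corresponding residual of the exact density, with
  difference quotients in place of derivatives; the latter is estimated pointwise with the
  Fokker-Planck equation.
\<close>

lemma residual_bound:
  assumes Km: "holder_const r Km ms" and Kv: "holder_v Kv" and t: "t < T"
  shows "\<bar>Res t x\<bar> \<le> CR Km Kv * \<rho> * h ^ CARD('d)"
proof -
  define \<tau>1 where "\<tau>1 = tm T (Suc t)"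
  define \<tau>0 where "\<tau>0 = tm T t"
  have t01: "\<tau>0 \<in> {0..1}" "\<tau>1 \<in> {0..1}"
    using tm_in[OF TN(1), of t] tm_in[OF TN(1), of "Suc t"] t unfolding \<tau>0_def \<tau>1_def by simp_all
  have d: "\<tau>1 - \<tau>0 = dt" "\<tau>0 < \<tau>1" unfolding \<tau>1_def \<tau>0_def by (rule tm_step)+
  have Km0: "Km > 0" by (rule holder_constD(1)[OF Km])
  let ?d = "real CARD('d)" and ?Ca = "Ct powr (r / 2)"
  define g where "g y = 1 * (1 * (1 / dt * ms \<tau>1 y + (- (1 / dt)) * ms \<tau>0 y)
     + 1 * ((- (\<theta> * \<sigma>)) * lapc N (ms \<tau>1) y + (- ((1 - \<theta>) * \<sigma>)) * lapc N (ms \<tau>0) y)) + 1 * divc N \<tau>0 y" for y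
  note mb = ms_bdd_borel[OF t01(1)] ms_bdd_borel[OF t01(2)]
  note lb = lapc_bdd_borel[OF mb(1) ms_periodic[OF t01(1)]] lapc_bdd_borel[OF mb(2) ms_periodic[OF t01(2)]]
  note gb = gradc_bdd_borel[OF flux_bdd_borel(2)[OF t01(1)] flux_periodic[OF t01(1)]]
  have db: "bdd_borel (\<lambda>y. divc N \<tau>0 y)" unfolding divc_def by (intro bdd_borel_sum gb) simp
  have g: "bdd_borel g" unfolding g_def[abs_def] by (intro bdd_borel_lin mb lb db)
  have Dv: "div_h N (Phi t) x = I_h N (\<lambda>y. divc N \<tau>0 y) x"
  proof -
    have "grad_h N (\<lambda>y. Phi t y $ i) x $ i = I_h N (\<lambda>y. gradc N (\<lambda>y. ms \<tau>0 y * vs \<tau>0 y $ i) y $ i) x" for i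
      unfolding Phi_def \<tau>0_def[symmetric] vec_lambda_beta
      by (rule I_h_grad[OF flux_bdd_borel(2)[OF t01(1)] flux_periodic[OF t01(1)]])
    then show ?thesis unfolding div_h_grad divc_def by (subst I_h_sum) (auto intro: gb)
  qed
  have "I_h N g x = 1 * (1 * (1 / dt * mhat (Suc t) x + (- (1 / dt)) * mhat t x)
     + 1 * ((- (\<theta> * \<sigma>)) * lap_h N (mhat (Suc t)) x + (- ((1 - \<theta>) * \<sigma>)) * lap_h N (mhat t) x)) + 1 * div_h N (Phi t) x"
    unfolding g_def[abs_def] Dv mhat_def \<tau>0_def[symmetric] \<tau>1_def[symmetric]
      I_h_lap[OF mb(1) ms_periodic[OF t01(1)]] I_h_lap[OF mb(2) ms_periodic[OF t01(2)]]
    by (simp only: I_h_lin bdd_borel_lin mb lb db)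
  then have R: "Res t x = I_h N g x" unfolding Res_def using TN by (simp add: field_simps)
  have gy: "\<bar>g y\<bar> \<le> CR Km Kv * \<rho>" for y
  proof -
    define L0 where "L0 = laplacian (ms \<tau>0) y"
    define td where "td = time_deriv ms \<tau>0 y"
    define A where "A = (ms \<tau>1 y - ms \<tau>0 y) / (\<tau>1 - \<tau>0)"
    define l1 where "l1 = lapc N (ms \<tau>1) y"
    define l0 where "l0 = lapc N (ms \<tau>0) y"
    have "\<bar>A - td\<bar> \<le> Km * (\<tau>1 - \<tau>0) powr (r / 2)"
      unfolding A_def td_def by (rule time_difference[OF ms_C_1_2 Km r_pos r_one t01 d(2)])
    also have "\<dots> \<le> Km * (?Ca * \<rho>)" unfolding d(1) using Km0 by (intro mult_left_mono h_facts) simp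
    finally have a1: "\<bar>A - td\<bar> \<le> Km * (?Ca * \<rho>)" .
    have "\<bar>laplacian (ms \<tau>1) y - L0\<bar> \<le> ?d * Km * \<bar>\<tau>1 - \<tau>0\<bar> powr (r / 2)"
      unfolding L0_def by (rule laplacian_time[OF ms_C_1_2 Km r_pos r_one t01(2,1)])
    also have "\<bar>\<tau>1 - \<tau>0\<bar> = dt" unfolding d(1) by simp
    also have "?d * Km * dt powr (r / 2) \<le> ?d * Km * (?Ca * \<rho>)" using Km0 by (intro mult_left_mono h_facts) simp
    finally have b1: "\<bar>laplacian (ms \<tau>1) y - L0\<bar> \<le> ?d * Km * (?Ca * \<rho>)" .
    have b2: "\<bar>l1 - laplacian (ms \<tau>1) y\<bar> \<le> ?d * Km * \<rho>"
      unfolding l1_def by (rule lapc_consistent[OF ms_C_1_2 Km r_pos r_one t01(2) TN(2)])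
    have b3: "\<bar>l0 - L0\<bar> \<le> ?d * Km * \<rho>"
      unfolding l0_def L0_def by (rule lapc_consistent[OF ms_C_1_2 Km r_pos r_one t01(1) TN(2)])
    have c1: "\<bar>\<theta> * \<sigma> * (l1 - L0)\<bar> \<le> \<theta> * \<sigma> * (?d * Km * \<rho> + ?d * Km * (?Ca * \<rho>))"
      unfolding abs_mult using b1 b2 sigma_pos th_half by (intro mult_mono) auto
    have c2: "\<bar>(1 - \<theta>) * \<sigma> * (l0 - L0)\<bar> \<le> (1 - \<theta>) * \<sigma> * (?d * Km * \<rho>)"
      unfolding abs_mult using b3 sigma_pos th_one by (intro mult_mono) auto
    have c3: "\<bar>divc N \<tau>0 y - (\<sigma> * L0 - td)\<bar> \<le> ?d * (4 * Km * Kv) * \<rho>"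
      unfolding L0_def td_def by (rule divc_consistent[OF Km Kv t01(1) TN(2)])
    have "g y = (A - td) - \<theta> * \<sigma> * (l1 - L0) - (1 - \<theta>) * \<sigma> * (l0 - L0) + (divc N \<tau>0 y - (\<sigma> * L0 - td))"
      unfolding g_def A_def d(1) l1_def l0_def by (simp add: algebra_simps)
    moreover have "CR Km Kv * \<rho> = Km * (?Ca * \<rho>) + \<theta> * \<sigma> * (?d * Km * \<rho> + ?d * Km * (?Ca * \<rho>))
       + (1 - \<theta>) * \<sigma> * (?d * Km * \<rho>) + ?d * (4 * Km * Kv) * \<rho>"
      unfolding CR_def by (simp only: algebra_simps)
    ultimately show ?thesis using a1 c1 c2 c3 by linarith
  qed
  show ?thesis unfolding R I_h_def by (rule integral_box_bound[OF TN(2) g gy])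
qed

lemma flux_average:
  assumes Km: "holder_const r Km ms" and Kv: "holder_v Kv" and t: "t \<le> T"
  shows "norm (mhat t x *\<^sub>R vs (tm T t) x - Phi t x) \<le> real CARD('d) * (Km * (Kv * real CARD('d))) * \<rho> * h ^ CARD('d)"
proof -
  let ?V = "h ^ CARD('d)"
  define \<tau>0 where "\<tau>0 = tm T t"
  have t0: "\<tau>0 \<in> {0..1}" unfolding \<tau>0_def by (rule tm_in[OF TN(1) t])
  have Km0: "Km > 0" by (rule holder_constD(1)[OF Km])
  have Kv0: "Kv > 0" by (rule holder_vD(1)[OF Kv])
  let ?d = "real CARD('d)"
  have d1: "?d \<ge> 1" by (simp add: Suc_leI)
  have "\<bar>(mhat t x *\<^sub>R vs \<tau>0 x - Phi t x) $ i\<bar> \<le> (Km * (Kv * (?d * \<rho>))) * ?V" for i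
  proof -
    let ?g = "\<lambda>y. vs \<tau>0 x $ i * ms \<tau>0 y + (- 1) * (ms \<tau>0 y * vs \<tau>0 y $ i)"
    have "(mhat t x *\<^sub>R vs \<tau>0 x - Phi t x) $ i = I_h N ?g x"
      unfolding I_h_lin[OF ms_bdd_borel[OF t0] flux_bdd_borel(2)[OF t0]] mhat_def Phi_def \<tau>0_def[symmetric] by simp
    moreover have "\<bar>I_h N ?g x\<bar> \<le> (Km * (Kv * (?d * \<rho>))) * ?V"
      unfolding I_h_def
    proof (rule integral_box_bound[OF TN(2)])
      show "bdd_borel ?g" by (intro bdd_borel_lin ms_bdd_borel t0 flux_bdd_borel)
      fix y assume y: "y \<in> box_h N x"
      have "\<bar>vs \<tau>0 x $ i - vs \<tau>0 y $ i\<bar> \<le> Kv * norm (x - y) powr r" by (rule holder_v_space[OF Kv t0])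
      also have "norm (x - y) powr r \<le> (?d * h) powr r"
        using box_h_norm[OF box_h_center[OF TN(2)] y] r_pos by (intro powr_mono2) auto
      also have "(?d * h) powr r = ?d powr r * \<rho>" by (rule powr_mult)
      also have "?d powr r * \<rho> \<le> ?d * \<rho>"
        using powr_mono[of r 1 ?d] r_one d1 by (intro mult_right_mono) auto
      finally have v: "\<bar>vs \<tau>0 x $ i - vs \<tau>0 y $ i\<bar> \<le> Kv * (?d * \<rho>)" using Kv0 by simp
      have "?g y = ms \<tau>0 y * (vs \<tau>0 x $ i - vs \<tau>0 y $ i)" by (simp add: algebra_simps)
      also have "\<bar>\<dots>\<bar> \<le> Km * (Kv * (?d * \<rho>))"
        unfolding abs_mult using holder_constD(8)[OF Km t0, of y] v Km0 by (intro mult_mono) auto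
      finally show "\<bar>?g y\<bar> \<le> Km * (Kv * (?d * \<rho>))" .
    qed
    ultimately show ?thesis by simp
  qed
  then have "(\<Sum>i\<in>UNIV. \<bar>(mhat t x *\<^sub>R vs \<tau>0 x - Phi t x) $ i\<bar>) \<le> (\<Sum>i\<in>(UNIV::'d set). (Km * (Kv * (?d * \<rho>))) * ?V)"
    by (intro sum_mono)
  also have "\<dots> = ?d * (Km * (Kv * ?d)) * \<rho> * ?V" by (simp add: mult_ac)
  finally show ?thesis unfolding \<tau>0_def[symmetric] by (intro order_trans[OF norm_le_l1_cart])
qed

abbreviation "vhat \<equiv> feedback (\<lambda>t. us (tm T t))"

lemma flux_consistent:
  assumes Ku: "holder_const r Ku us" and Km: "holder_const r Km ms" and Kv: "holder_v Kv" and t: "t < T" and x: "x \<in> grid N"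
  shows "norm (mhat t x *\<^sub>R vhat t x - Phi t x) \<le> CE Ku Km Kv * \<rho> * h ^ CARD('d)"
proof -
  let ?V = "h ^ CARD('d)"
  let ?d = "real CARD('d)"
  have tT: "t \<le> T" using t by simp
  have Km0: "Km > 0" by (rule holder_constD(1)[OF Km])
  have "norm (mhat t x *\<^sub>R (vhat t x - vs (tm T t) x)) \<le> (Km * ?V) * (CG Ku / \<alpha> * \<rho>)"
    unfolding norm_scaleR using mhat_bound[OF Km tT, of x] velocity_consistent[OF Ku t x] Km0 cell_volume by (intro mult_mono) auto
  moreover have "norm (mhat t x *\<^sub>R vs (tm T t) x - Phi t x) \<le> ?d * (Km * (Kv * ?d)) * \<rho> * ?V"
    by (rule flux_average[OF Km Kv tT])
  moreover have eq: "mhat t x *\<^sub>R vhat t x - Phi t x = mhat t x *\<^sub>R (vhat t x - vs (tm T t) x) + (mhat t x *\<^sub>R vs (tm T t) x - Phi t x)"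
    by (simp add: scaleR_diff_right)
  moreover have "CE Ku Km Kv * \<rho> * ?V = (Km * ?V) * (CG Ku / \<alpha> * \<rho>) + ?d * (Km * (Kv * ?d)) * \<rho> * ?V"
    unfolding CE_def by (simp only: algebra_simps)
  ultimately show ?thesis unfolding eq
    using norm_triangle_ineq[of "mhat t x *\<^sub>R (vhat t x - vs (tm T t) x)" "mhat t x *\<^sub>R vs (tm T t) x - Phi t x"] by linarith
qed

lemma constants_nonneg:
  assumes Ku: "Ku > 0" and Km: "Km > 0" and Kv: "Kv > 0"
  shows "CG Ku \<ge> 0" "CL Ku \<ge> 0" "CH Ku Km \<ge> 0" "CE Ku Km Kv \<ge> 0" "CR Km Kv \<ge> 0"
proof -
  have th: "\<theta> > 0" "1 - \<theta> > 0" using th_half th_one by simp_all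
  note p = Ku Km Kv th sigma_pos Ct_pos M_pos data_pos
  show G: "CG Ku \<ge> 0" "CL Ku \<ge> 0" unfolding CG_def CL_def using p by (intro mult_nonneg_nonneg add_nonneg_nonneg; simp)+
  show "CH Ku Km \<ge> 0" unfolding CH_def using p G by (intro mult_nonneg_nonneg add_nonneg_nonneg) simp_all
  show "CE Ku Km Kv \<ge> 0" unfolding CE_def using p G by (intro mult_nonneg_nonneg add_nonneg_nonneg divide_nonneg_nonneg) simp_all
  show "CR Km Kv \<ge> 0" unfolding CR_def using p by (intro mult_nonneg_nonneg add_nonneg_nonneg) simp_all
qed

section \<open>Error of the scheme\<close>

lemma sum_grid_const: "(\<Sum>x\<in>(grid N :: (real ^ 'd) set). c * h ^ CARD('d)) = c"
proof -
  have "(\<Sum>x\<in>(grid N :: (real ^ 'd) set). c * h ^ CARD('d)) = c * (real (card (grid N :: (real ^ 'd) set)) * h ^ CARD('d))" by (simp only: sum_constant mult_ac)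
  then show ?thesis unfolding cell_volume(2) by simp
qed

lemma solution_facts:
  assumes "theta_mfg_solution D \<theta> T N uh vh mh"
  shows "hjb_eq uh (fd mh)" "vh = feedback uh" "norm (vh t x) \<le> M" "t \<le> T \<Longrightarrow> prob N (mh t)"
    "flow mh (\<lambda>t x. mh t x *\<^sub>R vh t x)"
proof -
  have s: "uh = hjb mh" "vh = feedback uh" "mh = fpk vh"
    using assms unfolding theta_mfg_solution_def by blast+
  show "hjb_eq uh (fd mh)" unfolding s(1) by (rule HJB_spec)
  show "vh = feedback uh" by (rule s)
  have vb: "norm (vh t x) \<le> M" for t x unfolding s(2) by (rule V_op_bound)
  then show "norm (vh t x) \<le> M" .
  show "prob N (mh t)" if "t \<le> T" using FP_prob[of vh, OF vb] prob_flowsD[OF _ that] s(3) by simp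
  show "flow mh (\<lambda>t x. mh t x *\<^sub>R vh t x)" using FP_spec(2)[of vh] s(3) by simp
qed

lemma mhat_nonneg: "t \<le> T \<Longrightarrow> x \<in> grid N \<Longrightarrow> 0 \<le> mhat t x"
  using mhat_prob unfolding prob_def by blast

text \<open>
  Uniqueness argument of Lasry and Lions, for the discrete solution and the trace of the exact one:
  test each of the two Hamilton-Jacobi-Bellman equations with both densities, and subtract.
\<close>

lemma lasry_lions:
  assumes sol: "theta_mfg_solution D \<theta> T N uh vh mh"
    and Ku: "holder_const r Ku us" and Km: "holder_const r Km ms" and Kv: "holder_v Kv"
    and G: "hjb_const G" "G > 0"
    and D: "\<And>t. t \<le> T \<Longrightarrow> sqrt ((\<Sum>x\<in>grid N. (mh t x - mhat t x)\<^sup>2) / h ^ CARD('d)) \<le> \<Delta>"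
  shows "\<alpha> / 2 * (dt * (\<Sum>t<T. \<Sum>x\<in>grid N. mhat t x * (norm (vh t x - vhat t x))\<^sup>2)) \<le>
      CH Ku Km * \<rho> * \<Delta> + G * (Lf D * \<Delta> + CH Ku Km * \<rho>) * ((CE Ku Km Kv + CR Km Kv) * \<rho>)"
    and "t \<le> T \<Longrightarrow> x \<in> grid N \<Longrightarrow> \<bar>uh t x - us (tm T t) x\<bar> \<le> G * (Lf D * \<Delta> + CH Ku Km * \<rho>)"
proof -
  let ?V = "h ^ CARD('d)"
  define cH where "cH = CH Ku Km" define cE where "cE = CE Ku Km Kv" define cR where "cR = CR Km Kv"
  define \<delta> where "\<delta> = Lf D * \<Delta> + cH * \<rho>"
  note Kp = holder_constD(1)[OF Ku] holder_constD(1)[OF Km] holder_vD(1)[OF Kv]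
  note c0 = constants_nonneg(3,4,5)[OF Kp, folded cH_def cE_def cR_def]
  note s = solution_facts[OF sol]
  have mprob: "prob N (mh t)" if "t \<le> T" for t by (rule s(4)[OF that])
  have mpos: "0 \<le> mh t x" if "t \<le> T" "x \<in> grid N" for t x using mprob[OF that(1)] that unfolding prob_def by blast
  define uhat where "uhat = (\<lambda>t. us (tm T t))"
  have uh: "hjb_eq uh (fd mh)" by (rule s(1))
  have ut: "hjb_eq uhat Fhat" unfolding uhat_def by (rule hjb_eq_trace)
  define wh where "wh t x = mh t x *\<^sub>R vh t x" for t x
  have fh: "flow mh wh" unfolding wh_def[abs_def] by (rule s(5))
  have fd2: "\<bar>fd mhat t x - Fhat t x\<bar> \<le> cH * \<rho>" if "t < T" "x \<in> grid N" for t x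
    using hjb_consistent[OF Ku Km that] unfolding mhat_def cH_def by (simp add: abs_minus_commute)
  have fdiff: "\<bar>fd mh t x - Fhat t x\<bar> \<le> \<delta>" if t: "t < T" and x: "x \<in> grid N" for t x
  proof -
    have tT: "t \<le> T" using t by simp
    have "\<bar>fd mh t x - fd mhat t x\<bar> \<le> Lf D * sqrt ((\<Sum>x\<in>grid N. (mh t x - mhat t x)\<^sup>2) / ?V)"
      by (rule f_disc_lipschitz[OF TN tT mprob[OF tT] mhat_prob[OF tT]])
    also have "\<dots> \<le> Lf D * \<Delta>" using data_pos by (intro mult_left_mono D tT) simp
    finally show ?thesis using fd2[OF t x] unfolding \<delta>_def by linarith
  qed
  have st1: "\<bar>uh t x - uhat t x\<bar> \<le> G * \<delta>" if "t \<le> T" "x \<in> grid N" for t x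
    by (rule hjb_stable(1)[OF G(1) uh ut _ that], rule fdiff)
  have st2: "\<bar>B (uh (Suc t)) x - B (uhat (Suc t)) x\<bar> \<le> G * \<delta>" if "t < T" "x \<in> grid N" for t x
    by (rule hjb_stable(2)[OF G(1) uh ut _ that], rule fdiff)
  have st3: "norm (grad_h N (B (uh (Suc t))) x - grad_h N (B (uhat (Suc t))) x) \<le> G * \<delta>" if "t < T" "x \<in> grid N" for t x
    by (rule hjb_stable(3)[OF G(1) uh ut _ that], rule fdiff)
  show "\<bar>uh t x - us (tm T t) x\<bar> \<le> G * (Lf D * \<Delta> + CH Ku Km * \<rho>)" if "t \<le> T" "x \<in> grid N"
    using st1[OF that] unfolding uhat_def \<delta>_def cH_def .
  define p1 where "p1 t x = grad_h N (B (uh (Suc t))) x" for t x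
  define p2 where "p2 t x = grad_h N (B (uhat (Suc t))) x" for t x
  define H1 where "H1 t x = Ham D T t x (p1 t x)" for t x
  define H2 where "H2 t x = Ham D T t x (p2 t x)" for t x
  define z1 where "z1 t x = B (uh (Suc t)) x" for t x
  define z2 where "z2 t x = B (uhat (Suc t)) x" for t x
  define a1 where "a1 t x = (H1 t x - fd mh t x) * mh t x + p1 t x \<bullet> wh t x + z1 t x * 0" for t x
  define a2 where "a2 t x = (H2 t x - Fhat t x) * mh t x + p2 t x \<bullet> wh t x + z2 t x * 0" for t x
  define a3 where "a3 t x = (H1 t x - fd mh t x) * mhat t x + p1 t x \<bullet> Phi t x + z1 t x * Res t x" for t x
  define a4 where "a4 t x = (H2 t x - Fhat t x) * mhat t x + p2 t x \<bullet> Phi t x + z2 t x * Res t x" for t x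
  note ud = p1_def p2_def H1_def H2_def z1_def z2_def
  have step: "mh (Suc t) x = B (\<lambda>x. E (mh t) x - dt * div_h N (wh t) x + dt * 0) x" if "t < T" "x \<in> grid N" for t x
    using fh that unfolding flow_def by simp
  let ?S = "\<lambda>a. dt * (\<Sum>t<T. \<Sum>x\<in>grid N. a t x)" and ?P = "\<lambda>u m. (\<Sum>x\<in>grid N. gc D x * m T x) - (\<Sum>x\<in>grid N. u 0 x * m 0 x)"
  have d1: "?P uh mh = ?S a1"
    unfolding a1_def ud by (rule duality[where u = uh and F = "fd mh" and m = mh and w = wh and \<rho> = "\<lambda>t x. 0", OF uh]) (rule step)
  have d2: "?P uhat mh = ?S a2"
    unfolding a2_def ud by (rule duality[where u = uhat and F = "Fhat" and m = mh and w = wh and \<rho> = "\<lambda>t x. 0", OF ut]) (rule step)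
  have d3: "?P uh mhat = ?S a3"
    unfolding a3_def ud by (rule duality[where u = uh and F = "fd mh" and m = mhat and w = Phi and \<rho> = Res, OF uh]) (rule flow_trace)
  have d4: "?P uhat mhat = ?S a4"
    unfolding a4_def ud by (rule duality[where u = uhat and F = "Fhat" and m = mhat and w = Phi and \<rho> = Res, OF ut]) (rule flow_trace)
  have init: "mh 0 x = mhat 0 x" if "x \<in> grid N" for x using fh that unfolding flow_def mhat_0 by blast
  have i1: "(\<Sum>x\<in>grid N. uh 0 x * mh 0 x) = (\<Sum>x\<in>grid N. uh 0 x * mhat 0 x)"
    "(\<Sum>x\<in>grid N. uhat 0 x * mh 0 x) = (\<Sum>x\<in>grid N. uhat 0 x * mhat 0 x)" using init by simp_all
  \<comment> \<open>Both densities start from the same initial density, so that the boundary terms cancel.\<close>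
  have "?S a1 - ?S a2 - ?S a3 + ?S a4 = 0"
    unfolding d1[symmetric] d2[symmetric] d3[symmetric] d4[symmetric] i1 by simp
  moreover have "(\<Sum>t<T. \<Sum>x\<in>grid N. a1 t x - a2 t x - a3 t x + a4 t x) =
     (\<Sum>t<T. \<Sum>x\<in>grid N. a1 t x) - (\<Sum>t<T. \<Sum>x\<in>grid N. a2 t x) - (\<Sum>t<T. \<Sum>x\<in>grid N. a3 t x) + (\<Sum>t<T. \<Sum>x\<in>grid N. a4 t x)"
    by (simp only: sum.distrib sum_subtractf)
  ultimately have zero: "dt * (\<Sum>t<T. \<Sum>x\<in>grid N. a1 t x - a2 t x - a3 t x + a4 t x) = 0"
    by (simp only: right_diff_distrib distrib_left)
  define n where "n t x = (norm (vh t x - vhat t x))\<^sup>2" for t x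
  define mono where "mono t x = (fd mh t x - fd mhat t x) * (mh t x - mhat t x)" for t x
  define e where "e = G * \<delta> * ((cE + cR) * \<rho>)"
  have point: "a1 t x - a2 t x - a3 t x + a4 t x \<le> - (\<alpha> / 2 * (mhat t x * n t x)) - mono t x + cH * \<rho> * \<bar>mh t x - mhat t x\<bar> + e * ?V"
    if t: "t < T" and x: "x \<in> grid N" for t x
  proof -
    have tT: "t \<le> T" using t by simp
    have V1: "vh t x = Vopt (tm T t) x (p1 t x)" using t x unfolding s(2) V_op_eq p1_def by simp
    have V2: "vhat t x = Vopt (tm T t) x (p2 t x)" using t x unfolding V_op_eq p2_def uhat_def by simp
    have "\<alpha> / 2 * (norm (vh t x - vhat t x))\<^sup>2 \<le> H2 t x + p2 t x \<bullet> vh t x + ellc D (tm T t) x (vh t x)"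
      unfolding V2 H2_def by (rule Ham_ineq[OF TN(1) tT s(3)])
    moreover have "H1 t x = - (p1 t x \<bullet> vh t x) - ellc D (tm T t) x (vh t x)" unfolding V1 H1_def by (rule Ham_eq[OF TN(1) tT])
    moreover have n0: "0 \<le> \<alpha> / 2 * n t x" using data_pos unfolding n_def by simp
    ultimately have "0 \<le> H2 t x + p2 t x \<bullet> vh t x - H1 t x - p1 t x \<bullet> vh t x" unfolding n_def by linarith
    then have i1: "0 \<le> mh t x * (H2 t x + p2 t x \<bullet> vh t x - H1 t x - p1 t x \<bullet> vh t x)" by (intro mult_nonneg_nonneg mpos tT x)
    have "\<alpha> / 2 * (norm (vhat t x - vh t x))\<^sup>2 \<le> H1 t x + p1 t x \<bullet> vhat t x + ellc D (tm T t) x (vhat t x)"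
      unfolding V1 H1_def by (rule Ham_ineq[OF TN(1) tT V_op_bound])
    moreover have "H2 t x = - (p2 t x \<bullet> vhat t x) - ellc D (tm T t) x (vhat t x)" unfolding V2 H2_def by (rule Ham_eq[OF TN(1) tT])
    ultimately have "\<alpha> / 2 * n t x \<le> H1 t x + p1 t x \<bullet> vhat t x - H2 t x - p2 t x \<bullet> vhat t x"
      unfolding n_def norm_minus_commute[of "vh t x"] by linarith
    then have i2: "mhat t x * (\<alpha> / 2 * n t x) \<le> mhat t x * (H1 t x + p1 t x \<bullet> vhat t x - H2 t x - p2 t x \<bullet> vhat t x)"
      by (intro mult_left_mono mhat_nonneg tT x)
    have "\<bar>(p1 t x - p2 t x) \<bullet> (mhat t x *\<^sub>R vhat t x - Phi t x)\<bar> \<le> norm (p1 t x - p2 t x) * norm (mhat t x *\<^sub>R vhat t x - Phi t x)"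
      by (rule Cauchy_Schwarz_ineq2)
    also have "\<dots> \<le> (G * \<delta>) * (cE * \<rho> * ?V)"
      using st3[OF t x] flux_consistent[OF Ku Km Kv t x] unfolding p1_def p2_def cE_def
      by (intro mult_mono) (auto intro: order_trans[OF norm_ge_zero])
    finally have i3: "(p1 t x - p2 t x) \<bullet> (mhat t x *\<^sub>R vhat t x - Phi t x) \<le> (G * \<delta>) * (cE * \<rho> * ?V)" by simp
    have "\<bar>(z1 t x - z2 t x) * Res t x\<bar> \<le> (G * \<delta>) * (cR * \<rho> * ?V)"
      unfolding abs_mult using st2[OF t x] residual_bound[OF Km Kv t, of x] unfolding z1_def z2_def cR_def
      by (intro mult_mono) (auto intro: order_trans[OF abs_ge_zero])
    then have i4: "- ((z1 t x - z2 t x) * Res t x) \<le> (G * \<delta>) * (cR * \<rho> * ?V)" by linarith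
    have "\<bar>(fd mhat t x - Fhat t x) * (mh t x - mhat t x)\<bar> \<le> cH * \<rho> * \<bar>mh t x - mhat t x\<bar>"
      unfolding abs_mult by (intro mult_right_mono fd2 t x) simp
    then have i5: "- ((fd mhat t x - Fhat t x) * (mh t x - mhat t x)) \<le> cH * \<rho> * \<bar>mh t x - mhat t x\<bar>" by linarith
    have ev: "e * ?V = (G * \<delta>) * (cE * \<rho> * ?V) + (G * \<delta>) * (cR * \<rho> * ?V)" unfolding e_def by (simp only: algebra_simps)
    have alg: "(h1 - f1) * m + m * q1 + k1 * 0 - ((h2 - f2) * m + m * q2 + k2 * 0) - ((h1 - f1) * m' + s1 + k1 * R) + ((h2 - f2) * m' + s2 + k2 * R)
      = - (m * (h2 + q2 - h1 - q1)) - m' * (h1 + u1 - h2 - u2) - (f1 - f3) * (m - m') - (f3 - f2) * (m - m')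
        + (m' * u1 - s1 - (m' * u2 - s2)) - (k1 - k2) * R" for h1 h2 f1 f2 f3 m m' q1 q2 k1 k2 s1 s2 R u1 u2 :: real
      by (simp add: algebra_simps)
    have pe: "(p1 t x - p2 t x) \<bullet> (mhat t x *\<^sub>R vhat t x - Phi t x) =
      mhat t x * (p1 t x \<bullet> vhat t x) - p1 t x \<bullet> Phi t x - (mhat t x * (p2 t x \<bullet> vhat t x) - p2 t x \<bullet> Phi t x)"
      by (simp only: inner_diff_left inner_diff_right inner_scaleR_right right_diff_distrib)
    have "a1 t x - a2 t x - a3 t x + a4 t x =
      - (mh t x * (H2 t x + p2 t x \<bullet> vh t x - H1 t x - p1 t x \<bullet> vh t x))
      - mhat t x * (H1 t x + p1 t x \<bullet> vhat t x - H2 t x - p2 t x \<bullet> vhat t x)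
      - mono t x - (fd mhat t x - Fhat t x) * (mh t x - mhat t x)
      + (p1 t x - p2 t x) \<bullet> (mhat t x *\<^sub>R vhat t x - Phi t x) - (z1 t x - z2 t x) * Res t x"
      unfolding a1_def a2_def a3_def a4_def wh_def inner_scaleR_right mono_def pe by (rule alg)
    moreover have "mhat t x * (\<alpha> / 2 * n t x) = \<alpha> / 2 * (mhat t x * n t x)" by (simp only: mult_ac)
    ultimately show ?thesis unfolding ev using i1 i2 i3 i4 i5 by linarith
  qed
  have row: "(\<Sum>x\<in>grid N. a1 t x - a2 t x - a3 t x + a4 t x) \<le> - (\<alpha> / 2 * (\<Sum>x\<in>grid N. mhat t x * n t x)) + (cH * \<rho> * \<Delta> + e)"
    if t: "t < T" for t
  proof -
    have tT: "t \<le> T" using t by simp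
    have "(\<Sum>x\<in>grid N. a1 t x - a2 t x - a3 t x + a4 t x) \<le>
      (\<Sum>x\<in>grid N. - (\<alpha> / 2 * (mhat t x * n t x)) - mono t x + cH * \<rho> * \<bar>mh t x - mhat t x\<bar> + e * ?V)"
      by (intro sum_mono point t)
    also have "\<dots> = - (\<alpha> / 2 * (\<Sum>x\<in>grid N. mhat t x * n t x)) - (\<Sum>x\<in>grid N. mono t x)
       + cH * \<rho> * (\<Sum>x\<in>grid N. \<bar>mh t x - mhat t x\<bar>) + e"
      by (simp only: sum.distrib sum_subtractf sum_negf sum_distrib_left[symmetric] sum_grid_const[of 1, unfolded mult_1] mult_1_right)
    moreover have "0 \<le> (\<Sum>x\<in>grid N. mono t x)"
      unfolding mono_def by (rule f_disc_monotone[OF TN tT mprob[OF tT] mhat_prob[OF tT]])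
    moreover have "cH * \<rho> * (\<Sum>x\<in>grid N. \<bar>mh t x - mhat t x\<bar>) \<le> cH * \<rho> * \<Delta>"
      using c0 by (intro mult_left_mono order_trans[OF sum_abs_le_sqrt[OF TN(2)] D[OF tT]]) simp
    ultimately show ?thesis by linarith
  qed
  have dT: "dt * (\<Sum>t<T. c) = c" for c :: real using TN by simp
  have "0 \<le> dt * (\<Sum>t<T. - (\<alpha> / 2 * (\<Sum>x\<in>grid N. mhat t x * n t x)) + (cH * \<rho> * \<Delta> + e))"
    unfolding zero[symmetric] by (intro mult_left_mono sum_mono row) auto
  also have "\<dots> = - (\<alpha> / 2 * (dt * (\<Sum>t<T. \<Sum>x\<in>grid N. mhat t x * n t x))) + dt * (\<Sum>t<T. cH * \<rho> * \<Delta> + e)"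
    by (simp only: sum.distrib[of "\<lambda>t. - (\<alpha> / 2 * (\<Sum>x\<in>grid N. mhat t x * n t x))" "\<lambda>t. cH * \<rho> * \<Delta> + e"] sum_negf sum_distrib_left[symmetric] distrib_left mult_minus_right mult.left_commute)
  finally show "\<alpha> / 2 * (dt * (\<Sum>t<T. \<Sum>x\<in>grid N. mhat t x * (norm (vh t x - vhat t x))\<^sup>2)) \<le>
      CH Ku Km * \<rho> * \<Delta> + G * (Lf D * \<Delta> + CH Ku Km * \<rho>) * ((CE Ku Km Kv + CR Km Kv) * \<rho>)"
    unfolding dT n_def e_def \<delta>_def cH_def cE_def cR_def by linarith
qed

end

text \<open>
  If \<open>x > \<rho>\<close>, both terms on the right-hand side of the assumption are at most linear in \<open>x\<close>.
\<close>

lemma quadratic_bound: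
  fixes x a b \<rho> :: real
  assumes "x\<^sup>2 \<le> a * \<rho> * x + b * \<rho>\<^sup>2" "0 \<le> a" "0 \<le> b" "0 < \<rho>"
  shows "x \<le> (a + b + 1) * \<rho>"
proof (rule ccontr)
  assume "\<not> ?thesis"
  then have gt: "x > (a + b + 1) * \<rho>" by simp
  have "1 * \<rho> \<le> (a + b + 1) * \<rho>" using assms by (intro mult_right_mono) auto
  then have x\<rho>: "\<rho> < x" using gt by linarith
  then have x0: "x > 0" using assms by linarith
  have "b * \<rho>\<^sup>2 \<le> b * \<rho> * x"
    using x\<rho> assms unfolding power2_eq_square mult.assoc[symmetric] by (intro mult_left_mono) auto
  then have "x\<^sup>2 \<le> ((a + b) * \<rho>) * x" using assms(1) by (simp add: algebra_simps)
  then have "x * x \<le> ((a + b) * \<rho>) * x" by (simp add: power2_eq_square)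
  then have "x \<le> (a + b) * \<rho>" using x0 by (simp only: mult_le_cancel_right_pos)
  also have "\<dots> \<le> (a + b + 1) * \<rho>" using assms by (intro mult_right_mono) auto
  finally show False using gt by simp
qed

context mfg_grid
begin

text \<open>
  The fluxes differ by \<open>(mh - mhat) vh + mhat (vh - vhat)\<close> up to the consistency error; the first
  term is of the form that \<open>flow_energy\<close> admits.
\<close>

lemma density_energy:
  assumes sol: "theta_mfg_solution D \<theta> T N uh vh mh"
    and Ku: "holder_const r Ku us" and Km: "holder_const r Km ms" and Kv: "holder_v Kv" and t: "t \<le> T"
  shows "(\<Sum>x\<in>grid N. (mh t x - mhat t x)\<^sup>2) / h ^ CARD('d) \<le> 4 * exp (2 * (M\<^sup>2 / \<sigma>)) *
    ((2 * Km * (dt * (\<Sum>t<T. \<Sum>x\<in>grid N. mhat t x * (norm (vh t x - vhat t x))\<^sup>2)) + 2 * (CE Ku Km Kv)\<^sup>2 * \<rho>\<^sup>2) / \<sigma>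
      + (CR Km Kv)\<^sup>2 * \<rho>\<^sup>2)"
proof -
  define V where "V = h ^ CARD('d)"
  have V: "V > 0" unfolding V_def by (rule cell_volume)
  define cE where "cE = CE Ku Km Kv" define cR where "cR = CR Km Kv"
  define n where "n t x = (norm (vh t x - vhat t x))\<^sup>2" for t x
  define X where "X = dt * (\<Sum>t<T. \<Sum>x\<in>grid N. mhat t x * n t x)"
  define c4 where "c4 = 4 * exp (2 * (M\<^sup>2 / \<sigma>))"
  note s = solution_facts[OF sol]
  define wh where "wh t x = mh t x *\<^sub>R vh t x" for t x
  have fh: "flow mh wh" unfolding wh_def[abs_def] by (rule s(5))
  have step: "mh (Suc t) x = B (\<lambda>x. E (mh t) x - dt * div_h N (wh t) x + dt * 0) x" if "t < T" "x \<in> grid N" for t x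
    using fh that unfolding flow_def by simp
  define F where "F t x = mhat t x * norm (vh t x - vhat t x) + cE * \<rho> * V" for t x
  have first: "(\<Sum>x\<in>grid N. (mh t x - mhat t x)\<^sup>2) \<le> c4 * (dt * (\<Sum>t<T. \<Sum>x\<in>grid N. (F t x)\<^sup>2) / \<sigma> + cR\<^sup>2 * \<rho>\<^sup>2 * V)"
    unfolding c4_def
  proof (rule flow_energy[where ma = mh and mb = mhat and wa = wh and wb = Phi and ra = "\<lambda>t x. 0" and rb = Res])
    fix t and x :: "real ^ 'd" assume tx: "t < T" "x \<in> grid N"
    show "mh (Suc t) x = B (\<lambda>x. E (mh t) x - dt * div_h N (wh t) x + dt * 0) x" by (rule step[OF tx])
    show "mhat (Suc t) x = B (\<lambda>x. E (mhat t) x - dt * div_h N (Phi t) x + dt * Res t x) x" by (rule flow_trace[OF tx(2)])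
    have eq: "wh t x - Phi t x = (mh t x - mhat t x) *\<^sub>R vh t x + (mhat t x *\<^sub>R (vh t x - vhat t x) + (mhat t x *\<^sub>R vhat t x - Phi t x))"
      unfolding wh_def by (simp add: scaleR_diff_left scaleR_diff_right)
    have "norm (wh t x - Phi t x) \<le> norm ((mh t x - mhat t x) *\<^sub>R vh t x) + (norm (mhat t x *\<^sub>R (vh t x - vhat t x)) + norm (mhat t x *\<^sub>R vhat t x - Phi t x))"
      unfolding eq by (rule order_trans[OF norm_triangle_ineq add_left_mono[OF norm_triangle_ineq]])
    moreover have "norm ((mh t x - mhat t x) *\<^sub>R vh t x) \<le> M * \<bar>mh t x - mhat t x\<bar>"
      using mult_left_mono[OF s(3)[of t x] abs_ge_zero[of "mh t x - mhat t x"]] by (simp add: mult.commute)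
    moreover have "norm (mhat t x *\<^sub>R (vh t x - vhat t x)) + norm (mhat t x *\<^sub>R vhat t x - Phi t x) \<le> F t x"
      using flux_consistent[OF Ku Km Kv tx] mhat_nonneg[of t x] tx unfolding F_def cE_def V_def by simp
    ultimately show "norm (wh t x - Phi t x) \<le> M * \<bar>mh t x - mhat t x\<bar> + F t x" by linarith
  next
    fix x :: "real ^ 'd" assume "x \<in> grid N"
    then show "mh 0 x = mhat 0 x" using fh unfolding flow_def mhat_0 by blast
  next
    fix t assume t: "t < T"
    have "(\<Sum>x\<in>grid N. (0 - Res t x)\<^sup>2) \<le> (\<Sum>x\<in>(grid N :: (real ^ 'd) set). cR\<^sup>2 * \<rho>\<^sup>2 * V * V)"
    proof (rule sum_mono)
      fix x :: "real ^ 'd"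
      have "\<bar>Res t x\<bar>\<^sup>2 \<le> (cR * \<rho> * V)\<^sup>2" using residual_bound[OF Km Kv t, of x] unfolding cR_def V_def by (intro power_mono) auto
      then show "(0 - Res t x)\<^sup>2 \<le> cR\<^sup>2 * \<rho>\<^sup>2 * V * V" by (simp add: power2_eq_square mult_ac)
    qed
    then show "(\<Sum>x\<in>grid N. (0 - Res t x)\<^sup>2) \<le> cR\<^sup>2 * \<rho>\<^sup>2 * V" unfolding V_def sum_grid_const .
  qed (rule t)
  have "dt * (\<Sum>t<T. \<Sum>x\<in>grid N. (F t x)\<^sup>2) \<le> (2 * Km * X + 2 * cE\<^sup>2 * \<rho>\<^sup>2) * V"
  proof -
    have pt: "(F t x)\<^sup>2 \<le> 2 * Km * V * (mhat t x * n t x) + 2 * cE\<^sup>2 * \<rho>\<^sup>2 * V * V" if t: "t < T" and x: "x \<in> grid N" for t x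
    proof -
      have "(F t x)\<^sup>2 \<le> 2 * (mhat t x * norm (vh t x - vhat t x))\<^sup>2 + 2 * (cE * \<rho> * V)\<^sup>2"
        using sum_squares_bound[of "mhat t x * norm (vh t x - vhat t x)" "cE * \<rho> * V"] unfolding F_def power2_sum by linarith
      moreover have "mhat t x * (mhat t x * n t x) \<le> (Km * V) * (mhat t x * n t x)"
        using mhat_bound[OF Km, of t x] mhat_nonneg[of t x] t x unfolding V_def n_def by (intro mult_right_mono) auto
      ultimately show ?thesis unfolding n_def by (simp add: power2_eq_square mult_ac)
    qed
    have "dt * (\<Sum>t<T. \<Sum>x\<in>grid N. (F t x)\<^sup>2) \<le> dt * (\<Sum>t<T. \<Sum>x\<in>(grid N :: (real ^ 'd) set). 2 * Km * V * (mhat t x * n t x) + 2 * cE\<^sup>2 * \<rho>\<^sup>2 * V * V)"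
      by (intro mult_left_mono sum_mono pt) auto
    also have "\<dots> = 2 * Km * V * X + dt * (\<Sum>t<T. 2 * cE\<^sup>2 * \<rho>\<^sup>2 * V)"
    proof -
      have inner: "(\<Sum>x\<in>(grid N :: (real ^ 'd) set). 2 * Km * V * (mhat t x * n t x) + 2 * cE\<^sup>2 * \<rho>\<^sup>2 * V * V) =
          2 * Km * V * (\<Sum>x\<in>grid N. mhat t x * n t x) + 2 * cE\<^sup>2 * \<rho>\<^sup>2 * V" for t
        unfolding sum.distrib sum_grid_const[of "2 * cE\<^sup>2 * \<rho>\<^sup>2 * V", folded V_def] by (simp only: sum_distrib_left)
      have "dt * (\<Sum>t<T. p * A t + q) = p * (dt * (\<Sum>t<T. A t)) + dt * (\<Sum>t<T. q)" for p q and A :: "nat \<Rightarrow> real"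
        by (simp add: sum.distrib sum_distrib_left[symmetric] distrib_left)
      then show ?thesis unfolding inner X_def .
    qed
    also have "\<dots> = (2 * Km * X + 2 * cE\<^sup>2 * \<rho>\<^sup>2) * V" using TN by (simp add: algebra_simps)
    finally show ?thesis .
  qed
  then have "c4 * (dt * (\<Sum>t<T. \<Sum>x\<in>grid N. (F t x)\<^sup>2) / \<sigma> + cR\<^sup>2 * \<rho>\<^sup>2 * V) \<le> c4 * ((2 * Km * X + 2 * cE\<^sup>2 * \<rho>\<^sup>2) * V / \<sigma> + cR\<^sup>2 * \<rho>\<^sup>2 * V)"
    using sigma_pos unfolding c4_def by (intro mult_left_mono add_right_mono divide_right_mono) auto
  also have "\<dots> = c4 * ((2 * Km * X + 2 * cE\<^sup>2 * \<rho>\<^sup>2) / \<sigma> + cR\<^sup>2 * \<rho>\<^sup>2) * V" by (simp add: algebra_simps)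
  finally have "(\<Sum>x\<in>grid N. (mh t x - mhat t x)\<^sup>2) \<le> c4 * ((2 * Km * X + 2 * cE\<^sup>2 * \<rho>\<^sup>2) / \<sigma> + cR\<^sup>2 * \<rho>\<^sup>2) * V"
    using first by linarith
  then show ?thesis using V unfolding X_def n_def c4_def cE_def cR_def V_def[symmetric] by (simp add: pos_divide_le_eq)
qed

text \<open>
  The bound of \<open>lasry_lions\<close> is linear in the distance \<open>\<Delta>\<close> of the densities, while the energy
  estimate bounds \<open>\<Delta>\<^sup>2\<close> by it; the resulting quadratic inequality is solved by \<open>quadratic_bound\<close>.
\<close>

lemma scheme_error:
  assumes sol: "theta_mfg_solution D \<theta> T N uh vh mh"
    and Ku: "holder_const r Ku us" and Km: "holder_const r Km ms" and Kv: "holder_v Kv"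
    and G: "hjb_const G" "G > 0"
  defines "c4 \<equiv> 4 * exp (2 * (M\<^sup>2 / \<sigma>))" and "cH \<equiv> CH Ku Km" and "c \<equiv> CE Ku Km Kv + CR Km Kv"
  defines "a \<equiv> c4 * (4 * Km / (\<sigma> * \<alpha>)) * (cH + G * Lf D * c)"
    and "b \<equiv> c4 * ((4 * Km / (\<sigma> * \<alpha>)) * (G * cH * c) + 2 * (CE Ku Km Kv)\<^sup>2 / \<sigma> + (CR Km Kv)\<^sup>2)"
  shows "t \<le> T \<Longrightarrow> (\<Sum>x\<in>grid N. \<bar>mh t x - mhat t x\<bar>) \<le> (a + b + 1) * \<rho>"
    and "t \<le> T \<Longrightarrow> x \<in> grid N \<Longrightarrow> \<bar>uh t x - us (tm T t) x\<bar> \<le> G * (Lf D * (a + b + 1) + cH) * \<rho>"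
proof -
  define S where "S t = (\<Sum>x\<in>grid N. (mh t x - mhat t x)\<^sup>2) / h ^ CARD('d)" for t
  define \<Delta> where "\<Delta> = Max ((\<lambda>t. sqrt (S t)) ` {..T})"
  have \<Delta>: "sqrt (S t) \<le> \<Delta>" if "t \<le> T" for t unfolding \<Delta>_def using that by (intro Max_ge) auto
  have "\<Delta> \<in> (\<lambda>t. sqrt (S t)) ` {..T}" unfolding \<Delta>_def by (intro Max_in) auto
  then obtain t0 where t0: "t0 \<le> T" "\<Delta> = sqrt (S t0)" by auto
  have S0: "0 \<le> S t" for t unfolding S_def by (intro divide_nonneg_nonneg sum_nonneg) auto
  note Kp = holder_constD(1)[OF Ku] holder_constD(1)[OF Km] holder_vD(1)[OF Kv]
  have c0: "cH \<ge> 0" "CE Ku Km Kv \<ge> 0" "CR Km Kv \<ge> 0" "c \<ge> 0" "c4 \<ge> 0"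
    using constants_nonneg[OF Kp] unfolding cH_def c_def c4_def by simp_all
  define X where "X = dt * (\<Sum>t<T. \<Sum>x\<in>grid N. mhat t x * (norm (vh t x - vhat t x))\<^sup>2)"
  note LL = lasry_lions[OF sol Ku Km Kv G \<Delta>[unfolded S_def]]
  have LL1: "\<alpha> / 2 * X \<le> cH * \<rho> * \<Delta> + G * (Lf D * \<Delta> + cH * \<rho>) * (c * \<rho>)"
    unfolding X_def cH_def c_def by (rule LL(1))
  have "\<Delta>\<^sup>2 = S t0" unfolding t0(2) using S0 by simp
  also have "\<dots> \<le> c4 * ((2 * Km * X + 2 * (CE Ku Km Kv)\<^sup>2 * \<rho>\<^sup>2) / \<sigma> + (CR Km Kv)\<^sup>2 * \<rho>\<^sup>2)"
    unfolding S_def c4_def X_def by (rule density_energy[OF sol Ku Km Kv t0(1)])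
  also have "\<dots> = c4 * ((4 * Km / (\<sigma> * \<alpha>)) * (\<alpha> / 2 * X) + 2 * (CE Ku Km Kv)\<^sup>2 / \<sigma> * \<rho>\<^sup>2 + (CR Km Kv)\<^sup>2 * \<rho>\<^sup>2)"
    using sigma_pos data_pos by (simp add: field_simps)
  also have "\<dots> \<le> c4 * ((4 * Km / (\<sigma> * \<alpha>)) * (cH * \<rho> * \<Delta> + G * (Lf D * \<Delta> + cH * \<rho>) * (c * \<rho>)) + 2 * (CE Ku Km Kv)\<^sup>2 / \<sigma> * \<rho>\<^sup>2 + (CR Km Kv)\<^sup>2 * \<rho>\<^sup>2)"
    using c0 sigma_pos data_pos Kp by (intro mult_left_mono add_right_mono LL1) auto
  also have "\<dots> = a * \<rho> * \<Delta> + b * \<rho>\<^sup>2"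
    unfolding a_def b_def power2_eq_square by (simp only: algebra_simps)
  finally have q: "\<Delta>\<^sup>2 \<le> a * \<rho> * \<Delta> + b * \<rho>\<^sup>2" .
  have ab: "0 \<le> a" "0 \<le> b" unfolding a_def b_def using c0 sigma_pos data_pos Kp G(2)
    by (intro mult_nonneg_nonneg add_nonneg_nonneg divide_nonneg_nonneg; simp)+
  have D: "\<Delta> \<le> (a + b + 1) * \<rho>" by (rule quadratic_bound[OF q ab h_facts(4)])
  show "(\<Sum>x\<in>grid N. \<bar>mh t x - mhat t x\<bar>) \<le> (a + b + 1) * \<rho>" if "t \<le> T"
    using sum_abs_le_sqrt[OF TN(2), of "\<lambda>x. mh t x - mhat t x"] \<Delta>[OF that, unfolded S_def] D by linarith
  show "\<bar>uh t x - us (tm T t) x\<bar> \<le> G * (Lf D * (a + b + 1) + cH) * \<rho>" if "t \<le> T" "x \<in> grid N"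
  proof -
    have "\<bar>uh t x - us (tm T t) x\<bar> \<le> G * (Lf D * \<Delta> + cH * \<rho>)" unfolding cH_def by (rule LL(2)[OF _ that])
    also have "\<dots> \<le> G * (Lf D * ((a + b + 1) * \<rho>) + cH * \<rho>)"
      using D G(2) data_pos by (intro mult_left_mono add_right_mono) auto
    finally show ?thesis by (simp add: algebra_simps)
  qed
qed

end

context mfg
begin

lemma scheme_convergence:
  obtains (error) C where "C > 0"
    and "\<And>T N uh vh mh. cfl T N \<Longrightarrow> theta_mfg_solution D \<theta> T N uh vh mh \<Longrightarrow>
      (\<forall>t\<le>T. \<forall>x\<in>grid N. \<bar>uh t x - us (tm T t) x\<bar> \<le> C * (1 / real N) powr r) \<and>
      (\<forall>t\<le>T. (\<Sum>x\<in>grid N. \<bar>mh t x - I_h N (ms (tm T t)) x\<bar>) \<le> C * (1 / real N) powr r)"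
proof -
  obtain Ku where Ku: "holder_const r Ku us" using holder_const_exists[OF B_parts(2)] by blast
  obtain Km where Km: "holder_const r Km ms" using holder_const_exists[OF B_parts(3)] by blast
  obtain Kv where Kv: "holder_v Kv" using holder_v_exists by blast
  obtain G where G: "hjb_const G" "G > 0" using hjb_const_exists by blast
  define c4 where "c4 = 4 * exp (2 * (M\<^sup>2 / \<sigma>))"
  define cH where "cH = CH Ku Km"
  define c where "c = CE Ku Km Kv + CR Km Kv"
  define a where "a = c4 * (4 * Km / (\<sigma> * \<alpha>)) * (cH + G * Lf D * c)"
  define b where "b = c4 * ((4 * Km / (\<sigma> * \<alpha>)) * (G * cH * c) + 2 * (CE Ku Km Kv)\<^sup>2 / \<sigma> + (CR Km Kv)\<^sup>2)"
  define C1 where "C1 = G * (Lf D * (a + b + 1) + cH)"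
  define C where "C = \<bar>C1\<bar> + \<bar>a + b + 1\<bar> + 1"
  have le: "C1 * x \<le> C * x" "(a + b + 1) * x \<le> C * x" if "x \<ge> 0" for x :: real
    unfolding C_def using that by (intro mult_right_mono; linarith)+
  have "C > 0" unfolding C_def by linarith
  then show ?thesis
  proof (rule error)
    fix T N uh vh mh assume cfl: "cfl T N" and sol: "theta_mfg_solution D \<theta> T N uh vh mh"
    interpret mfg_grid D \<theta> r us ms vs T N by unfold_locales (rule cfl)
    have "\<bar>uh t x - us (tm T t) x\<bar> \<le> C1 * (1 / real N) powr r" if "t \<le> T" "x \<in> grid N" for t x
      unfolding C1_def a_def b_def c4_def cH_def c_def by (rule scheme_error(2)[OF sol Ku Km Kv G that])
    moreover have "(\<Sum>x\<in>grid N. \<bar>mh t x - I_h N (ms (tm T t)) x\<bar>) \<le> (a + b + 1) * (1 / real N) powr r" if "t \<le> T" for t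
      unfolding a_def b_def c4_def cH_def c_def by (rule scheme_error(1)[OF sol Ku Km Kv G that, unfolded mhat_def])
    ultimately show "(\<forall>t\<le>T. \<forall>x\<in>grid N. \<bar>uh t x - us (tm T t) x\<bar> \<le> C * (1 / real N) powr r) \<and>
      (\<forall>t\<le>T. (\<Sum>x\<in>grid N. \<bar>mh t x - I_h N (ms (tm T t)) x\<bar>) \<le> C * (1 / real N) powr r)"
      using le[of "(1 / real N) powr r"] by (meson order_trans powr_ge_zero)
  qed
qed

end

theorem theorem4p9:
  fixes D :: "'d::finite mfg_data"
    and \<theta> r :: real
    and us ms :: "real \<Rightarrow> real ^ 'd \<Rightarrow> real"
    and vs :: "real \<Rightarrow> real ^ 'd \<Rightarrow> real ^ 'd"
  assumes "sigma D > 0" and "1 / 2 < \<theta>" and "\<theta> < 1" and "0 < r" and "r < 1"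
    and "data_on_torus D"
    and "assumption_A D"
    and "assumption_B D r us vs ms"
    and "assumption_C D"
    and "assumption_D D"
  shows "\<exists>c C Cbar :: real. 0 < c \<and> c < 1 \<and> C > 0 \<and>
    (\<forall>T N :: nat. T \<ge> 1 \<longrightarrow> N \<ge> 1 \<longrightarrow>
      1 / real T \<le> (1 / real N)\<^sup>2 / (2 * real CARD('d) * (1 - \<theta>) * sigma D) \<longrightarrow>
      1 / real N \<le> 2 * (1 - \<theta>) * sigma D / Mbound D \<longrightarrow>
      (\<forall>(uh :: nat \<Rightarrow> real ^ 'd \<Rightarrow> real) (vh :: nat \<Rightarrow> real ^ 'd \<Rightarrow> real ^ 'd)
        (mh :: nat \<Rightarrow> real ^ 'd \<Rightarrow> real)
        (m :: nat \<Rightarrow> nat \<Rightarrow> real ^ 'd \<Rightarrow> real) (w :: nat \<Rightarrow> nat \<Rightarrow> real ^ 'd \<Rightarrow> real ^ 'd).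
        theta_mfg_solution D \<theta> T N uh vh mh \<longrightarrow>
        frank_wolfe D \<theta> T N m w \<longrightarrow>
        (let u = (\<lambda>k. HJB D \<theta> T N (m k));
             \<gamma> = (\<lambda>k. J_tilde D T N (m k) (w k) - J_tilde D T N mh (\<lambda>t x. mh t x *\<^sub>R vh t x));
             err = (\<lambda>k. norm_inf_p T N \<infinity> (\<lambda>t x. u k t x - us (real t * (1 / real T)) x)
                      + norm_inf_p T N 1 (\<lambda>t x. m k t x - I_h N (ms (real t * (1 / real T))) x))
         in (\<forall>k\<ge>1. \<gamma> k \<le> ereal (C * c ^ k)) \<and>
            (\<forall>k\<ge>1. norm_inf_p T N \<infinity> (\<lambda>t x. u k t x - uh t x)
                    + norm_inf_p T N 1 (\<lambda>t x. m k t x - mh t x) \<le> Cbar * c powr (real k / 2)) \<and>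
            (\<forall>k\<ge>1. err k \<le> Cbar * ((1 / real N) powr r + c powr (real k / 2))) \<and>
            (\<forall>k\<ge>1. real k \<ge> 2 * r * ln (1 / real N) / ln c \<longrightarrow>
                    err k \<le> 2 * Cbar * (1 / real N) powr r))))"
proof -
  interpret mfg D \<theta> r us ms vs
    by unfold_locales (rule assms)+
  from frank_wolfe_convergence show ?thesis
  proof cases
  case (rates c C Cb)
  note c = rates(1-4)
  from scheme_convergence show ?thesis
  proof cases
  case (error Ce)
  note Ce = error(1)
  define Cbar where "Cbar = 2 * (Cb + Ce)"
  show ?thesis
    unfolding Let_def
  proof (rule exI[of _ c], rule exI[of _ C], rule exI[of _ Cbar], intro conjI allI impI c)
    fix T N :: nat and uh vh mh m w k
    assume TN: "T \<ge> 1" "N \<ge> 1" "1 / real T \<le> (1 / real N)\<^sup>2 / (2 * real CARD('d) * (1 - \<theta>) * sigma D)"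
      "1 / real N \<le> 2 * (1 - \<theta>) * sigma D / Mbound D"
      and sol: "theta_mfg_solution D \<theta> T N uh vh mh" and alg: "frank_wolfe D \<theta> T N m w" and k: "(1::nat) \<le> k"
    have cfl: "cfl T N" unfolding cfl_def using TN by blast
    have N: "N > 0" using TN by simp
    note F = rates(5)[OF cfl sol alg k] and S = error(2)[OF cfl sol]
    let ?eu = "norm_inf_p T N \<infinity> (\<lambda>t x. HJB D \<theta> T N (m k) t x - us (tm T t) x)"
      and ?em = "norm_inf_p T N 1 (\<lambda>t x. m k t x - I_h N (ms (tm T t)) x)"
    define \<epsilon> where "\<epsilon> = c powr (real k / 2)"
    define \<rho> where "\<rho> = (1 / real N) powr r"
    have pos: "\<epsilon> \<ge> 0" "\<rho> \<ge> 0" by (simp_all add: \<epsilon>_def \<rho>_def)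
    have u1: "\<bar>HJB D \<theta> T N (m k) t x - uh t x\<bar> \<le> Cb * \<epsilon>" if "t \<le> T" "x \<in> grid N" for t x
      using F that unfolding \<epsilon>_def by blast
    have m1: "(\<Sum>x\<in>grid N. \<bar>m k t x - mh t x\<bar>) \<le> Cb * \<epsilon>" if "t \<le> T" for t
      using F that unfolding \<epsilon>_def by blast
    have u2: "\<bar>uh t x - us (tm T t) x\<bar> \<le> Ce * \<rho>" if "t \<le> T" "x \<in> grid N" for t x
      using S that unfolding \<rho>_def by blast
    have m2: "(\<Sum>x\<in>grid N. \<bar>mh t x - I_h N (ms (tm T t)) x\<bar>) \<le> Ce * \<rho>" if "t \<le> T" for t
      using S that unfolding \<rho>_def by blast
    show "J_tilde D T N (m k) (w k) - J_tilde D T N mh (\<lambda>t x. mh t x *\<^sub>R vh t x) \<le> ereal (C * c ^ k)"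
      using F by blast
    have "norm_inf_p T N \<infinity> (\<lambda>t x. HJB D \<theta> T N (m k) t x - uh t x) \<le> Cb * \<epsilon>"
      by (rule norm_inf_p_inf_le[OF N u1])
    moreover have "norm_inf_p T N 1 (\<lambda>t x. m k t x - mh t x) \<le> Cb * \<epsilon>" by (rule norm_inf_p_1_le[OF m1])
    moreover have "2 * (Cb * \<epsilon>) \<le> Cbar * \<epsilon>" using mult_nonneg_nonneg[OF less_imp_le[OF Ce] pos(1)] by (simp add: Cbar_def algebra_simps)
    ultimately show "norm_inf_p T N \<infinity> (\<lambda>t x. HJB D \<theta> T N (m k) t x - uh t x)
        + norm_inf_p T N 1 (\<lambda>t x. m k t x - mh t x) \<le> Cbar * c powr (real k / 2)"
      unfolding \<epsilon>_def[symmetric] by linarith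
    have double: "p + q \<le> z" if "p \<le> y" "q \<le> y" "2 * y \<le> z" for p q y z :: real using that by linarith
    have "?eu \<le> Cb * \<epsilon> + Ce * \<rho>"
    proof (rule norm_inf_p_inf_le[OF N])
      fix t and x :: "real ^ 'd" assume "t \<le> T" "x \<in> grid N"
      then show "\<bar>HJB D \<theta> T N (m k) t x - us (tm T t) x\<bar> \<le> Cb * \<epsilon> + Ce * \<rho>" using u1[of t x] u2[of t x] by linarith
    qed
    moreover have "?em \<le> Cb * \<epsilon> + Ce * \<rho>"
    proof (rule norm_inf_p_1_le)
      fix t assume t: "t \<le> T"
      have "(\<Sum>x\<in>grid N. \<bar>m k t x - I_h N (ms (tm T t)) x\<bar>) \<le> (\<Sum>x\<in>grid N. \<bar>m k t x - mh t x\<bar> + \<bar>mh t x - I_h N (ms (tm T t)) x\<bar>)"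
        by (intro sum_mono) linarith
      also have "\<dots> \<le> Cb * \<epsilon> + Ce * \<rho>" unfolding sum.distrib by (intro add_mono m1 m2 t)
      finally show "(\<Sum>x\<in>grid N. \<bar>m k t x - I_h N (ms (tm T t)) x\<bar>) \<le> Cb * \<epsilon> + Ce * \<rho>" .
    qed
    moreover have "2 * (Cb * \<epsilon> + Ce * \<rho>) \<le> Cbar * (\<rho> + \<epsilon>)"
      using mult_nonneg_nonneg[OF less_imp_le[OF Ce] pos(1)] mult_nonneg_nonneg[OF less_imp_le[OF c(4)] pos(2)] by (simp add: Cbar_def algebra_simps)
    ultimately have err: "?eu + ?em \<le> Cbar * (\<rho> + \<epsilon>)"
      by (rule double)
    then show "?eu + ?em \<le> Cbar * ((1 / real N) powr r + c powr (real k / 2))"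
      unfolding \<epsilon>_def \<rho>_def .
    assume kk: "2 * r * ln (1 / real N) / ln c \<le> real k"
    have lc: "ln c < 0" using c by simp
    have "real k * ln c \<le> 2 * r * ln (1 / real N)" using kk lc by (simp add: neg_divide_le_eq)
    then have "\<epsilon> \<le> \<rho>" unfolding \<epsilon>_def \<rho>_def powr_def using c N by simp
    then have "Cbar * (\<rho> + \<epsilon>) \<le> Cbar * (2 * \<rho>)" using c(4) Ce by (intro mult_left_mono) (auto simp: Cbar_def)
    then show "?eu + ?em \<le> 2 * Cbar * (1 / real N) powr r"
      using err unfolding \<rho>_def[symmetric] by simp
  qed
  qed
  qed
qed

end
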